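(* The $n$-simplex $\Delta_n$ with uniform measure has QLPB and QLPI $3$-cubature formulas (quasilinear, positive, and respectively boundary and interior) with $O(n)$ points. More precisely, if there exists a Hadamard matrix of order $n$, then the following points (in barycentric coordinates) and weights form a $3$-cubature formula for $\Delta_{n-1}$ with $3n-1$ points: $$\begin{array}{cl} (1,0,0,\ldots,0)_S & \dfrac{2}{n(n+1)(n+2)} \\[2mm] \left(\tfrac2n,\ldots,\tfrac2n,0,\ldots,0\right)_H & \dfrac{n}{2(n+1)(n+2)} \\[2mm] \left(\tfrac1n,\tfrac1n,\ldots,\tfrac1n\right) & \dfrac{4n}{(n+1)(n+2)} \end{array}$$ Each weight is the weight of each individual point in its row. When there is no Hadamard matrix of order $n$, one can use a Hadamard matrix of order $\ell>n$: the resulting formula on $\Delta_{\ell-1}$ with $3\ell-1$ points can be projected onto $\Delta_{n-1}$ to give a $3$-cubature formula for $\Delta_{n-1}$. Using known Hadamard matrices one can take $\ell=n+o(n)$ (by letting $\ell-1$ be the first prime after $n$ which is $3$ mod $4$), and the formula on $\Delta_{n-1}$ has $3n+o(n)$ points. If the Hadamard conjecture holds, one can take $\ell=4\lceil n/4\rceil$, and the formula on $\Delta_{n-1}$ has between $3n-1$ and $3n+5$ points.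
   Context: $\Delta_{n-1}=\{\vec x\in\mathbb{R}_{\ge0}^n : x_1+\cdots+x_n=1\}$ is the $(n-1)$-dimensional simplex, with uniform probability measure; $(x_1,\dots,x_n)$ are its barycentric coordinates. A $3$-cubature formula for a probability measure $\mu$ is a finite collection of points $\vec p_a$ with weights $w_a$ such that $\int P\,d\mu=\sum_a w_aP(\vec p_a)$ for all polynomials $P$ of degree at most $3$. Points are counted with multiplicity. A formula is positive (P) if all $w_a>0$. It is interior (I) if every point lies in the interior of the simplex (all barycentric coordinates positive), and boundary (B) if every point lies in the simplex and some point lies on its boundary. A family of formulas is quasilinear (QL) if the points and weights of each formula in it can be generated in quasilinear time in the length $L$ of the output, that is, in time $O((\log L)^\beta L)$ for some $\beta$. A Hadamard matrix of order $n$ is an $n\times n$ matrix with entries $\pm1$ and orthogonal rows. The Hadamard conjecture asserts that there is a Hadamard matrix of every order divisible by $4$. The subscript $S$ denotes full symmetrization (all distinct coordinate permutations of the point, i.e. the $n$ vertices). The subscript $H$ denotes symmetrization in the pattern of a Hadamard design: take a Hadamard matrix of order $n$ normalized so that its first row is all $+1$. For each of the other $n-1$ rows, the set of positions of its $+1$ entries and the set of positions of its $-1$ entries are two blocks of size $n/2$. The $2n-2$ points are those with coordinate $2/n$ on a block and $0$ off it. Projecting a formula from $\Delta_{\ell-1}$ onto $\Delta_{n-1}$ means dropping the last $\ell-n$ coordinates of each point, discarding points that become the origin, rescaling the remaining points radially onto $\Delta_{n-1}$, and adjusting the weights accordingly: a point whose first $n$ coordinates sum to $s>0$ has its weight multiplied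 by $s^3\,\frac{\ell(\ell+1)(\ell+2)}{n(n+1)(n+2)}$. *)

theory Defs
  imports
    "HOL-Probability.Probability"
    "HOL-Library.Landau_Symbols"
    "HOL-Library.Log_Nat"
    "HOL-Computational_Algebra.Primes"
    "Jordan_Normal_Form.Matrix"
begin

section \<open>The simplex and its uniform measure\<close>

text \<open>
  Coordinates are numbered from 0, so \<open>\<Delta>\<^bsub>n-1\<^esub>\<close> has the \<open>n\<close> barycentric coordinates \<open>0, \<dots>, n - 1\<close>.
  The uniform measure is the image of normalized Lebesgue measure under the chart that
  solves for the last coordinate; the chart is affine, hence scales volume by a constant.
\<close>

definition simplex_measure :: "nat \<Rightarrow> (nat \<Rightarrow> real) measure" where
  "simplex_measure n =
    distr
      (uniform_measure (Pi\<^sub>M {..<n-1} (\<lambda>_. lborel))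
        {y \<in> space (Pi\<^sub>M {..<n-1} (\<lambda>_. lborel)). (\<forall>i<n-1. 0 \<le> y i) \<and> (\<Sum>i<n-1. y i) \<le> 1})
      (Pi\<^sub>M {..<n} (\<lambda>_. borel))
      (\<lambda>y. \<lambda>i\<in>{..<n}. if i < n - 1 then y i else 1 - (\<Sum>j<n-1. y j))"


section \<open>Cubature formulas\<close>

definition polynomial_of_degree_le :: "nat \<Rightarrow> nat \<Rightarrow> ((nat \<Rightarrow> real) \<Rightarrow> real) \<Rightarrow> bool" where
  "polynomial_of_degree_le n t P \<longleftrightarrow>
    (\<exists>(A :: (nat \<Rightarrow> nat) set) (c :: (nat \<Rightarrow> nat) \<Rightarrow> real).
       finite A \<and> (\<forall>\<alpha>\<in>A. (\<Sum>i<n. \<alpha> i) \<le> t) \<and>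
       P = (\<lambda>x. \<Sum>\<alpha>\<in>A. c \<alpha> * (\<Prod>i<n. x i ^ \<alpha> i)))"

text \<open>A formula is a list of pairs (weight, coordinates of the point); a list, so that points
  are counted with multiplicity.\<close>

type_synonym formula = "(real \<times> real list) list"

definition cubature_formula ::
    "nat \<Rightarrow> nat \<Rightarrow> (nat \<Rightarrow> real) measure \<Rightarrow> formula \<Rightarrow> bool" where
  "cubature_formula t n \<mu> F \<longleftrightarrow>
    (\<forall>(w, p)\<in>set F. length p = n) \<and>
    (\<forall>P. polynomial_of_degree_le n t P \<longrightarrow>
       integrable \<mu> P \<and> (\<integral>x. P x \<partial>\<mu>) = (\<Sum>(w, p)\<leftarrow>F. w * P (\<lambda>i. p ! i)))"

definition simplex_cubature3 :: "nat \<Rightarrow> formula \<Rightarrow> bool" where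
  "simplex_cubature3 n F \<longleftrightarrow>
    cubature_formula 3 n (simplex_measure n) F \<and> (\<forall>(w, p)\<in>set F. sum_list p = 1)"

definition positive_formula :: "formula \<Rightarrow> bool" where
  "positive_formula F \<longleftrightarrow> (\<forall>(w, p)\<in>set F. 0 < w)"

definition in_simplex :: "real list \<Rightarrow> bool" where
  "in_simplex p \<longleftrightarrow> (\<forall>x\<in>set p. 0 \<le> x) \<and> sum_list p = 1"

definition interior_formula :: "formula \<Rightarrow> bool" where
  "interior_formula F \<longleftrightarrow> (\<forall>(w, p)\<in>set F. in_simplex p \<and> (\<forall>x\<in>set p. 0 < x))"

definition boundary_formula :: "formula \<Rightarrow> bool" where
  "boundary_formula F \<longleftrightarrow>
    (\<forall>(w, p)\<in>set F. in_simplex p) \<and> (\<exists>(w, p)\<in>set F. \<exists>x\<in>set p. x = 0)"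


section \<open>Quasilinear families\<close>

text \<open>
  The machine model is the random access machine with logarithmic cost (Aho, Hopcroft and
  Ullman, The Design and Analysis of Computer Algorithms, Section 1.3), with structured control
  instead of jumps.  Registers hold integers; \<open>Load i j\<close> and \<open>Store i j\<close> are the indirect
  accesses \<open>M[i] := M[M[j]]\<close> and \<open>M[M[i]] := M[j]\<close>.  Every instruction costs the total
  length of the integers it operates on, computed addresses included; addresses written in the
  program are bounded for a given program and are not charged.
\<close>

datatype aop = Add | Sub | Mul | Div

fun aval :: "aop \<Rightarrow> int \<Rightarrow> int \<Rightarrow> int" where
  "aval Add x y = x + y"
| "aval Sub x y = x - y"
| "aval Mul x y = x * y"
| "aval Div x y = x div y"

datatype com =
    Const int int
  | Arith int aop int int
  | Load int int
  | Store int int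
  | Print int
  | Seq com com
  | IfPos int com com
  | WhilePos int com

text \<open>Binary digits plus one sign bit.\<close>

definition len :: "int \<Rightarrow> nat" where
  "len x = nat (bitlen \<bar>x\<bar>) + 1"

text \<open>\<open>exec c M os t M'\<close>: started with memory \<open>M\<close>, the program \<open>c\<close> halts in time \<open>t\<close> with memory
  \<open>M'\<close>, having printed the integers \<open>os\<close>.\<close>

inductive exec :: "com \<Rightarrow> (int \<Rightarrow> int) \<Rightarrow> int list \<Rightarrow> nat \<Rightarrow> (int \<Rightarrow> int) \<Rightarrow> bool" where
  Const: "exec (Const i x) M [] (len x) (M(i := x))"
| Arith: "exec (Arith i f j k) M [] (len (M j) + len (M k)) (M(i := aval f (M j) (M k)))"
| Load: "exec (Load i j) M [] (len (M j) + len (M (M j))) (M(i := M (M j)))"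
| Store: "exec (Store i j) M [] (len (M i) + len (M j)) (M(M i := M j))"
| Print: "exec (Print i) M [M i] (len (M i)) M"
| Seq: "exec c1 M os1 t1 M1 \<Longrightarrow> exec c2 M1 os2 t2 M2 \<Longrightarrow>
    exec (Seq c1 c2) M (os1 @ os2) (t1 + t2) M2"
| IfTrue: "0 < M i \<Longrightarrow> exec c1 M os t M' \<Longrightarrow> exec (IfPos i c1 c2) M os (len (M i) + t) M'"
| IfFalse: "\<not> 0 < M i \<Longrightarrow> exec c2 M os t M' \<Longrightarrow> exec (IfPos i c1 c2) M os (len (M i) + t) M'"
| WhileFalse: "\<not> 0 < M i \<Longrightarrow> exec (WhilePos i c) M [] (len (M i)) M"
| WhileTrue: "0 < M i \<Longrightarrow> exec c M os1 t1 M1 \<Longrightarrow> exec (WhilePos i c) M1 os2 t2 M2 \<Longrightarrow>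
    exec (WhilePos i c) M (os1 @ os2) (len (M i) + t1 + t2) M2"

text \<open>
  A formula is printed as the sequence of its weights and coordinates, each point preceded by
  its weight, every number as numerator and denominator in lowest terms.  Lowest terms are
  required because otherwise the output, against whose length the running time is measured,
  could be padded.
\<close>

definition prints_formula :: "int list \<Rightarrow> formula \<Rightarrow> bool" where
  "prints_formula os F \<longleftrightarrow>
    (\<exists>qs :: (int \<times> int) list.
       (\<forall>(a, b)\<in>set qs. 0 < b \<and> coprime a b) \<and>
       os = concat (map (\<lambda>(a, b). [a, b]) qs) \<and>
       map (\<lambda>(a, b). real_of_int a / real_of_int b) qs = concat (map (\<lambda>(w, p). w # p) F))"

text \<open>One program serves the whole family; it receives the index \<open>d\<close> in register 0.\<close>

definition quasilinear :: "(nat \<Rightarrow> formula) \<Rightarrow> bool" where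
  "quasilinear F \<longleftrightarrow>
    (\<exists>c os T (\<beta> :: real).
       (\<forall>d\<ge>1. prints_formula (os d) (F d) \<and>
               (\<exists>M'. exec c ((\<lambda>_. 0)(0 := int d)) (os d) (T d) M')) \<and>
       (\<lambda>d. real (T d)) \<in>
         O(\<lambda>d. ln (real (sum_list (map len (os d)))) powr \<beta> * real (sum_list (map len (os d)))))"


section \<open>Hadamard matrices and the formula\<close>

definition hadamard_matrix :: "nat \<Rightarrow> int mat \<Rightarrow> bool" where
  "hadamard_matrix n H \<longleftrightarrow>
    H \<in> carrier_mat n n \<and>
    (\<forall>i<n. \<forall>j<n. H $$ (i, j) \<in> {1, -1}) \<and>
    (\<forall>i<n. \<forall>j<n. i \<noteq> j \<longrightarrow> scalar_prod (row H i) (row H j) = 0)"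

definition normalized_hadamard :: "nat \<Rightarrow> int mat \<Rightarrow> bool" where
  "normalized_hadamard n H \<longleftrightarrow> hadamard_matrix n H \<and> (\<forall>j<n. H $$ (0, j) = 1)"

definition hadamard_conjecture :: bool where
  "hadamard_conjecture \<longleftrightarrow> (\<forall>n>0. 4 dvd n \<longrightarrow> (\<exists>H. hadamard_matrix n H))"

definition vertex :: "nat \<Rightarrow> nat \<Rightarrow> real list" where
  "vertex n i = map (\<lambda>j. if j = i then 1 else 0) [0..<n]"

definition block_point :: "nat \<Rightarrow> int mat \<Rightarrow> nat \<Rightarrow> int \<Rightarrow> real list" where
  "block_point n H i e = map (\<lambda>j. if H $$ (i, j) = e then 2 / real n else 0) [0..<n]"

definition hadamard_formula :: "nat \<Rightarrow> int mat \<Rightarrow> formula" where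
  "hadamard_formula n H =
    map (\<lambda>i. (2 / (real n * (real n + 1) * (real n + 2)), vertex n i)) [0..<n] @
    concat (map (\<lambda>i. map (\<lambda>e. (real n / (2 * (real n + 1) * (real n + 2)), block_point n H i e))
                        [1, -1])
                [1..<n]) @
    [(4 * real n / ((real n + 1) * (real n + 2)), replicate n (1 / real n))]"

definition project_formula :: "nat \<Rightarrow> nat \<Rightarrow> formula \<Rightarrow> formula" where
  "project_formula l n F =
    map (\<lambda>(w, p). let q = take n p; s = sum_list q in
           (w * (s ^ 3 * (real l * (real l + 1) * (real l + 2)
                           / (real n * (real n + 1) * (real n + 2)))),
            map (\<lambda>x. x / s) q))
        (filter (\<lambda>(w, p). \<exists>x\<in>set (take n p). x \<noteq> 0) F)"

definition first_prime_3mod4_after :: "nat \<Rightarrow> nat \<Rightarrow> bool" where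
  "first_prime_3mod4_after n p \<longleftrightarrow>
    prime p \<and> n < p \<and> p mod 4 = 3 \<and> (\<forall>q. prime q \<and> n < q \<and> q mod 4 = 3 \<longrightarrow> p \<le> q)"

end

theory Submission
  imports
    Defs
    "HOL-Complex_Analysis.Complex_Analysis"
    "HOL-Number_Theory.Prime_Powers"
    "HOL-Number_Theory.Euler_Criterion"
    "HOL-Real_Asymp.Real_Asymp"
begin

text \<open>
  The uniform measure has \<open>\<integral> x\<^sup>\<alpha> = (n - 1)! \<alpha>! / (n - 1 + |\<alpha>|)!\<close>.  On the simplex every polynomial of degree at
  most 3 is a cubic form, so it suffices to match the moments \<open>x\<^sub>i x\<^sub>j x\<^sub>k\<close>, and a cubic form lets a point \<open>q\<close> of
  weight \<open>v\<close> be traded for \<open>q / s\<close> of weight \<open>v s\<^sup>3\<close>; this makes projection work.  The signs of a Hadamard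
  matrix and of its negative have the first three moments of independent signs, whence the moments
  \<open>1 + [i = j] + [j = k] + [i = k]\<close> of the block points and the centre; the vertices supply the missing
  \<open>2 [i = j = k]\<close>.

  Normalized Hadamard matrices of order \<open>p + 1\<close> come from Paley's construction.  That the primes
  \<open>p \<equiv> 3 (mod 4)\<close> have gaps \<open>o(p)\<close> is the prime number theorem for this class, obtained by Newman's contour
  argument from the non-vanishing of \<open>\<zeta>(s) L(s, \<chi>\<^sub>4)\<close> on the line \<open>Re s = 1\<close>.

  The quasilinear families use Sylvester matrices of order \<open>2 ^ k \<ge> n\<close>, whose entries are parities that a
  register machine computes in logarithmic time.  Every printed coordinate then costs a polylogarithmic
  amount, Euclid's algorithm for lowest terms included.
\<close>

section \<open>Newman's contour argument\<close>

text \<open>Two different demands are made on the Hadamard matrices. For \<open>3 n + o(n)\<close>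
  points they must exist just above every \<open>n\<close>. Only ratios of consecutive primes matter
  for this, and the argument never passes through an asymptotic formula for \<open>psi3\<close>: the
  convergence of the integral of \<open>(psi3 x - x / 2) / x^2\<close> already excludes, for large
  \<open>n\<close>, intervals \<open>[n, (1 + e) n]\<close> without a prime of the class. For the
  quasilinear families \<open>O(n)\<close> points suffice, so the order may be rounded up to a power
  of two, and the entries are computed without any search.

  The obstacle to an interior formula is that vertices and blocks lie on the boundary. A symmetric
  cubic moment has three coefficients: a constant, that of two equal indices and that of three equal
  indices. Moving the coordinates away from 0 disturbs them, and the new weights must be positive
  solutions of three equations, rational because the machine prints fractions. One large integer
  parameter \<open>m = fam_m\<close> keeps the disturbances small and the solution explicit.\<close>

lemma contour_integral_right_half_circle:
  assumes "R > 0"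
  shows "((\<lambda>w. 1 / w) has_contour_integral \<i> * pi) (part_circlepath 0 R (-(pi/2)) (pi/2))"
proof -
  have "((\<lambda>t::real. \<i>) has_integral (pi/2 - (-(pi/2))) *\<^sub>R \<i>) {-(pi/2)..pi/2}"
    by (rule has_integral_const_real[THEN has_integral_eq_rhs]) auto
  hence "((\<lambda>t. 1 / (0 + of_real R * cis t) * of_real R * \<i> * cis t) has_integral (\<i> * pi)) {-(pi/2)..pi/2}"
    using assms by (auto simp: scaleR_conv_of_real field_simps)
  thus ?thesis using assms
    by (subst has_contour_integral_part_circlepath_iff) auto
qed

lemma contour_integral_left_half_circle:
  assumes "R > 0"
  shows "((\<lambda>w. 1 / w) has_contour_integral \<i> * pi) (part_circlepath 0 R (pi/2) (3*pi/2))"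
proof -
  have "((\<lambda>t::real. \<i>) has_integral (3*pi/2 - pi/2) *\<^sub>R \<i>) {pi/2..3*pi/2}"
    by (rule has_integral_const_real[THEN has_integral_eq_rhs]) auto
  hence "((\<lambda>t. 1 / (0 + of_real R * cis t) * of_real R * \<i> * cis t) has_integral (\<i> * pi)) {pi/2..3*pi/2}"
    using assms by (auto simp: scaleR_conv_of_real field_simps)
  thus ?thesis using assms
    by (subst has_contour_integral_part_circlepath_iff) auto
qed

text \<open>Three sides of a rectangle that close the right half circle on the left. The depth
  \<open>h\<close> stays free, because a function holomorphic near the imaginary axis may not extend
  far beyond it.\<close>

definition lpath :: "real \<Rightarrow> real \<Rightarrow> real \<Rightarrow> complex" where
  "lpath R h = linepath (\<i>*R) (Complex (-h) R) +++ linepath (Complex (-h) R) (Complex (-h) (-R)) +++ linepath (Complex (-h) (-R)) (-\<i>*R)"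

text \<open>On \<open>Re w \<le> 0\<close> without the origin, \<open>Ln (-w)\<close> is a primitive
  of \<open>1 / w\<close>: the sign moves the branch cut to the positive real axis. So this path
  makes half a turn, like the half circles.\<close>

lemma contour_integral_lpath:
  assumes "R > 0" "h > 0"
  shows "((\<lambda>w. 1 / w) has_contour_integral \<i> * pi) (lpath R h)"
proof -
  have pi1: "path_image (lpath R h) \<subseteq> {w. Re w \<le> 0 \<and> w \<noteq> 0}"
  proof -
    have c: "closed_segment (\<i>*R) (Complex (-h) R) \<subseteq> {w. Re w \<le> 0 \<and> Im w = R}"
      using assms by (intro closed_segment_subset) (auto simp: convex_def algebra_simps add_nonpos_nonpos mult_nonneg_nonpos simp flip: distrib_right)
    have d: "closed_segment (Complex (-h) R) (Complex (-h) (-R)) \<subseteq> {w. Re w = -h}"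
      using assms by (intro closed_segment_subset) (auto simp: convex_def algebra_simps add_nonpos_nonpos mult_nonneg_nonpos simp flip: distrib_right)
    have e: "closed_segment (Complex (-h) (-R)) (-\<i>*R) \<subseteq> {w. Re w \<le> 0 \<and> Im w = -R}"
      using assms by (intro closed_segment_subset) (auto simp: convex_def algebra_simps add_nonpos_nonpos mult_nonneg_nonpos simp flip: distrib_right)
    show ?thesis unfolding lpath_def using c d e assms
      by (fastforce simp: path_image_join)
  qed
  have "((\<lambda>w. 1 / w) has_contour_integral (Ln (-pathfinish (lpath R h)) - Ln (-pathstart (lpath R h)))) (lpath R h)"
  proof (rule contour_integral_primitive[where S = "{w. Re w \<le> 0 \<and> w \<noteq> 0}"])
    show "valid_path (lpath R h)" by (auto simp: lpath_def intro!: valid_path_join)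
    show "path_image (lpath R h) \<subseteq> {w. Re w \<le> 0 \<and> w \<noteq> 0}" by (rule pi1)
    fix x assume x: "x \<in> {w. Re w \<le> 0 \<and> w \<noteq> 0}"
    hence "-x \<notin> \<real>\<^sub>\<le>\<^sub>0" by (auto simp: complex_nonpos_Reals_iff complex_eq_iff)
    thus "((\<lambda>a. Ln (-a)) has_field_derivative 1 / x) (at x within {w. Re w \<le> 0 \<and> w \<noteq> 0})"
      using x by (auto intro!: derivative_eq_intros simp: field_simps)
  qed
  moreover have "Ln (-pathfinish (lpath R h)) - Ln (-pathstart (lpath R h)) = \<i> * pi"
  proof -
    have "Ln (\<i> * of_real R) = of_real (ln R) + \<i> * of_real pi / 2"
      using Ln_times_of_real[of R \<i>] assms by (simp add: mult.commute Ln_of_real)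
    moreover have "Ln (-(\<i> * of_real R)) = of_real (ln R) - \<i> * of_real pi / 2"
      using Ln_times_of_real[of R "-\<i>"] assms by (simp add: mult.commute Ln_of_real)
    ultimately show ?thesis by (simp add: lpath_def)
  qed
  ultimately show ?thesis by simp
qed

text \<open>Subtracting the value at the centre leaves a removable singularity, so that Cauchy's theorem
  on a convex set applies and no winding number is needed.\<close>

lemma Cauchy_formula_two_halves:
  assumes "open D" "convex D" "k holomorphic_on D" "0 \<in> D"
    and "valid_path g1" "valid_path g2" "path_image g1 \<subseteq> D - {0}" "path_image g2 \<subseteq> D - {0}"
    and "pathfinish g1 = pathstart g2" "pathfinish g2 = pathstart g1"
    and "((\<lambda>w. 1 / w) has_contour_integral \<i> * pi) g1" "((\<lambda>w. 1 / w) has_contour_integral \<i> * pi) g2"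
  shows "contour_integral g1 (\<lambda>w. k w / w) + contour_integral g2 (\<lambda>w. k w / w) = 2 * pi * \<i> * k 0"
proof -
  define f where "f = (\<lambda>w. if w = 0 then deriv k 0 else (k w - k 0) / (w - 0))"
  have f: "f holomorphic_on D"
    unfolding f_def by (rule pole_lemma_open) (use assms in auto)
  have "(f has_contour_integral 0) (g1 +++ g2)"
    by (rule Cauchy_theorem_convex_simple[OF f assms(2)])
       (use assms in \<open>auto simp: path_image_join valid_path_imp_path\<close>)
  moreover have i: "f contour_integrable_on g1" "f contour_integrable_on g2"
    using f assms by (auto intro!: contour_integrable_holomorphic_simple)
  ultimately have z: "contour_integral g1 f + contour_integral g2 f = 0"
    using assms by (metis contour_integral_join contour_integral_unique)
  have e: "contour_integral g (\<lambda>w. k w / w) = contour_integral g f + k 0 * (\<i> * pi)"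
    if "f contour_integrable_on g" "((\<lambda>w. 1 / w) has_contour_integral \<i> * pi) g" "path_image g \<subseteq> D - {0}" for g
  proof (rule contour_integral_unique)
    have "((\<lambda>w. f w + k 0 * (1 / w)) has_contour_integral (contour_integral g f + k 0 * (\<i> * pi))) g"
      by (intro has_contour_integral_add has_contour_integral_integral has_contour_integral_lmul that)
    thus "((\<lambda>w. k w / w) has_contour_integral (contour_integral g f + k 0 * (\<i> * pi))) g"
      by (rule has_contour_integral_eq) (use that(3) in \<open>auto simp: f_def field_simps\<close>)
  qed
  show ?thesis using e[OF i(1)] e[OF i(2)] z assms by (simp add: algebra_simps add_eq_0_iff)
qed

lemma part_circle_right:
  assumes "R > 0" "w \<in> path_image (part_circlepath 0 R (-(pi/2)) (pi/2))"
  shows "norm w = R \<and> Re w \<ge> 0"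
proof -
  obtain t where t: "w = R * cis t" "-(pi/2) \<le> t" "t \<le> pi/2"
    using assms by (auto simp: path_image_part_circlepath cis_conv_exp)
  thus ?thesis using assms by (auto simp: norm_mult cos_ge_zero)
qed

lemma part_circle_left:
  assumes "R > 0" "w \<in> path_image (part_circlepath 0 R (pi/2) (3*pi/2))"
  shows "norm w = R \<and> Re w \<le> 0"
proof -
  obtain t where t: "w = R * cis t" "pi/2 \<le> t" "t \<le> 3*pi/2"
    using assms by (auto simp: path_image_part_circlepath cis_conv_exp)
  have "cos (t - pi) \<ge> 0" using t by (intro cos_ge_zero) auto
  hence "cos t \<le> 0" by (simp add: cos_diff)
  thus ?thesis using assms t by (auto simp: norm_mult mult_nonneg_nonpos)
qed

text \<open>Newman's kernel. Since \<open>R^2 = w * cnj w\<close> on the circle, it equals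
  \<open>2 * Re w / R^2\<close> there; the factor \<open>Re w\<close> cancels the
  \<open>1 / Re w\<close> in the bounds for tails and partial sums.\<close>

lemma norm_kernel_on_circle:
  fixes w :: complex
  assumes "norm w = R" "R > 0"
  shows "norm ((1 + w\<^sup>2 / (of_real R)\<^sup>2) / w) = 2 * \<bar>Re w\<bar> / R\<^sup>2"
proof -
  have w: "w \<noteq> 0" using assms by auto
  have "(of_real R)\<^sup>2 = w * cnj w" using assms complex_norm_square[of w] by simp
  hence "(1 + w\<^sup>2 / (of_real R)\<^sup>2) / w = (w + cnj w) / (of_real R)\<^sup>2"
    using w assms by (simp add: field_simps power2_eq_square)
  also have "\<dots> = of_real (2 * Re w / R\<^sup>2)" by (simp add: complex_add_cnj)
  finally show ?thesis by (simp only: norm_of_real) (simp add: abs_mult)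
qed

lemma imaginary_on_circle: "norm w = R \<Longrightarrow> Re w = 0 \<Longrightarrow> w \<in> {\<i> * R, -\<i> * R}"
  by (auto simp: complex_eq_iff cmod_def)

text \<open>The majorant of \<open>u n w\<close> is \<open>B\<close> times the integral of
  \<open>x powr (-1 - Re w)\<close> over \<open>[n, n + 1]\<close>, on either side of the imaginary
  axis. On the right it telescopes to a bound for the tail, on the left to one for the partial sum.
  Partial sums are entire, so their contour may be a full circle; that of \<open>G\<close> has to
  stay close to the axis.\<close>

theorem Newman_tauberian:
  fixes u :: "nat \<Rightarrow> complex \<Rightarrow> complex" and G :: "complex \<Rightarrow> complex" and B :: real
  assumes hol: "\<And>n. u n holomorphic_on UNIV"
    and bound: "\<And>n w. n \<ge> 1 \<Longrightarrow> Re w \<noteq> 0 \<Longrightarrow>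
        norm (u n w) \<le> B * ((real n powr (-Re w) - real (n+1) powr (-Re w)) / Re w)"
    and U: "open U" "{w. Re w \<ge> 0} \<subseteq> U" "G holomorphic_on U"
    and sums: "\<And>w. Re w > 0 \<Longrightarrow> (\<lambda>n. u (Suc n) w) sums G w"
  shows "(\<lambda>n. u (Suc n) 0) sums G 0"
proof -
  define S where "S = (\<lambda>N w. \<Sum>n<N. u (Suc n) w)"
  have holS: "S N holomorphic_on X" for N X
    unfolding S_def using hol by (intro holomorphic_intros) (auto intro: holomorphic_on_subset)
  have B0: "B \<ge> 0"
  proof -
    have "0 \<le> B * (1/2)" using order_trans[OF norm_ge_zero bound[of 1 1]] by (simp add: powr_minus)
    thus ?thesis by simp
  qed
  have tail: "norm (G w - S N w) \<le> B * (real (N+1) powr (-Re w) / Re w)" if "Re w > 0" for N w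
  proof -
    define f where "f = (\<lambda>m. real (Suc m) powr (-Re w))"
    have "f \<longlonglongrightarrow> 0" unfolding f_def using that
      by (intro tendsto_neg_powr filterlim_compose[OF filterlim_real_sequentially filterlim_Suc]) auto
    hence "(\<lambda>m. f (m + N)) \<longlonglongrightarrow> 0" by (rule LIMSEQ_ignore_initial_segment)
    hence "(\<lambda>m. f (m + N) - f (Suc m + N)) sums (f (0 + N) - 0)"
      by (intro telescope_sums'[of "\<lambda>m. f (m+N)"])
    hence t: "(\<lambda>m. B * ((f (m + N) - f (Suc m + N)) / Re w)) sums (B * ((f N) / Re w))"
      by (intro sums_mult sums_divide) simp
    have s: "(\<lambda>m. u (Suc (m + N)) w) sums (G w - S N w)"
      using sums[OF that] unfolding S_def by (subst sums_iff_shift) simp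
    have b: "norm (u (Suc (m + N)) w) \<le> B * ((f (m + N) - f (Suc m + N)) / Re w)" for m
      using bound[of "Suc (m+N)" w] that by (simp add: f_def)
    have "summable (\<lambda>m. norm (u (Suc (m + N)) w))"
      by (rule summable_comparison_test'[OF sums_summable[OF t], of 0]) (use b in simp)
    hence "norm (\<Sum>m. u (Suc (m + N)) w) \<le> (\<Sum>m. norm (u (Suc (m + N)) w))"
      by (rule summable_norm)
    also have "\<dots> \<le> (\<Sum>m. B * ((f (m + N) - f (Suc m + N)) / Re w))"
      by (intro suminf_le b sums_summable[OF t]) fact
    also have "\<dots> = B * (f N / Re w)" using t by (rule sums_unique[symmetric])
    finally show ?thesis using s by (simp add: sums_iff f_def add.commute)
  qed
  have head: "norm (S N w) \<le> B * (real (N+1) powr (-Re w) / (-Re w))" if "Re w < 0" for N w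
  proof -
    have "norm (S N w) \<le> (\<Sum>n<N. B * ((real (Suc n) powr (-Re w) - real (Suc (Suc n)) powr (-Re w)) / Re w))"
      unfolding S_def using bound[of "Suc _" w] that by (intro order_trans[OF norm_sum] sum_mono) simp
    also have "\<dots> = B * ((\<Sum>n<N. real (Suc n) powr (-Re w) - real (Suc (Suc n)) powr (-Re w)) / Re w)"
      by (simp only: sum_distrib_left sum_divide_distrib)
    also have "(\<Sum>n<N. real (Suc n) powr (-Re w) - real (Suc (Suc n)) powr (-Re w)) = 1 - real (N+1) powr (-Re w)"
      using sum_lessThan_telescope'[of "\<lambda>n. real (Suc n) powr (-Re w)" N] by simp
    also have "(1 - real (N+1) powr (-Re w)) / Re w \<le> real (N+1) powr (-Re w) / (-Re w)"
      using that by (simp add: field_simps)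
    finally show ?thesis using B0 by (simp add: mult_left_mono)
  qed
  \<comment> \<open>The order of the choices matters: \<open>R\<close> first, since the two half
    circles cost \<open>2 * B / R\<close> uniformly in \<open>N\<close>; then the depth
    \<open>h\<close>, which makes the horizontal sides cheap; last \<open>N\<close>, which kills the
    vertical side.\<close>
  have key: "\<exists>N0. \<forall>N\<ge>N0. norm (S N 0 - G 0) \<le> 2 * B / R + e" if R: "R > 0" and e: "e > 0" for R e :: real
  proof -
    let ?A = "(\<lambda>y. \<i> * of_real y) ` {-2*R..2*R}"
    have "compact ?A" by (intro compact_continuous_image continuous_intros) auto
    moreover have "?A \<subseteq> U" using U(2) by auto
    ultimately obtain d where d: "d > 0" "(\<Union>x\<in>?A. ball x d) \<subseteq> U"
      using compact_subset_open_imp_ball_epsilon_subset[OF _ U(1)] by metis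
    \<comment> \<open>Convexity serves \<open>Cauchy_formula_two_halves\<close>; the height
      \<open>2 * R\<close> leaves room around a contour of height \<open>R\<close>, and compactness
      of the segment provides the margin \<open>d\<close>.\<close>
    define D where "D = {w. Re w > -d} \<inter> {w. Im w < 2 * R} \<inter> {w. Im w > -2 * R}"
    have D: "open D" "convex D" unfolding D_def
      by (auto intro!: open_Int convex_Int open_halfspace_Re_gt open_halfspace_Im_lt open_halfspace_Im_gt
            convex_halfspace_Re_gt convex_halfspace_Im_lt convex_halfspace_Im_gt)
    have D0: "0 \<in> D" using R d by (auto simp: D_def)
    have DU: "D \<subseteq> U"
    proof
      fix w assume w: "w \<in> D"
      show "w \<in> U"
      proof (cases "Re w \<ge> 0")
        case False
        have "dist (\<i> * of_real (Im w)) w = \<bar>Re w\<bar>"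
          by (simp add: dist_norm cmod_def)
        hence "w \<in> ball (\<i> * of_real (Im w)) d" using w False by (auto simp: D_def)
        thus ?thesis using d w by (force simp: D_def)
      qed (use U in auto)
    qed
    define h0 where "h0 = d / 2"
    define q where "q = (\<lambda>w. G w * ((1 + w\<^sup>2 / (of_real R)\<^sup>2) / w))"
    have qcont: "continuous_on X q" if "X \<subseteq> D - {0}" for X
      unfolding q_def using that DU U(3) R
      by (intro continuous_intros holomorphic_on_imp_continuous_on) (auto intro: holomorphic_on_subset)
    \<comment> \<open>The bound \<open>M\<close> is taken on horizontal segments of the fixed depth
      \<open>h0\<close>, so that \<open>h\<close> can afterwards be chosen in terms of
      \<open>M\<close>.\<close>
    let ?K1 = "cbox (Complex (-h0) R) (Complex 0 R) \<union> cbox (Complex (-h0) (-R)) (Complex 0 (-R))"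
    have K1: "?K1 \<subseteq> D - {0}" using R d by (auto simp: in_cbox_complex_iff D_def h0_def)
    have "compact (q ` ?K1)" by (intro compact_continuous_image qcont[OF K1] compact_Un compact_cbox)
    then obtain M where M: "M > 0" "\<And>w. w \<in> ?K1 \<Longrightarrow> norm (q w) \<le> M"
      using compact_imp_bounded bounded_pos by (metis imageI)
    define h where "h = min h0 (e / (2 * M))"
    have h: "h > 0" "h \<le> h0" "2 * M * h \<le> e" using M e d by (auto simp: h_def h0_def field_simps min_def)
    let ?K2 = "closed_segment (Complex (-h) R) (Complex (-h) (-R))"
    have K2': "?K2 \<subseteq> {w. Re w = -h} \<inter> {w. Im w \<le> R} \<inter> {w. Im w \<ge> -R}"
      using R by (intro closed_segment_subset convex_Int convex_halfspace_Im_le convex_halfspace_Im_ge)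
         (auto simp: convex_def algebra_simps simp flip: distrib_right)
    have K2: "?K2 \<subseteq> D - {0}" using K2' R h d by (auto simp: D_def h0_def)
    have "compact (q ` ?K2)" by (intro compact_continuous_image qcont[OF K2] compact_segment)
    then obtain M2 where M2: "M2 > 0" "\<And>w. w \<in> ?K2 \<Longrightarrow> norm (q w) \<le> M2"
      using compact_imp_bounded bounded_pos by (metis imageI)
    have K3: "closed_segment (\<i>*R) (Complex (-h) R) \<subseteq> cbox (Complex (-h0) R) (Complex 0 R)"
      using h by (intro closed_segment_subset convex_box) (auto simp: in_cbox_complex_iff)
    have K4: "closed_segment (Complex (-h) (-R)) (-\<i>*R) \<subseteq> cbox (Complex (-h0) (-R)) (Complex 0 (-R))"
      using h by (intro closed_segment_subset convex_box) (auto simp: in_cbox_complex_iff)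
    let ?c1 = "part_circlepath 0 R (-(pi/2)) (pi/2)" and ?c2 = "part_circlepath 0 R (pi/2) (3*pi/2)"
    let ?l = "lpath R h"
    have ends: "pathstart ?c1 = -\<i>*R" "pathfinish ?c1 = \<i>*R" "pathstart ?c2 = \<i>*R" "pathfinish ?c2 = -\<i>*R"
        "pathstart ?l = \<i>*R" "pathfinish ?l = -\<i>*R"
    proof -
      have "cos (3*pi/2) = 0" "sin (3*pi/2) = -1"
        using cos_3over2_pi sin_3over2_pi by (simp_all add: mult.commute)
      thus "pathfinish ?c2 = -\<i>*R" by (auto simp: complex_eq_iff Re_exp Im_exp)
    qed (auto simp: complex_eq_iff Re_exp Im_exp lpath_def)
    have vp: "valid_path ?c1" "valid_path ?c2" "valid_path ?l"
      by (auto simp: lpath_def intro!: valid_path_join)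
    have pil: "path_image ?l \<subseteq> D - {0}"
      using K1 K2 K3 K4 unfolding lpath_def by (auto simp: path_image_join)
    have pi1: "path_image ?c1 \<subseteq> D - {0}"
    proof
      fix w assume w: "w \<in> path_image ?c1"
      have "\<bar>Im w\<bar> \<le> R" using part_circle_right[OF R w] abs_Im_le_cmod[of w] by simp
      hence "Im w < 2 * R" "Im w > -2 * R" using R by linarith+
      thus "w \<in> D - {0}"
        using part_circle_right[OF R w] R d by (auto simp: D_def)
    qed
    have pi2: "path_image ?c2 \<subseteq> UNIV - {0}" using part_circle_left[OF R] R by fastforce
    have main: "2 * pi * norm (G 0 - S N 0) \<le> 2 * pi * B / R + 2 * pi * B / R + (2 * M * h + M2 * real (N+1) powr (-h) * (2 * R))" for N
    proof -
      define T where "T = real (N+1)"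
      have T: "T \<ge> 1" by (simp add: T_def)
      \<comment> \<open>The factor \<open>T powr w\<close> is 1 at the centre, and its modulus
        \<open>T powr Re w\<close> compensates the decay of the tail on the right and the growth of
        the partial sum on the left.\<close>
      define E :: "(complex \<Rightarrow> complex) \<Rightarrow> complex \<Rightarrow> complex" where "E = (\<lambda>f w. (f w * (of_real T powr w * (1 + w\<^sup>2 / (of_real R)\<^sup>2))) / w)"
      have holk: "(\<lambda>w. f w * (of_real T powr w * (1 + w\<^sup>2 / (of_real R)\<^sup>2))) holomorphic_on X"
        if "f holomorphic_on X" for f X
        using that T R by (intro holomorphic_intros) auto
      have int: "E f contour_integrable_on g"
        if "f holomorphic_on X" "open X" "valid_path g" "path_image g \<subseteq> X - {0}" for f X g
        unfolding E_def using that
        by (intro contour_integrable_holomorphic_simple[where S = "X - {0}"] holomorphic_intros holk)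
           (auto intro: holomorphic_on_subset)
      have nT: "norm (of_real T powr w) = T powr Re w" for w
        using T by (simp add: norm_powr_real_powr)
      have "contour_integral ?c1 (E G) + contour_integral ?l (E G) = 2 * pi * \<i> * (G 0 * (of_real T powr 0 * (1 + 0\<^sup>2 / (of_real R)\<^sup>2)))"
        unfolding E_def
        by (rule Cauchy_formula_two_halves[OF D]) (use D0 holk[OF holomorphic_on_subset[OF U(3) DU]] vp pil pi1 ends
             contour_integral_right_half_circle[OF R] contour_integral_lpath[OF R h(1)] in auto)
      hence 1: "contour_integral ?c1 (E G) + contour_integral ?l (E G) = 2 * pi * \<i> * G 0"
        using T by simp
      have "contour_integral ?c1 (E (S N)) + contour_integral ?c2 (E (S N)) = 2 * pi * \<i> * (S N 0 * (of_real T powr 0 * (1 + 0\<^sup>2 / (of_real R)\<^sup>2)))"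
        unfolding E_def
        by (rule Cauchy_formula_two_halves[OF open_UNIV convex_UNIV]) (use holk[OF holS] vp pi2 pi1 ends
             contour_integral_right_half_circle[OF R] contour_integral_left_half_circle[OF R] in auto)
      hence 2: "contour_integral ?c1 (E (S N)) + contour_integral ?c2 (E (S N)) = 2 * pi * \<i> * S N 0"
        using T by simp
      have EE: "norm (E f w) = norm (f w) * (T powr Re w * (2 * \<bar>Re w\<bar> / R\<^sup>2))" if "norm w = R" for f w
      proof -
        have "E f w = f w * (of_real T powr w * ((1 + w\<^sup>2 / (of_real R)\<^sup>2) / w))" by (simp add: E_def)
        thus ?thesis using norm_kernel_on_circle[OF that R] by (simp only: norm_mult nT)
      qed
      have i1: "E G contour_integrable_on ?c1" "E (S N) contour_integrable_on ?c1" "E (S N) contour_integrable_on ?c2" "E G contour_integrable_on ?l"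
        by (rule int[of G D, OF holomorphic_on_subset[OF U(3) DU] D(1)] int[of "S N" UNIV, OF holS open_UNIV];
            use vp pi1 pi2 pil in blast)+
      have "((\<lambda>w. E G w - E (S N) w) has_contour_integral (contour_integral ?c1 (E G) - contour_integral ?c1 (E (S N)))) ?c1"
        by (intro has_contour_integral_diff has_contour_integral_integral i1)
      hence "norm (contour_integral ?c1 (E G) - contour_integral ?c1 (E (S N))) \<le> 2 * B / R\<^sup>2 * R * (pi/2 - -(pi/2))"
      proof (rule has_contour_integral_bound_part_circlepath_strong[where k = "{\<i>*R, -\<i>*R}"])
        \<comment> \<open>The ends of the half circle are exempt: \<open>tail\<close> asks for
          \<open>Re w > 0\<close>.\<close>
        fix w assume w: "w \<in> path_image ?c1 - {\<i>*R, -\<i>*R}"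
        have nw: "norm w = R" "Re w > 0" using part_circle_right[OF R, of w] imaginary_on_circle[of w R] w by force+
        have "E G w - E (S N) w = E (\<lambda>w. G w - S N w) w" by (simp add: E_def field_simps diff_divide_distrib)
        hence "norm (E G w - E (S N) w) = norm (G w - S N w) * (T powr Re w * (2 * \<bar>Re w\<bar> / R\<^sup>2))"
          by (simp only: EE[OF nw(1)])
        also have "\<dots> \<le> (B * (T powr (-Re w) / Re w)) * (T powr Re w * (2 * \<bar>Re w\<bar> / R\<^sup>2))"
          using tail[OF nw(2), of N] by (intro mult_right_mono) (auto simp: T_def)
        also have "\<dots> = 2 * B / R\<^sup>2 * (T powr (-Re w) * T powr Re w)" using nw R by (simp add: field_simps)
        also have "T powr (-Re w) * T powr Re w = 1" using T by (simp flip: powr_add)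
        finally show "norm (E G w - E (S N) w) \<le> 2 * B / R\<^sup>2" by simp
      qed (use R B0 in auto)
      hence b1: "norm (contour_integral ?c1 (E G) - contour_integral ?c1 (E (S N))) \<le> 2 * pi * B / R"
        using R by (simp add: field_simps power2_eq_square)
      have "norm (contour_integral ?c2 (E (S N))) \<le> 2 * B / R\<^sup>2 * R * (3*pi/2 - pi/2)"
      proof (rule has_contour_integral_bound_part_circlepath_strong[where k = "{\<i>*R, -\<i>*R}", OF has_contour_integral_integral[OF i1(3)]])
        fix w assume w: "w \<in> path_image ?c2 - {\<i>*R, -\<i>*R}"
        have nw: "norm w = R" "Re w < 0" using part_circle_left[OF R, of w] imaginary_on_circle[of w R] w by force+
        have "norm (E (S N) w) = norm (S N w) * (T powr Re w * (2 * \<bar>Re w\<bar> / R\<^sup>2))"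
          by (simp only: EE[OF nw(1)])
        also have "\<dots> \<le> (B * (T powr (-Re w) / (-Re w))) * (T powr Re w * (2 * \<bar>Re w\<bar> / R\<^sup>2))"
          using head[OF nw(2), of N] by (intro mult_right_mono) (auto simp: T_def)
        also have "\<dots> = 2 * B / R\<^sup>2 * (T powr (-Re w) * T powr Re w)" using nw R by (simp add: field_simps)
        also have "T powr (-Re w) * T powr Re w = 1" using T by (simp flip: powr_add)
        finally show "norm (E (S N) w) \<le> 2 * B / R\<^sup>2" by simp
      qed (use R B0 in auto)
      hence b2: "norm (contour_integral ?c2 (E (S N))) \<le> 2 * pi * B / R"
        using R by (simp add: field_simps power2_eq_square)
      have Eq: "norm (E G w) = norm (q w) * T powr Re w" for w
        by (simp add: E_def q_def norm_mult nT norm_divide)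
      let ?s1 = "linepath (\<i>*R) (Complex (-h) R)" and ?s2 = "linepath (Complex (-h) R) (Complex (-h) (-R))"
        and ?s3 = "linepath (Complex (-h) (-R)) (-\<i>*R)"
      have il: "E G contour_integrable_on ?s1" "E G contour_integrable_on ?s2" "E G contour_integrable_on ?s3"
        using i1(4) unfolding lpath_def by auto
      have sp: "contour_integral ?l (E G) = contour_integral ?s1 (E G) + (contour_integral ?s2 (E G) + contour_integral ?s3 (E G))"
        using il unfolding lpath_def by (simp add: contour_integral_join)
      have small: "norm (E G w) \<le> M" if "w \<in> ?K1" for w
      proof -
        have "T powr Re w \<le> T powr 0" using that T by (intro powr_mono) (auto simp: in_cbox_complex_iff)
        hence "norm (q w) * T powr Re w \<le> M * 1" using M(2)[OF that] T M(1) by (intro mult_mono) auto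
        thus ?thesis by (simp add: Eq)
      qed
      have "norm (contour_integral ?s1 (E G)) \<le> M * norm (Complex (-h) R - \<i>*R)"
        by (rule has_contour_integral_bound_linepath[OF has_contour_integral_integral[OF il(1)]]) (use M small K3 in auto)
      moreover have "norm (Complex (-h) R - \<i>*R) = h" using h by (simp add: cmod_def)
      moreover have "norm (contour_integral ?s3 (E G)) \<le> M * norm (-\<i>*R - Complex (-h) (-R))"
        by (rule has_contour_integral_bound_linepath[OF has_contour_integral_integral[OF il(3)]]) (use M small K4 in auto)
      moreover have "norm (-\<i>*R - Complex (-h) (-R)) = h" using h by (simp add: cmod_def)
      moreover have "norm (contour_integral ?s2 (E G)) \<le> (M2 * T powr (-h)) * norm (Complex (-h) (-R) - Complex (-h) R)"
      proof (rule has_contour_integral_bound_linepath[OF has_contour_integral_integral[OF il(2)]])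
        fix w assume w: "w \<in> ?K2"
        hence "Re w = -h" using K2' by auto
        thus "norm (E G w) \<le> M2 * T powr (-h)" using M2(2)[OF w] by (simp add: Eq mult_right_mono)
      qed (use M2 in auto)
      moreover have "norm (Complex (-h) (-R) - Complex (-h) R) = 2 * R" using R by (simp add: cmod_def real_sqrt_mult)
      moreover have "norm (contour_integral ?l (E G)) \<le> norm (contour_integral ?s1 (E G)) + norm (contour_integral ?s2 (E G)) + norm (contour_integral ?s3 (E G))"
        unfolding sp by (smt (verit) norm_triangle_ineq)
      ultimately have b3: "norm (contour_integral ?l (E G)) \<le> 2 * M * h + M2 * T powr (-h) * (2 * R)"
        by simp
      have "2 * pi * norm (G 0 - S N 0) = norm (2 * pi * \<i> * G 0 - 2 * pi * \<i> * S N 0)"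
        by (simp add: norm_mult flip: right_diff_distrib)
      also have "2 * pi * \<i> * G 0 - 2 * pi * \<i> * S N 0 = (contour_integral ?c1 (E G) - contour_integral ?c1 (E (S N))) + contour_integral ?l (E G) - contour_integral ?c2 (E (S N))"
        unfolding 1[symmetric] 2[symmetric] by simp
      also have "norm \<dots> \<le> norm (contour_integral ?c1 (E G) - contour_integral ?c1 (E (S N))) + norm (contour_integral ?l (E G)) + norm (contour_integral ?c2 (E (S N)))"
        by (smt (verit) norm_triangle_ineq norm_triangle_ineq4)
      finally show ?thesis using b1 b2 b3[unfolded T_def] by linarith
    qed
    have "((\<lambda>N. real (N+1) powr (-h)) \<longlongrightarrow> 0) sequentially"
      using h by (intro tendsto_neg_powr) (auto intro!: filterlim_compose[OF filterlim_real_sequentially filterlim_Suc] simp del: of_nat_Suc)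
    hence "((\<lambda>N. M2 * real (N+1) powr (-h) * (2 * R)) \<longlongrightarrow> M2 * 0 * (2 * R)) sequentially"
      by (intro tendsto_intros)
    hence "eventually (\<lambda>N. M2 * real (N+1) powr (-h) * (2 * R) < e) sequentially"
      using e by (intro order_tendstoD) auto
    then obtain N0 where N0: "\<And>N. N \<ge> N0 \<Longrightarrow> M2 * real (N+1) powr (-h) * (2 * R) < e"
      unfolding eventually_sequentially by blast
    have "norm (S N 0 - G 0) \<le> 2 * B / R + e" if "N \<ge> N0" for N
    proof -
      have "2 * pi * norm (G 0 - S N 0) \<le> 2 * pi * B / R + 2 * pi * B / R + (e + e)"
        using main[of N] N0[OF that] h(3) by linarith
      also have "\<dots> \<le> 2 * pi * (2 * B / R + e)"
        using e pi_gt3 by (simp add: field_simps)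
      finally show ?thesis by (simp add: norm_minus_commute)
    qed
    thus ?thesis by blast
  qed
  have "(\<lambda>N. S N 0) \<longlonglongrightarrow> G 0"
  proof (rule LIMSEQ_I)
    fix e :: real assume e: "e > 0"
    \<comment> \<open>This makes \<open>2 * B / R\<close> at most \<open>e / 2\<close>; the summand
      1 keeps \<open>R\<close> positive when \<open>B = 0\<close>.\<close>
    define R where "R = 4 * B / e + 1"
    have R: "R > 0" using B0 e by (auto simp: R_def intro!: add_nonneg_pos)
    obtain N0 where N0: "\<forall>N\<ge>N0. norm (S N 0 - G 0) \<le> 2 * B / R + e / 4" using key[OF R, of "e/4"] e by auto
    have "2 * B / R \<le> e / 2" using R e B0 by (simp add: R_def field_simps)
    thus "\<exists>N0. \<forall>N\<ge>N0. norm (S N 0 - G 0) < e" using N0 e by (intro exI[of _ N0]) force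
  qed
  thus ?thesis unfolding S_def sums_def .
qed

section \<open>Dirichlet series\<close>

lemma norm_nat_powr: "norm (of_nat n powr s :: complex) = real n powr Re s"
  using norm_powr_real_powr[of "of_nat n" s] by simp

lemma holomorphic_series_majorant:
  fixes f :: "nat \<Rightarrow> complex \<Rightarrow> complex"
  assumes "open S" "\<And>n. f n holomorphic_on S"
    and "\<And>x. x \<in> S \<Longrightarrow> \<exists>d h. 0 < d \<and> summable h \<and> (\<forall>n. \<forall>y\<in>ball x d \<inter> S. norm (f n y) \<le> h n)"
  shows "(\<lambda>s. \<Sum>n. f n s) holomorphic_on S"
    and "\<And>s. s \<in> S \<Longrightarrow> (\<lambda>n. f n s) sums (\<Sum>n. f n s)"
    and "\<And>s. s \<in> S \<Longrightarrow> (\<lambda>n. deriv (f n) s) sums deriv (\<lambda>s. \<Sum>n. f n s) s"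
proof -
  have "\<exists>g g'. \<forall>x \<in> S. ((\<lambda>n. f n x) sums g x) \<and> ((\<lambda>n. deriv (f n) x) sums g' x) \<and> (g has_field_derivative g' x) (at x)"
  proof (rule series_and_derivative_comparison_local[OF assms(1)])
    show "(f n has_field_derivative deriv (f n) x) (at x)" if "x \<in> S" for n x
      using holomorphic_derivI[OF assms(2,1) that] .
    show "\<exists>d h. 0 < d \<and> summable h \<and> (\<forall>\<^sub>F n in sequentially. \<forall>y\<in>ball x d \<inter> S. norm (f n y) \<le> h n)" if x: "x \<in> S" for x
    proof -
      obtain d h where "0 < d" "summable h" "\<forall>n. \<forall>y\<in>ball x d \<inter> S. norm (f n y) \<le> h n"
        using assms(3)[OF x] by blast
      thus ?thesis by (intro exI[of _ d] exI[of _ h]) auto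
    qed
  qed
  then obtain g g' where g: "\<And>x. x \<in> S \<Longrightarrow> (\<lambda>n. f n x) sums g x" "\<And>x. x \<in> S \<Longrightarrow> (\<lambda>n. deriv (f n) x) sums g' x"
      "\<And>x. x \<in> S \<Longrightarrow> (g has_field_derivative g' x) (at x)" by blast
  have eq: "g x = (\<Sum>n. f n x)" if "x \<in> S" for x using g(1)[OF that] by (simp add: sums_iff)
  have der: "((\<lambda>s. \<Sum>n. f n s) has_field_derivative g' x) (at x)" if "x \<in> S" for x
    by (rule has_field_derivative_transform_within_open[OF g(3)[OF that] assms(1) that]) (rule eq)
  show "(\<lambda>s. \<Sum>n. f n s) holomorphic_on S"
    unfolding holomorphic_on_open[OF assms(1)] using der by blast
  show "(\<lambda>n. f n s) sums (\<Sum>n. f n s)" if "s \<in> S" for s using g(1)[OF that] eq[OF that] by simp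
  show "(\<lambda>n. deriv (f n) s) sums deriv (\<lambda>s. \<Sum>n. f n s) s" if "s \<in> S" for s
    using g(2)[OF that] DERIV_imp_deriv[OF der[OF that]] by simp
qed

text \<open>Absolute convergence of the double series permits grouping the pairs
  \<open>(m, n)\<close> by their product. The values at 0 have to vanish because 0 has infinitely
  many factorizations.\<close>

lemma dirichlet_product_sums:
  fixes f g :: "nat \<Rightarrow> complex"
  assumes 0: "f 0 = 0" "g 0 = 0" and sf: "summable (\<lambda>n. norm (f n))" and sg: "summable (\<lambda>n. norm (g n))"
  shows "(\<lambda>k. if k = 0 then 0 else \<Sum>d | d dvd k. f (k div d) * g d) sums (suminf f * suminf g)"
proof -
  define P where "P = (\<lambda>(m, n). f m * g n)"
  have hf: "(f has_sum suminf f) UNIV"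
    by (intro norm_summable_imp_has_sum sf summable_sums summable_norm_cancel[OF sf])
  have hg: "(g has_sum suminf g) UNIV"
    by (intro norm_summable_imp_has_sum sg summable_sums summable_norm_cancel[OF sg])
  have s: "(\<lambda>x. norm (P x)) summable_on (UNIV \<times> UNIV)"
  proof (subst Infinite_Sum.abs_summable_on_Sigma_iff, intro conjI ballI)
    have ag: "(\<lambda>n. norm (g n)) summable_on UNIV" using sg by (intro norm_summable_imp_summable_on) auto
    show "(\<lambda>y. norm (P (x, y))) summable_on UNIV" for x
      unfolding P_def using ag by (auto simp: norm_mult intro!: summable_on_cmult_right)
    have "(\<Sum>\<^sub>\<infinity>y. norm (P (x, y))) = norm (f x) * (\<Sum>\<^sub>\<infinity>y. norm (g y))" for x
      unfolding P_def using ag by (simp add: norm_mult infsum_cmult_right)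
    moreover have "(\<lambda>n. norm (f n)) summable_on UNIV" using sf by (intro norm_summable_imp_summable_on) auto
    ultimately show "(\<lambda>x. norm (\<Sum>\<^sub>\<infinity>y\<in>UNIV. norm (P (x, y)))) summable_on UNIV"
      by (auto simp: abs_mult intro!: summable_on_cmult_left infsum_nonneg)
  qed
  have "P summable_on (UNIV \<times> UNIV)" using s by (rule Infinite_Sum.abs_summable_summable)
  hence "(P has_sum (suminf f * suminf g)) (UNIV \<times> UNIV)"
  proof (rule has_sum_SigmaI[rotated 2])
    show "((\<lambda>y. P (x, y)) has_sum (f x * suminf g)) UNIV" for x
      unfolding P_def using has_sum_cmult_right[OF hg] by simp
    show "((\<lambda>x. f x * suminf g) has_sum (suminf f * suminf g)) UNIV"
      by (rule has_sum_cmult_left[OF hf])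
  qed
  also have "?this \<longleftrightarrow> (P has_sum (suminf f * suminf g)) ({1..} \<times> {1..})"
    by (intro has_sum_cong_neutral) (auto simp: P_def 0 Suc_le_eq intro!: Nat.gr0I)
  also have "\<dots> \<longleftrightarrow> ((\<lambda>(k, d). f (k div d) * g d) has_sum (suminf f * suminf g)) (SIGMA k:{1..}. {d. d dvd k})"
    by (rule has_sum_reindex_bij_witness[where i = "\<lambda>(k, d). (k div d, d)" and j = "\<lambda>(m, n). (m * n, n)"])
       (auto simp: P_def Suc_le_eq dvd_div_eq_0_iff intro!: Nat.gr0I)
  finally have "((\<lambda>k. \<Sum>d | d dvd k. f (k div d) * g d) has_sum (suminf f * suminf g)) {1..}"
    by (rule has_sum_SigmaD) (auto intro!: has_sum_finiteI)
  also have "?this \<longleftrightarrow> ((\<lambda>k. if k = 0 then 0 else \<Sum>d | d dvd k. f (k div d) * g d) has_sum (suminf f * suminf g)) UNIV"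
    by (intro has_sum_cong_neutral) auto
  finally show ?thesis by (rule has_sum_imp_sums)
qed

text \<open>One bound for the characters and for their products with \<open>mangoldt\<close>; it is
  summable against \<open>n powr (-s)\<close> for \<open>Re s > 1\<close>.\<close>

definition log_bounded :: "(nat \<Rightarrow> complex) \<Rightarrow> bool" where
  "log_bounded a \<longleftrightarrow> (\<forall>n\<ge>1. norm (a n) \<le> ln (real n) + 1)"

definition dseries :: "(nat \<Rightarrow> complex) \<Rightarrow> complex \<Rightarrow> complex" where
  "dseries a s = (\<Sum>n. a n * of_nat n powr (-s))"

lemma summable_log_powr:
  fixes \<sigma> :: real
  assumes "\<sigma> > 1"
  shows "summable (\<lambda>n. (ln (real n) + 1) * real n powr (-\<sigma>))"
proof -
  define e where "e = (\<sigma> - 1) / 2"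
  have e: "e > 0" using assms by (simp add: e_def)
  have "summable (\<lambda>n. (1 / e + 1) * real n powr (e - \<sigma>))"
    using assms by (intro summable_mult) (auto simp: summable_real_powr_iff e_def field_simps)
  thus ?thesis
  proof (rule summable_comparison_test'[where N = 1])
    fix n :: nat assume n: "n \<ge> 1"
    have "ln (real n) \<le> real n powr e / e" "1 \<le> real n powr e"
      using n e by (auto intro!: ln_powr_bound ge_one_powr_ge_zero)
    hence "(ln (real n) + 1) * real n powr (-\<sigma>) \<le> (real n powr e / e + real n powr e) * real n powr (-\<sigma>)"
      by (intro mult_right_mono) auto
    also have "\<dots> = (1 / e + 1) * real n powr (e - \<sigma>)"
      using n by (simp add: algebra_simps flip: powr_add)
    finally show "norm ((ln (real n) + 1) * real n powr (-\<sigma>)) \<le> (1 / e + 1) * real n powr (e - \<sigma>)"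
      using n by (simp add: abs_mult)
  qed
qed

lemma dseries_term_bound:
  assumes "log_bounded a" "\<sigma> \<le> Re s"
  shows "norm (a n * of_nat n powr (-s)) \<le> (ln (real n) + 1) * real n powr (-\<sigma>)"
proof (cases "n = 0")
  case False
  hence "norm (a n) * real n powr (-Re s) \<le> (ln (real n) + 1) * real n powr (-\<sigma>)"
    using assms by (intro mult_mono powr_mono) (auto simp: log_bounded_def)
  thus ?thesis by (simp add: norm_mult norm_nat_powr)
qed auto

lemma dseries_abs_summable:
  assumes "log_bounded a" "Re s > 1"
  shows "summable (\<lambda>n. norm (a n * of_nat n powr (-s)))"
  by (rule summable_comparison_test'[OF summable_log_powr[OF assms(2)], of 0])
     (use dseries_term_bound[OF assms(1) order_refl] in auto)

lemma dseries_sums: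
  assumes "log_bounded a" "Re s > 1"
  shows "(\<lambda>n. a n * of_nat n powr (-s)) sums dseries a s"
  unfolding dseries_def by (intro summable_sums summable_norm_cancel[OF dseries_abs_summable] assms)

lemma dseries_majorant:
  assumes "log_bounded a" "Re x > 1"
  shows "\<exists>d h. 0 < d \<and> summable h \<and> (\<forall>n. \<forall>y\<in>ball x d \<inter> {s. Re s > 1}. norm (a n * of_nat n powr (-y)) \<le> h n)"
proof (intro exI[of _ "(Re x - 1) / 2"] exI[of _ "\<lambda>n. (ln (real n) + 1) * real n powr (- ((Re x + 1) / 2))"] conjI ballI allI)
  show "summable (\<lambda>n. (ln (real n) + 1) * real n powr (- ((Re x + 1) / 2)))"
    using summable_log_powr[of "(Re x + 1) / 2"] assms by simp
  fix n y assume y: "y \<in> ball x ((Re x - 1) / 2) \<inter> {s. Re s > 1}"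
  have "\<bar>Re x - Re y\<bar> \<le> norm (x - y)" using abs_Re_le_cmod[of "x - y"] by simp
  hence "Re x - Re y < (Re x - 1) / 2" using y by (auto simp: dist_norm)
  hence "(Re x + 1) / 2 \<le> Re y" by (simp add: field_simps)
  thus "norm (a n * of_nat n powr (-y)) \<le> (ln (real n) + 1) * real n powr (- ((Re x + 1) / 2))"
    using dseries_term_bound[OF assms(1), of "(Re x + 1) / 2" y n] by simp
qed (use assms in auto)

lemma open_Re_gt: "open {s. Re s > c}" by (rule open_halfspace_Re_gt)

lemma dseries_holomorphic:
  assumes "log_bounded a"
  shows "dseries a holomorphic_on {s. Re s > 1}"
  unfolding dseries_def using dseries_majorant[OF assms]
  by (intro holomorphic_series_majorant(1) open_Re_gt holomorphic_intros) auto

lemma dseries_deriv: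
  assumes "log_bounded a" "Re s > 1"
  shows "(\<lambda>n. - of_real (ln (real n)) * a n * of_nat n powr (-s)) sums deriv (dseries a) s"
proof -
  have "deriv (\<lambda>s. a n * of_nat n powr (-s)) s = - of_real (ln (real n)) * a n * of_nat n powr (-s)" for n
  proof (cases "n = 0")
    case False
    thus ?thesis
      using DERIV_cmult[OF DERIV_chain2[OF has_field_derivative_powr_right[of "of_nat n" "-s"] DERIV_minus[OF DERIV_ident]], of "a n"]
      by (intro DERIV_imp_deriv) (simp add: Ln_of_nat mult_ac)
  qed auto
  moreover have "(\<lambda>n. deriv (\<lambda>s. a n * of_nat n powr (-s)) s) sums deriv (\<lambda>s. \<Sum>n. a n * of_nat n powr (-s)) s"
    using dseries_majorant[OF assms(1)] assms(2)
    by (intro holomorphic_series_majorant(3)[where S = "{s. Re s > 1}"] open_Re_gt holomorphic_intros) auto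
  ultimately show ?thesis by (simp add: dseries_def[abs_def])
qed

lemma log_bounded_bounded: "(\<And>n. norm (a n) \<le> 1) \<Longrightarrow> log_bounded a"
  by (auto simp: log_bounded_def intro: order_trans[of _ 1])

lemma log_bounded_mangoldt:
  assumes "\<And>n. norm (a n) \<le> 1"
  shows "log_bounded (\<lambda>n. a n * mangoldt n)"
proof -
  have "norm (a n * mangoldt n) \<le> 1 * (ln n + 1)" if "n \<ge> 1" for n
    using assms[of n] mangoldt_le[of n] that unfolding norm_mult by (intro mult_mono) (auto simp: mangoldt_nonneg)
  thus ?thesis by (auto simp: log_bounded_def)
qed

text \<open>The sum of \<open>mangoldt d\<close> over the divisors of \<open>k\<close> is
  \<open>ln k\<close>; twisted by a completely multiplicative \<open>c\<close>, this identity turns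
  termwise differentiation into a Dirichlet product. The product form is meaningful also at zeros of
  \<open>dseries c\<close>.\<close>

lemma deriv_dseries_multiplicative:
  fixes c :: "nat \<Rightarrow> complex"
  assumes "\<And>m n. c (m * n) = c m * c n" "\<And>n. norm (c n) \<le> 1" "Re s > 1"
  shows "deriv (dseries c) s = - (dseries c s * dseries (\<lambda>n. c n * mangoldt n) s)"
proof -
  note lb = log_bounded_bounded[OF assms(2)] log_bounded_mangoldt[OF assms(2)]
  have "(\<lambda>k. if k = 0 then 0 else \<Sum>d | d dvd k. (c (k div d) * of_nat (k div d) powr (-s)) * (c d * mangoldt d * of_nat d powr (-s)))
      sums (dseries c s * dseries (\<lambda>n. c n * mangoldt n) s)"
    unfolding dseries_def by (rule dirichlet_product_sums) (use lb assms(3) in \<open>auto intro!: dseries_abs_summable\<close>)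
  also have "(\<lambda>k. if k = 0 then 0 else \<Sum>d | d dvd k. (c (k div d) * of_nat (k div d) powr (-s)) * (c d * mangoldt d * of_nat d powr (-s)))
      = (\<lambda>k. - (- of_real (ln (real k)) * c k * of_nat k powr (-s)))"
  proof
    fix k :: nat
    have "(\<Sum>d | d dvd k. (c (k div d) * of_nat (k div d) powr (-s)) * (c d * mangoldt d * of_nat d powr (-s))) =
        (\<Sum>d | d dvd k. c k * of_nat k powr (-s) * mangoldt d)"
    proof (intro sum.cong refl)
      fix d assume "d \<in> {d. d dvd k}"
      then obtain e where e: "k = d * e" by auto
      show "(c (k div d) * of_nat (k div d) powr (-s)) * (c d * mangoldt d * of_nat d powr (-s)) = c k * of_nat k powr (-s) * mangoldt d"
        by (cases "d = 0") (auto simp: e assms(1) powr_times_real)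
    qed
    also have "\<dots> = c k * of_nat k powr (-s) * of_real (ln (real k))" if "k \<noteq> 0"
      using mangoldt_sum[OF that, where ?'a = complex] by (simp flip: sum_distrib_left)
    finally show "(if k = 0 then 0 else \<Sum>d | d dvd k. (c (k div d) * of_nat (k div d) powr (-s)) * (c d * mangoldt d * of_nat d powr (-s)))
       = - (- of_real (ln (real k)) * c k * of_nat k powr (-s))" by auto
  qed
  finally have "dseries c s * dseries (\<lambda>n. c n * mangoldt n) s = - deriv (dseries c) s"
    using sums_minus[OF dseries_deriv[OF lb(1) assms(3)]] by (rule sums_unique2)
  thus ?thesis by simp
qed

section \<open>The characters modulo 4\<close>

definition chi0 :: "nat \<Rightarrow> complex" where "chi0 n = (if odd n then 1 else 0)"
definition chi4 :: "nat \<Rightarrow> complex" where "chi4 n = (if n mod 4 = 1 then 1 else if n mod 4 = 3 then -1 else 0)"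

lemma chi0_mult: "chi0 (m * n) = chi0 m * chi0 n" and chi0_bound: "norm (chi0 n) \<le> 1"
  by (auto simp: chi0_def)

lemma chi4_mult: "chi4 (m * n) = chi4 m * chi4 n"
proof -
  have *: "m mod 4 \<in> {0,1,2,3}" "n mod 4 \<in> {0,1,2,3}" by auto
  have e: "(m * n) mod 4 = ((m mod 4) * (n mod 4)) mod 4" by (rule mod_mult_eq[symmetric])
  from * show ?thesis unfolding chi4_def e by (elim insertE emptyE) simp_all
qed

lemma chi4_bound: "norm (chi4 n) \<le> 1" by (auto simp: chi4_def)

text \<open>The mean value inequality on a real segment; \<open>Re s > -1\<close> makes the modulus
  of the derivative largest at the left end.\<close>

lemma powr_diff_bound:
  fixes s :: complex
  assumes "0 < a" "a \<le> x" "Re s > -1"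
  shows "norm (of_real x powr (-s) - of_real a powr (-s)) \<le> norm s * a powr (-Re s - 1) * (x - a)"
proof -
  have "norm (of_real x powr (-s) - of_real a powr (-s)) \<le> norm s * a powr (-Re s - 1) * norm (complex_of_real x - of_real a)"
  proof (rule field_differentiable_bound[where S = "complex_of_real ` {a..x}" and f' = "\<lambda>z. (-s) * z powr (-s - 1)"])
    show "convex (complex_of_real ` {a..x})" by (intro convex_linear_image) (auto intro: linearI simp: scaleR_conv_of_real)
    fix z assume "z \<in> complex_of_real ` {a..x}"
    then obtain t where t: "z = of_real t" "a \<le> t" "t \<le> x" by auto
    have "z \<notin> \<real>\<^sub>\<le>\<^sub>0" using t assms by (auto simp: complex_nonpos_Reals_iff)
    thus "((\<lambda>z. z powr (-s)) has_field_derivative (-s) * z powr (-s - 1)) (at z within complex_of_real ` {a..x})"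
      by (rule has_field_derivative_at_within[OF has_field_derivative_powr])
    have "norm (z powr (-s - 1)) = t powr (-Re s - 1)" using t assms by (subst norm_powr_real_powr) auto
    also have "\<dots> \<le> a powr (-Re s - 1)" using t assms by (intro powr_mono2') auto
    finally show "norm ((-s) * z powr (-s - 1)) \<le> norm s * a powr (-Re s - 1)"
      by (simp add: norm_mult mult_left_mono)
  qed (use assms in auto)
  thus ?thesis using assms by (simp add: norm_of_real flip: of_real_diff)
qed

section \<open>Continuation of the two L-series to \<open>Re s > 0\<close>\<close>

text \<open>Pairing the classes 1 and 3 modulo 4 leaves differences of order
  \<open>k powr (-Re s - 1)\<close>, so the paired series converges absolutely for
  \<open>Re s > 0\<close>.\<close>

definition L4_term :: "nat \<Rightarrow> complex \<Rightarrow> complex" where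
  "L4_term k s = of_nat (4*k+1) powr (-s) - of_nat (4*k+3) powr (-s)"

definition L4 :: "complex \<Rightarrow> complex" where "L4 s = (\<Sum>k. L4_term k s)"

text \<open>\<open>Z0_term k s\<close> is \<open>(s - 1) \<integral> ((2k+1) powr -s - x powr -s) dx / 2\<close> over \<open>[2k+1, 2k+3]\<close>; the integrals of
  \<open>x powr -s\<close> telescope.\<close>

definition Z0_term :: "nat \<Rightarrow> complex \<Rightarrow> complex" where
  "Z0_term k s = (s - 1) * of_nat (2*k+1) powr (-s) + (of_nat (2*k+3) powr (1-s) - of_nat (2*k+1) powr (1-s)) / 2"

text \<open>The continuation of \<open>(s - 1) * dseries chi0 s\<close>. The summand
  \<open>1/2\<close> restores \<open>(s - 1) / 2\<close> times the integral of
  \<open>x powr (-s)\<close> from 1 to infinity, which the terms have subtracted.\<close>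

definition Z0 :: "complex \<Rightarrow> complex" where "Z0 s = 1/2 + (\<Sum>k. Z0_term k s)"

lemma L4_term_bound:
  assumes "Re s > 0"
  shows "norm (L4_term k s) \<le> norm s * 2 * real (k+1) powr (-Re s - 1)"
proof -
  have "norm (L4_term k s) = norm (complex_of_real (4*real k+3) powr (-s) - complex_of_real (4*real k+1) powr (-s))"
    by (simp add: L4_term_def norm_minus_commute add.commute)
  also have "\<dots> \<le> norm s * (4*real k+1) powr (-Re s - 1) * ((4*real k+3) - (4*real k+1))"
    using assms by (intro powr_diff_bound) auto
  also have "\<dots> \<le> norm s * real (k+1) powr (-Re s - 1) * 2"
    using assms by (intro mult_mono powr_mono2') auto
  finally show ?thesis by (simp add: mult_ac)
qed

lemma Z0_term_bound:
  assumes "Re s > 0"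
  shows "norm (Z0_term k s) \<le> norm (s - 1) * norm s * 2 * real (k+1) powr (-Re s - 1)"
proof -
  define a where "a = real (2*k+1)"
  have a: "a > 0" by (simp add: a_def)
  \<comment> \<open>\<open>Z0_term k s\<close> is the increment of \<open>F\<close> over
    \<open>[a, a + 2]\<close>, and the derivative of \<open>F\<close> is again a difference of
    powers, so that \<open>powr_diff_bound\<close> applies inside the mean value inequality.\<close>
  define F where "F = (\<lambda>z. z powr (1 - s) / 2 + (s - 1) * of_real a powr (-s) * z / 2)"
  have "norm (F (of_real (a+2)) - F (of_real a)) \<le> (norm (s - 1) / 2 * (norm s * a powr (-Re s - 1) * 2)) * norm (complex_of_real (a+2) - of_real a)"
  proof (rule field_differentiable_bound[where S = "complex_of_real ` {a..a+2}" and f' = "\<lambda>z. (1 - s) / 2 * (z powr (-s) - of_real a powr (-s))"])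
    show "convex (complex_of_real ` {a..a+2})" by (intro convex_linear_image) (auto intro: linearI simp: scaleR_conv_of_real)
    fix z assume "z \<in> complex_of_real ` {a..a+2}"
    then obtain t where t: "z = of_real t" "a \<le> t" "t \<le> a+2" by auto
    have "z \<notin> \<real>\<^sub>\<le>\<^sub>0" using t a by (auto simp: complex_nonpos_Reals_iff)
    thus "(F has_field_derivative (1 - s) / 2 * (z powr (-s) - of_real a powr (-s))) (at z within complex_of_real ` {a..a+2})"
      unfolding F_def by (auto intro!: derivative_eq_intros simp: field_simps)
    have "norm (z powr (-s) - of_real a powr (-s)) \<le> norm s * a powr (-Re s - 1) * (t - a)"
      unfolding t using a t assms by (intro powr_diff_bound) auto
    also have "\<dots> \<le> norm s * a powr (-Re s - 1) * 2" using t by (intro mult_left_mono) auto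
    finally have "norm (s - 1) / 2 * norm (z powr (-s) - of_real a powr (-s)) \<le> norm (s - 1) / 2 * (norm s * a powr (-Re s - 1) * 2)"
      by (rule mult_left_mono) auto
    thus "norm ((1 - s) / 2 * (z powr (-s) - of_real a powr (-s))) \<le> norm (s - 1) / 2 * (norm s * a powr (-Re s - 1) * 2)"
      by (simp only: norm_mult norm_divide norm_minus_commute[of 1 s] norm_numeral)
  next
    show "complex_of_real (a + 2) \<in> complex_of_real ` {a..a+2}" by (intro imageI) auto
  qed auto
  also have "F (of_real (a+2)) - F (of_real a) = Z0_term k s"
    by (simp add: F_def Z0_term_def a_def field_simps)
  also have "(norm (s - 1) / 2 * (norm s * a powr (-Re s - 1) * 2)) * norm (complex_of_real (a+2) - of_real a)
      = norm (s - 1) * norm s * 2 * a powr (-Re s - 1)" by simp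
  also have "\<dots> \<le> norm (s - 1) * norm s * 2 * real (k+1) powr (-Re s - 1)"
    using assms by (intro mult_left_mono powr_mono2') (auto simp: a_def)
  finally show ?thesis .
qed

text \<open>On the ball of radius \<open>Re x / 2\<close> the exponent stays at most
  \<open>-Re x / 2 - 1\<close> and the factor \<open>q\<close> stays bounded. The quadratic bound on
  \<open>q\<close> covers both \<open>s * 2\<close> and \<open>(s - 1) * s * 2\<close>.\<close>

lemma powr_series_majorant:
  fixes q :: "complex \<Rightarrow> complex" and f :: "nat \<Rightarrow> complex \<Rightarrow> complex"
  assumes x: "Re x > 0" and q: "\<And>s. norm (q s) \<le> (norm s + 1)\<^sup>2 * 2"
    and b: "\<And>n s. Re s > 0 \<Longrightarrow> norm (f n s) \<le> norm (q s) * real (n+1) powr (-Re s - 1)"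
  shows "\<exists>d h. 0 < d \<and> summable h \<and> (\<forall>n. \<forall>y\<in>ball x d \<inter> {s. Re s > 0}. norm (f n y) \<le> h n)"
proof (intro exI[of _ "Re x / 2"] exI[of _ "\<lambda>n. ((norm x + Re x / 2 + 1)\<^sup>2 * 2) * real (Suc n) powr (-(Re x) / 2 - 1)"] conjI ballI allI)
  have "summable (\<lambda>n. real (Suc n) powr (-(Re x) / 2 - 1))"
    using x by (subst summable_Suc_iff) (simp add: summable_real_powr_iff)
  thus "summable (\<lambda>n. ((norm x + Re x / 2 + 1)\<^sup>2 * 2) * real (Suc n) powr (-(Re x) / 2 - 1))"
    by (rule summable_mult)
  fix n y assume y: "y \<in> ball x (Re x / 2) \<inter> {s. Re s > 0}"
  have "\<bar>Re x - Re y\<bar> \<le> norm (x - y)" using abs_Re_le_cmod[of "x - y"] by simp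
  hence r: "Re y \<ge> Re x / 2" using y by (auto simp: dist_norm)
  have "norm y \<le> norm x + norm (x - y)" by (metis norm_triangle_sub norm_minus_commute)
  hence ny: "norm y \<le> norm x + Re x / 2" using y by (auto simp: dist_norm)
  have "norm (f n y) \<le> norm (q y) * real (n+1) powr (-Re y - 1)" using b y by auto
  also have "\<dots> \<le> ((norm y + 1)\<^sup>2 * 2) * real (n+1) powr (-(Re x) / 2 - 1)"
  proof (rule mult_mono)
    show "real (n+1) powr (-Re y - 1) \<le> real (n+1) powr (-(Re x) / 2 - 1)"
      using r by (intro powr_mono) auto
  qed (use q[of y] in auto)
  also have "\<dots> \<le> ((norm x + Re x / 2 + 1)\<^sup>2 * 2) * real (n+1) powr (-(Re x) / 2 - 1)"
    using ny by (intro mult_right_mono power_mono) auto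
  finally show "norm (f n y) \<le> ((norm x + Re x / 2 + 1)\<^sup>2 * 2) * real (Suc n) powr (-(Re x) / 2 - 1)" by simp
qed (use x in auto)

lemma L4_majorant:
  assumes "Re x > 0"
  shows "\<exists>d h. 0 < d \<and> summable h \<and> (\<forall>n. \<forall>y\<in>ball x d \<inter> {s. Re s > 0}. norm (L4_term n y) \<le> h n)"
proof -
  have q: "norm (s * 2) \<le> (norm s + 1)\<^sup>2 * 2" for s :: complex
  proof -
    have "norm s * 1 \<le> (norm s + 1) * (norm s + 1)" by (intro mult_mono) auto
    thus ?thesis unfolding norm_mult power2_eq_square norm_numeral by linarith
  qed
  have b: "norm (L4_term n s) \<le> norm (s * 2) * real (n+1) powr (-Re s - 1)" if "Re s > 0" for n s
    using L4_term_bound[OF that, of n] unfolding norm_mult norm_numeral .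
  show ?thesis by (rule powr_series_majorant[OF assms q b])
qed

lemma Z0_majorant:
  assumes "Re x > 0"
  shows "\<exists>d h. 0 < d \<and> summable h \<and> (\<forall>n. \<forall>y\<in>ball x d \<inter> {s. Re s > 0}. norm (Z0_term n y) \<le> h n)"
proof -
  have q: "norm ((s - 1) * s * 2) \<le> (norm s + 1)\<^sup>2 * 2" for s :: complex
  proof -
    have "norm (s - 1) * norm s \<le> (norm s + 1) * (norm s + 1)"
      using norm_triangle_ineq4[of s 1] by (intro mult_mono) auto
    thus ?thesis unfolding norm_mult power2_eq_square norm_numeral by linarith
  qed
  have b: "norm (Z0_term n s) \<le> norm ((s - 1) * s * 2) * real (n+1) powr (-Re s - 1)" if "Re s > 0" for n s
    using Z0_term_bound[OF that, of n] unfolding norm_mult norm_numeral .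
  show ?thesis by (rule powr_series_majorant[OF assms q b])
qed

lemma L4_holomorphic: "L4 holomorphic_on {s. Re s > 0}"
  and L4_sums: "Re s > 0 \<Longrightarrow> (\<lambda>k. L4_term k s) sums L4 s"
proof -
  have h: "L4_term n holomorphic_on {s. Re s > 0}" for n
    unfolding L4_term_def by (intro holomorphic_intros)
  have maj: "\<exists>d h. 0 < d \<and> summable h \<and> (\<forall>n. \<forall>y\<in>ball x d \<inter> {s. Re s > 0}. norm (L4_term n y) \<le> h n)"
    if "x \<in> {s. Re s > 0}" for x using L4_majorant that by simp
  note * = holomorphic_series_majorant(1,2)[OF open_Re_gt h maj]
  show "L4 holomorphic_on {s. Re s > 0}"
    unfolding L4_def using *(1) by simp
  show "Re s > 0 \<Longrightarrow> (\<lambda>k. L4_term k s) sums L4 s"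
    using *(2)[of s] by (simp add: L4_def)
qed

lemma Z0_holomorphic: "Z0 holomorphic_on {s. Re s > 0}"
  and Z0_sums: "Re s > 0 \<Longrightarrow> (\<lambda>k. Z0_term k s) sums (Z0 s - 1/2)"
proof -
  have h: "Z0_term n holomorphic_on {s. Re s > 0}" for n
    unfolding Z0_term_def by (intro holomorphic_intros) auto
  have maj: "\<exists>d h. 0 < d \<and> summable h \<and> (\<forall>n. \<forall>y\<in>ball x d \<inter> {s. Re s > 0}. norm (Z0_term n y) \<le> h n)"
    if "x \<in> {s. Re s > 0}" for x using Z0_majorant that by simp
  note * = holomorphic_series_majorant(1,2)[OF open_Re_gt h maj]
  show "Z0 holomorphic_on {s. Re s > 0}"
    unfolding Z0_def using *(1) by (intro holomorphic_intros) simp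
  show "Re s > 0 \<Longrightarrow> (\<lambda>k. Z0_term k s) sums (Z0 s - 1/2)"
    using *(2)[of s] by (simp add: Z0_def)
qed

lemma L4_eq_dseries:
  assumes "Re s > 1" shows "L4 s = dseries chi4 s"
proof -
  have "(\<lambda>n. chi4 n * of_nat n powr (-s)) sums dseries chi4 s"
    by (intro dseries_sums log_bounded_bounded chi4_bound assms)
  from sums_group[OF this, of 4]
  have "(\<lambda>n. \<Sum>k = n*4..<n*4+4. chi4 k * of_nat k powr (-s)) sums dseries chi4 s" by simp
  also have "(\<lambda>n. \<Sum>k = n*4..<n*4+4. chi4 k * of_nat k powr (-s)) = (\<lambda>n. L4_term n s)"
  proof
    fix n :: nat
    have "{n*4..<n*4+4} = {4*n, 4*n+1, 4*n+2, 4*n+3}" by auto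
    moreover have "chi4 (4 * n) = 0" "chi4 (4 * n + 1) = 1" "chi4 (4 * n + 3) = -1" "chi4 (4 * n + 2) = 0"
      by (simp_all add: chi4_def mod_Suc)
    ultimately show "(\<Sum>k = n*4..<n*4+4. chi4 k * of_nat k powr (-s)) = L4_term n s"
      by (simp add: L4_term_def del: of_nat_add of_nat_mult)
  qed
  finally show ?thesis using L4_sums[of s] assms by (simp add: sums_iff)
qed

lemma Z0_eq_dseries:
  assumes "Re s > 1" shows "Z0 s = (s - 1) * dseries chi0 s"
proof -
  have "(\<lambda>n. chi0 n * of_nat n powr (-s)) sums dseries chi0 s"
    by (intro dseries_sums log_bounded_bounded chi0_bound assms)
  from sums_group[OF this, of 2]
  have "(\<lambda>n. \<Sum>k = n*2..<n*2+2. chi0 k * of_nat k powr (-s)) sums dseries chi0 s" by simp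
  also have "(\<lambda>n. \<Sum>k = n*2..<n*2+2. chi0 k * of_nat k powr (-s)) = (\<lambda>n. of_nat (2*n+1) powr (-s))"
  proof
    fix n :: nat
    have "{n*2..<n*2+2} = {2*n, 2*n+1}" by auto
    thus "(\<Sum>k = n*2..<n*2+2. chi0 k * of_nat k powr (-s)) = of_nat (2*n+1) powr (-s)"
      by (simp add: chi0_def algebra_simps)
  qed
  finally have 1: "(\<lambda>n. (s - 1) * of_nat (2*n+1) powr (-s)) sums ((s - 1) * dseries chi0 s)"
    by (rule sums_mult)
  define g where "g = (\<lambda>n. of_nat (2*n+1) powr (1-s) :: complex)"
  have "(\<lambda>n. norm (g n)) \<longlonglongrightarrow> 0"
  proof -
    have "(\<lambda>n. real n powr Re (1-s)) \<longlonglongrightarrow> 0" using assms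
      by (intro tendsto_neg_powr filterlim_real_sequentially) auto
    from LIMSEQ_subseq_LIMSEQ[OF this, of "\<lambda>n. 2*n+1"]
    have "(\<lambda>n. real (2*n+1) powr Re (1-s)) \<longlonglongrightarrow> 0" by (simp add: strict_mono_def o_def)
    thus ?thesis unfolding g_def norm_nat_powr .
  qed
  hence "g \<longlonglongrightarrow> 0" by (rule tendsto_norm_zero_cancel)
  from telescope_sums[OF this] have "(\<lambda>n. (g (Suc n) - g n) / 2) sums ((0 - g 0) / 2)" by (rule sums_divide)
  note sums_add[OF 1 this]
  also have "(\<lambda>n. (s - 1) * of_nat (2*n+1) powr (-s) + (g (Suc n) - g n) / 2) = (\<lambda>n. Z0_term n s)"
  proof
    fix n :: nat
    have "2 * Suc n + 1 = 2 * n + 3" by simp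
    thus "(s - 1) * of_nat (2*n+1) powr (-s) + (g (Suc n) - g n) / 2 = Z0_term n s"
      unfolding g_def Z0_term_def by (simp only:)
  qed
  also have "(0 - g 0) / 2 = - (1 / 2)" by (simp add: g_def)
  finally have "Z0 s - 1/2 = (s - 1) * dseries chi0 s + - (1 / 2)"
    using Z0_sums[of s] assms by (intro sums_unique2[of "\<lambda>n. Z0_term n s"]) auto
  thus ?thesis by simp
qed

lemma Z0_1: "Z0 1 = 1/2"
proof -
  have "of_nat (2*k+3) \<noteq> (0::complex)" "of_nat (2*k+1) \<noteq> (0::complex)" for k :: nat
    by (subst of_nat_eq_0_iff; simp)+
  hence "Z0_term k 1 = 0" for k by (simp add: Z0_term_def del: of_nat_add of_nat_mult)
  thus ?thesis by (simp add: Z0_def)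
qed

text \<open>At 1 the series is Leibniz's \<open>1 - 1/3 + 1/5 - ...\<close>, positive pair by
  pair.\<close>

lemma L4_1: "L4 1 \<noteq> 0"
proof -
  have "(\<lambda>k. Re (L4_term k 1)) sums Re (L4 1)" by (intro sums_Re L4_sums) auto
  moreover have "Re (L4_term k 1) > 0" for k
  proof -
    have "L4_term k 1 = of_real (1 / (4*k+1) - 1 / (4*k+3))"
      by (simp add: L4_term_def powr_minus divide_inverse)
    moreover have "1 / real (4*k+3) < 1 / real (4*k+1)" by (intro divide_strict_left_mono) auto
    ultimately show ?thesis by (simp only: Re_complex_of_real)
  qed
  ultimately have "Re (L4 1) > 0" using suminf_pos[of "\<lambda>k. Re (L4_term k 1)"] by (simp add: sums_iff)
  thus ?thesis by auto
qed

section \<open>Non-vanishing on the line Re s = 1\<close>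

abbreviation "V0 \<equiv> dseries (\<lambda>n. chi0 n * mangoldt n)"
abbreviation "V4 \<equiv> dseries (\<lambda>n. chi4 n * mangoldt n)"

lemmas log_bounded_chi = log_bounded_mangoldt[of chi0, OF chi0_bound] log_bounded_mangoldt[of chi4, OF chi4_bound]

lemma Z0_deriv:
  assumes "Re s > 1"
  shows "(s - 1) * deriv Z0 s = Z0 s * (1 - (s - 1) * V0 s)"
proof -
  have "(dseries chi0 has_field_derivative deriv (dseries chi0) s) (at s)"
    using holomorphic_derivI[OF dseries_holomorphic open_Re_gt] log_bounded_bounded[of chi0, OF chi0_bound] assms by blast
  hence "((\<lambda>s. (s - 1) * dseries chi0 s) has_field_derivative (dseries chi0 s + (s - 1) * deriv (dseries chi0) s)) (at s)"
    by (auto intro!: derivative_eq_intros)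
  hence "(Z0 has_field_derivative (dseries chi0 s + (s - 1) * deriv (dseries chi0) s)) (at s)"
    by (rule has_field_derivative_transform_within_open[OF _ open_Re_gt[of 1]]) (use assms Z0_eq_dseries in auto)
  hence e: "deriv Z0 s = dseries chi0 s + (s - 1) * deriv (dseries chi0) s" by (rule DERIV_imp_deriv)
  show ?thesis
    unfolding e deriv_dseries_multiplicative[of chi0, OF chi0_mult chi0_bound assms] Z0_eq_dseries[OF assms]
    by (simp add: algebra_simps)
qed

lemma L4_deriv:
  assumes "Re s > 1"
  shows "deriv L4 s = - (L4 s * V4 s)"
proof -
  have "(dseries chi4 has_field_derivative deriv (dseries chi4) s) (at s)"
    using holomorphic_derivI[OF dseries_holomorphic open_Re_gt] log_bounded_bounded[of chi4, OF chi4_bound] assms by blast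
  hence "(L4 has_field_derivative deriv (dseries chi4) s) (at s)"
    by (rule has_field_derivative_transform_within_open[OF _ open_Re_gt[of 1]]) (use assms L4_eq_dseries in auto)
  hence e: "deriv L4 s = deriv (dseries chi4) s" by (rule DERIV_imp_deriv)
  show ?thesis
    unfolding e deriv_dseries_multiplicative[of chi4, OF chi4_mult chi4_bound assms] L4_eq_dseries[OF assms] by simp
qed

text \<open>Both L-series in one function: its logarithmic derivative involves the coefficients
  \<open>(chi0 n + chi4 n) * mangoldt n\<close>, which are nonnegative, and a zero of either factor
  is a zero of the product.\<close>

definition ZL :: "complex \<Rightarrow> complex" where "ZL s = Z0 s * L4 s"

lemma ZL_holomorphic: "ZL holomorphic_on {s. Re s > 0}"
  unfolding ZL_def by (intro holomorphic_intros Z0_holomorphic L4_holomorphic)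

lemma ZL_1: "ZL 1 \<noteq> 0" using L4_1 by (simp add: ZL_def Z0_1)

lemma ZL_deriv:
  assumes "Re s > 1"
  shows "(s - 1) * deriv ZL s = ZL s * (1 - (s - 1) * (V0 s + V4 s))"
proof -
  have s: "s \<in> {s. Re s > 0}" using assms by simp
  have "deriv ZL s = Z0 s * deriv L4 s + deriv Z0 s * L4 s"
    unfolding ZL_def[abs_def]
    by (rule deriv_mult; rule holomorphic_on_imp_differentiable_at[OF _ open_Re_gt s])
       (rule Z0_holomorphic L4_holomorphic)+
  hence "(s - 1) * deriv ZL s = Z0 s * ((s - 1) * deriv L4 s) + ((s - 1) * deriv Z0 s) * L4 s"
    by (simp add: algebra_simps)
  thus ?thesis unfolding Z0_deriv[OF assms] L4_deriv[OF assms] ZL_def by (simp add: algebra_simps)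
qed

lemma tendsto_add_of_real: "((\<lambda>t. z + complex_of_real t) \<longlongrightarrow> z) (at_right 0)"
proof -
  have "((\<lambda>t. z + complex_of_real t) \<longlongrightarrow> z + of_real 0) (at_right 0)" by (intro tendsto_intros)
  thus ?thesis by simp
qed

text \<open>With \<open>f w = (w - z) ^ m * g w\<close> and \<open>g z \<noteq> 0\<close>, the
  logarithmic derivative is \<open>m / (w - z)\<close> plus a term bounded near \<open>z\<close>;
  the factor \<open>t = w - z\<close> leaves only the order \<open>m\<close>.\<close>

lemma logderiv_order_limit:
  assumes f: "f holomorphic_on S" "open S" "connected S" "z \<in> S" "\<not> f constant_on S"
  shows "\<exists>m::nat. (m = 0 \<longleftrightarrow> f z \<noteq> 0) \<and> eventually (\<lambda>t. f (z + complex_of_real t) \<noteq> 0) (at_right 0) \<and>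
     ((\<lambda>t. of_real t * (deriv f (z + of_real t) / f (z + of_real t))) \<longlongrightarrow> of_nat m) (at_right 0)"
proof (cases "f z = 0")
  case False
  have c: "isCont h z" if "h holomorphic_on S" for h
    using that f by (metis continuous_on_eq_continuous_at holomorphic_on_imp_continuous_on)
  have lim: "((\<lambda>t. h (z + complex_of_real t)) \<longlongrightarrow> h z) (at_right 0)" if "h holomorphic_on S" for h
    using isCont_tendsto_compose[OF c[OF that] tendsto_add_of_real] .
  have "((\<lambda>t. of_real t * (deriv f (z + of_real t) / f (z + of_real t))) \<longlongrightarrow> of_real 0 * (deriv f z / f z)) (at_right 0)"
    by (intro tendsto_intros lim f holomorphic_deriv False)
  moreover have "eventually (\<lambda>t. f (z + complex_of_real t) \<noteq> 0) (at_right 0)"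
    using tendsto_imp_eventually_ne[OF lim[OF f(1)] False] .
  ultimately show ?thesis using False by (intro exI[of _ 0]) auto
next
  case True
  obtain g r n where g: "0 < n" "0 < r" "ball z r \<subseteq> S" "g holomorphic_on ball z r"
      "\<And>w. w \<in> ball z r \<Longrightarrow> f w = (w - z) ^ n * g w" "\<And>w. w \<in> ball z r \<Longrightarrow> g w \<noteq> 0"
    using holomorphic_factor_zero_nonconstant[OF f(1-4) True f(5)] by metis
  have zb: "z \<in> ball z r" using g by simp
  have c: "isCont h z" if "h holomorphic_on ball z r" for h
    using that zb by (metis continuous_on_eq_continuous_at holomorphic_on_imp_continuous_on open_ball)
  have lim: "((\<lambda>t. h (z + complex_of_real t)) \<longlongrightarrow> h z) (at_right 0)" if "h holomorphic_on ball z r" for h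
    using isCont_tendsto_compose[OF c[OF that] tendsto_add_of_real] .
  have ev: "eventually (\<lambda>t. 0 < t \<and> t < r) (at_right (0::real))"
    using g by (intro eventually_at_rightI[of 0 r]) auto
  have fz: "f (z + of_real t) = of_real t ^ n * g (z + of_real t)" "z + of_real t \<in> ball z r" if "0 < t \<and> t < r" for t
    using g(5)[of "z + of_real t"] that by (auto simp: dist_norm)
  have "((\<lambda>t. of_nat n + of_real t * (deriv g (z + of_real t) / g (z + of_real t))) \<longlongrightarrow> of_nat n + of_real 0 * (deriv g z / g z)) (at_right 0)"
    by (intro tendsto_intros lim g holomorphic_deriv zb open_ball)
  moreover have "eventually (\<lambda>t. of_nat n + of_real t * (deriv g (z + of_real t) / g (z + of_real t)) = of_real t * (deriv f (z + of_real t) / f (z + of_real t))) (at_right 0)"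
    using ev
  proof eventually_elim
    case (elim t)
    let ?w = "z + of_real t"
    have w: "?w \<in> ball z r" using fz(2)[OF elim] .
    have gd: "(g has_field_derivative deriv g ?w) (at ?w)" using holomorphic_derivI[OF g(4) open_ball w] .
    have "((\<lambda>w. (w - z) ^ n * g w) has_field_derivative (of_nat n * (?w - z) ^ (n - 1) * g ?w + (?w - z) ^ n * deriv g ?w)) (at ?w)"
      by (rule derivative_eq_intros gd refl | simp)+
    hence "(f has_field_derivative (of_nat n * (?w - z) ^ (n - 1) * g ?w + (?w - z) ^ n * deriv g ?w)) (at ?w)"
      by (rule has_field_derivative_transform_within_open[OF _ open_ball w]) (simp add: g(5))
    hence "deriv f ?w = of_nat n * of_real t ^ (n - 1) * g ?w + of_real t ^ n * deriv g ?w"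
      by (simp add: DERIV_imp_deriv)
    moreover have "complex_of_real t ^ n = of_real t * of_real t ^ (n - 1)" using g(1) by (cases n) auto
    moreover have "g ?w \<noteq> 0" "t \<noteq> 0" using g(6)[OF w] elim by auto
    ultimately show ?case unfolding fz(1)[OF elim] by (simp add: field_simps)
  qed
  ultimately have "((\<lambda>t. of_real t * (deriv f (z + of_real t) / f (z + of_real t))) \<longlongrightarrow> of_nat n) (at_right 0)"
    by (simp add: filterlim_cong[OF refl refl, of _ _ "at_right 0"] tendsto_cong)
  moreover have "eventually (\<lambda>t. f (z + complex_of_real t) \<noteq> 0) (at_right 0)"
    using ev by eventually_elim (use fz g(6) in auto)
  ultimately show ?thesis using True g(1) by (intro exI[of _ n]) auto
qed

lemma connected_Re_gt: "connected {s. Re s > c}"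
  by (intro convex_connected convex_halfspace_Re_gt)

text \<open>By \<open>ZL_deriv\<close>, \<open>V0 + V4\<close> is \<open>1 / (s - 1)\<close> minus
  the logarithmic derivative of \<open>ZL\<close>; the limit reads off the simple pole at 1 and the
  order of the zero at \<open>z\<close>.\<close>

lemma residue_limit:
  assumes "Re z \<ge> 1" "\<not> ZL constant_on {s. Re s > 0}"
  shows "\<exists>m::nat. (m = 0 \<longleftrightarrow> ZL z \<noteq> 0) \<and>
    ((\<lambda>t. of_real t * (V0 (z + of_real t) + V4 (z + of_real t))) \<longlongrightarrow> (if z = 1 then 1 else 0) - of_nat m) (at_right 0)"
proof -
  obtain m :: nat where m: "m = 0 \<longleftrightarrow> ZL z \<noteq> 0" "eventually (\<lambda>t. ZL (z + complex_of_real t) \<noteq> 0) (at_right 0)"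
     "((\<lambda>t. of_real t * (deriv ZL (z + of_real t) / ZL (z + of_real t))) \<longlongrightarrow> of_nat m) (at_right 0)"
    using logderiv_order_limit[OF ZL_holomorphic open_Re_gt connected_Re_gt _ assms(2), of z] assms by auto
  have "((\<lambda>t. of_real t / (z + of_real t - 1)) \<longlongrightarrow> (if z = 1 then 1 else 0)) (at_right 0)"
  proof (cases "z = 1")
    case True
    have "eventually (\<lambda>t. 1 = complex_of_real t / (z + of_real t - 1)) (at_right 0)"
      using True by (intro eventually_at_rightI[of 0 1]) auto
    thus ?thesis using True by (auto intro: Lim_transform_eventually[OF tendsto_const])
  next
    case False
    have "((\<lambda>t. of_real t / (z + of_real t - 1)) \<longlongrightarrow> of_real 0 / (z + of_real 0 - 1)) (at_right 0)"
      using False by (intro tendsto_intros) auto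
    thus ?thesis using False by simp
  qed
  from tendsto_diff[OF this m(3)]
  have "((\<lambda>t. of_real t * (V0 (z + of_real t) + V4 (z + of_real t))) \<longlongrightarrow> (if z = 1 then 1 else 0) - of_nat m) (at_right 0)"
  proof (rule Lim_transform_eventually)
    have "eventually (\<lambda>t::real. 0 < t) (at_right 0)" by (simp add: eventually_at_right_less)
    with m(2) show "eventually (\<lambda>t. of_real t / (z + of_real t - 1) - of_real t * (deriv ZL (z + of_real t) / ZL (z + of_real t))
        = of_real t * (V0 (z + of_real t) + V4 (z + of_real t))) (at_right 0)"
    proof eventually_elim
      case (elim t)
      let ?w = "z + of_real t"
      have w: "Re ?w > 1" using elim assms by simp
      hence "?w \<noteq> 1" by (metis less_irrefl one_complex.sel(1))
      hence "?w - 1 \<noteq> 0" by simp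
      hence "deriv ZL ?w / ZL ?w = 1 / (?w - 1) - (V0 ?w + V4 ?w)"
        using ZL_deriv[OF w] elim by (simp add: divide_simps) (simp add: algebra_simps)
      thus ?case by (simp only: right_diff_distrib) simp
    qed
  qed
  thus ?thesis using m by (intro exI[of _ m]) auto
qed

lemma Re_nat_powr:
  assumes "n > 0"
  shows "Re (of_nat n powr (- Complex x y)) = real n powr (-x) * cos (y * ln (real n))"
  using assms by (simp add: powr_def Re_exp Ln_of_nat mult_ac)

text \<open>\<open>3 + 4 cos \<theta> + cos 2\<theta> = 2 (1 + cos \<theta>)\<^sup>2\<close>, applied to the series with coefficients \<open>2 \<Lambda>(n)\<close> on \<open>n \<equiv> 1 (mod 4)\<close>.\<close>

lemma three_four_one:
  assumes "x > 1"
  shows "3 * Re (V0 (Complex x 0) + V4 (Complex x 0)) + 4 * Re (V0 (Complex x y) + V4 (Complex x y))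
     + Re (V0 (Complex x (2*y)) + V4 (Complex x (2*y))) \<ge> 0"
proof -
  define c where "c = (\<lambda>n. if n mod 4 = (1::nat) then 2 * mangoldt n else (0::real))"
  have c0: "c n \<ge> 0" for n by (auto simp: c_def mangoldt_nonneg)
  have cc: "chi0 n * mangoldt n + chi4 n * mangoldt n = of_real (c n)" for n
  proof -
    have "odd n \<longleftrightarrow> n mod 4 = 1 \<or> n mod 4 = 3" by presburger
    thus ?thesis by (auto simp: chi0_def chi4_def c_def)
  qed
  have "(\<lambda>n. c n * (real n powr (-x) * cos (y * ln (real n)))) sums Re (V0 (Complex x y) + V4 (Complex x y))" for y
  proof -
    have "(\<lambda>n. chi0 n * mangoldt n * of_nat n powr (- Complex x y) + chi4 n * mangoldt n * of_nat n powr (- Complex x y))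
       sums (V0 (Complex x y) + V4 (Complex x y))"
      using assms by (intro sums_add dseries_sums log_bounded_chi) auto
    hence "(\<lambda>n. Re (chi0 n * mangoldt n * of_nat n powr (- Complex x y) + chi4 n * mangoldt n * of_nat n powr (- Complex x y)))
       sums Re (V0 (Complex x y) + V4 (Complex x y))" by (rule sums_Re)
    moreover have "Re (chi0 n * mangoldt n * of_nat n powr (- Complex x y) + chi4 n * mangoldt n * of_nat n powr (- Complex x y))
       = c n * (real n powr (-x) * cos (y * ln (real n)))" for n
    proof -
      have "chi0 n * mangoldt n * of_nat n powr (- Complex x y) + chi4 n * mangoldt n * of_nat n powr (- Complex x y)
         = of_real (c n) * of_nat n powr (- Complex x y)"
        by (simp only: distrib_right flip: cc)
      thus ?thesis by (cases "n = 0") (simp_all add: Re_nat_powr c_def)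
    qed
    ultimately show ?thesis by simp
  qed note * = this
  have s: "(\<lambda>n. 3 * (c n * (real n powr (-x) * cos (0 * ln (real n)))) + 4 * (c n * (real n powr (-x) * cos (y * ln (real n))))
         + c n * (real n powr (-x) * cos ((2 * y) * ln (real n)))) sums
      (3 * Re (V0 (Complex x 0) + V4 (Complex x 0)) + 4 * Re (V0 (Complex x y) + V4 (Complex x y))
     + Re (V0 (Complex x (2*y)) + V4 (Complex x (2*y))))"
    by (intro sums_add sums_mult *)
  have "0 \<le> 3 * (c n * (real n powr (-x) * cos (0 * ln (real n)))) + 4 * (c n * (real n powr (-x) * cos (y * ln (real n))))
         + c n * (real n powr (-x) * cos ((2 * y) * ln (real n)))" for n
  proof -
    have e: "cos ((2 * y) * ln (real n)) = 2 * (cos (y * ln (real n)))\<^sup>2 - 1"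
      using cos_double_cos[of "y * ln (real n)"] by (simp add: mult.assoc)
    have "3 * (c n * (real n powr (-x) * cos (0 * ln (real n)))) + 4 * (c n * (real n powr (-x) * cos (y * ln (real n))))
         + c n * (real n powr (-x) * cos ((2 * y) * ln (real n))) = c n * real n powr (-x) * (2 * (1 + cos (y * ln (real n)))\<^sup>2)"
      unfolding e by (simp add: power2_eq_square algebra_simps)
    also have "\<dots> \<ge> 0" using c0 by simp
    finally show ?thesis .
  qed
  from sums_le[OF this sums_zero s] show ?thesis .
qed

theorem ZL_nonzero:
  assumes "Re z \<ge> 1"
  shows "ZL z \<noteq> 0"
proof
  assume z0: "ZL z = 0"
  hence z1: "z \<noteq> 1" using ZL_1 by auto
  have nc: "\<not> ZL constant_on {s. Re s > 0}"
    using z0 ZL_1 assms unfolding constant_on_def by force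
  let ?W = "\<lambda>z t. of_real t * (V0 (z + of_real t) + V4 (z + of_real t))"
  obtain m :: nat where m: "m \<noteq> 0" "(?W z \<longlongrightarrow> - of_nat m) (at_right 0)"
    using residue_limit[OF assms nc] z0 z1 by auto
  show False
  proof (cases "Re z = 1")
    case False
    hence z: "z \<in> {s. Re s > 1}" using assms by auto
    have c: "isCont h z" if "h holomorphic_on {s. Re s > 1}" for h
      using that z open_Re_gt by (metis continuous_on_eq_continuous_at holomorphic_on_imp_continuous_on)
    have lim: "((\<lambda>t. h (z + complex_of_real t)) \<longlongrightarrow> h z) (at_right 0)" if "h holomorphic_on {s. Re s > 1}" for h
      using isCont_tendsto_compose[OF c[OF that] tendsto_add_of_real] .
    have "(?W z \<longlongrightarrow> of_real 0 * (V0 z + V4 z)) (at_right 0)"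
      by (intro tendsto_intros lim dseries_holomorphic log_bounded_chi)
    from tendsto_unique[OF _ this m(2)] show False using m(1) by simp
  next
    case True
    define y where "y = Im z"
    have z: "z = Complex 1 y" using True by (simp add: y_def complex_eq_iff)
    obtain m1 :: nat where m1: "(?W (Complex 1 (2*y)) \<longlongrightarrow> - of_nat m1) (at_right 0)"
      using residue_limit[OF _ nc, of "Complex 1 (2*y)"] z z1 by (auto simp: complex_eq_iff)
    have m2: "(?W 1 \<longlongrightarrow> 1) (at_right 0)"
      using residue_limit[OF _ nc, of 1] ZL_1 by auto
    \<comment> \<open>The limit is \<open>3 - 4 m - m1\<close>: the pole at 1 counts three times and
      the zero at \<open>z\<close> four times, so \<open>m \<ge> 1\<close> makes it
      negative.\<close>
    have "((\<lambda>t. 3 * Re (?W 1 t) + 4 * Re (?W z t) + Re (?W (Complex 1 (2*y)) t)) \<longlongrightarrow> 3 * Re 1 + 4 * Re (- of_nat m) + Re (- of_nat m1)) (at_right 0)"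
      by (intro tendsto_intros m m1 m2)
    moreover have "eventually (\<lambda>t. 0 \<le> 3 * Re (?W 1 t) + 4 * Re (?W z t) + Re (?W (Complex 1 (2*y)) t)) (at_right 0)"
    proof (rule eventually_at_rightI[of 0 1])
      fix t :: real assume "t \<in> {0<..<1}"
      hence t: "t > 0" by simp
      have e: "Complex 1 y + of_real t = Complex (1 + t) y" "1 + of_real t = Complex (1 + t) 0" for y
        by (simp_all add: complex_eq_iff)
      have "0 \<le> t * (3 * Re (V0 (Complex (1+t) 0) + V4 (Complex (1+t) 0)) + 4 * Re (V0 (Complex (1+t) y) + V4 (Complex (1+t) y))
         + Re (V0 (Complex (1+t) (2*y)) + V4 (Complex (1+t) (2*y))))"
        using three_four_one[of "1 + t" y] t by (intro mult_nonneg_nonneg) auto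
      thus "0 \<le> 3 * Re (?W 1 t) + 4 * Re (?W z t) + Re (?W (Complex 1 (2*y)) t)"
        unfolding z e Re_complex_of_real by (simp add: algebra_simps)
    qed auto
    ultimately have "0 \<le> 3 * Re 1 + 4 * Re (- of_nat m) + Re (- of_nat m1)"
      by (rule tendsto_lowerbound) simp
    thus False using m(1) by simp
  qed
qed

section \<open>Chebyshev's bound\<close>

definition psi :: "nat \<Rightarrow> real" where "psi n = (\<Sum>k\<in>{1..n}. mangoldt k)"

text \<open>Legendre's formula for factorials. The range of \<open>d\<close> is fixed by
  \<open>N\<close>, so that the sums for \<open>n\<close> and for \<open>2 * n\<close> can be
  subtracted termwise.\<close>

lemma ln_fact_mangoldt:
  "n \<le> N \<Longrightarrow> (\<Sum>d\<in>{1..N}. mangoldt d * real (n div d)) = ln (fact n)"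
proof (induction n)
  case (Suc n)
  have "(\<Sum>d\<in>{1..N}. mangoldt d * real (Suc n div d)) = (\<Sum>d\<in>{1..N}. mangoldt d * real (n div d) + (if d dvd Suc n then mangoldt d else 0))"
    by (intro sum.cong refl) (auto simp: div_Suc dvd_eq_mod_eq_0 algebra_simps)
  also have "\<dots> = ln (fact n) + (\<Sum>d\<in>{1..N}. if d dvd Suc n then mangoldt d else 0)"
    using Suc by (simp add: sum.distrib)
  also have "(\<Sum>d\<in>{1..N}. if d dvd Suc n then mangoldt d else 0) = (\<Sum>d | d dvd Suc n. mangoldt d :: real)"
  proof (intro sum.mono_neutral_cong_right)
    have "1 \<le> d \<and> d \<le> N" if "d dvd Suc n" for d
      using dvd_imp_le[OF that] Suc.prems that by (cases d) auto
    thus "{d. d dvd Suc n} \<subseteq> {1..N}" by auto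
  qed auto
  also have "\<dots> = ln (real (Suc n))" using mangoldt_sum[of "Suc n", where ?'a = real] by simp
  finally show ?case by (simp add: ln_mult)
qed auto

lemma psi_mono: "m \<le> n \<Longrightarrow> psi m \<le> psi n"
  unfolding psi_def by (intro sum_mono2) (auto simp: mangoldt_nonneg)

text \<open>\<open>(2 * n) div d - 2 * (n div d)\<close> is never negative and is at least 1 for
  \<open>n < d \<le> 2 * n\<close>; summed against \<open>mangoldt\<close> it gives the logarithm of
  the central binomial coefficient.\<close>

lemma psi_double: "psi (2 * n) - psi n \<le> 2 * n * ln 2"
proof -
  have "psi (2 * n) - psi n = (\<Sum>d\<in>{n<..2*n}. mangoldt d)"
  proof -
    have "{1..2*n} = {1..n} \<union> {n<..2*n}" by auto
    hence "psi (2 * n) = psi n + (\<Sum>d\<in>{n<..2*n}. mangoldt d)"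
      unfolding psi_def by (simp only:) (subst sum.union_disjoint, auto)
    thus ?thesis by simp
  qed
  also have "\<dots> \<le> (\<Sum>d\<in>{n<..2*n}. mangoldt d * (real ((2*n) div d) - 2 * real (n div d)))"
  proof (rule sum_mono)
    fix d assume d: "d \<in> {n<..2*n}"
    have "(2*n) div d \<noteq> 0" using d by (auto simp: div_eq_0_iff)
    hence "mangoldt d * 1 \<le> mangoldt d * (real ((2*n) div d) - 2 * real (n div d))"
      using d by (intro mult_left_mono) (auto simp: mangoldt_nonneg Suc_le_eq)
    thus "mangoldt d \<le> mangoldt d * (real ((2*n) div d) - 2 * real (n div d))" by simp
  qed
  also have "\<dots> \<le> (\<Sum>d\<in>{1..2*n}. mangoldt d * (real ((2*n) div d) - 2 * real (n div d)))"
  proof (rule sum_mono2)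
    fix d
    have "2 * (n div d) \<le> (2 * n) div d"
      by (cases "d = 0") (auto simp: less_eq_div_iff_mult_less_eq mult.assoc)
    hence "2 * real (n div d) \<le> real ((2*n) div d)" by linarith
    thus "mangoldt d * (real ((2*n) div d) - 2 * real (n div d)) \<ge> 0" by (simp add: mangoldt_nonneg)
  qed auto
  also have "\<dots> = (\<Sum>d\<in>{1..2*n}. mangoldt d * real ((2*n) div d)) - 2 * (\<Sum>d\<in>{1..2*n}. mangoldt d * real (n div d))"
    by (simp add: sum_subtractf sum_distrib_left algebra_simps)
  also have "\<dots> = ln (fact (2*n)) - 2 * ln (fact n)"
    by (subst (1 2) ln_fact_mangoldt) auto
  also have "\<dots> = ln (real ((2*n) choose n))"
    by (subst binomial_fact) (auto simp: ln_div ln_mult)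
  also have "\<dots> \<le> ln (2 ^ (2 * n))"
  proof (subst ln_le_cancel_iff)
    show "real ((2*n) choose n) \<le> 2 ^ (2*n)" using binomial_le_pow2[of "2*n" n] by (metis of_nat_le_iff of_nat_numeral of_nat_power)
  qed auto
  also have "\<dots> = 2 * n * ln 2" by (simp add: ln_realpow)
  finally show ?thesis by simp
qed

text \<open>Induction by halving, rounded up. With the constant 4 the step closes:
  \<open>4 m + 2 m \<le> 3 (n + 1) \<le> 4 n\<close> when \<open>2 m \<le> n + 1\<close> and
  \<open>n \<ge> 3\<close>.\<close>

lemma psi_le: "psi n \<le> 4 * n"
proof (induction n rule: less_induct)
  case (less n)
  consider "n \<le> 1" | "n = 2" | "n \<ge> 3" by linarith
  thus ?case
  proof cases
    case 1
    hence "n = 0 \<or> n = 1" by auto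
    thus ?thesis by (auto simp: psi_def)
  next
    case 2
    thus ?thesis using mangoldt_le[of 2] ln_2_less_1 by (simp add: psi_def numeral_2_eq_2)
  next
    case 3
    define m where "m = (n + 1) div 2"
    have m: "n \<le> 2 * m" "2 * m \<le> n + 1" "m < n" using 3 unfolding m_def by linarith+
    have "psi n \<le> psi (2 * m)" by (intro psi_mono m)
    also have "\<dots> \<le> psi m + 2 * m * ln 2" using psi_double[of m] by simp
    also have "\<dots> \<le> 4 * real m + 2 * real m * 1" using less[OF m(3)] ln_2_less_1 by (intro add_mono) (auto simp: mult_left_le)
    also have "\<dots> \<le> 4 * n" using m 3 by linarith
    finally show ?thesis .
  qed
qed

definition psi3 :: "nat \<Rightarrow> real" where "psi3 n = (\<Sum>k\<in>{1..n}. if k mod 4 = 3 then mangoldt k else 0)"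

lemma psi3_le: "psi3 n \<le> 4 * n"
proof -
  have "psi3 n \<le> psi n" unfolding psi3_def psi_def by (intro sum_mono) (auto simp: mangoldt_nonneg)
  thus ?thesis using psi_le[of n] by simp
qed

lemma psi3_nonneg: "psi3 n \<ge> 0" unfolding psi3_def by (intro sum_nonneg) (auto simp: mangoldt_nonneg)

lemma psi3_mono: "m \<le> n \<Longrightarrow> psi3 m \<le> psi3 n"
  unfolding psi3_def by (intro sum_mono2) (auto simp: mangoldt_nonneg)

lemma psi3_Suc: "psi3 (Suc n) = psi3 n + (if Suc n mod 4 = 3 then mangoldt (Suc n) else 0)"
  unfolding psi3_def by (simp add: atLeastAtMostSuc_conv add.commute)

section \<open>The prime number theorem for the class 3 modulo 4\<close>

definition a3 :: "nat \<Rightarrow> complex" where "a3 n = (if n mod 4 = 3 then mangoldt n else 0)"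

text \<open>\<open>dseries a3 = (V0 - V4) / 2\<close> without its pole at 1, in terms of the continued functions.\<close>

definition E3 :: "complex \<Rightarrow> complex" where "E3 s = (deriv L4 s / L4 s - deriv Z0 s / Z0 s) / 2"

lemma log_bounded_a3: "log_bounded a3"
proof -
  have "log_bounded (\<lambda>n. (if n mod 4 = 3 then 1 else 0) * mangoldt n)" by (rule log_bounded_mangoldt) auto
  also have "(\<lambda>n. (if n mod 4 = 3 then 1 else 0) * mangoldt n) = a3" by (auto simp: a3_def)
  finally show ?thesis .
qed

lemma dseries_a3:
  assumes "Re s > 1"
  shows "dseries a3 s = 1 / (2 * (s - 1)) + E3 s"
proof -
  have s1: "s - 1 \<noteq> 0" using assms by auto
  have nz: "Z0 s \<noteq> 0" "L4 s \<noteq> 0" using ZL_nonzero[of s] assms by (auto simp: ZL_def)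
  have "a3 n = (chi0 n * mangoldt n - chi4 n * mangoldt n) / 2" for n
  proof -
    have "odd n \<longleftrightarrow> n mod 4 = 1 \<or> n mod 4 = 3" by presburger
    thus ?thesis by (auto simp: chi0_def chi4_def a3_def)
  qed
  hence e: "a3 n * of_nat n powr (-s) = (chi0 n * mangoldt n * of_nat n powr (-s) - chi4 n * mangoldt n * of_nat n powr (-s)) / 2" for n
    by (simp add: diff_divide_distrib left_diff_distrib)
  have "(\<lambda>n. a3 n * of_nat n powr (-s)) sums ((V0 s - V4 s) / 2)"
    unfolding e by (intro sums_divide sums_diff dseries_sums log_bounded_chi assms)
  hence 1: "dseries a3 s = (V0 s - V4 s) / 2"
    using dseries_sums[OF log_bounded_a3 assms] sums_unique2 by blast
  have 2: "deriv Z0 s / Z0 s = 1 / (s - 1) - V0 s"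
    using Z0_deriv[OF assms] nz s1 by (simp add: divide_simps) (simp add: algebra_simps)
  have 3: "deriv L4 s / L4 s = - V4 s" using L4_deriv[OF assms] nz by simp
  show ?thesis unfolding E3_def 1 2 3 using s1 by (simp add: divide_simps) (simp add: algebra_simps)
qed

text \<open>The part over \<open>[n, n + 1]\<close>, where the step function \<open>psi3\<close> is
  constant, of the integral of \<open>(psi3 x - x / 2) * x powr (-2 - w)\<close>. Written with
  \<open>exp\<close> and \<open>ln\<close> the integrand is visibly entire in
  \<open>w\<close>.\<close>

definition newman_term :: "nat \<Rightarrow> complex \<Rightarrow> complex" where
  "newman_term n w = (if n = 0 then 0 else
     integral {real n..real n + 1} (\<lambda>x. of_real (psi3 n - x / 2) * exp ((-2 - w) * of_real (ln x))))"

lemma newman_term_holomorphic: "newman_term n holomorphic_on UNIV"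
proof (cases "n = 0")
  case False
  have "(\<lambda>w. integral (cbox (real n) (real n + 1)) (\<lambda>x. of_real (psi3 n - x / 2) * exp ((-2 - w) * of_real (ln x)))) holomorphic_on UNIV"
  proof (rule leibniz_rule_holomorphic[where fx = "\<lambda>w x. of_real (psi3 n - x / 2) * (exp ((-2 - w) * of_real (ln x)) * (- of_real (ln x)))"])
    show "((\<lambda>w. of_real (psi3 n - t / 2) * exp ((-2 - w) * of_real (ln t))) has_field_derivative
        of_real (psi3 n - t / 2) * (exp ((-2 - x) * of_real (ln t)) * (- of_real (ln t)))) (at x within UNIV)" for t and x :: complex
      by (auto intro!: derivative_eq_intros)
    show "(\<lambda>x. complex_of_real (psi3 n - x / 2) * exp ((-2 - w) * of_real (ln x))) integrable_on cbox (real n) (real n + 1)" for w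
      using False by (intro integrable_continuous continuous_intros) auto
    show "continuous_on (UNIV \<times> cbox (real n) (real n + 1)) (\<lambda>(w, x). complex_of_real (psi3 n - x / 2) * (exp ((-2 - w) * of_real (ln x)) * (- of_real (ln x))))"
      unfolding case_prod_beta using False by (intro continuous_intros) auto
  qed auto
  moreover have "newman_term n = (\<lambda>w. integral (cbox (real n) (real n + 1)) (\<lambda>x. of_real (psi3 n - x / 2) * exp ((-2 - w) * of_real (ln x))))"
    using False by (auto simp: newman_term_def)
  ultimately show ?thesis by simp
qed (simp add: newman_term_def[abs_def])

lemma has_integral_powr_step:
  assumes "r \<noteq> 0" "n \<ge> 1"
  shows "((\<lambda>x. x powr (-1 - r)) has_integral ((real n powr (-r) - (real n + 1) powr (-r)) / r)) {real n..real n + 1}"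
proof -
  have e: "-1 - r = -r - 1" by simp
  have "((\<lambda>x. x powr (-1 - r)) has_integral (- ((real n + 1) powr (-r)) / r - (- (real n powr (-r)) / r))) {real n..real n + 1}"
  proof (rule fundamental_theorem_of_calculus)
    fix x assume "x \<in> {real n..real n + 1}"
    hence "x > 0" using assms by auto
    hence "((\<lambda>x. - (x powr (-r)) / r) has_real_derivative x powr (-1 - r)) (at x)"
      unfolding e using assms by (auto intro!: derivative_eq_intros simp: field_simps)
    thus "((\<lambda>x. - (x powr (-r)) / r) has_vector_derivative x powr (-1 - r)) (at x within {real n..real n + 1})"
      by (simp add: has_real_derivative_iff_has_vector_derivative has_vector_derivative_at_within)
  qed auto
  thus ?thesis by (simp add: diff_divide_distrib)
qed

text \<open>Chebyshev's bound provides the constant: \<open>psi3 n\<close> and \<open>x / 2\<close>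
  both lie between 0 and \<open>4 * x\<close>, hence so does the modulus of their
  difference.\<close>

lemma newman_term_bound:
  assumes "n \<ge> 1" "Re w \<noteq> 0"
  shows "norm (newman_term n w) \<le> 4 * ((real n powr (-Re w) - real (n+1) powr (-Re w)) / Re w)"
proof -
  have "norm (integral {real n..real n + 1} (\<lambda>x. of_real (psi3 n - x / 2) * exp ((-2 - w) * of_real (ln x))))
     \<le> integral {real n..real n + 1} (\<lambda>x. 4 * x powr (-1 - Re w))"
  proof (rule integral_norm_bound_integral)
    show "(\<lambda>x. complex_of_real (psi3 n - x / 2) * exp ((-2 - w) * of_real (ln x))) integrable_on {real n..real n + 1}"
      using assms by (intro integrable_continuous_real continuous_intros) auto
    show "(\<lambda>x. 4 * x powr (-1 - Re w)) integrable_on {real n..real n + 1}"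
      using assms by (intro integrable_continuous_real continuous_intros) auto
    fix x assume x: "x \<in> {real n..real n + 1}"
    have "\<bar>psi3 n - x / 2\<bar> \<le> 4 * x" using psi3_le[of n] psi3_nonneg[of n] x by auto
    moreover have "norm (exp ((-2 - w) * of_real (ln x))) = x powr (-2 - Re w)"
      using x assms by (simp add: powr_def)
    ultimately have "norm (of_real (psi3 n - x / 2) * exp ((-2 - w) * of_real (ln x))) \<le> 4 * x * x powr (-2 - Re w)"
      unfolding norm_mult norm_of_real by (intro mult_mono) auto
    also have "\<dots> = 4 * x powr (-1 - Re w)"
      using x assms powr_add[of x 1 "-2 - Re w"] by simp
    finally show "norm (of_real (psi3 n - x / 2) * exp ((-2 - w) * of_real (ln x))) \<le> 4 * x powr (-1 - Re w)" .
  qed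
  also have "integral {real n..real n + 1} (\<lambda>x. 4 * x powr (-1 - Re w)) = 4 * ((real n powr (-Re w) - (real n + 1) powr (-Re w)) / Re w)"
    using has_integral_powr_step[OF assms(2,1)] by (simp add: integral_unique)
  finally show ?thesis using assms by (simp add: newman_term_def add.commute)
qed

lemma exp_ln_has_vector_derivative:
  fixes c :: complex
  assumes "x > 0"
  shows "((\<lambda>x. exp (c * of_real (ln x))) has_vector_derivative (c / of_real x * exp (c * of_real (ln x)))) (at x within S)"
proof -
  have "((\<lambda>x. c * of_real (ln x)) has_vector_derivative c * of_real (1 / x)) (at x)"
    using assms by (auto intro!: derivative_eq_intros simp: has_real_derivative_iff_has_vector_derivative[symmetric] divide_inverse)
  from field_vector_diff_chain_at[OF this DERIV_exp]
  have "((\<lambda>x. exp (c * of_real (ln x))) has_vector_derivative (c * of_real (1 / x) * exp (c * of_real (ln x)))) (at x)"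
    by (simp add: o_def)
  from has_vector_derivative_at_within[OF this] show ?thesis by simp
qed

lemma newman_term_eq:
  assumes "Re w > 0" "n \<ge> 1"
  shows "newman_term n w = of_real (psi3 n) * (of_nat n powr (-(1+w)) - of_nat (n+1) powr (-(1+w))) / (1 + w)
     - (of_nat n powr (-w) - of_nat (n+1) powr (-w)) / (2 * w)"
proof -
  have w: "w \<noteq> 0" "1 + w \<noteq> 0" using assms by (auto simp: complex_eq_iff)
  have w': "2 + w * 2 \<noteq> 0"
  proof -
    have "2 + w * 2 = 2 * (1 + w)" by simp
    thus ?thesis using w(2) by (simp only: mult_eq_0_iff) simp
  qed
  define F where "F = (\<lambda>x. of_real (psi3 n) * (- exp (-(1+w) * of_real (ln x))) / (1 + w) + exp (-w * of_real (ln x)) / (2 * w))"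
  have "((\<lambda>x. of_real (psi3 n - x / 2) * exp ((-2 - w) * of_real (ln x))) has_integral (F (real n + 1) - F (real n))) {real n..real n + 1}"
  proof (rule fundamental_theorem_of_calculus)
    fix x assume "x \<in> {real n..real n + 1}"
    hence x: "x > 0" using assms by auto
    define e where "e = exp ((-2 - w) * of_real (ln x))"
    have ex: "exp (of_real (ln x)) = complex_of_real x" by (subst exp_of_real) (simp add: x)
    have e1: "exp (-(1+w) * of_real (ln x)) = of_real x * e"
      unfolding e_def ex[symmetric] exp_add[symmetric] by (simp add: algebra_simps)
    have e2: "exp (-w * of_real (ln x)) = of_real x * (of_real x * e)"
      unfolding e_def ex[symmetric] exp_add[symmetric] by (simp add: algebra_simps)
    have "(F has_vector_derivative (of_real (psi3 n) * (- (-(1+w) / of_real x * exp (-(1+w) * of_real (ln x)))) / (1 + w)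
       + (-w / of_real x * exp (-w * of_real (ln x))) / (2 * w))) (at x within {real n..real n + 1})"
      unfolding F_def
      by (intro has_vector_derivative_add has_vector_derivative_divide has_vector_derivative_mult_right has_vector_derivative_minus exp_ln_has_vector_derivative x)
    also have "(of_real (psi3 n) * (- (-(1+w) / of_real x * exp (-(1+w) * of_real (ln x)))) / (1 + w)
       + (-w / of_real x * exp (-w * of_real (ln x))) / (2 * w)) = of_real (psi3 n - x / 2) * e"
      unfolding e1 e2 using x w w' by (simp add: divide_simps) (simp add: algebra_simps)
    finally show "(F has_vector_derivative of_real (psi3 n - x / 2) * exp ((-2 - w) * of_real (ln x))) (at x within {real n..real n + 1})"
      unfolding e_def .
  qed auto
  hence eq: "newman_term n w = F (real n + 1) - F (real n)"
    using assms by (simp add: newman_term_def integral_unique)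
  have ex: "exp (c * of_real (ln (real m))) = of_nat m powr c" if "m \<ge> 1" for m and c :: complex
    using that by (simp add: powr_def Ln_of_nat)
  have F12: "F (real n + 1) = of_real (psi3 n) * (- (of_nat (n+1) powr (-(1+w)))) / (1 + w) + of_nat (n+1) powr (-w) / (2 * w)"
    "F (real n) = of_real (psi3 n) * (- (of_nat n powr (-(1+w)))) / (1 + w) + of_nat n powr (-w) / (2 * w)"
    unfolding F_def using ex[OF assms(2), of "-w"] ex[OF assms(2), of "-(1+w)"] ex[of "n+1" "-w"] ex[of "n+1" "-(1+w)"]
    by (simp_all add: add.commute)
  show ?thesis unfolding eq F12 by (simp add: diff_divide_distrib algebra_simps)
qed

lemma newman_term_0:
  assumes "n \<ge> 1"
  shows "newman_term n 0 = of_real (psi3 n * (1 / n - 1 / real (Suc n)) - (ln (real (Suc n)) - ln (real n)) / 2)"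
proof -
  have "((\<lambda>x. psi3 n / x\<^sup>2 - 1 / (2 * x)) has_integral ((- psi3 n / (real n + 1) - ln (real n + 1) / 2) - (- psi3 n / real n - ln (real n) / 2))) {real n..real n + 1}"
  proof (rule fundamental_theorem_of_calculus)
    fix x assume "x \<in> {real n..real n + 1}"
    hence "x > 0" using assms by auto
    hence "((\<lambda>x. - psi3 n / x - ln x / 2) has_real_derivative (psi3 n / x\<^sup>2 - 1 / (2 * x))) (at x)"
      by (auto intro!: derivative_eq_intros simp: field_simps power2_eq_square)
    thus "((\<lambda>x. - psi3 n / x - ln x / 2) has_vector_derivative (psi3 n / x\<^sup>2 - 1 / (2 * x))) (at x within {real n..real n + 1})"
      by (simp add: has_real_derivative_iff_has_vector_derivative has_vector_derivative_at_within)
  qed auto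
  from has_integral_of_real[OF this]
  have "((\<lambda>x. complex_of_real (psi3 n / x\<^sup>2 - 1 / (2 * x))) has_integral complex_of_real ((- psi3 n / (real n + 1) - ln (real n + 1) / 2) - (- psi3 n / real n - ln (real n) / 2))) {real n..real n + 1}" .
  hence "((\<lambda>x. of_real (psi3 n - x / 2) * exp ((-2 - 0) * of_real (ln x))) has_integral complex_of_real ((- psi3 n / (real n + 1) - ln (real n + 1) / 2) - (- psi3 n / real n - ln (real n) / 2))) {real n..real n + 1}"
  proof (rule has_integral_eq[rotated])
    fix x assume "x \<in> {real n..real n + 1}"
    hence x: "x > 0" using assms by auto
    have "(-2 - 0) * complex_of_real (ln x) = of_real (-2 * ln x)" by simp
    hence "exp ((-2 - 0) * complex_of_real (ln x)) = of_real (exp (- 2 * ln x))" by (simp only: exp_of_real)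
    also have "exp (- 2 * ln x) = 1 / x\<^sup>2" using x by (simp add: exp_minus exp_double divide_inverse)
    finally have e: "exp ((-2 - 0) * complex_of_real (ln x)) = of_real (1 / x\<^sup>2)" .
    have "psi3 n / x\<^sup>2 - 1 / (2 * x) = (psi3 n - x / 2) * (1 / x\<^sup>2)" using x by (simp add: field_simps power2_eq_square)
    thus "complex_of_real (psi3 n / x\<^sup>2 - 1 / (2 * x)) = of_real (psi3 n - x / 2) * exp ((-2 - 0) * of_real (ln x))"
      unfolding e by (simp only: of_real_mult)
  qed
  from integral_unique[OF this]
  have "newman_term n 0 = complex_of_real ((- psi3 n / (real n + 1) - ln (real n + 1) / 2) - (- psi3 n / real n - ln (real n) / 2))"
    using assms unfolding newman_term_def by (subst if_not_P) auto
  thus ?thesis by (simp add: algebra_simps diff_divide_distrib)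
qed

lemma powr_neg_tendsto_0:
  assumes "r > 0" shows "(\<lambda>n. real (Suc n) powr (-r)) \<longlonglongrightarrow> 0"
  using assms by (intro tendsto_neg_powr filterlim_compose[OF filterlim_real_sequentially filterlim_Suc]) auto

text \<open>Partial summation: the jumps of \<open>psi3\<close> are the coefficients
  \<open>a3\<close>, and the boundary term tends to 0 by Chebyshev's bound. The parts with
  \<open>x / 2\<close> telescope.\<close>

lemma newman_sums:
  assumes "Re w > 0"
  shows "(\<lambda>n. newman_term (Suc n) w) sums (dseries a3 (1 + w) / (1 + w) - 1 / (2 * w))"
proof -
  define f where "f = (\<lambda>n. of_nat n powr (-(1+w)) :: complex)"
  define g where "g = (\<lambda>n. of_nat (Suc n) powr (-w) :: complex)"
  have part: "(\<Sum>n<N. of_real (psi3 (Suc n)) * (f (Suc n) - f (Suc (Suc n)))) = (\<Sum>n\<le>N. a3 n * f n) - of_real (psi3 N) * f (Suc N)" for N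
  proof (induction N)
    case 0
    thus ?case by (simp add: psi3_def a3_def)
  next
    case (Suc N)
    have "of_real (psi3 (Suc N)) = of_real (psi3 N) + a3 (Suc N)" by (simp add: psi3_Suc a3_def)
    thus ?case using Suc by (simp add: algebra_simps)
  qed
  have "(\<lambda>N. of_real (psi3 N) * f (Suc N)) \<longlonglongrightarrow> 0"
  proof (rule tendsto_norm_zero_cancel, rule tendsto_sandwich[OF _ _ tendsto_const])
    show "(\<lambda>N. 4 * real (Suc N) powr (-Re w)) \<longlonglongrightarrow> 0"
      using tendsto_mult_right_zero[OF powr_neg_tendsto_0[OF assms], of 4] by simp
    show "eventually (\<lambda>N. norm (of_real (psi3 N) * f (Suc N)) \<le> 4 * real (Suc N) powr (-Re w)) sequentially"
    proof (intro always_eventually allI)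
      fix N
      have "norm (of_real (psi3 N) * f (Suc N)) = psi3 N * real (Suc N) powr (-1 - Re w)"
        unfolding f_def norm_mult norm_nat_powr using psi3_nonneg[of N] by (simp add: add.commute)
      also have "\<dots> \<le> (4 * real (Suc N)) * real (Suc N) powr (-1 - Re w)"
        using psi3_le[of N] by (intro mult_right_mono) auto
      also have "\<dots> = 4 * real (Suc N) powr (-Re w)"
        using powr_add[of "real (Suc N)" 1 "-1 - Re w"] by simp
      finally show "norm (of_real (psi3 N) * f (Suc N)) \<le> 4 * real (Suc N) powr (-Re w)" .
    qed
  qed auto
  moreover have "(\<lambda>N. \<Sum>n\<le>N. a3 n * f n) \<longlonglongrightarrow> dseries a3 (1 + w)"
    using dseries_sums[OF log_bounded_a3, of "1 + w"] assms unfolding f_def sums_def_le by simp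
  ultimately have "(\<lambda>N. (\<Sum>n\<le>N. a3 n * f n) - of_real (psi3 N) * f (Suc N)) \<longlonglongrightarrow> dseries a3 (1 + w) - 0"
    by (intro tendsto_diff)
  hence "(\<lambda>n. of_real (psi3 (Suc n)) * (f (Suc n) - f (Suc (Suc n)))) sums dseries a3 (1 + w)"
    unfolding sums_def part by simp
  hence 1: "(\<lambda>n. of_real (psi3 (Suc n)) * (f (Suc n) - f (Suc (Suc n))) / (1 + w)) sums (dseries a3 (1 + w) / (1 + w))"
    by (rule sums_divide)
  have "(\<lambda>n. norm (g n)) \<longlonglongrightarrow> 0"
    unfolding g_def norm_nat_powr using powr_neg_tendsto_0[OF assms] by simp
  hence "g \<longlonglongrightarrow> 0" by (rule tendsto_norm_zero_cancel)
  from telescope_sums'[OF this] have "(\<lambda>n. (g n - g (Suc n)) / (2 * w)) sums ((g 0 - 0) / (2 * w))"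
    by (rule sums_divide)
  from sums_diff[OF 1 this] show ?thesis
    using assms by (simp add: newman_term_eq f_def g_def)
qed

theorem newman_summable: "summable (\<lambda>n. newman_term (Suc n) 0)"
proof -
  \<comment> \<open>What remains of \<open>dseries a3 (1 + w) / (1 + w) - 1 / (2 * w)\<close> when
    the poles at \<open>w = 0\<close> cancel; the main term \<open>x / 2\<close> matches the residue
    \<open>1/2\<close> of \<open>dseries a3\<close> at 1.\<close>
  define G where "G = (\<lambda>w. E3 (1 + w) / (1 + w) - 1 / (2 * (1 + w)))"
  \<comment> \<open>Where \<open>ZL\<close> does not vanish, both denominators in \<open>E3\<close>
    are nonzero; by \<open>ZL_nonzero\<close> this region includes the closed half plane
    \<open>Re s \<ge> 1\<close>.\<close>
  define S where "S = {s. s \<in> {s. Re s > 0} \<and> ZL s \<in> - {0}}"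
  have oS: "open S"
    unfolding S_def using continuous_open_preimage[OF holomorphic_on_imp_continuous_on[OF ZL_holomorphic] open_Re_gt, of "-{0}"]
    by (simp add: vimage_def Int_def open_Compl)
  have E: "E3 holomorphic_on S"
    unfolding E3_def
    by (intro holomorphic_intros holomorphic_deriv oS holomorphic_on_subset[OF Z0_holomorphic] holomorphic_on_subset[OF L4_holomorphic])
       (auto simp: S_def ZL_def)
  have "(\<lambda>n. newman_term (Suc n) 0) sums G 0"
  proof (rule Newman_tauberian[where B = 4 and U = "(\<lambda>w. 1 + w) -` S"])
    show "open ((\<lambda>w. 1 + w) -` S)" using oS by (intro open_vimage continuous_intros)
    show "{w. Re w \<ge> 0} \<subseteq> (\<lambda>w. 1 + w) -` S" using ZL_nonzero by (auto simp: S_def)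
    have "(E3 \<circ> (\<lambda>w. 1 + w)) holomorphic_on ((\<lambda>w. 1 + w) -` S)"
      by (rule holomorphic_on_compose_gen[OF _ E]) (auto intro!: holomorphic_intros)
    moreover have "1 + w \<noteq> 0 \<and> 2 + 2 * w \<noteq> 0" if "w \<in> (\<lambda>w. 1 + w) -` S" for w
    proof -
      have "Re (1 + w) > 0" using that by (simp add: S_def)
      hence "1 + w \<noteq> 0" by (metis less_irrefl zero_complex.sel(1))
      moreover have "2 + 2 * w = 2 * (1 + w)" by simp
      ultimately show ?thesis by (simp only: mult_eq_0_iff) simp
    qed
    ultimately show "G holomorphic_on ((\<lambda>w. 1 + w) -` S)"
      unfolding G_def o_def by (intro holomorphic_intros) auto
  next
    fix w :: complex assume w: "Re w > 0"
    hence w0: "w \<noteq> 0" "1 + w \<noteq> 0" by (auto simp: complex_eq_iff)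
    have "(1 / (2 * w) + E) / (1 + w) - 1 / (2 * w) = E / (1 + w) - 1 / (2 * (1 + w))" for E
    proof -
      have "(1 / (2 * w) + E) / (1 + w) - 1 / (2 * w) = (1 / w / (1 + w) - 1 / w) / 2 + E / (1 + w)"
        by (simp add: add_divide_distrib diff_divide_distrib mult_ac)
      also have "1 / w / (1 + w) - 1 / w = - 1 / (1 + w)"
      proof -
        have "1 / w / (1 + w) - 1 / w = (1 / w) * (1 / (1 + w) - 1)" by (simp add: right_diff_distrib)
        also have "1 / (1 + w) - 1 = - w / (1 + w)" using w0(2) by (simp add: field_simps)
        also have "(1 / w) * (- w / (1 + w)) = - 1 / (1 + w)" using w0 by simp
        finally show ?thesis .
      qed
      finally show ?thesis by simp
    qed
    hence "dseries a3 (1 + w) / (1 + w) - 1 / (2 * w) = G w"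
      using dseries_a3[of "1 + w"] w by (simp add: G_def)
    thus "(\<lambda>n. newman_term (Suc n) w) sums G w" using newman_sums[OF w] by simp
  qed (rule newman_term_holomorphic | erule (1) newman_term_bound)+
  thus ?thesis by (rule sums_summable)
qed

section \<open>From convergence to primes in short intervals\<close>

definition prime_power_sum :: "nat \<Rightarrow> real" where
  "prime_power_sum m = (\<Sum>k | k \<in> {1..m} \<and> \<not> prime k. mangoldt k)"

text \<open>A power \<open>p ^ j \<le> m\<close> with \<open>j \<ge> 2\<close> has
  \<open>p \<le> sqrt m\<close> and \<open>j \<le> log 2 m\<close>, so there are few of them, and
  each weighs at most \<open>ln m\<close>.\<close>

lemma prime_power_sum_le:
  assumes "m \<ge> 1"
  shows "prime_power_sum m \<le> sqrt m * log 2 m * ln m"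
proof -
  define A where "A = {k \<in> {1..m}. primepow k \<and> \<not> prime k}"
  define P where "P = {1..nat \<lfloor>sqrt m\<rfloor>} \<times> {1..nat \<lfloor>log 2 m\<rfloor>}"
  have sub: "A \<subseteq> (\<lambda>(p, j). p ^ j) ` P"
  proof
    fix k assume k: "k \<in> A"
    then obtain p j where pj: "prime p" "j > 0" "k = p ^ j"
      by (auto simp: A_def primepow_def)
    have "j \<noteq> 1" using k pj by (auto simp: A_def)
    hence j: "j \<ge> 2" using pj by simp
    have p: "p \<ge> 2" using pj(1) by (rule prime_ge_2_nat)
    have km: "k \<le> m" using k by (auto simp: A_def)
    have "p ^ 2 \<le> p ^ j" using p j by (intro power_increasing) auto
    hence "p ^ 2 \<le> m" using km pj by simp
    hence "real p ^ 2 \<le> real m" by (metis of_nat_le_iff of_nat_power)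
    hence "real p \<le> sqrt m" by (intro real_le_rsqrt)
    hence 1: "p \<le> nat \<lfloor>sqrt m\<rfloor>" by (simp add: le_nat_floor)
    have "2 ^ j \<le> p ^ j" using p by (intro power_mono) auto
    hence "2 ^ j \<le> m" using km pj(3) by linarith
    hence "real j \<le> log 2 m" by (intro le_log2_of_power)
    hence 2: "j \<le> nat \<lfloor>log 2 m\<rfloor>" by (simp add: le_nat_floor)
    show "k \<in> (\<lambda>(p, j). p ^ j) ` P" using 1 2 p j pj by (auto simp: P_def intro!: image_eqI[of _ _ "(p, j)"])
  qed
  have "finite P" by (simp add: P_def)
  hence "card A \<le> card P" using sub by (meson card_image_le card_mono finite_imageI order_trans)
  also have "card P = nat \<lfloor>sqrt m\<rfloor> * nat \<lfloor>log 2 m\<rfloor>" by (simp add: P_def card_cartesian_product)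
  finally have "real (card A) \<le> real (nat \<lfloor>sqrt m\<rfloor>) * real (nat \<lfloor>log 2 m\<rfloor>)" by (metis of_nat_le_iff of_nat_mult)
  also have "\<dots> \<le> sqrt m * log 2 m" using assms by (intro mult_mono) auto
  finally have c: "real (card A) \<le> sqrt m * log 2 m" .
  have "prime_power_sum m = (\<Sum>k\<in>A. mangoldt k)"
    unfolding prime_power_sum_def A_def by (intro sum.mono_neutral_right) (auto simp: mangoldt_def)
  also have "\<dots> \<le> (\<Sum>k\<in>A. ln m)"
  proof (rule sum_mono)
    fix k assume k: "k \<in> A"
    hence "mangoldt k \<le> ln (real k)" by (intro mangoldt_le) (auto simp: A_def)
    also have "\<dots> \<le> ln m" using k by (simp add: A_def)
    finally show "mangoldt k \<le> ln m" .
  qed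
  also have "\<dots> = real (card A) * ln m" by simp
  also have "\<dots> \<le> sqrt m * log 2 m * ln m" using c assms by (intro mult_right_mono) auto
  finally show ?thesis .
qed

text \<open>In a range without primes of the class, \<open>psi3\<close> can grow only through higher
  prime powers.\<close>

lemma psi3_flat:
  assumes "a \<le> c" "\<not> (\<exists>p. prime p \<and> a < p \<and> p \<le> c \<and> p mod 4 = 3)"
  shows "psi3 c \<le> psi3 a + prime_power_sum c"
proof -
  have "{1..c} = {1..a} \<union> {a<..c}" using assms by auto
  hence "psi3 c = psi3 a + (\<Sum>k\<in>{a<..c}. if k mod 4 = 3 then mangoldt k else 0)"
    unfolding psi3_def by (simp only:) (subst sum.union_disjoint, auto)
  also have "(\<Sum>k\<in>{a<..c}. if k mod 4 = 3 then mangoldt k else 0) = (\<Sum>k | k \<in> {a<..c} \<and> k mod 4 = 3. mangoldt k :: real)"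
    by (rule sum.inter_filter[symmetric]) simp
  also have "\<dots> \<le> prime_power_sum c"
    unfolding prime_power_sum_def using assms(2) by (intro sum_mono2) (auto simp: mangoldt_nonneg)
  finally show ?thesis by simp
qed

definition newman_real :: "nat \<Rightarrow> real" where
  "newman_real n = psi3 n * (1 / n - 1 / real (Suc n)) - (ln (real (Suc n)) - ln (real n)) / 2"

lemma newman_real_Cauchy:
  assumes "e > 0" shows "\<exists>N. \<forall>m\<ge>N. \<forall>n. \<bar>\<Sum>k\<in>{m..<n}. newman_real k\<bar> < e"
proof -
  have "(\<lambda>n. newman_term (Suc n) 0) = (\<lambda>n. of_real (newman_real (Suc n)))"
    using newman_term_0[of "Suc _"] by (auto simp: newman_real_def)
  hence "summable (\<lambda>n. complex_of_real (newman_real (Suc n)))" using newman_summable by simp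
  hence "summable (\<lambda>n. newman_real (Suc n))" by (simp only: summable_complex_of_real)
  hence "summable newman_real" by (simp only: summable_Suc_iff)
  thus ?thesis using assms unfolding summable_Cauchy by simp
qed

text \<open>Since \<open>psi3\<close> is monotone it may be replaced by its value at either end of
  the range; what remains telescopes.\<close>

lemma sum_newman_real:
  assumes "1 \<le> a" "a \<le> b"
  shows "(\<Sum>k\<in>{a..<b}. newman_real k) \<ge> psi3 a * (1 / a - 1 / b) - (ln b - ln a) / 2"
    and "(\<Sum>k\<in>{a..<b}. newman_real k) \<le> psi3 b * (1 / a - 1 / b) - (ln b - ln a) / 2"
proof -
  have t1: "(\<Sum>k\<in>{a..<b}. 1 / real k - 1 / real (Suc k)) = 1 / a - 1 / b"
    using sum_Suc_diff'[OF assms(2), of "\<lambda>k. - 1 / real k"] by (simp add: algebra_simps)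
  have t2: "(\<Sum>k\<in>{a..<b}. ln (real (Suc k)) - ln (real k)) = ln b - ln a"
    using sum_Suc_diff'[OF assms(2), of "\<lambda>k. ln (real k)"] .
  have pos: "1 / real k - 1 / real (Suc k) \<ge> 0" if "k \<in> {a..<b}" for k
    using that assms by (simp add: field_simps)
  have e: "(\<Sum>k\<in>{a..<b}. c * (1 / real k - 1 / real (Suc k)) - (ln (real (Suc k)) - ln (real k)) / 2) = c * (1 / a - 1 / b) - (ln b - ln a) / 2" for c :: real
    by (simp only: sum_subtractf[of "\<lambda>k. c * (1 / real k - 1 / real (Suc k))"] sum_distrib_left[symmetric] sum_divide_distrib[symmetric] t1 t2)
  show "(\<Sum>k\<in>{a..<b}. newman_real k) \<ge> psi3 a * (1 / a - 1 / b) - (ln b - ln a) / 2"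
    unfolding e[symmetric] newman_real_def
    by (intro sum_mono diff_right_mono mult_right_mono psi3_mono pos) auto
  show "(\<Sum>k\<in>{a..<b}. newman_real k) \<le> psi3 b * (1 / a - 1 / b) - (ln b - ln a) / 2"
    unfolding e[symmetric] newman_real_def
    by (intro sum_mono diff_right_mono mult_right_mono psi3_mono pos) auto
qed

lemma floor_mult_tendsto:
  assumes "c > 0"
  shows "(\<lambda>n. real (nat \<lfloor>c * real n\<rfloor>) / real n) \<longlonglongrightarrow> c"
proof (rule tendsto_sandwich)
  show "eventually (\<lambda>n. c - 1 / real n \<le> real (nat \<lfloor>c * real n\<rfloor>) / real n) sequentially"
    using eventually_gt_at_top[of 0]
  proof eventually_elim
    case (elim n)
    have "c * real n - 1 \<le> real (nat \<lfloor>c * real n\<rfloor>)" using assms elim by linarith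
    hence "(c * real n - 1) / real n \<le> real (nat \<lfloor>c * real n\<rfloor>) / real n" by (rule divide_right_mono) simp
    thus ?case using elim by (simp add: diff_divide_distrib)
  qed
  show "eventually (\<lambda>n. real (nat \<lfloor>c * real n\<rfloor>) / real n \<le> c) sequentially"
    using eventually_gt_at_top[of 0]
  proof eventually_elim
    case (elim n)
    have "real (nat \<lfloor>c * real n\<rfloor>) \<le> c * real n" using assms by simp
    thus ?case using elim by (simp add: field_simps)
  qed
  show "(\<lambda>n. c - 1 / real n) \<longlonglongrightarrow> c" by real_asymp
qed auto

text \<open>Without such a prime \<open>psi3\<close> is almost constant on \<open>[n, c n]\<close>.  The sums of \<open>newman_real\<close> over \<open>[n, b n)\<close>
  and over \<open>[b n, c n)\<close> then bound \<open>psi3 n / n\<close> above by \<open>hi n\<close> and below by \<open>lo n\<close>, although the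
  limit of \<open>hi\<close> is less than that of \<open>lo\<close>.\<close>

theorem prime_3_mod_4_in_interval:
  fixes e :: real
  assumes "e > 0"
  shows "eventually (\<lambda>n. \<exists>p. prime p \<and> n < p \<and> real p \<le> (1 + e) * real n \<and> p mod 4 = (3::nat)) sequentially"
proof -
  \<comment> \<open>Two equal factors lead from \<open>n\<close> to \<open>(1 + e) * n\<close>: the
    first stretch serves the upper estimate, the second the lower one.\<close>
  define \<mu> where "\<mu> = sqrt (1 + e)"
  have mu: "\<mu> > 1" "\<mu> * \<mu> = 1 + e" using assms by (auto simp: \<mu>_def)
  \<comment> \<open>The contradiction needs
    \<open>\<kappa> * (\<mu> + 1) < (\<mu> - 1) * ln \<mu> / 2\<close>; this choice makes the left
    side half of the right.\<close>
  define \<kappa> where "\<kappa> = (\<mu> - 1) * ln \<mu> / (4 * (\<mu> + 1))"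
  have kappa: "\<kappa> > 0" "\<kappa> * (\<mu> + 1) = (\<mu> - 1) * ln \<mu> / 4" using mu by (auto simp: \<kappa>_def field_simps)
  define b where "b = (\<lambda>n. nat \<lfloor>\<mu> * real n\<rfloor>)"
  define c where "c = (\<lambda>n. b (b n))"
  define hi where "hi = (\<lambda>n. (ln (b n / n) / 2 + \<kappa>) / (1 - 1 / (b n / n)))"
  define lo where "lo = (\<lambda>n. (ln (c n / b n) / 2 - \<kappa>) / (1 / (b n / n) * (1 - 1 / (c n / b n))) - prime_power_sum (c n) / n)"
  have bn: "(\<lambda>n. b n / n) \<longlonglongrightarrow> \<mu>" unfolding b_def using mu by (intro floor_mult_tendsto) auto
  have b_ge: "b n \<ge> n" for n
  proof -
    have "1 * real n \<le> \<mu> * real n" using mu by (intro mult_right_mono) auto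
    thus ?thesis unfolding b_def by (simp add: le_nat_floor)
  qed
  have b_le: "real (b n) \<le> \<mu> * real n" for n unfolding b_def using mu by simp
  have b_top: "filterlim b at_top sequentially"
    by (rule filterlim_at_top_mono[OF filterlim_ident]) (use b_ge in auto)
  have cn: "(\<lambda>n. c n / b n) \<longlonglongrightarrow> \<mu>"
    using filterlim_compose[OF bn b_top] unfolding c_def .
  have c_le: "real (c n) \<le> (1 + e) * real n" for n
  proof -
    have "real (c n) \<le> \<mu> * real (b n)" unfolding c_def by (rule b_le)
    also have "\<dots> \<le> \<mu> * (\<mu> * real n)" using mu b_le by (intro mult_left_mono) auto
    also have "\<dots> = (1 + e) * real n" using mu by (simp flip: mult.assoc)
    finally show ?thesis .
  qed
  have c_ge: "c n \<ge> b n" for n unfolding c_def by (rule b_ge)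
  have pp: "(\<lambda>n. prime_power_sum (c n) / n) \<longlonglongrightarrow> 0"
  proof (rule tendsto_sandwich[OF _ _ tendsto_const])
    show "eventually (\<lambda>n. 0 \<le> prime_power_sum (c n) / n) sequentially"
      by (intro always_eventually allI divide_nonneg_nonneg) (auto simp: prime_power_sum_def mangoldt_nonneg intro!: sum_nonneg)
    show "eventually (\<lambda>n. prime_power_sum (c n) / n \<le> sqrt ((1 + e) * n) * log 2 ((1 + e) * n) * ln ((1 + e) * n) / n) sequentially"
      using eventually_gt_at_top[of 0]
    proof eventually_elim
      case (elim n)
      have c1: "c n \<ge> 1" using b_ge[of n] c_ge[of n] elim by simp
      have e1: "(1 + e) * n \<ge> 1" using c1 c_le[of n] by linarith
      have "prime_power_sum (c n) \<le> sqrt (c n) * log 2 (c n) * ln (c n)" by (rule prime_power_sum_le[OF c1])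
      also have "\<dots> \<le> sqrt ((1 + e) * n) * log 2 ((1 + e) * n) * ln ((1 + e) * n)"
        using c1 c_le[of n] e1 by (intro mult_mono mult_nonneg_nonneg) auto
      finally show ?case by (simp add: divide_right_mono)
    qed
    show "(\<lambda>n. sqrt ((1 + e) * real n) * log 2 ((1 + e) * real n) * ln ((1 + e) * real n) / real n) \<longlonglongrightarrow> 0"
      using assms by real_asymp
  qed
  have hi: "hi \<longlonglongrightarrow> (ln \<mu> / 2 + \<kappa>) / (1 - 1 / \<mu>)"
    unfolding hi_def using mu by (intro tendsto_intros bn) auto
  have lo: "lo \<longlonglongrightarrow> (ln \<mu> / 2 - \<kappa>) / (1 / \<mu> * (1 - 1 / \<mu>)) - 0"
    unfolding lo_def using mu by (intro tendsto_intros bn cn pp) auto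
  have "(ln \<mu> / 2 + \<kappa>) / (1 - 1 / \<mu>) < (ln \<mu> / 2 - \<kappa>) / (1 / \<mu> * (1 - 1 / \<mu>)) - 0"
  proof -
    have "(\<mu> - 1) * ln \<mu> > 0" using mu by simp
    hence "ln \<mu> / 2 + \<kappa> < \<mu> * (ln \<mu> / 2 - \<kappa>)"
      using kappa(2) by (simp add: algebra_simps)
    moreover have "1 - 1 / \<mu> > 0" using mu by simp
    ultimately have "(ln \<mu> / 2 + \<kappa>) / (1 - 1 / \<mu>) < (\<mu> * (ln \<mu> / 2 - \<kappa>)) / (1 - 1 / \<mu>)"
      by (rule divide_strict_right_mono)
    also have "\<dots> = (ln \<mu> / 2 - \<kappa>) / (1 / \<mu> * (1 - 1 / \<mu>)) - 0"
    proof -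
      have "(\<mu> * X) / d = X / (1 / \<mu> * d) - 0" for X d :: real using mu by simp
      thus ?thesis .
    qed
    finally show ?thesis .
  qed
  from order_tendstoD(1)[OF tendsto_diff[OF lo hi], of 0] this
  have ev: "eventually (\<lambda>n. 0 < lo n - hi n) sequentially" by simp
  obtain N where N: "\<And>m n. m \<ge> N \<Longrightarrow> \<bar>\<Sum>k\<in>{m..<n}. newman_real k\<bar> < \<kappa>"
    using newman_real_Cauchy[OF kappa(1)] by blast
  note ev
  moreover have "eventually (\<lambda>n. b n / n > 1) sequentially" "eventually (\<lambda>n. c n / b n > 1) sequentially"
    using order_tendstoD(1)[OF bn mu(1)] order_tendstoD(1)[OF cn mu(1)] by auto
  ultimately show ?thesis using eventually_ge_at_top[of N] eventually_gt_at_top[of 0]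
  proof eventually_elim
    case (elim n)
    show ?case
    proof (rule ccontr)
      assume no: "\<not> ?case"
      have "\<not> (\<exists>p. prime p \<and> n < p \<and> p \<le> c n \<and> p mod 4 = 3)"
      proof
        assume "\<exists>p. prime p \<and> n < p \<and> p \<le> c n \<and> p mod 4 = 3"
        then obtain p where p: "prime p" "n < p" "p \<le> c n" "p mod 4 = 3" by blast
        have "real p \<le> (1 + e) * n" using p(3) c_le[of n] by linarith
        thus False using no p by blast
      qed
      hence flat: "psi3 (c n) \<le> psi3 n + prime_power_sum (c n)"
        using b_ge[of n] c_ge[of n] by (intro psi3_flat) auto
      have n: "real n > 0" "real (b n) > real n" "real (c n) > real (b n)" using elim b_ge[of n] by (auto simp: field_simps)
      define x where "x = b n / n"
      define y where "y = c n / b n"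
      have xy: "x > 1" "y > 1" using elim by (auto simp: x_def y_def)
      have "psi3 n * (1 / n - 1 / b n) - (ln (b n) - ln n) / 2 \<le> (\<Sum>k\<in>{n..<b n}. newman_real k)"
        using b_ge[of n] elim by (intro sum_newman_real) auto
      also have "\<dots> < \<kappa>" using N[of n "b n"] elim by auto
      finally have "psi3 n * (1 / n - 1 / b n) < ln x / 2 + \<kappa>"
        using n by (simp add: x_def ln_div)
      moreover have "psi3 n * (1 / n - 1 / b n) = psi3 n / n * (1 - 1 / x)" using n by (simp add: x_def field_simps)
      ultimately have "psi3 n / n < (ln x / 2 + \<kappa>) / (1 - 1 / x)" using xy by (simp add: pos_less_divide_eq)
      hence up: "psi3 n / n < hi n" by (simp add: hi_def x_def)
      have "- \<kappa> < (\<Sum>k\<in>{b n..<c n}. newman_real k)" using N[of "b n" "c n"] elim b_ge[of n] by auto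
      also have "\<dots> \<le> psi3 (c n) * (1 / b n - 1 / c n) - (ln (c n) - ln (b n)) / 2"
        using b_ge[of n] c_ge[of n] elim by (intro sum_newman_real) auto
      also have "\<dots> \<le> (psi3 n + prime_power_sum (c n)) * (1 / b n - 1 / c n) - (ln (c n) - ln (b n)) / 2"
        using flat n by (intro diff_right_mono mult_right_mono) (auto simp: field_simps)
      also have "\<dots> = (psi3 n + prime_power_sum (c n)) / n * (1 / x * (1 - 1 / y)) - ln y / 2"
        using n by (simp add: x_def y_def ln_div field_simps)
      finally have "ln y / 2 - \<kappa> < (psi3 n + prime_power_sum (c n)) / n * (1 / x * (1 - 1 / y))" by simp
      moreover have "1 / x * (1 - 1 / y) > 0" using xy by simp
      ultimately have "(ln y / 2 - \<kappa>) / (1 / x * (1 - 1 / y)) < (psi3 n + prime_power_sum (c n)) / n"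
        by (subst pos_divide_less_eq)
      hence "lo n < psi3 n / n" by (simp add: lo_def x_def y_def add_divide_distrib)
      thus False using up elim by simp
    qed
  qed
qed

section \<open>The Paley matrix\<close>

text \<open>For \<open>c\<close> prime to \<open>p\<close> the map
  \<open>x \<mapsto> c * x + d\<close> permutes the residues modulo \<open>p\<close>.\<close>

lemma sum_mod_affine:
  fixes f :: "int \<Rightarrow> int"
  assumes "prime p" "\<And>x. f (x mod int p) = f x" "\<not> int p dvd c"
  shows "(\<Sum>x\<in>{0..<int p}. f (c * x + d)) = (\<Sum>x\<in>{0..<int p}. f x)"
proof -
  have p: "int p > 0" using assms(1) by (simp add: prime_gt_0_nat)
  have inj: "inj_on (\<lambda>x. (c * x + d) mod int p) {0..<int p}"
  proof (rule inj_onI)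
    fix x y assume xy: "x \<in> {0..<int p}" "y \<in> {0..<int p}" "(c * x + d) mod int p = (c * y + d) mod int p"
    hence "int p dvd (c * x + d) - (c * y + d)" by (simp add: mod_eq_dvd_iff)
    hence "int p dvd c * (x - y)" by (simp add: algebra_simps)
    hence "int p dvd x - y" using assms(1,3) by (simp add: prime_dvd_mult_iff)
    thus "x = y" using xy(1,2) by (metis atLeastLessThan_iff mod_eq_dvd_iff mod_pos_pos_trivial)
  qed
  have "(\<lambda>x. (c * x + d) mod int p) ` {0..<int p} = {0..<int p}"
    by (intro endo_inj_surj inj) (use p in auto)
  hence "(\<Sum>x\<in>{0..<int p}. f x) = (\<Sum>x\<in>(\<lambda>x. (c * x + d) mod int p) ` {0..<int p}. f x)" by simp
  also have "\<dots> = (\<Sum>x\<in>{0..<int p}. f (c * x + d))"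
    by (subst sum.reindex[OF inj]) (simp add: assms(2))
  finally show ?thesis ..
qed

context
  fixes p :: nat
  assumes p: "prime p" "p mod 4 = 3"
begin

lemma p_gt_2: "p > 2"
  using prime_ge_2_nat[OF p(1)] p(2) by (cases "p = 2") auto

lemma Legendre_mod: "Legendre (x mod int p) (int p) = Legendre x (int p)"
  by (simp add: Legendre_def QuadRes_def cong_def)

text \<open>As \<open>p > 2\<close>, the values -1, 0, 1 are distinct modulo \<open>p\<close>; so
  the congruences of Euler's criterion become equalities.\<close>

lemma Legendre_eqI:
  assumes "[Legendre x (int p) = y] (mod int p)" "y \<in> {-1, 0, 1}"
  shows "Legendre x (int p) = y"
proof -
  have "Legendre x (int p) \<in> {-1, 0, 1}" by (auto simp: Legendre_def)
  hence "\<bar>Legendre x (int p) - y\<bar> < int p" using assms(2) p_gt_2 by auto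
  moreover have "int p dvd Legendre x (int p) - y" using assms(1) by (simp add: cong_iff_dvd_diff)
  ultimately show ?thesis using zdvd_imp_le[of "int p" "\<bar>Legendre x (int p) - y\<bar>"] by (cases "Legendre x (int p) = y") auto
qed

lemma Legendre_mult: "Legendre (x * y) (int p) = Legendre x (int p) * Legendre y (int p)"
proof (rule Legendre_eqI)
  note e = euler_criterion[OF p(1) p_gt_2]
  have "[Legendre (x * y) (int p) = x ^ ((p - 1) div 2) * y ^ ((p - 1) div 2)] (mod int p)"
    using e[of "x * y"] by (simp add: power_mult_distrib)
  also have "[x ^ ((p - 1) div 2) * y ^ ((p - 1) div 2) = Legendre x (int p) * Legendre y (int p)] (mod int p)"
    by (intro cong_mult cong_sym[OF e])
  finally show "[Legendre (x * y) (int p) = Legendre x (int p) * Legendre y (int p)] (mod int p)" .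
qed (auto simp: Legendre_def)

lemma Legendre_minus_1: "Legendre (-1) (int p) = -1"
proof (rule Legendre_eqI)
  have "odd ((p - 1) div 2)" using p(2) by presburger
  thus "[Legendre (-1) (int p) = -1] (mod int p)" using euler_criterion[OF p(1) p_gt_2, of "-1"] by simp
qed simp

lemma Legendre_minus: "Legendre (-x) (int p) = - Legendre x (int p)"
  using Legendre_mult[of "-1" x] by (simp add: Legendre_minus_1)

lemma Legendre_square: "\<not> int p dvd x \<Longrightarrow> Legendre x (int p) * Legendre x (int p) = 1"
  by (auto simp: Legendre_def cong_0_iff)

lemma Legendre_0: "int p dvd x \<Longrightarrow> Legendre x (int p) = 0"
  by (auto simp: Legendre_def cong_0_iff)

lemma sum_Legendre: "(\<Sum>x\<in>{0..<int p}. Legendre x (int p)) = 0"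
proof -
  have "\<not> int p dvd -1" using p_gt_2 by simp
  from sum_mod_affine[where f = "\<lambda>x. Legendre x (int p)", OF p(1) Legendre_mod this, of 0]
  have "(\<Sum>x\<in>{0..<int p}. Legendre (-x) (int p)) = (\<Sum>x\<in>{0..<int p}. Legendre x (int p))" by simp
  thus ?thesis by (simp add: Legendre_minus sum_negf)
qed

lemma sum_Legendre_shift: "(\<Sum>x\<in>{0..<int p}. Legendre (x + c) (int p)) = 0"
proof -
  have "\<not> int p dvd 1" using p_gt_2 by simp
  from sum_mod_affine[where f = "\<lambda>x. Legendre x (int p)", OF p(1) Legendre_mod this, of c] show ?thesis by (simp add: sum_Legendre)
qed

text \<open>The correlation sum does not depend on \<open>c\<close> for \<open>c\<close> prime to \<open>p\<close> (scale \<open>x\<close> by \<open>c\<close>), it is \<open>p - 1\<close> for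
  \<open>c = 0\<close>, and summing over all \<open>c\<close> gives 0.\<close>

lemma Legendre_correlation:
  assumes "\<not> int p dvd c"
  shows "(\<Sum>x\<in>{0..<int p}. Legendre x (int p) * Legendre (x + c) (int p)) = -1"
proof -
  define S where "S = (\<lambda>c. \<Sum>x\<in>{0..<int p}. Legendre x (int p) * Legendre (x + c) (int p))"
  have scale: "S c = S 1" if "\<not> int p dvd c" for c
  proof -
    have "S c = (\<Sum>x\<in>{0..<int p}. Legendre (c * x + 0) (int p) * Legendre ((c * x + 0) + c) (int p))"
      unfolding S_def
    proof (rule sum_mod_affine[OF p(1) _ that, symmetric])
      fix x
      have "Legendre (x mod int p + c) (int p) = Legendre (x + c) (int p)"
        by (metis Legendre_mod mod_add_left_eq)
      thus "Legendre (x mod int p) (int p) * Legendre (x mod int p + c) (int p) = Legendre x (int p) * Legendre (x + c) (int p)"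
        by (simp add: Legendre_mod)
    qed
    also have "\<dots> = (\<Sum>x\<in>{0..<int p}. Legendre x (int p) * Legendre (x + 1) (int p))"
    proof (rule sum.cong[OF refl])
      fix x
      have "Legendre (c * x + 0) (int p) * Legendre ((c * x + 0) + c) (int p)
        = (Legendre c (int p) * Legendre c (int p)) * (Legendre x (int p) * Legendre (x + 1) (int p))"
        using Legendre_mult[of c x] Legendre_mult[of c "x + 1"] by (simp add: algebra_simps)
      thus "Legendre (c * x + 0) (int p) * Legendre ((c * x + 0) + c) (int p) = Legendre x (int p) * Legendre (x + 1) (int p)"
        using Legendre_square[OF that] by simp
    qed
    finally show ?thesis by (simp add: S_def)
  qed
  have pos: "int p > 0" using p_gt_2 by simp
  have nd: "\<not> int p dvd x" if "x \<in> {0..<int p} - {0}" for x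
    using that zdvd_imp_le[of "int p" x] by auto
  have S0: "S 0 = int p - 1"
  proof -
    have "S 0 = (\<Sum>x\<in>{0..<int p} - {0}. Legendre x (int p) * Legendre x (int p))"
      unfolding S_def by (rule sum.mono_neutral_cong_right) (auto simp: Legendre_0)
    also have "\<dots> = (\<Sum>x\<in>{0..<int p} - {0}. 1)" by (intro sum.cong refl Legendre_square nd)
    finally show ?thesis using pos by simp
  qed
  have "0 = (\<Sum>x\<in>{0..<int p}. Legendre x (int p) * (\<Sum>c\<in>{0..<int p}. Legendre (c + x) (int p)))"
    by (simp add: sum_Legendre_shift)
  also have "\<dots> = (\<Sum>c\<in>{0..<int p}. S c)"
    unfolding S_def by (subst sum.swap) (simp add: sum_distrib_left add.commute)
  also have "\<dots> = S 0 + (\<Sum>c\<in>{0..<int p} - {0}. S c)"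
    using pos by (intro sum.remove) auto
  also have "(\<Sum>c\<in>{0..<int p} - {0}. S c) = (\<Sum>c\<in>{0..<int p} - {0}. S 1)"
    by (intro sum.cong refl scale nd)
  also have "\<dots> = (int p - 1) * S 1" using pos by simp
  also have "S 0 + (int p - 1) * S 1 = (int p - 1) + (int p - 1) * S 1" unfolding S0 ..
  also have "\<dots> = (int p - 1) * (S 1 + 1)" by (simp add: algebra_simps)
  finally have "(int p - 1) * (S 1 + 1) = 0" ..
  hence "S 1 = -1" using p_gt_2 by simp
  thus ?thesis using scale[OF assms] by (simp add: S_def)
qed

text \<open>The Legendre symbols of differences form a skew matrix because -1 is a non-residue for
  \<open>p \<equiv> 3\<close> modulo 4. Its zero diagonal is filled with 1, and it is bordered by a
  row of 1, which normalizes it, and a column of -1.\<close>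

definition paley :: "int mat" where
  "paley = mat (p + 1) (p + 1) (\<lambda>(i, j). if i = 0 then 1 else if j = 0 then -1 else
     Legendre (int j - int i) (int p) + (if i = j then 1 else 0))"

lemma sum_lessThan_int: "(\<Sum>j<p. f (int j)) = (\<Sum>x\<in>{0..<int p}. f x)"
proof -
  have "{0..<int p} = int ` {..<p}" using image_int_atLeastLessThan[of 0 p] by (simp add: lessThan_atLeast0)
  thus ?thesis by (simp add: sum.reindex)
qed

lemma not_dvd_diff: "a < p \<Longrightarrow> b < p \<Longrightarrow> a \<noteq> b \<Longrightarrow> \<not> int p dvd int a - int b"
  using zdvd_imp_le[of "int p" "\<bar>int a - int b\<bar>"] by auto

theorem normalized_hadamard_paley: "normalized_hadamard (p + 1) paley"
  unfolding normalized_hadamard_def hadamard_matrix_def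
proof (intro conjI allI impI)
  show "paley \<in> carrier_mat (p + 1) (p + 1)" by (simp add: paley_def)
next
  fix i j assume ij: "i < p + 1" "j < p + 1"
  show "paley $$ (i, j) \<in> {1, -1}"
  proof (cases "i = 0 \<or> j = 0 \<or> i = j")
    case True
    thus ?thesis using ij Legendre_0[of 0] by (auto simp: paley_def)
  next
    case False
    hence "\<not> int p dvd int (j - 1) - int (i - 1)" using ij by (intro not_dvd_diff) auto
    moreover have "int (j - 1) - int (i - 1) = int j - int i" using False by auto
    ultimately have "\<not> int p dvd int j - int i" by simp
    hence "Legendre (int j - int i) (int p) \<in> {1, -1}" by (auto simp: Legendre_def cong_0_iff)
    thus ?thesis using False ij by (simp add: paley_def)
  qed
next
  fix j assume "j < p + 1" thus "paley $$ (0, j) = 1" by (simp add: paley_def)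
next
  define q where "q = (\<lambda>a x. Legendre (x - int a) (int p) + (if x = int a then 1 else 0))"
  have entry: "paley $$ (Suc a, Suc j) = q a (int j)" if "a < p" "j < p" for a j
    using that by (simp add: paley_def q_def)
  have q1: "(\<Sum>x\<in>{0..<int p}. q a x) = 1" if "a < p" for a
    using that sum_Legendre_shift[of "- int a"] by (simp add: q_def sum.distrib)
  have q2: "(\<Sum>x\<in>{0..<int p}. q a x * q b x) = -1" if "a < p" "b < p" "a \<noteq> b" for a b
  proof -
    have "q a x * q b x = Legendre (x - int a) (int p) * Legendre (x - int b) (int p)
        + ((if x = int a then Legendre (int a - int b) (int p) else 0) + (if x = int b then Legendre (int b - int a) (int p) else 0))" for x
      using that by (auto simp: q_def Legendre_0)
    hence "(\<Sum>x\<in>{0..<int p}. q a x * q b x) = (\<Sum>x\<in>{0..<int p}. Legendre (x - int a) (int p) * Legendre (x - int b) (int p))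
        + (Legendre (int a - int b) (int p) + Legendre (int b - int a) (int p))"
      using that by (simp add: sum.distrib)
    \<comment> \<open>The diagonal entries contribute two Legendre symbols, which cancel by
      skewness.\<close>
    also have "Legendre (int b - int a) (int p) = - Legendre (int a - int b) (int p)"
      using Legendre_minus[of "int a - int b"] by simp
    also have "(\<Sum>x\<in>{0..<int p}. Legendre (x - int a) (int p) * Legendre (x - int b) (int p))
       = (\<Sum>x\<in>{0..<int p}. Legendre x (int p) * Legendre (x + (int a - int b)) (int p))"
    proof -
      have n: "\<not> int p dvd 1" using p_gt_2 by simp
      have "Legendre (x mod int p + (int a - int b)) (int p) = Legendre (x + (int a - int b)) (int p)" for x
        by (metis Legendre_mod mod_add_left_eq)
      from sum_mod_affine[where f = "\<lambda>x. Legendre x (int p) * Legendre (x + (int a - int b)) (int p)", OF p(1) _ n, of "- int a"] this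
      show ?thesis by (simp add: Legendre_mod)
    qed
    also have "\<dots> = -1" by (intro Legendre_correlation not_dvd_diff that)
    finally show ?thesis by simp
  qed
  have sp: "scalar_prod (row paley i) (row paley k) = paley $$ (i, 0) * paley $$ (k, 0) + (\<Sum>j<p. paley $$ (i, Suc j) * paley $$ (k, Suc j))"
    if "i < p + 1" "k < p + 1" for i k
  proof -
    have "scalar_prod (row paley i) (row paley k) = (\<Sum>j<Suc p. paley $$ (i, j) * paley $$ (k, j))"
      using that by (auto simp: scalar_prod_def paley_def atLeast0LessThan intro!: sum.cong)
    thus ?thesis by (simp only: sum.lessThan_Suc_shift)
  qed
  have zero_row: "scalar_prod (row paley 0) (row paley (Suc b)) = 0" if "b < p" for b
  proof -
    have "(\<Sum>j<p. paley $$ (0, Suc j) * paley $$ (Suc b, Suc j)) = (\<Sum>j<p. q b (int j))"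
      using that by (intro sum.cong refl) (simp add: entry, simp add: paley_def)
    also have "\<dots> = 1" using q1[OF that] by (simp add: sum_lessThan_int)
    finally show ?thesis using that sp[of 0 "Suc b"] by (simp add: paley_def)
  qed
  fix i k assume ik: "i < p + 1" "k < p + 1" "i \<noteq> k"
  show "scalar_prod (row paley i) (row paley k) = 0"
  proof (cases "i = 0 \<or> k = 0")
    case True
    have "scalar_prod (row paley i) (row paley k) = scalar_prod (row paley k) (row paley i)"
      by (rule comm_scalar_prod[of _ "p + 1"]) (use ik in \<open>simp_all add: paley_def\<close>)
    thus ?thesis using True ik zero_row[of "k - 1"] zero_row[of "i - 1"] by auto
  next
    case False
    then obtain a b where ab: "i = Suc a" "k = Suc b" by (metis not0_implies_Suc)
    have "(\<Sum>j<p. paley $$ (Suc a, Suc j) * paley $$ (Suc b, Suc j)) = (\<Sum>j<p. q a (int j) * q b (int j))"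
      using ik ab by (intro sum.cong refl) (simp add: entry)
    also have "\<dots> = -1" using q2[of a b] sum_lessThan_int[of "\<lambda>x. q a x * q b x"] ik ab by simp
    finally show ?thesis using ik ab sp[of i k] by (simp add: paley_def)
  qed
qed

end

section \<open>Moments of the simplex\<close>

text \<open>Integration by parts moves one power from \<open>y\<close> to \<open>t - y\<close>,
  hence the induction on \<open>m\<close> with \<open>k\<close> arbitrary.\<close>

lemma has_integral_beta_nat:
  fixes t :: real
  assumes "t \<ge> 0"
  shows "((\<lambda>y. y ^ m * (t - y) ^ k) has_integral (fact m * fact k / fact (m + k + 1) * t ^ (m + k + 1))) {0..t}"
proof (induction m arbitrary: k)
  case 0
  have "((\<lambda>y. (t - y) ^ k) has_integral (- ((t - t) ^ (k + 1)) / (k + 1) - (- ((t - 0) ^ (k + 1)) / (k + 1)))) {0..t}"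
  proof (rule fundamental_theorem_of_calculus[OF assms])
    fix y
    have "((\<lambda>y. - ((t - y) ^ (k + 1)) / (k + 1)) has_real_derivative (t - y) ^ k) (at y)"
      by (rule derivative_eq_intros refl | simp)+
    thus "((\<lambda>y. - ((t - y) ^ (k + 1)) / (k + 1)) has_vector_derivative (t - y) ^ k) (at y within {0..t})"
      by (simp add: has_real_derivative_iff_has_vector_derivative has_vector_derivative_at_within)
  qed
  moreover have "fact k / fact (Suc k) = 1 / (real k + 1)" by (simp add: add.commute)
  hence "fact 0 * fact k / fact (0 + k + 1) * t ^ (0 + k + 1) = t ^ (k + 1) / (k + 1)" by simp
  ultimately show ?case by simp
next
  case (Suc m)
  have "((\<lambda>y. real (Suc m) * (y ^ m * (t - y) ^ Suc k) - real (Suc k) * (y ^ Suc m * (t - y) ^ k)) has_integral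
      (t ^ Suc m * (t - t) ^ Suc k - 0 ^ Suc m * (t - 0) ^ Suc k)) {0..t}"
  proof (rule fundamental_theorem_of_calculus[OF assms])
    fix y
    have "((\<lambda>y. y ^ Suc m * (t - y) ^ Suc k) has_real_derivative
       (real (Suc m) * (y ^ m * (t - y) ^ Suc k) - real (Suc k) * (y ^ Suc m * (t - y) ^ k))) (at y)"
      by (rule derivative_eq_intros refl | simp)+
    thus "((\<lambda>y. y ^ Suc m * (t - y) ^ Suc k) has_vector_derivative
       (real (Suc m) * (y ^ m * (t - y) ^ Suc k) - real (Suc k) * (y ^ Suc m * (t - y) ^ k))) (at y within {0..t})"
      by (simp only: has_real_derivative_iff_has_vector_derivative has_vector_derivative_at_within)
  qed
  from has_integral_diff[OF has_integral_mult_right[OF Suc.IH[of "Suc k"], of "real (Suc m)"] this]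
  have "((\<lambda>y. real (Suc k) * (y ^ Suc m * (t - y) ^ k)) has_integral
      (real (Suc m) * (fact m * fact (Suc k) / fact (m + Suc k + 1) * t ^ (m + Suc k + 1)))) {0..t}"
    by simp
  from has_integral_mult_right[OF this, of "1 / real (Suc k)"]
  have "((\<lambda>y. y ^ Suc m * (t - y) ^ k) has_integral
      (1 / real (Suc k) * (real (Suc m) * (fact m * fact (Suc k) / fact (m + Suc k + 1) * t ^ (m + Suc k + 1))))) {0..t}"
    by (simp del: of_nat_Suc power_Suc)
  also have "1 / real (Suc k) * (real (Suc m) * (fact m * fact (Suc k) / fact (m + Suc k + 1) * t ^ (m + Suc k + 1)))
     = fact (Suc m) * fact k / fact (Suc m + k + 1) * t ^ (Suc m + k + 1)"
  proof -
    have "m + Suc k + 1 = Suc m + k + 1" by simp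
    moreover have "1 / real (Suc k) * (real (Suc m) * (fact m * (real (Suc k) * fact k) / F * T))
       = real (Suc m) * fact m * fact k / F * T" for F T :: real
      by (simp del: of_nat_Suc)
    moreover have "fact (Suc m) = real (Suc m) * fact m" "fact (Suc k) = real (Suc k) * fact k" by simp_all
    ultimately show ?thesis by (simp only:)
  qed
  finally show ?case .
qed

definition in_corner :: "nat set \<Rightarrow> real \<Rightarrow> (nat \<Rightarrow> real) \<Rightarrow> bool" where
  "in_corner A t x \<longleftrightarrow> (\<forall>i\<in>A. 0 \<le> x i) \<and> sum x A \<le> t"

text \<open>Dirichlet's integrand on a corner of variable size \<open>t\<close>: fixing one
  coordinate \<open>y\<close> leaves the same integrand on a corner of size \<open>t - y\<close>,
  which makes an induction on \<open>A\<close> possible. For \<open>t = 1\<close> the factor with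
  exponent \<open>b\<close> is the power of the remaining barycentric coordinate.\<close>

definition corner_monomial :: "nat set \<Rightarrow> (nat \<Rightarrow> nat) \<Rightarrow> nat \<Rightarrow> real \<Rightarrow> (nat \<Rightarrow> real) \<Rightarrow> real" where
  "corner_monomial A a b t x = (if in_corner A t x then (\<Prod>i\<in>A. x i ^ a i) * (t - sum x A) ^ b else 0)"

lemma measurable_in_corner:
  assumes "finite A"
  shows "Measurable.pred (Pi\<^sub>M A (\<lambda>_. lborel)) (in_corner A t)"
  unfolding in_corner_def using assms by measurable

lemma measurable_corner_monomial:
  assumes "finite A"
  shows "corner_monomial A a b t \<in> borel_measurable (Pi\<^sub>M A (\<lambda>_. lborel))"
proof -
  note [measurable] = measurable_in_corner[OF assms]
  show ?thesis unfolding corner_monomial_def[abs_def] using assms by measurable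
qed

lemma corner_monomial_insert:
  assumes "finite A" "c \<notin> A"
  shows "corner_monomial (insert c A) a b t (x(c := y)) =
    (if 0 \<le> y \<and> y \<le> t then y ^ a c * corner_monomial A a b (t - y) x else 0)"
proof -
  have s: "sum (x(c := y)) (insert c A) = y + sum x A"
    using assms by (simp add: sum_delta_notmem)
  have p: "(\<Prod>i\<in>A. (x(c := y)) i ^ a i) = (\<Prod>i\<in>A. x i ^ a i)"
    using assms by (intro prod.cong refl) auto
  have "in_corner (insert c A) t (x(c := y)) \<longleftrightarrow> 0 \<le> y \<and> y \<le> t \<and> in_corner A (t - y) x"
    unfolding in_corner_def s using assms sum_nonneg[of A x] by auto force
  thus ?thesis unfolding corner_monomial_def s using assms
    by (simp add: p algebra_simps del: fun_upd_apply) (simp add: algebra_simps)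
qed

lemma nn_integral_corner_monomial:
  assumes "finite A" "t \<ge> 0"
  shows "(\<integral>\<^sup>+ x. ennreal (corner_monomial A a b t x) \<partial>(Pi\<^sub>M A (\<lambda>_. lborel))) =
     ennreal ((\<Prod>i\<in>A. fact (a i)) * fact b / fact (card A + sum a A + b) * t ^ (card A + sum a A + b))"
  using assms
proof (induction A arbitrary: t rule: finite_induct)
  case empty
  thus ?case by (simp add: PiM_empty corner_monomial_def in_corner_def)
next
  case (insert c A t)
  interpret product_sigma_finite "\<lambda>_::nat. lborel :: real measure" by standard
  let ?k = "card A + sum a A + b"
  let ?C = "(\<Prod>i\<in>A. fact (a i)) * fact b / fact ?k :: real"
  have C0: "?C \<ge> 0" by (intro divide_nonneg_nonneg mult_nonneg_nonneg prod_nonneg) auto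
  note [measurable] = measurable_corner_monomial
  have fin: "finite (insert c A)" using insert by simp
  have "(\<integral>\<^sup>+ x. ennreal (corner_monomial (insert c A) a b t x) \<partial>(Pi\<^sub>M (insert c A) (\<lambda>_. lborel))) =
     (\<integral>\<^sup>+ y. \<integral>\<^sup>+ x. ennreal (corner_monomial (insert c A) a b t (x(c := y))) \<partial>(Pi\<^sub>M A (\<lambda>_. lborel)) \<partial>lborel)"
    using insert.hyps measurable_corner_monomial[OF fin] by (intro product_nn_integral_insert_rev) auto
  also have "\<dots> = (\<integral>\<^sup>+ y. ennreal (y ^ a c * (t - y) ^ ?k * ?C) * indicator {0..t} y \<partial>lborel)"
  proof (rule nn_integral_cong)
    fix y :: real
    show "(\<integral>\<^sup>+ x. ennreal (corner_monomial (insert c A) a b t (x(c := y))) \<partial>(Pi\<^sub>M A (\<lambda>_. lborel)))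
       = ennreal (y ^ a c * (t - y) ^ ?k * ?C) * indicator {0..t} y"
    proof (cases "0 \<le> y \<and> y \<le> t")
      case True
      have "(\<integral>\<^sup>+ x. ennreal (corner_monomial (insert c A) a b t (x(c := y))) \<partial>(Pi\<^sub>M A (\<lambda>_. lborel)))
        = (\<integral>\<^sup>+ x. ennreal (y ^ a c) * ennreal (corner_monomial A a b (t - y) x) \<partial>(Pi\<^sub>M A (\<lambda>_. lborel)))"
        using True insert.hyps by (intro nn_integral_cong) (simp add: corner_monomial_insert ennreal_mult' )
      also have "\<dots> = ennreal (y ^ a c) * ennreal (?C * (t - y) ^ ?k)"
        using True insert.IH[of "t - y"] insert.hyps measurable_corner_monomial[OF insert.hyps(1)]
        by (subst nn_integral_cmult) auto
      also have "\<dots> = ennreal (y ^ a c * (t - y) ^ ?k * ?C)"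
        using True by (simp add: mult_ac flip: ennreal_mult')
      finally show ?thesis using True by simp
    qed (use insert.hyps in \<open>auto simp: corner_monomial_insert\<close>)
  qed
  also have "\<dots> = ennreal (fact (a c) * fact ?k / fact (a c + ?k + 1) * t ^ (a c + ?k + 1) * ?C)"
  proof (rule nn_integral_has_integral_lebesgue')
    show "((\<lambda>y. y ^ a c * (t - y) ^ ?k * ?C) has_integral (fact (a c) * fact ?k / fact (a c + ?k + 1) * t ^ (a c + ?k + 1) * ?C)) {0..t}"
      by (rule has_integral_mult_left[OF has_integral_beta_nat[OF insert.prems]])
    show "0 \<le> y ^ a c * (t - y) ^ ?k * ?C" if "y \<in> {0..t}" for y
      using that C0 by (intro mult_nonneg_nonneg) auto
  qed
  also have "a c + ?k + 1 = card (insert c A) + sum a (insert c A) + b" using insert.hyps by simp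
  also have "fact (a c) * fact ?k / fact (card (insert c A) + sum a (insert c A) + b) * t ^ (card (insert c A) + sum a (insert c A) + b) * ?C
     = (\<Prod>i\<in>insert c A. fact (a i)) * fact b / fact (card (insert c A) + sum a (insert c A) + b) * t ^ (card (insert c A) + sum a (insert c A) + b)"
    using insert.hyps by (simp add: field_simps)
  finally show ?case .
qed

definition monomial :: "nat \<Rightarrow> (nat \<Rightarrow> nat) \<Rightarrow> (nat \<Rightarrow> real) \<Rightarrow> real" where
  "monomial n \<alpha> x = (\<Prod>i<n. x i ^ \<alpha> i)"

definition simplex_chart :: "nat \<Rightarrow> (nat \<Rightarrow> real) \<Rightarrow> nat \<Rightarrow> real" where
  "simplex_chart n y = (\<lambda>i\<in>{..<n}. if i < n - 1 then y i else 1 - (\<Sum>j<n-1. y j))"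

abbreviation corner_measure :: "nat \<Rightarrow> (nat \<Rightarrow> real) measure" where
  "corner_measure n \<equiv> Pi\<^sub>M {..<n-1} (\<lambda>_. lborel)"

abbreviation corner :: "nat \<Rightarrow> (nat \<Rightarrow> real) set" where
  "corner n \<equiv> {y \<in> space (corner_measure n). in_corner {..<n-1} 1 y}"

lemma simplex_measure_eq:
  "simplex_measure n = distr (uniform_measure (corner_measure n) (corner n)) (Pi\<^sub>M {..<n} (\<lambda>_. borel)) (simplex_chart n)"
  unfolding simplex_measure_def simplex_chart_def[abs_def] in_corner_def by (simp add: Ball_def)

lemma corner_sets: "corner n \<in> sets (corner_measure n)"
  using measurable_in_corner[of "{..<n-1}" 1] by (auto simp: pred_def)

lemma simplex_chart_measurable: "simplex_chart n \<in> corner_measure n \<rightarrow>\<^sub>M Pi\<^sub>M {..<n} (\<lambda>_. borel)"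
  unfolding simplex_chart_def[abs_def]
proof (rule measurable_restrict)
  fix i assume "i \<in> {..<n}"
  show "(\<lambda>y. if i < n - 1 then y i else 1 - (\<Sum>j<n-1. y j)) \<in> borel_measurable (corner_measure n)"
    by (cases "i < n - 1") auto
qed

lemma simplex_chart_measurable': "simplex_chart n \<in> uniform_measure (corner_measure n) (corner n) \<rightarrow>\<^sub>M Pi\<^sub>M {..<n} (\<lambda>_. borel)"
  using simplex_chart_measurable by (simp add: measurable_def uniform_measure_def)

lemma monomial_measurable: "monomial n \<alpha> \<in> borel_measurable (Pi\<^sub>M {..<n} (\<lambda>_. borel))"
  unfolding monomial_def[abs_def] by measurable

lemma monomial_measurable': "monomial n \<alpha> \<in> borel_measurable (simplex_measure n)"
  using monomial_measurable by (simp add: simplex_measure_eq)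

lemma monomial_chart:
  assumes "n \<ge> 1"
  shows "monomial n \<alpha> (simplex_chart n y) = (\<Prod>i<n-1. y i ^ \<alpha> i) * (1 - (\<Sum>j<n-1. y j)) ^ \<alpha> (n - 1)"
proof -
  obtain m where m: "n = Suc m" using assms by (cases n) auto
  show ?thesis unfolding monomial_def simplex_chart_def m by simp
qed

lemma sum_simplex_chart:
  assumes "n \<ge> 1"
  shows "(\<Sum>i<n. simplex_chart n y i) = 1"
proof -
  obtain m where m: "n = Suc m" using assms by (cases n) auto
  show ?thesis unfolding simplex_chart_def m by simp
qed

lemma emeasure_corner: "emeasure (corner_measure n) (corner n) = ennreal (1 / fact (n - 1))"
proof -
  have "emeasure (corner_measure n) (corner n) = (\<integral>\<^sup>+ x. indicator (corner n) x \<partial>(corner_measure n))"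
    using corner_sets[of n] by simp
  also have "\<dots> = (\<integral>\<^sup>+ x. ennreal (corner_monomial {..<n-1} (\<lambda>_. 0) 0 1 x) \<partial>(corner_measure n))"
    by (intro nn_integral_cong) (auto simp: corner_monomial_def indicator_def)
  also have "\<dots> = ennreal (1 / fact (n - 1))" by (subst nn_integral_corner_monomial) auto
  finally show ?thesis .
qed

theorem has_bochner_integral_simplex_monomial:
  assumes n: "n \<ge> 1"
  shows "has_bochner_integral (simplex_measure n) (monomial n \<alpha>)
    (fact (n - 1) * (\<Prod>i<n. fact (\<alpha> i)) / fact (n - 1 + (\<Sum>i<n. \<alpha> i)))"
proof (rule has_bochner_integral_nn_integral)
  let ?U = "uniform_measure (corner_measure n) (corner n)"
  have split: "(\<Sum>i<n. \<alpha> i) = (\<Sum>i<n-1. \<alpha> i) + \<alpha> (n - 1)" "(\<Prod>i<n. fact (\<alpha> i)) = (\<Prod>i<n-1. fact (\<alpha> i)) * (fact (\<alpha> (n - 1)) :: real)"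
    using n by (cases n; simp)+
  show "monomial n \<alpha> \<in> borel_measurable (simplex_measure n)" by (rule monomial_measurable')
  have "{x \<in> space (Pi\<^sub>M {..<n} (\<lambda>_. borel)). 0 \<le> monomial n \<alpha> x} \<in> sets (Pi\<^sub>M {..<n} (\<lambda>_. borel))"
    using monomial_measurable[of n \<alpha>] by measurable
  moreover have "AE y in ?U. 0 \<le> monomial n \<alpha> (simplex_chart n y)"
    by (rule AE_uniform_measureI[OF corner_sets])
       (auto simp: monomial_chart[OF n] in_corner_def intro!: AE_I2 mult_nonneg_nonneg prod_nonneg)
  ultimately show "AE x in simplex_measure n. 0 \<le> monomial n \<alpha> x"
    unfolding simplex_measure_eq by (subst AE_distr_iff[OF simplex_chart_measurable']) auto
  show "0 \<le> fact (n - 1) * (\<Prod>i<n. fact (\<alpha> i)) / (fact (n - 1 + (\<Sum>i<n. \<alpha> i)) :: real)"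
    by (intro divide_nonneg_nonneg mult_nonneg_nonneg prod_nonneg) auto
  have m: "(\<lambda>y. ennreal (monomial n \<alpha> (simplex_chart n y))) \<in> borel_measurable (corner_measure n)"
    using measurable_compose[OF simplex_chart_measurable monomial_measurable] by measurable
  have "(\<integral>\<^sup>+ x. ennreal (monomial n \<alpha> x) \<partial>simplex_measure n) = (\<integral>\<^sup>+ y. ennreal (monomial n \<alpha> (simplex_chart n y)) \<partial>?U)"
    unfolding simplex_measure_eq
    by (subst nn_integral_distr[OF simplex_chart_measurable']) (use monomial_measurable in auto)
  also have "\<dots> = (\<integral>\<^sup>+ y. ennreal (monomial n \<alpha> (simplex_chart n y)) * indicator (corner n) y \<partial>corner_measure n) / emeasure (corner_measure n) (corner n)"
    by (rule nn_integral_uniform_measure[OF m corner_sets])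
  also have "(\<integral>\<^sup>+ y. ennreal (monomial n \<alpha> (simplex_chart n y)) * indicator (corner n) y \<partial>corner_measure n)
     = (\<integral>\<^sup>+ y. ennreal (corner_monomial {..<n-1} \<alpha> (\<alpha> (n - 1)) 1 y) \<partial>corner_measure n)"
    by (intro nn_integral_cong) (auto simp: corner_monomial_def monomial_chart[OF n] indicator_def)
  also have "\<dots> = ennreal ((\<Prod>i<n. fact (\<alpha> i)) / fact (n - 1 + (\<Sum>i<n. \<alpha> i)))"
    by (subst nn_integral_corner_monomial) (auto simp: split add.assoc)
  also have "\<dots> / emeasure (corner_measure n) (corner n) = ennreal ((\<Prod>i<n. fact (\<alpha> i)) / fact (n - 1 + (\<Sum>i<n. \<alpha> i)) / (1 / fact (n - 1)))"
    unfolding emeasure_corner by (rule divide_ennreal) (auto intro!: divide_nonneg_nonneg prod_nonneg)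
  finally show "(\<integral>\<^sup>+ x. ennreal (monomial n \<alpha> x) \<partial>simplex_measure n) =
      ennreal (fact (n - 1) * (\<Prod>i<n. fact (\<alpha> i)) / fact (n - 1 + (\<Sum>i<n. \<alpha> i)))"
    by (simp add: field_simps)
qed

section \<open>A criterion for 3-cubature formulas\<close>

text \<open>\<open>monomial3_moment i j k\<close> is \<open>\<alpha>!\<close> for the monomial \<open>x\<^sup>\<alpha> = x i * x j * x k\<close>: the factors count how often the
  last, and then the first, variable repeats.\<close>

definition monomial3_moment :: "nat \<Rightarrow> nat \<Rightarrow> nat \<Rightarrow> real" where
  "monomial3_moment i j k = (1 + of_bool (j = k)) * (1 + of_bool (i = j) + of_bool (i = k))"

lemma monomial_Suc:
  assumes "i < n"
  shows "monomial n (\<alpha>(i := Suc (\<alpha> i))) x = x i * monomial n \<alpha> x"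
proof -
  have "monomial n \<beta> x = x i ^ \<beta> i * (\<Prod>j\<in>{..<n}-{i}. x j ^ \<beta> j)" for \<beta>
    unfolding monomial_def using assms by (intro prod.remove) auto
  moreover have "(\<Prod>j\<in>{..<n}-{i}. x j ^ (\<alpha>(i := Suc (\<alpha> i))) j) = (\<Prod>j\<in>{..<n}-{i}. x j ^ \<alpha> j)"
    by (intro prod.cong) auto
  ultimately show ?thesis by simp
qed

lemma fact_Suc_exponent:
  fixes n i :: nat and \<alpha> :: "nat \<Rightarrow> nat"
  assumes "i < n"
  shows "(\<Prod>j<n. fact ((\<alpha>(i := Suc (\<alpha> i))) j)) = (1 + real (\<alpha> i)) * (\<Prod>j<n. fact (\<alpha> j))"
proof -
  have "(\<Prod>j<n. fact (\<beta> j)) = fact (\<beta> i) * (\<Prod>j\<in>{..<n}-{i}. fact (\<beta> j) :: real)" for \<beta> :: "nat \<Rightarrow> nat"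
    using assms by (intro prod.remove) auto
  moreover have "(\<Prod>j\<in>{..<n}-{i}. fact ((\<alpha>(i := Suc (\<alpha> i))) j)) = (\<Prod>j\<in>{..<n}-{i}. fact (\<alpha> j) :: real)"
    by (intro prod.cong) auto
  ultimately show ?thesis by simp
qed

lemma sum_Suc_exponent:
  fixes n i :: nat and \<alpha> :: "nat \<Rightarrow> nat"
  assumes "i < n"
  shows "(\<Sum>j<n. (\<alpha>(i := Suc (\<alpha> i))) j) = Suc (\<Sum>j<n. \<alpha> j :: nat)"
proof -
  have "(\<Sum>j<n. \<beta> j) = \<beta> i + (\<Sum>j\<in>{..<n}-{i}. \<beta> j)" for \<beta> :: "nat \<Rightarrow> nat"
    using assms by (intro sum.remove) auto
  moreover have "(\<Sum>j\<in>{..<n}-{i}. (\<alpha>(i := Suc (\<alpha> i))) j) = (\<Sum>j\<in>{..<n}-{i}. \<alpha> j)"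
    by (intro sum.cong) auto
  ultimately show ?thesis by simp
qed

lemma exponent_decompose:
  fixes n :: nat and \<alpha> :: "nat \<Rightarrow> nat"
  assumes "(\<Sum>j<n. \<alpha> j) = Suc m"
  shows "\<exists>i<n. \<exists>\<beta>. \<alpha> = \<beta>(i := Suc (\<beta> i)) \<and> (\<Sum>j<n. \<beta> j) = m"
proof -
  obtain i where i: "i < n" "\<alpha> i > 0" using assms by (metis lessThan_iff sum.neutral nat.distinct(1) neq0_conv)
  define \<beta> where "\<beta> = \<alpha>(i := \<alpha> i - 1)"
  have "\<alpha> = \<beta>(i := Suc (\<beta> i))" using i by (auto simp: \<beta>_def)
  moreover from this have "(\<Sum>j<n. \<beta> j) = m" using sum_Suc_exponent[OF i(1), of \<beta>] assms by simp
  ultimately show ?thesis using i by blast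
qed

lemma cubic_monomial:
  fixes n :: nat and \<alpha> :: "nat \<Rightarrow> nat"
  assumes "(\<Sum>j<n. \<alpha> j) = 3"
  shows "\<exists>i<n. \<exists>j<n. \<exists>k<n. (\<forall>x. monomial n \<alpha> x = x i * x j * x k) \<and> (\<Prod>j<n. fact (\<alpha> j)) = monomial3_moment i j k"
proof -
  obtain i \<beta> where i: "i < n" "\<alpha> = \<beta>(i := Suc (\<beta> i))" "(\<Sum>j<n. \<beta> j) = Suc (Suc 0)"
    using exponent_decompose[where n = n and \<alpha> = \<alpha> and m = 2] assms by (auto simp: numeral_3_eq_3 numeral_2_eq_2)
  obtain j \<gamma> where j: "j < n" "\<beta> = \<gamma>(j := Suc (\<gamma> j))" "(\<Sum>j<n. \<gamma> j) = Suc 0"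
    using exponent_decompose[OF i(3)] by auto
  obtain k \<delta> where k: "k < n" "\<gamma> = \<delta>(k := Suc (\<delta> k))" "(\<Sum>j<n. \<delta> j) = 0"
    using exponent_decompose[OF j(3)] by auto
  have z: "\<delta> l = 0" if "l < n" for l using k(3) that by simp
  have "monomial n \<delta> x = 1" for x unfolding monomial_def using z by (intro prod.neutral) auto
  hence "monomial n \<alpha> x = x i * x j * x k" for x
    using monomial_Suc[OF i(1), of \<beta> x] monomial_Suc[OF j(1), of \<gamma> x] monomial_Suc[OF k(1), of \<delta> x] i(2) j(2) k(2) by simp
  moreover have "(\<Prod>j<n. fact (\<delta> j)) = (1::real)" using z by (intro prod.neutral) auto
  hence "(\<Prod>j<n. fact (\<alpha> j)) = monomial3_moment i j k"
    using fact_Suc_exponent[OF i(1), of \<beta>] fact_Suc_exponent[OF j(1), of \<gamma>] fact_Suc_exponent[OF k(1), of \<delta>] i(2) j(2) k(2) z[OF i(1)] z[OF j(1)] z[OF k(1)]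
    by (auto simp: monomial3_moment_def)
  ultimately show ?thesis using i(1) j(1) k(1) by blast
qed

definition formula_sum :: "formula \<Rightarrow> (real list \<Rightarrow> real) \<Rightarrow> real" where
  "formula_sum F f = (\<Sum>(w, p)\<leftarrow>F. w * f p)"

lemma formula_sum_Nil [simp]: "formula_sum [] f = 0" by (simp add: formula_sum_def)
lemma formula_sum_Cons [simp]: "formula_sum ((w, p) # F) f = w * f p + formula_sum F f" by (simp add: formula_sum_def)
lemma formula_sum_append [simp]: "formula_sum (F @ G) f = formula_sum F f + formula_sum G f" by (simp add: formula_sum_def)

lemma formula_sum_cong: "(\<And>w p. (w, p) \<in> set F \<Longrightarrow> f p = g p) \<Longrightarrow> formula_sum F f = formula_sum F g"
  unfolding formula_sum_def by (intro arg_cong[of _ _ sum_list] map_cong) auto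

lemma formula_sum_sum: "formula_sum F (\<lambda>p. \<Sum>i\<in>A. f i p) = (\<Sum>i\<in>A. formula_sum F (f i))"
  by (induction F) (auto simp: sum.distrib sum_distrib_left)

lemma formula_sum_cmult: "formula_sum F (\<lambda>p. c * f p) = c * formula_sum F f"
  by (induction F) (auto simp: algebra_simps)

text \<open>On the simplex the coordinates sum to 1, so a monomial of lower degree is a sum of cubic ones.\<close>

theorem simplex_cubature3I:
  assumes n: "n \<ge> 1"
    and pts: "\<And>w p. (w, p) \<in> set F \<Longrightarrow> length p = n \<and> sum_list p = 1"
    and cubic: "\<And>i j k. i < n \<Longrightarrow> j < n \<Longrightarrow> k < n \<Longrightarrow>
      formula_sum F (\<lambda>p. p ! i * p ! j * p ! k) = monomial3_moment i j k / (real n * (real n + 1) * (real n + 2))"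
  shows "simplex_cubature3 n F"
proof -
  have sum1: "(\<Sum>i<n. p ! i) = 1" if "(w, p) \<in> set F" for w p
    using pts[OF that] by (auto simp: sum_list_sum_nth atLeast0LessThan)
  have AE1: "AE x in simplex_measure n. (\<Sum>i<n. x i) = 1"
    unfolding simplex_measure_eq
    by (subst AE_distr_iff[OF simplex_chart_measurable']) (auto simp: sum_simplex_chart[OF n])
  have main: "integrable (simplex_measure n) (monomial n \<alpha>) \<and>
     integral\<^sup>L (simplex_measure n) (monomial n \<alpha>) = formula_sum F (\<lambda>p. monomial n \<alpha> (\<lambda>i. p ! i))"
    if "(\<Sum>i<n. \<alpha> i) + m = 3" for \<alpha> m
    using that
  proof (induction m arbitrary: \<alpha>)
    case 0
    then obtain i j k where ijk: "i < n" "j < n" "k < n" "\<And>x. monomial n \<alpha> x = x i * x j * x k"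
        "(\<Prod>j<n. fact (\<alpha> j)) = monomial3_moment i j k"
      using cubic_monomial[where n = n and \<alpha> = \<alpha>] by auto
    have "fact (n - 1 + 3) = real n * (real n + 1) * (real n + 2) * fact (n - 1)"
    proof -
      obtain m where "n = Suc m" using n by (cases n) auto
      thus ?thesis by (simp add: numeral_3_eq_3 algebra_simps)
    qed
    hence "has_bochner_integral (simplex_measure n) (monomial n \<alpha>) (monomial3_moment i j k / (real n * (real n + 1) * (real n + 2)))"
      using has_bochner_integral_simplex_monomial[OF n, of \<alpha>] 0 ijk(5) by simp
    moreover have "monomial n \<alpha> = (\<lambda>x. x i * x j * x k)" by (rule ext) (rule ijk(4))
    ultimately show ?case using cubic[OF ijk(1-3)] by (simp add: has_bochner_integral_iff)
  next
    case (Suc m)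
    have IH: "integrable (simplex_measure n) (monomial n (\<alpha>(i := Suc (\<alpha> i)))) \<and>
     integral\<^sup>L (simplex_measure n) (monomial n (\<alpha>(i := Suc (\<alpha> i)))) = formula_sum F (\<lambda>p. monomial n (\<alpha>(i := Suc (\<alpha> i))) (\<lambda>i. p ! i))"
      if "i < n" for i
      using Suc.prems sum_Suc_exponent[OF that, of \<alpha>] by (intro Suc.IH) simp
    have dec: "(\<Sum>i<n. monomial n (\<alpha>(i := Suc (\<alpha> i))) x) = (\<Sum>i<n. x i) * monomial n \<alpha> x" for x
      by (simp add: monomial_Suc sum_distrib_right)
    have AE: "AE x in simplex_measure n. monomial n \<alpha> x = (\<Sum>i<n. monomial n (\<alpha>(i := Suc (\<alpha> i))) x)"
      using AE1 by eventually_elim (simp add: dec)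
    have m: "(\<lambda>x. \<Sum>i<n. monomial n (\<alpha>(i := Suc (\<alpha> i))) x) \<in> borel_measurable (simplex_measure n)"
      by (intro borel_measurable_sum monomial_measurable')
    have int: "integrable (simplex_measure n) (\<lambda>x. \<Sum>i<n. monomial n (\<alpha>(i := Suc (\<alpha> i))) x)"
      using IH by (intro Bochner_Integration.integrable_sum) auto
    have 1: "integrable (simplex_measure n) (monomial n \<alpha>)"
      using integrable_cong_AE[OF monomial_measurable' m AE] int by simp
    have "integral\<^sup>L (simplex_measure n) (monomial n \<alpha>) = (\<Sum>i<n. integral\<^sup>L (simplex_measure n) (monomial n (\<alpha>(i := Suc (\<alpha> i)))))"
      unfolding integral_cong_AE[OF monomial_measurable' m AE]
      using IH by (intro Bochner_Integration.integral_sum) auto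
    also have "\<dots> = (\<Sum>i<n. formula_sum F (\<lambda>p. monomial n (\<alpha>(i := Suc (\<alpha> i))) (\<lambda>i. p ! i)))"
      using IH by (intro sum.cong refl) auto
    also have "\<dots> = formula_sum F (\<lambda>p. monomial n \<alpha> (\<lambda>i. p ! i))"
      unfolding formula_sum_sum[symmetric] using sum1 by (intro formula_sum_cong) (simp add: dec)
    finally show ?case using 1 by blast
  qed
  have "cubature_formula 3 n (simplex_measure n) F"
    unfolding cubature_formula_def
  proof (intro conjI allI impI)
    show "\<forall>(w, p)\<in>set F. length p = n" using pts by auto
    fix P assume "polynomial_of_degree_le n 3 P"
    then obtain A c where A: "finite A" "\<And>\<alpha>. \<alpha> \<in> A \<Longrightarrow> (\<Sum>i<n. \<alpha> i) \<le> 3" "P = (\<lambda>x. \<Sum>\<alpha>\<in>A. c \<alpha> * monomial n \<alpha> x)"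
      unfolding polynomial_of_degree_le_def monomial_def by auto
    have *: "integrable (simplex_measure n) (monomial n \<alpha>)"
      "integral\<^sup>L (simplex_measure n) (monomial n \<alpha>) = formula_sum F (\<lambda>p. monomial n \<alpha> (\<lambda>i. p ! i))" if "\<alpha> \<in> A" for \<alpha>
      using main[of \<alpha> "3 - (\<Sum>i<n. \<alpha> i)"] A(2)[OF that] by auto
    show "integrable (simplex_measure n) P"
      unfolding A(3) using * by (intro Bochner_Integration.integrable_sum integrable_mult_right) auto
    have "integral\<^sup>L (simplex_measure n) P = (\<Sum>\<alpha>\<in>A. c \<alpha> * formula_sum F (\<lambda>p. monomial n \<alpha> (\<lambda>i. p ! i)))"
      unfolding A(3) using * by (subst Bochner_Integration.integral_sum) auto
    also have "\<dots> = formula_sum F (\<lambda>p. P (\<lambda>i. p ! i))"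
      unfolding A(3) formula_sum_sum formula_sum_cmult ..
    finally show "integral\<^sup>L (simplex_measure n) P = (\<Sum>(w, p)\<leftarrow>F. w * P (\<lambda>i. p ! i))"
      by (simp add: formula_sum_def)
  qed
  thus ?thesis using pts by (auto simp: simplex_cubature3_def)
qed

section \<open>Homogeneous cubic formulas\<close>

text \<open>Scaling a point by \<open>1 / s\<close> and its weight by \<open>s\<^sup>3\<close> does not change its contribution to a cubic form.\<close>

definition cubic_moments :: "nat \<Rightarrow> formula \<Rightarrow> bool" where
  "cubic_moments n F \<longleftrightarrow> (\<forall>i<n. \<forall>j<n. \<forall>k<n. formula_sum F (\<lambda>q. q ! i * q ! j * q ! k) = monomial3_moment i j k)"

definition normalize_formula :: "nat \<Rightarrow> formula \<Rightarrow> formula" where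
  "normalize_formula n F =
    map (\<lambda>(v, q). (v * sum_list q ^ 3 / (real n * (real n + 1) * (real n + 2)), map (\<lambda>x. x / sum_list q) q)) F"

lemma sum_list_map_divide: "(\<Sum>x\<leftarrow>q. x / s) = sum_list q / (s :: real)"
  by (induction q) (auto simp: add_divide_distrib)

theorem simplex_cubature3_normalize:
  assumes n: "n \<ge> 1" and pts: "\<And>v q. (v, q) \<in> set F \<Longrightarrow> length q = n \<and> sum_list q \<noteq> 0" and F: "cubic_moments n F"
  shows "simplex_cubature3 n (normalize_formula n F)"
proof (rule simplex_cubature3I[OF n])
  show "length p = n \<and> sum_list p = 1" if "(w, p) \<in> set (normalize_formula n F)" for w p
    using that pts by (auto simp: normalize_formula_def sum_list_map_divide)
  fix i j k assume ijk: "i < n" "j < n" "k < n"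
  let ?D = "real n * (real n + 1) * (real n + 2)"
  have "formula_sum (normalize_formula n F) (\<lambda>p. p ! i * p ! j * p ! k) = formula_sum F (\<lambda>q. q ! i * q ! j * q ! k) / ?D"
    using pts
  proof (induction F)
    case (Cons a F)
    obtain v q where a: "a = (v, q)" by (cases a)
    have q: "length q = n" "sum_list q \<noteq> 0" using Cons.prems[of v q] a by auto
    have "v * sum_list q ^ 3 / ?D * (q ! i / sum_list q * (q ! j / sum_list q) * (q ! k / sum_list q)) = v * (q ! i * q ! j * q ! k) / ?D"
      using q(2) by (simp add: power3_eq_cube mult.assoc)
    moreover have "formula_sum (normalize_formula n F) (\<lambda>p. p ! i * p ! j * p ! k) = formula_sum F (\<lambda>q. q ! i * q ! j * q ! k) / ?D"
      using Cons.prems by (intro Cons.IH) auto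
    ultimately show ?case using ijk q(1) a by (simp add: normalize_formula_def add_divide_distrib)
  qed (simp add: normalize_formula_def)
  also have "\<dots> = monomial3_moment i j k / ?D" using F ijk by (simp add: cubic_moments_def)
  finally show "formula_sum (normalize_formula n F) (\<lambda>p. p ! i * p ! j * p ! k) = monomial3_moment i j k / ?D" .
qed

section \<open>The Hadamard formula\<close>

text \<open>Both sides of the double count are \<open>\<Sum>i j. (\<Sum>r. H r i * H r j)\<^sup>2\<close>; the rows give \<open>n * n\<^sup>2\<close>, which the
  diagonal \<open>i = j\<close> already accounts for.\<close>

lemma columns_orthogonal:
  fixes a :: "nat \<Rightarrow> nat \<Rightarrow> int"
  assumes pm: "\<And>r i. r < n \<Longrightarrow> i < n \<Longrightarrow> a r i \<in> {1, -1}"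
    and orth: "\<And>r s. r < n \<Longrightarrow> s < n \<Longrightarrow> r \<noteq> s \<Longrightarrow> (\<Sum>i<n. a r i * a s i) = 0"
    and ij: "i < n" "j < n"
  shows "(\<Sum>r<n. a r i * a r j) = (if i = j then int n else 0)"
proof -
  have sq: "a r i * a r i = 1" if "r < n" "i < n" for r i using pm[OF that] by auto
  define c where "c = (\<lambda>i j. \<Sum>r<n. a r i * a r j)"
  define d where "d = (\<lambda>r s. \<Sum>i<n. a r i * a s i)"
  have diag: "c i i = int n" if "i < n" for i using that sq by (simp add: c_def)
  have d: "d r s = (if r = s then int n else 0)" if "r < n" "s < n" for r s
    using that sq orth by (simp add: d_def)
  have swap: "(\<Sum>j<n. \<Sum>r<n. \<Sum>s<n. F j r s) = (\<Sum>r<n. \<Sum>s<n. \<Sum>j<n. F j r s)" for F :: "nat \<Rightarrow> nat \<Rightarrow> nat \<Rightarrow> int"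
  proof -
    have "(\<Sum>j<n. \<Sum>r<n. \<Sum>s<n. F j r s) = (\<Sum>r<n. \<Sum>j<n. \<Sum>s<n. F j r s)" by (rule sum.swap)
    also have "\<dots> = (\<Sum>r<n. \<Sum>s<n. \<Sum>j<n. F j r s)" by (rule sum.cong[OF refl], rule sum.swap)
    finally show ?thesis .
  qed
  have "(\<Sum>i<n. \<Sum>j<n. c i j * c i j) = (\<Sum>i<n. \<Sum>j<n. \<Sum>r<n. \<Sum>s<n. a r i * a r j * (a s i * a s j))"
    by (simp add: c_def sum_product)
  also have "\<dots> = (\<Sum>i<n. \<Sum>r<n. \<Sum>s<n. \<Sum>j<n. a r i * a r j * (a s i * a s j))"
    by (rule sum.cong[OF refl], rule swap)
  also have "\<dots> = (\<Sum>r<n. \<Sum>s<n. \<Sum>i<n. \<Sum>j<n. a r i * a r j * (a s i * a s j))"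
    by (rule swap)
  also have "\<dots> = (\<Sum>r<n. \<Sum>s<n. d r s * d r s)"
    by (simp add: d_def sum_product mult_ac)
  also have "\<dots> = (\<Sum>r<n. \<Sum>s<n. if r = s then int n * int n else 0)"
    using d by (intro sum.cong refl) auto
  also have "\<dots> = int n * (int n * int n)" by simp
  finally have total: "(\<Sum>i<n. \<Sum>j<n. c i j * c i j) = int n * (int n * int n)" .
  have "(\<Sum>i<n. \<Sum>j\<in>{..<n}-{i}. c i j * c i j) = (\<Sum>i<n. (\<Sum>j<n. c i j * c i j) - int n * int n)"
    using diag by (intro sum.cong refl) (simp add: sum_diff1)
  also have "\<dots> = 0" using total by (simp add: sum_subtractf)
  finally have "\<forall>i\<in>{..<n}. (\<Sum>j\<in>{..<n}-{i}. c i j * c i j) = 0"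
    by (subst (asm) sum_nonneg_eq_0_iff) (auto intro!: sum_nonneg)
  hence "(\<Sum>j\<in>{..<n}-{i}. c i j * c i j) = 0" using ij by blast
  hence "\<forall>j\<in>{..<n}-{i}. c i j * c i j = 0" by (subst (asm) sum_nonneg_eq_0_iff) auto
  hence "i \<noteq> j \<Longrightarrow> c i j = 0" using ij by auto
  thus ?thesis using diag[OF ij(1)] by (auto simp: c_def)
qed

lemma formula_sum_map: "formula_sum (map (\<lambda>i. (c, f i)) xs) g = c * (\<Sum>i\<leftarrow>xs. g (f i))"
  by (induction xs) (auto simp: algebra_simps)

lemma formula_sum_map_upt: "formula_sum (map (\<lambda>i. (c, f i)) [m..<n]) g = c * (\<Sum>i=m..<n. g (f i))"
  by (simp add: formula_sum_map interv_sum_list_conv_sum_set_nat)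

lemma formula_sum_concat: "formula_sum (concat (map h [m..<n])) g = (\<Sum>i=m..<n. formula_sum (h i) g)"
proof -
  have "formula_sum (concat (map h xs)) g = (\<Sum>i\<leftarrow>xs. formula_sum (h i) g)" for xs
    by (induction xs) auto
  thus ?thesis by (simp add: interv_sum_list_conv_sum_set_nat)
qed

lemma hadamard_entries:
  assumes "hadamard_matrix n H"
  shows "r < n \<Longrightarrow> i < n \<Longrightarrow> H $$ (r, i) \<in> {1, -1}"
    and "r < n \<Longrightarrow> s < n \<Longrightarrow> r \<noteq> s \<Longrightarrow> (\<Sum>i<n. H $$ (r, i) * H $$ (s, i)) = 0"
proof -
  show "r < n \<Longrightarrow> i < n \<Longrightarrow> H $$ (r, i) \<in> {1, -1}" using assms unfolding hadamard_matrix_def by blast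
  assume rs: "r < n" "s < n" "r \<noteq> s"
  have "dim_row H = n" "dim_col H = n" using assms by (auto simp: hadamard_matrix_def)
  hence "scalar_prod (row H r) (row H s) = (\<Sum>i<n. H $$ (r, i) * H $$ (s, i))"
    using rs by (auto simp: scalar_prod_def atLeast0LessThan intro!: sum.cong)
  thus "(\<Sum>i<n. H $$ (r, i) * H $$ (s, i)) = 0" using assms rs unfolding hadamard_matrix_def by simp
qed

text \<open>Multiplying each column by its entry in row 0 makes that row constant; in products of
  two rows the new signs occur squared.\<close>

lemma normalized_exists:
  assumes "hadamard_matrix n H" "n \<ge> 1"
  shows "\<exists>H. normalized_hadamard n H"
proof -
  define G where "G = mat n n (\<lambda>(i, j). H $$ (0, j) * H $$ (i, j))"
  note e = hadamard_entries[OF assms(1)]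
  have sq: "H $$ (i, j) * H $$ (i, j) = 1" if "i < n" "j < n" for i j using e(1)[OF that] by auto
  have "scalar_prod (row G i) (row G j) = 0" if "i < n" "j < n" "i \<noteq> j" for i j
  proof -
    have "scalar_prod (row G i) (row G j) = (\<Sum>k<n. (H $$ (0, k) * H $$ (0, k)) * (H $$ (i, k) * H $$ (j, k)))"
      using that by (auto simp: scalar_prod_def G_def atLeast0LessThan mult_ac intro!: sum.cong)
    also have "\<dots> = (\<Sum>k<n. H $$ (i, k) * H $$ (j, k))"
      using sq assms(2) by (intro sum.cong refl) auto
    finally show ?thesis using e(2)[OF that] by simp
  qed
  moreover have "H $$ (0, j) * H $$ (i, j) \<in> {1, -1}" if "i < n" "j < n" for i j
    using e(1)[of 0 j] e(1)[OF that] assms(2) that by auto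
  ultimately have "normalized_hadamard n G"
    using sq assms(2) by (auto simp: normalized_hadamard_def hadamard_matrix_def G_def)
  thus ?thesis by blast
qed

text \<open>The second sum is what a strength 3 orthogonal array, that is the rows of \<open>H\<close> and of \<open>-H\<close>, sees of three
  columns.\<close>

lemma sum_equal_entries:
  assumes H: "hadamard_matrix l H" and ijk: "i < l" "j < l" "k < l"
  shows "(\<Sum>r<l. \<Sum>e\<leftarrow>[1, -1]. of_bool (H $$ (r, i) = e \<and> H $$ (r, j) = e \<and> H $$ (r, k) = e) :: real)
     = real l / 4 * (1 + of_bool (i = j) + of_bool (j = k) + of_bool (i = k))"
proof -
  note e = hadamard_entries[OF H]
  have col: "(\<Sum>r<l. real_of_int (H $$ (r, i)) * of_int (H $$ (r, j))) = real l * of_bool (i = j)" if "i < l" "j < l" for i j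
  proof -
    have "(\<Sum>r<l. real_of_int (H $$ (r, i)) * of_int (H $$ (r, j))) = of_int (\<Sum>r<l. H $$ (r, i) * H $$ (r, j))" by simp
    also have "(\<Sum>r<l. H $$ (r, i) * H $$ (r, j)) = (if i = j then int l else 0)"
      by (rule columns_orthogonal[where a = "\<lambda>r i. H $$ (r, i)"]) (use e that in auto)
    finally show ?thesis by simp
  qed
  have "(\<Sum>r<l. \<Sum>e\<leftarrow>[1, -1]. of_bool (H $$ (r, i) = e \<and> H $$ (r, j) = e \<and> H $$ (r, k) = e) :: real)
     = (\<Sum>r<l. (1 + of_int (H $$ (r, i)) * of_int (H $$ (r, j)) + of_int (H $$ (r, j)) * of_int (H $$ (r, k)) + of_int (H $$ (r, i)) * of_int (H $$ (r, k))) / 4)"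
  proof (rule sum.cong[OF refl])
    fix r assume "r \<in> {..<l}"
    hence "H $$ (r, i) \<in> {1, -1}" "H $$ (r, j) \<in> {1, -1}" "H $$ (r, k) \<in> {1, -1}" using e(1) ijk by auto
    thus "(\<Sum>e\<leftarrow>[1, -1]. of_bool (H $$ (r, i) = e \<and> H $$ (r, j) = e \<and> H $$ (r, k) = e) :: real)
      = (1 + of_int (H $$ (r, i)) * of_int (H $$ (r, j)) + of_int (H $$ (r, j)) * of_int (H $$ (r, k)) + of_int (H $$ (r, i)) * of_int (H $$ (r, k))) / 4"
      by auto
  qed
  also have "\<dots> = real l / 4 * (1 + of_bool (i = j) + of_bool (j = k) + of_bool (i = k))"
    using ijk by (simp add: sum.distrib col algebra_simps flip: sum_divide_distrib)
  finally show ?thesis .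
qed

lemma monomial3_moment_eq:
  "monomial3_moment i j k = 1 + of_bool (i = j) + of_bool (j = k) + of_bool (i = k) + 2 * of_bool (i = j \<and> j = k)"
  by (auto simp: monomial3_moment_def)

text \<open>The centre is row 0 in disguise. That row would contribute an empty block and the point
  with all coordinates \<open>2 / l\<close>, which is twice the centre; trading it for the centre
  multiplies the weight by 8 and yields exactly the stated weight. The sum over all rows is then
  given by \<open>sum_equal_entries\<close>.\<close>

lemma hadamard_formula_moments:
  assumes H: "normalized_hadamard l H" and l: "l \<ge> 1" and ijk: "i < l" "j < l" "k < l"
  shows "formula_sum (hadamard_formula l H) (\<lambda>p. p ! i * p ! j * p ! k) = monomial3_moment i j k / (real l * (real l + 1) * (real l + 2))"
proof -
  have hm: "hadamard_matrix l H" and row0: "\<And>j. j < l \<Longrightarrow> H $$ (0, j) = 1" using H by (auto simp: normalized_hadamard_def)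
  let ?D = "real l * (real l + 1) * (real l + 2)"
  let ?g = "\<lambda>p :: real list. p ! i * p ! j * p ! k"
  let ?b = "\<lambda>r e. of_bool (H $$ (r, i) = e \<and> H $$ (r, j) = e \<and> H $$ (r, k) = e) :: real"
  have v: "?g (vertex l r) = of_bool (i = r \<and> j = r \<and> k = r)" for r
    using ijk by (auto simp: vertex_def)
  have bp: "?g (block_point l H r e) = (2 / real l) ^ 3 * ?b r e" for r e
    using ijk by (auto simp: block_point_def power3_eq_cube)
  have V: "(\<Sum>r=0..<l. ?g (vertex l r)) = of_bool (i = j \<and> j = k)"
  proof -
    have "(\<Sum>r=0..<l. ?g (vertex l r)) = (\<Sum>r=0..<l. if r = i then of_bool (i = j \<and> j = k) else 0)"
      unfolding v by (intro sum.cong refl) auto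
    thus ?thesis using ijk by simp
  qed
  have "(\<Sum>r<l. \<Sum>e\<leftarrow>[1, -1]. ?b r e) = 1 + (\<Sum>r=1..<l. \<Sum>e\<leftarrow>[1, -1]. ?b r e)"
  proof -
    have "{..<l} = insert 0 {1..<l}" using l by auto
    thus ?thesis using row0 ijk by simp
  qed
  hence B: "(\<Sum>r=1..<l. \<Sum>e\<leftarrow>[1, -1]. ?b r e) = real l / 4 * (1 + of_bool (i = j) + of_bool (j = k) + of_bool (i = k)) - 1"
    using sum_equal_entries[OF hm ijk] by simp
  have "formula_sum (hadamard_formula l H) ?g = 2 / ?D * of_bool (i = j \<and> j = k)
      + (\<Sum>r=1..<l. real l / (2 * (real l + 1) * (real l + 2)) * (\<Sum>e\<leftarrow>[1, -1]. (2 / real l) ^ 3 * ?b r e))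
      + 4 * real l / ((real l + 1) * (real l + 2)) * (1 / real l) ^ 3"
    unfolding hadamard_formula_def using ijk
    by (simp only: formula_sum_append formula_sum_map_upt formula_sum_concat V)
       (simp only: formula_sum_map bp, simp add: power3_eq_cube)
  also have "(\<Sum>r=1..<l. real l / (2 * (real l + 1) * (real l + 2)) * (\<Sum>e\<leftarrow>[1, -1]. (2 / real l) ^ 3 * ?b r e))
      = real l / (2 * (real l + 1) * (real l + 2)) * (2 / real l) ^ 3 * (\<Sum>r=1..<l. \<Sum>e\<leftarrow>[1, -1]. ?b r e)"
    by (simp add: sum_distrib_left algebra_simps)
  also have "2 / ?D * of_bool (i = j \<and> j = k)
      + real l / (2 * (real l + 1) * (real l + 2)) * (2 / real l) ^ 3 * (\<Sum>r=1..<l. \<Sum>e\<leftarrow>[1, -1]. ?b r e)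
      + 4 * real l / ((real l + 1) * (real l + 2)) * (1 / real l) ^ 3 = monomial3_moment i j k / ?D"
  proof -
    define X where "X = real l"
    have X: "X > 0" using l by (simp add: X_def)
    have "2 / (X * (X + 1) * (X + 2)) * a + X / (2 * (X + 1) * (X + 2)) * (2 / X) ^ 3 * (X / 4 * b - 1) + 4 * X / ((X + 1) * (X + 2)) * (1 / X) ^ 3
       = (b + 2 * a) / (X * (X + 1) * (X + 2))" for a b :: real
      using X by (simp add: divide_simps power3_eq_cube) (simp add: algebra_simps)
    thus ?thesis unfolding B monomial3_moment_eq X_def by simp
  qed
  finally show ?thesis .
qed

text \<open>Orthogonality to the constant row 0 makes the entries of every other row sum to
  0.\<close>

lemma hadamard_row_count:
  assumes H: "normalized_hadamard l H" and r: "1 \<le> r" "r < l" and e: "e \<in> {1, -1}"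
  shows "2 * card {j. j < l \<and> H $$ (r, j) = e} = l"
proof -
  have hm: "hadamard_matrix l H" and row0: "\<And>j. j < l \<Longrightarrow> H $$ (0, j) = 1" using H by (auto simp: normalized_hadamard_def)
  have "(\<Sum>j<l. H $$ (0, j) * H $$ (r, j)) = 0" using r by (intro hadamard_entries[OF hm]) auto
  hence z: "(\<Sum>j<l. H $$ (r, j)) = 0" using row0 by simp
  have "(\<Sum>j<l. 2 * of_bool (H $$ (r, j) = e)) = (\<Sum>j<l. 1 + e * H $$ (r, j))"
  proof (rule sum.cong[OF refl])
    fix j assume "j \<in> {..<l}"
    hence "H $$ (r, j) \<in> {1, -1}" using r by (intro hadamard_entries[OF hm]) auto
    thus "2 * of_bool (H $$ (r, j) = e) = 1 + e * H $$ (r, j)" using e by auto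
  qed
  also have "\<dots> = int l" using z by (simp add: sum.distrib flip: sum_distrib_left)
  also have "(\<Sum>j<l. 2 * of_bool (H $$ (r, j) = e)) = int (2 * card {j. j < l \<and> H $$ (r, j) = e})"
    by (simp add: sum.If_cases of_bool_def Int_def flip: sum_distrib_left)
  finally show ?thesis by linarith
qed

lemma sum_list_block_point: "sum_list (block_point l H r e) = 2 / real l * card {j. j < l \<and> H $$ (r, j) = e}"
proof -
  have "sum_list (block_point l H r e) = (\<Sum>j=0..<l. if H $$ (r, j) = e then 2 / real l else 0)"
    by (simp add: block_point_def interv_sum_list_conv_sum_set_nat)
  also have "\<dots> = (\<Sum>j\<in>{0..<l} \<inter> {j. H $$ (r, j) = e}. 2 / real l)" by (simp add: sum.If_cases)
  also have "{0..<l} \<inter> {j. H $$ (r, j) = e} = {j. j < l \<and> H $$ (r, j) = e}" by auto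
  finally show ?thesis by simp
qed

lemma hadamard_formula_cases:
  assumes "(w, p) \<in> set (hadamard_formula l H)" "l \<ge> 1"
  obtains i where "i < l" "w = 2 / (real l * (real l + 1) * (real l + 2))" "p = vertex l i"
  | r e where "1 \<le> r" "r < l" "e \<in> {1, -1}" "w = real l / (2 * (real l + 1) * (real l + 2))" "p = block_point l H r e"
  | "w = 4 * real l / ((real l + 1) * (real l + 2))" "p = replicate l (1 / real l)"
proof -
  consider "(w, p) \<in> set (map (\<lambda>i. (2 / (real l * (real l + 1) * (real l + 2)), vertex l i)) [0..<l])"
    | "(w, p) \<in> set (concat (map (\<lambda>i. map (\<lambda>e. (real l / (2 * (real l + 1) * (real l + 2)), block_point l H i e)) [1, -1]) [1..<l]))"
    | "(w, p) = (4 * real l / ((real l + 1) * (real l + 2)), replicate l (1 / real l))"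
    using assms unfolding hadamard_formula_def by (simp only: set_append Un_iff list.set insert_iff empty_iff) blast
  thus thesis
  proof cases
    case 1
    thus thesis using that(1) by auto
  next
    case 2
    then obtain r where r: "r \<in> set [1..<l]" "(w, p) \<in> set (map (\<lambda>e. (real l / (2 * (real l + 1) * (real l + 2)), block_point l H r e)) [1, -1])"
      unfolding set_concat by (subst (asm) set_map) blast
    then obtain e where "e \<in> {1, -1}" "w = real l / (2 * (real l + 1) * (real l + 2))" "p = block_point l H r e"
      by (simp only: set_map list.set image_iff prod.inject) blast
    thus thesis using that(2)[of r e] r(1) by simp
  next
    case 3
    thus thesis using that(3) by simp
  qed
qed

lemma hadamard_formula_points:
  assumes H: "normalized_hadamard l H" and l: "l \<ge> 1" and wp: "(w, p) \<in> set (hadamard_formula l H)"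
  shows "w > 0 \<and> length p = l \<and> (\<forall>x\<in>set p. x \<ge> 0) \<and> sum_list p = 1"
  using wp l
proof (cases rule: hadamard_formula_cases)
  case (1 i)
  have "sum_list (vertex l i) = (\<Sum>j=0..<l. if j = i then 1 else 0)"
    unfolding vertex_def by (subst interv_sum_list_conv_sum_set_nat) simp
  thus ?thesis using 1 l by (auto simp: vertex_def)
next
  case (2 r e)
  have "2 * real (card {j. j < l \<and> H $$ (r, j) = e}) = real l"
    using hadamard_row_count[OF H 2(1,2,3)] by (metis of_nat_mult of_nat_numeral)
  hence "sum_list p = 1" using l 2 by (simp add: sum_list_block_point field_simps)
  thus ?thesis using 2 l by (auto simp: block_point_def)
next
  case 3
  thus ?thesis using l by (auto simp: sum_list_replicate)
qed

theorem simplex_cubature3_hadamard: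
  assumes "normalized_hadamard n H" "n \<ge> 1"
  shows "simplex_cubature3 n (hadamard_formula n H)"
  using assms hadamard_formula_moments[OF assms] hadamard_formula_points[OF assms]
  by (intro simplex_cubature3I) auto

lemma length_hadamard_formula: "n \<ge> 1 \<Longrightarrow> length (hadamard_formula n H) = 3 * n - 1"
  by (simp add: hadamard_formula_def length_concat o_def sum_list_triv)

lemma positive_hadamard_formula:
  assumes "normalized_hadamard n H" "n \<ge> 1" shows "positive_formula (hadamard_formula n H)"
  using hadamard_formula_points[OF assms] by (auto simp: positive_formula_def)

lemma boundary_hadamard_formula:
  assumes "normalized_hadamard n H" "n \<ge> 2" shows "boundary_formula (hadamard_formula n H)"
proof -
  have "(2 / (real n * (real n + 1) * (real n + 2)), vertex n 0) \<in> set (hadamard_formula n H)"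
    using assms by (auto simp: hadamard_formula_def)
  moreover have "0 \<in> set (vertex n 0)" using assms(2) by (auto simp: vertex_def intro!: image_eqI[of _ _ 1])
  ultimately show ?thesis using hadamard_formula_points[OF assms(1)] assms(2)
    by (force simp: boundary_formula_def in_simplex_def)
qed

section \<open>Projection\<close>

lemma project_formula_eq:
  "project_formula l n F = normalize_formula n (map (\<lambda>(w, p). (w * (real l * (real l + 1) * (real l + 2)), take n p))
     (filter (\<lambda>(w, p). \<exists>x\<in>set (take n p). x \<noteq> 0) F))"
  by (auto simp: project_formula_def normalize_formula_def Let_def)

lemma sum_list_pos: "(\<And>x. x \<in> set q \<Longrightarrow> x \<ge> 0) \<Longrightarrow> \<exists>x\<in>set q. x \<noteq> 0 \<Longrightarrow> sum_list q > (0::real)"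
  by (metis order_less_le sum_list_nonneg sum_list_nonneg_eq_0_iff)

text \<open>The moments with indices below \<open>n\<close> do not see the dropped coordinates, and
  a discarded point contributes 0 to them. Once the factor \<open>l (l + 1) (l + 2)\<close> is
  cleared, the required values do not depend on the dimension.\<close>

lemma cubic_moments_project:
  assumes n: "n \<le> l" and len: "\<And>w p. (w, p) \<in> set F \<Longrightarrow> length p = l"
    and F: "\<And>i j k. i < l \<Longrightarrow> j < l \<Longrightarrow> k < l \<Longrightarrow>
       formula_sum F (\<lambda>p. p ! i * p ! j * p ! k) = monomial3_moment i j k / (real l * (real l + 1) * (real l + 2))"
  shows "cubic_moments n (map (\<lambda>(w, p). (w * (real l * (real l + 1) * (real l + 2)), take n p))
     (filter (\<lambda>(w, p). \<exists>x\<in>set (take n p). x \<noteq> 0) F))"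
  unfolding cubic_moments_def
proof (intro allI impI)
  fix i j k assume ijk: "i < n" "j < n" "k < n"
  let ?D = "real l * (real l + 1) * (real l + 2)"
  have "formula_sum (map (\<lambda>(w, p). (w * ?D, take n p)) (filter (\<lambda>(w, p). \<exists>x\<in>set (take n p). x \<noteq> 0) F)) (\<lambda>q. q ! i * q ! j * q ! k)
     = formula_sum F (\<lambda>p. p ! i * p ! j * p ! k) * ?D"
    using len
  proof (induction F)
    case (Cons a F)
    obtain w p where a: "a = (w, p)" by (cases a)
    have p: "length p = l" using Cons.prems[of w p] a by auto
    have IH: "formula_sum (map (\<lambda>(w, p). (w * ?D, take n p)) (filter (\<lambda>(w, p). \<exists>x\<in>set (take n p). x \<noteq> 0) F)) (\<lambda>q. q ! i * q ! j * q ! k)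
     = formula_sum F (\<lambda>p. p ! i * p ! j * p ! k) * ?D" using Cons.prems by (intro Cons.IH) auto
    show ?case
    proof (cases "\<exists>x\<in>set (take n p). x \<noteq> 0")
      case True
      thus ?thesis using IH ijk a by (simp add: algebra_simps)
    next
      case False
      have "p ! i \<in> set (take n p)" using ijk p n by (auto simp: in_set_conv_nth intro!: exI[of _ i])
      hence "p ! i = 0" using False by blast
      thus ?thesis using IH False a by simp
    qed
  qed simp
  also have "\<dots> = monomial3_moment i j k"
  proof -
    have "?D \<noteq> 0" using ijk n by simp
    thus ?thesis using F[of i j k] ijk n by simp
  qed
  finally show "formula_sum (map (\<lambda>(w, p). (w * ?D, take n p)) (filter (\<lambda>(w, p). \<exists>x\<in>set (take n p). x \<noteq> 0) F)) (\<lambda>q. q ! i * q ! j * q ! k) = monomial3_moment i j k" .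
qed

context
  fixes n l :: nat and H :: "int mat"
  assumes n: "n \<ge> 1" and nl: "n \<le> l" and H: "normalized_hadamard l H"
begin

lemma l1: "l \<ge> 1" using n nl by simp

lemma project_filter_points:
  assumes "(w, p) \<in> set (filter (\<lambda>(w, p). \<exists>x\<in>set (take n p). x \<noteq> 0) (hadamard_formula l H))"
  shows "w > 0 \<and> length (take n p) = n \<and> (\<forall>x\<in>set (take n p). x \<ge> 0) \<and> sum_list (take n p) > 0"
proof -
  have "w > 0" "length p = l" "\<forall>x\<in>set p. x \<ge> 0" "\<exists>x\<in>set (take n p). x \<noteq> 0"
    using hadamard_formula_points[OF H l1, of w p] assms by auto
  moreover from this have "\<forall>x\<in>set (take n p). x \<ge> 0" by (meson in_set_takeD)
  ultimately show ?thesis using nl sum_list_pos[of "take n p"] by auto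
qed

theorem simplex_cubature3_project: "simplex_cubature3 n (project_formula l n (hadamard_formula l H))"
  unfolding project_formula_eq
proof (rule simplex_cubature3_normalize[OF n])
  show "cubic_moments n (map (\<lambda>(w, p). (w * (real l * (real l + 1) * (real l + 2)), take n p))
     (filter (\<lambda>(w, p). \<exists>x\<in>set (take n p). x \<noteq> 0) (hadamard_formula l H)))"
    using hadamard_formula_points[OF H l1] hadamard_formula_moments[OF H l1] nl by (intro cubic_moments_project) auto
qed (use project_filter_points in fastforce)

lemma project_points:
  assumes "(v, q) \<in> set (project_formula l n (hadamard_formula l H))"
  shows "v > 0 \<and> in_simplex q"
proof -
  obtain w p where wp: "(w, p) \<in> set (filter (\<lambda>(w, p). \<exists>x\<in>set (take n p). x \<noteq> 0) (hadamard_formula l H))"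
    "v = w * (real l * (real l + 1) * (real l + 2)) * sum_list (take n p) ^ 3 / (real n * (real n + 1) * (real n + 2))"
    "q = map (\<lambda>x. x / sum_list (take n p)) (take n p)"
    using assms unfolding project_formula_eq normalize_formula_def by auto
  note pp = project_filter_points[OF wp(1)]
  have "v > 0" unfolding wp(2) using pp n l1 by (intro divide_pos_pos mult_pos_pos zero_less_power) auto
  moreover have "in_simplex q" unfolding in_simplex_def wp(3) using pp by (auto simp: sum_list_map_divide)
  ultimately show ?thesis ..
qed

lemma positive_project: "positive_formula (project_formula l n (hadamard_formula l H))"
  using project_points by (auto simp: positive_formula_def)

lemma take_vertex: "take n (vertex l i) = vertex n i"
  using nl by (simp add: vertex_def take_map)

lemma sum_vertex: "i < n \<Longrightarrow> sum_list (vertex n i) = 1"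
  unfolding vertex_def by (subst interv_sum_list_conv_sum_set_nat) simp

lemma boundary_project:
  assumes n2: "n \<ge> 2" shows "boundary_formula (project_formula l n (hadamard_formula l H))"
proof -
  define w where "w = 2 / (real l * (real l + 1) * (real l + 2))"
  have "(w, vertex l 0) \<in> set (hadamard_formula l H)"
    using l1 by (auto simp: hadamard_formula_def w_def)
  moreover have "1 \<in> set (vertex n 0)" "0 \<in> set (vertex n 0)" using n2 by (auto simp: vertex_def intro!: image_eqI[of _ _ 1])
  moreover from this(1) have "\<exists>x\<in>set (vertex n 0). x \<noteq> 0" by force
  ultimately have "(w, vertex l 0) \<in> set (filter (\<lambda>(w, p). \<exists>x\<in>set (take n p). x \<noteq> 0) (hadamard_formula l H))"
    by (simp add: take_vertex)
  hence "\<exists>v. (v, vertex n 0) \<in> set (project_formula l n (hadamard_formula l H))"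
    unfolding project_formula_eq normalize_formula_def using sum_vertex[of 0] n2
    by (force simp: take_vertex image_iff)
  thus ?thesis using \<open>0 \<in> set (vertex n 0)\<close> project_points by (force simp: boundary_formula_def)
qed

lemma length_project:
  "length (project_formula l n (hadamard_formula l H)) = n + 1 +
     (\<Sum>r=1..<l. of_bool (\<exists>j<n. H $$ (r, j) = 1) + of_bool (\<exists>j<n. H $$ (r, j) = -1))"
proof -
  define P where "P = (\<lambda>(w :: real, p :: real list). \<exists>x\<in>set (take n p). x \<noteq> 0)"
  have ex: "(\<exists>x\<in>set (map f [0..<n]). x \<noteq> 0) \<longleftrightarrow> (\<exists>j<n. f j \<noteq> 0)" for f :: "nat \<Rightarrow> real"
    by (auto simp: Bex_def)
  have bp: "(\<exists>x\<in>set (take n (block_point l H r e)). x \<noteq> 0) \<longleftrightarrow> (\<exists>j<n. H $$ (r, j) = e)" for r e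
  proof -
    have "take n (block_point l H r e) = map (\<lambda>j. if H $$ (r, j) = e then 2 / real l else 0) [0..<n]"
      using nl by (simp add: block_point_def take_map)
    hence "(\<exists>x\<in>set (take n (block_point l H r e)). x \<noteq> 0) \<longleftrightarrow> (\<exists>j<n. (if H $$ (r, j) = e then 2 / real l else 0) \<noteq> 0)"
      by (simp only: ex)
    also have "\<dots> \<longleftrightarrow> (\<exists>j<n. H $$ (r, j) = e)" using l1 by auto
    finally show ?thesis .
  qed
  have vx: "(\<exists>x\<in>set (take n (vertex l i)). x \<noteq> 0) \<longleftrightarrow> i < n" for i
    unfolding take_vertex unfolding vertex_def ex by auto
  have len_concat: "length (filter P (concat (map h [a..<b]))) = (\<Sum>i=a..<b. length (filter P (h i)))" for h a b
  proof -
    have "length (filter P (concat (map h xs))) = (\<Sum>i\<leftarrow>xs. length (filter P (h i)))" for xs by (induction xs) auto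
    thus ?thesis by (simp add: interv_sum_list_conv_sum_set_nat)
  qed
  have "length (filter P (map (\<lambda>i. (w, vertex l i)) [0..<l])) = n" for w
  proof -
    have "length (filter P (map (\<lambda>i. (w, vertex l i)) [0..<l])) = length (filter (\<lambda>i. i < n) [0..<l])"
      by (simp add: filter_map o_def P_def vx)
    also have "\<dots> = n"
    proof -
      have "filter (\<lambda>i. i < n) [n..<l] = []" by (simp add: filter_empty_conv)
      moreover have "filter (\<lambda>i. i < n) [0..<n] = [0..<n]" by (simp add: filter_id_conv)
      moreover have "[0..<l] = [0..<n] @ [n..<l]" using nl by (metis le_add_diff_inverse upt_add_eq_append zero_le)
      ultimately show ?thesis by (simp only: filter_append) simp
    qed
    finally show ?thesis .
  qed
  moreover have "filter P [(w, replicate l (1 / real l))] = [(w, replicate l (1 / real l))]" for w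
    using n nl by (simp add: P_def)
  moreover have "length (filter P (map (\<lambda>e. (w, block_point l H r e)) [1, -1])) = of_bool (\<exists>j<n. H $$ (r, j) = 1) + of_bool (\<exists>j<n. H $$ (r, j) = -1)" for w r
    by (simp add: P_def bp)
  ultimately show ?thesis
    unfolding project_formula_def P_def[symmetric] hadamard_formula_def
    by (simp only: length_map filter_append length_append len_concat) simp
qed

lemma length_project_le: "length (project_formula l n (hadamard_formula l H)) \<le> n + 2 * l - 1"
proof -
  have "(\<Sum>r=1..<l. of_bool (\<exists>j<n. H $$ (r, j) = 1) + of_bool (\<exists>j<n. H $$ (r, j) = -1)) \<le> (\<Sum>r=1..<l. 2 :: nat)"
    by (intro sum_mono) auto
  thus ?thesis unfolding length_project using l1 by simp
qed

text \<open>One of the two blocks of each row contains column 0. This crude count serves the case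
  \<open>2 * n \<le> l\<close>, where a block may miss the first \<open>n\<close> columns; it still
  gives at least \<open>3 * n\<close> points.\<close>

lemma length_project_ge: "n + l \<le> length (project_formula l n (hadamard_formula l H))"
proof -
  have "(\<Sum>r=1..<l. 1 :: nat) \<le> (\<Sum>r=1..<l. of_bool (\<exists>j<n. H $$ (r, j) = 1) + of_bool (\<exists>j<n. H $$ (r, j) = -1))"
  proof (rule sum_mono)
    fix r assume "r \<in> {1..<l}"
    hence "H $$ (r, 0) \<in> {1, -1}"
      using H l1 by (intro hadamard_entries) (auto simp: normalized_hadamard_def)
    hence "H $$ (r, 0) = 1 \<or> H $$ (r, 0) = -1" by blast
    moreover have "0 < n" using n by simp
    ultimately have "(\<exists>j<n. H $$ (r, j) = 1) \<or> (\<exists>j<n. H $$ (r, j) = -1)" by blast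
    thus "1 \<le> of_bool (\<exists>j<n. H $$ (r, j) = 1) + (of_bool (\<exists>j<n. H $$ (r, j) = -1) :: nat)" by auto
  qed
  thus ?thesis unfolding length_project using l1 by simp
qed

text \<open>If a block missed the first \<open>n\<close> columns, its complement, of size
  \<open>l / 2 < n\<close>, would contain all of them. So no point is lost except vertices.\<close>

lemma length_project_eq:
  assumes "l < 2 * n"
  shows "length (project_formula l n (hadamard_formula l H)) = n + 2 * l - 1"
proof -
  have hm: "hadamard_matrix l H" using H by (simp add: normalized_hadamard_def)
  have ex: "\<exists>j<n. H $$ (r, j) = e" if r: "1 \<le> r" "r < l" and e: "e \<in> {1, -1}" for r e
  proof (rule ccontr)
    assume no: "\<not> ?thesis"
    have "{..<n} \<subseteq> {j. j < l \<and> H $$ (r, j) = -e}"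
    proof
      fix j assume j: "j \<in> {..<n}"
      hence "H $$ (r, j) \<in> {1, -1}" using nl by (intro hadamard_entries(1)[OF hm r(2)]) auto
      moreover have "H $$ (r, j) \<noteq> e" using no j by auto
      ultimately show "j \<in> {j. j < l \<and> H $$ (r, j) = -e}" using e j nl by auto
    qed
    hence "n \<le> card {j. j < l \<and> H $$ (r, j) = -e}" using card_mono[of "{j. j < l \<and> H $$ (r, j) = -e}" "{..<n}"] by simp
    moreover have "2 * card {j. j < l \<and> H $$ (r, j) = -e} = l" using e by (intro hadamard_row_count[OF H r]) auto
    ultimately show False using assms by linarith
  qed
  have "(\<Sum>r=1..<l. of_bool (\<exists>j<n. H $$ (r, j) = 1) + of_bool (\<exists>j<n. H $$ (r, j) = -1)) = (\<Sum>r=1..<l. 2 :: nat)"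
    using ex by (intro sum.cong refl) auto
  thus ?thesis unfolding length_project using l1 by simp
qed

end

section \<open>A compiler for expressions\<close>

datatype exp = Var int | Lit int | Op aop exp exp

fun ev :: "exp \<Rightarrow> (int \<Rightarrow> int) \<Rightarrow> int" where
  "ev (Var i) s = s i"
| "ev (Lit x) s = x"
| "ev (Op f a b) s = aval f (ev a s) (ev b s)"

fun esize :: "exp \<Rightarrow> nat" where
  "esize (Var i) = 1"
| "esize (Lit x) = 1"
| "esize (Op f a b) = esize a + esize b + 1"

fun ok_exp :: "exp \<Rightarrow> bool" where
  "ok_exp (Var i) = (0 \<le> i \<and> i < 100)"
| "ok_exp (Lit x) = (\<bar>x\<bar> \<le> 100)"
| "ok_exp (Op f a b) = (ok_exp a \<and> ok_exp b)"

text \<open>The instruction set has no register copy, so a variable is fetched by adding it to 0.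
  Intermediate results are stacked in the registers from \<open>k\<close> upwards.\<close>

fun compile :: "exp \<Rightarrow> int \<Rightarrow> com" where
  "compile (Var i) k = Seq (Const k 0) (Arith k Add i k)"
| "compile (Lit x) k = Const k x"
| "compile (Op f a b) k = Seq (compile a k) (Seq (compile b (k + 1)) (Arith k f k (k + 1)))"

definition assign :: "int \<Rightarrow> exp \<Rightarrow> com" where
  "assign x e = Seq (compile e 100) (Seq (Const 101 0) (Arith x Add 100 101))"

text \<open>Registers below 100 hold variables.  \<open>reg_degree\<close> bounds the contents of a register by a power
  of the parameter \<open>N0\<close>, and \<open>degree_bound\<close> extends this to expressions, so that no instruction
  touches an integer beyond \<open>N0 ^ 100\<close>.\<close>

abbreviation (input) "rN \<equiv> 0 :: int"
abbreviation (input) "rL \<equiv> 1 :: int"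
abbreviation (input) "rM \<equiv> 2 :: int"
abbreviation (input) "rQ \<equiv> 3 :: int"
abbreviation (input) "rD \<equiv> 4 :: int"
abbreviation (input) "rW \<equiv> 5 :: int"
abbreviation (input) "rLo \<equiv> 6 :: int"
abbreviation (input) "rHi \<equiv> 7 :: int"
abbreviation (input) "rKind \<equiv> 8 :: int"
abbreviation (input) "rIdx \<equiv> 9 :: int"
abbreviation (input) "rFlip \<equiv> 10 :: int"
abbreviation (input) "rS \<equiv> 11 :: int"
abbreviation (input) "rJ \<equiv> 12 :: int"
abbreviation (input) "rX \<equiv> 13 :: int"
abbreviation (input) "rU \<equiv> 14 :: int"
abbreviation (input) "rV \<equiv> 15 :: int"
abbreviation (input) "rT \<equiv> 16 :: int"
abbreviation (input) "rP \<equiv> 17 :: int"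
abbreviation (input) "rI \<equiv> 18 :: int"
abbreviation (input) "rA \<equiv> 19 :: int"
abbreviation (input) "rB \<equiv> 20 :: int"
abbreviation (input) "rC \<equiv> 21 :: int"

text \<open>Degree 4 is for the levels and the coordinates, 5 for a sum of \<open>n\<close>
  coordinates, 15 for the common denominator, 20 for the weights. A weight times the cube of a
  coordinate sum has degree \<open>20 + 3 * 5\<close>, within the 40 allowed in the registers for
  fractions.\<close>

definition reg_degree :: "int \<Rightarrow> nat" where
  "reg_degree i = (if i \<in> {3, 6, 7, 13} then 4 else if i = 4 then 15 else if i = 5 then 20 else if i = 11 then 5
     else if i \<in> {14, 15, 16, 19, 20} then 40 else 1)"

fun degree_bound :: "exp \<Rightarrow> nat" where
  "degree_bound (Var i) = reg_degree i"
| "degree_bound (Lit x) = 1"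
| "degree_bound (Op Add a b) = Suc (max (degree_bound a) (degree_bound b))"
| "degree_bound (Op Sub a b) = Suc (max (degree_bound a) (degree_bound b))"
| "degree_bound (Op Mul a b) = degree_bound a + degree_bound b"
| "degree_bound (Op Div a b) = max (degree_bound a) (degree_bound b)"

fun block :: "(int \<times> exp) list \<Rightarrow> com" where
  "block [] = Const 100 0"
| "block ((x, e) # xs) = Seq (assign x e) (block xs)"

fun run_block :: "(int \<times> exp) list \<Rightarrow> (int \<Rightarrow> int) \<Rightarrow> int \<Rightarrow> int" where
  "run_block [] s = s"
| "run_block ((x, e) # xs) s = run_block xs (s(x := ev e s))"

fun ok_block :: "(int \<times> exp) list \<Rightarrow> bool" where
  "ok_block [] = True"
| "ok_block ((x, e) # xs) = (0 \<le> x \<and> x < 100 \<and> ok_exp e \<and> degree_bound e \<le> reg_degree x \<and> ok_block xs)"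

fun block_size :: "(int \<times> exp) list \<Rightarrow> nat" where
  "block_size [] = 1"
| "block_size ((x, e) # xs) = esize e + 1 + block_size xs"

lemma abs_div_le: "\<bar>x div y\<bar> \<le> \<bar>x :: int\<bar>"
proof -
  have pos: "\<bar>x div y\<bar> \<le> \<bar>x\<bar>" if "y > 0" for x y :: int
  proof (cases "x \<ge> 0")
    case True
    have "x div y * 1 \<le> x div y * y" using that True by (intro mult_left_mono) (auto simp: pos_imp_zdiv_nonneg_iff)
    also have "\<dots> \<le> x" using div_mult_mod_eq[of x y] pos_mod_sign[OF that, of x] by linarith
    finally show ?thesis using True that by (simp add: pos_imp_zdiv_nonneg_iff)
  next
    case False
    have "x * y \<le> x * 1" using False that by (intro mult_left_mono_neg) auto
    hence "x \<le> x div y" using zdiv_mono1[OF _ that, of "x * y" x] that by simp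
    moreover have "x div y < 0" using False that by (simp add: neg_imp_zdiv_neg_iff div_neg_pos_less0)
    ultimately show ?thesis using False by simp
  qed
  consider "y = 0" | "y > 0" | "y < 0" by linarith
  thus ?thesis
  proof cases
    case 3
    thus ?thesis using pos[of "-y" "-x"] by simp
  qed (auto simp: pos)
qed

lemma len_mono: "\<bar>x\<bar> \<le> \<bar>y\<bar> \<Longrightarrow> len x \<le> len y"
proof -
  assume xy: "\<bar>x\<bar> \<le> \<bar>y\<bar>"
  have "\<bar>y\<bar> < 2 ^ nat (bitlen \<bar>y\<bar>)"
    using bitlen_bounds[of "\<bar>y\<bar>"] by (cases "y = 0") auto
  hence "bitlen \<bar>x\<bar> \<le> bitlen \<bar>y\<bar>" using xy by (subst bitlen_le_iff_power) (auto simp: bitlen_nonneg)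
  thus ?thesis by (simp add: len_def nat_mono)
qed

lemma len_pos: "len x \<ge> 1" by (simp add: len_def)
lemma len_0 [simp]: "len 0 = 1" by (simp add: len_def)

section \<open>Cost of compiled programs\<close>

text \<open>\<open>N0\<close> will be \<open>100 * n\<close>. Literals are at most 100 in modulus,
  so they, like \<open>n\<close> and its small multiples, have degree 1.\<close>

locale ram =
  fixes N0 :: int
  assumes N0_ge: "N0 \<ge> 100"
begin

text \<open>Three lengths pay for fetching a variable: one constant 0 and the two operands of an
  addition. An arithmetic operation needs two.\<close>

definition cost :: nat where "cost = 3 * len (N0 ^ 100)"

definition wf :: "(int \<Rightarrow> int) \<Rightarrow> bool" where "wf s \<longleftrightarrow> (\<forall>i<100. \<bar>s i\<bar> \<le> N0 ^ reg_degree i)"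

definition agree :: "(int \<Rightarrow> int) \<Rightarrow> (int \<Rightarrow> int) \<Rightarrow> bool" where "agree M s \<longleftrightarrow> (\<forall>i<100. M i = s i)"

lemma len_le: "\<bar>x\<bar> \<le> N0 ^ d \<Longrightarrow> d \<le> 100 \<Longrightarrow> len x \<le> len (N0 ^ 100)"
proof (rule len_mono)
  assume "\<bar>x\<bar> \<le> N0 ^ d" "d \<le> 100"
  hence "\<bar>x\<bar> \<le> N0 ^ 100" using N0_ge power_increasing[of d 100 N0] by linarith
  thus "\<bar>x\<bar> \<le> \<bar>N0 ^ 100\<bar>" by simp
qed

lemma N0_pow_mono: "a \<le> b \<Longrightarrow> N0 ^ a \<le> N0 ^ b" using N0_ge by (intro power_increasing) auto

lemma abs_add_le:
  assumes "\<bar>x\<bar> \<le> N0 ^ a" "\<bar>y\<bar> \<le> N0 ^ b"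
  shows "\<bar>x\<bar> + \<bar>y\<bar> \<le> N0 ^ Suc (max a b)"
proof -
  have "\<bar>x\<bar> + \<bar>y\<bar> \<le> 2 * N0 ^ max a b"
    using assms N0_pow_mono[of a "max a b"] N0_pow_mono[of b "max a b"] by simp
  also have "\<dots> \<le> N0 * N0 ^ max a b" using N0_ge by (intro mult_right_mono) auto
  finally show ?thesis by simp
qed

lemma abs_ev_le: "wf s \<Longrightarrow> ok_exp e \<Longrightarrow> \<bar>ev e s\<bar> \<le> N0 ^ degree_bound e"
proof (induction e rule: degree_bound.induct)
  case (1 i) thus ?case by (simp add: wf_def)
next
  case (2 x) thus ?case using N0_ge by simp
next
  case (3 a b)
  hence "\<bar>ev a s\<bar> + \<bar>ev b s\<bar> \<le> N0 ^ Suc (max (degree_bound a) (degree_bound b))" by (intro abs_add_le) auto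
  moreover have "\<bar>ev a s + ev b s\<bar> \<le> \<bar>ev a s\<bar> + \<bar>ev b s\<bar>" by linarith
  ultimately show ?case by (simp del: power_Suc)
next
  case (4 a b)
  hence "\<bar>ev a s\<bar> + \<bar>ev b s\<bar> \<le> N0 ^ Suc (max (degree_bound a) (degree_bound b))" by (intro abs_add_le) auto
  moreover have "\<bar>ev a s - ev b s\<bar> \<le> \<bar>ev a s\<bar> + \<bar>ev b s\<bar>" by linarith
  ultimately show ?case by (simp del: power_Suc)
next
  case (5 a b)
  thus ?case using N0_ge by (simp add: abs_mult power_add mult_mono)
next
  case (6 a b)
  have "\<bar>ev a s div ev b s\<bar> \<le> \<bar>ev a s\<bar>" by (rule abs_div_le)
  also have "\<dots> \<le> N0 ^ degree_bound a" using 6 by simp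
  also have "\<dots> \<le> N0 ^ max (degree_bound a) (degree_bound b)" by (intro N0_pow_mono) simp
  finally show ?case by simp
qed

lemma degree_bound_Op: "degree_bound a \<le> degree_bound (Op f a b)" "degree_bound b \<le> degree_bound (Op f a b)"
  by (cases f; simp)+

lemma exec_compile:
  assumes "wf s" "\<And>i. i < 100 \<Longrightarrow> M i = s i" "ok_exp e" "degree_bound e \<le> 100" "k \<ge> 100"
  shows "\<exists>M' t. exec (compile e k) M [] t M' \<and> (\<forall>i<k. M' i = M i) \<and> M' k = ev e s \<and> t \<le> esize e * cost"
  using assms
proof (induction e arbitrary: M k)
  case (Var i)
  let ?M1 = "M(k := 0)"
  have "len (s i) \<le> len (N0 ^ 100)" using Var by (intro len_le[of _ "reg_degree i"]) (auto simp: wf_def)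
  hence t: "len 0 + (len (?M1 i) + len (?M1 k)) \<le> cost"
    using Var len_pos[of "N0 ^ 100"] by (simp add: cost_def)
  have "exec (compile (Var i) k) M ([] @ []) (len 0 + (len (?M1 i) + len (?M1 k))) (?M1(k := aval Add (?M1 i) (?M1 k)))"
    unfolding compile.simps by (rule exec.Seq[OF exec.Const exec.Arith])
  hence r: "exec (compile (Var i) k) M [] (len 0 + (len (?M1 i) + len (?M1 k))) (?M1(k := aval Add (?M1 i) (?M1 k)))"
    by (simp only: append_Nil)
  show ?case
    by (rule exI[of _ "?M1(k := aval Add (?M1 i) (?M1 k))"], rule exI[of _ "len 0 + (len (?M1 i) + len (?M1 k))"], intro conjI r)
       (use t Var in auto)
next
  case (Lit x)
  have "len x \<le> len (N0 ^ 100)" using Lit N0_ge by (intro len_le[of _ 1]) auto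
  thus ?case unfolding compile.simps
    by (intro exI[of _ "M(k := x)"] exI[of _ "len x"] conjI exec.Const) (auto simp: cost_def)
next
  case (Op f a b)
  have oab: "ok_exp a" "ok_exp b" "degree_bound a \<le> 100" "degree_bound b \<le> 100"
    using Op.prems degree_bound_Op[of a f b] degree_bound_Op(2)[of b f a] by auto
  obtain M1 t1 where 1: "exec (compile a k) M [] t1 M1" "\<forall>i<k. M1 i = M i" "M1 k = ev a s" "t1 \<le> esize a * cost"
    using Op.IH(1)[OF Op.prems(1,2) oab(1,3) Op.prems(5)] by blast
  obtain M2 t2 where 2: "exec (compile b (k+1)) M1 [] t2 M2" "\<forall>i<k+1. M2 i = M1 i" "M2 (k+1) = ev b s" "t2 \<le> esize b * cost"
    using Op.IH(2)[OF Op.prems(1) _ oab(2,4), of M1 "k+1"] Op.prems 1(2) by auto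
  have la: "len (ev a s) \<le> len (N0 ^ 100)" using abs_ev_le[OF Op.prems(1) oab(1)] oab by (intro len_le)
  have lb: "len (ev b s) \<le> len (N0 ^ 100)" using abs_ev_le[OF Op.prems(1) oab(2)] oab by (intro len_le)
  have m2: "M2 k = ev a s" using 1(3) 2(2) by simp
  have "exec (compile (Op f a b) k) M ([] @ [] @ []) (t1 + (t2 + (len (M2 k) + len (M2 (k+1))))) (M2(k := aval f (M2 k) (M2 (k+1))))"
    unfolding compile.simps by (intro exec.Seq[OF 1(1)] exec.Seq[OF 2(1)] exec.Arith)
  hence r: "exec (compile (Op f a b) k) M [] (t1 + (t2 + (len (M2 k) + len (M2 (k+1))))) (M2(k := aval f (M2 k) (M2 (k+1))))"
    by (simp only: append_Nil)
  have "t1 + (t2 + (len (M2 k) + len (M2 (k+1)))) \<le> esize (Op f a b) * cost"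
    using 1(4) 2(3,4) m2 la lb by (simp add: cost_def add_mult_distrib)
  moreover have "\<forall>i<k. (M2(k := aval f (M2 k) (M2 (k+1)))) i = M i" using 1(2) 2(2) by simp
  ultimately show ?case
    by (intro exI[of _ "M2(k := aval f (M2 k) (M2 (k+1)))"] exI[of _ "t1 + (t2 + (len (M2 k) + len (M2 (k+1))))"] conjI r)
       (simp_all add: m2 2(3))
qed

text \<open>The machine memory need only agree with the abstract state on the variable registers, so
  temporaries never have to be described. Time is counted in units of \<open>cost\<close>, and
  \<open>wf\<close> travels along as an invariant, so that sequential composition yields the size
  bounds by itself.\<close>

definition runs :: "com \<Rightarrow> (int \<Rightarrow> int) \<Rightarrow> int list \<Rightarrow> nat \<Rightarrow> (int \<Rightarrow> int) \<Rightarrow> bool" where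
  "runs c s os k s' \<longleftrightarrow> (wf s \<longrightarrow> wf s' \<and> (\<forall>M. agree M s \<longrightarrow> (\<exists>M' t. exec c M os t M' \<and> agree M' s' \<and> t \<le> k * cost)))"

lemma runsI:
  assumes "wf s \<Longrightarrow> runs c s os k s'" shows "runs c s os k s'"
  using assms by (auto simp: runs_def)

lemma runs_mono: "runs c s os k s' \<Longrightarrow> k \<le> k' \<Longrightarrow> runs c s os k' s'"
  unfolding runs_def by (meson le_trans mult_le_mono1)

lemma runs_eq: "runs c s os k s' \<Longrightarrow> os = os' \<Longrightarrow> k \<le> k' \<Longrightarrow> s' = s'' \<Longrightarrow> runs c s os' k' s''"
  using runs_mono by blast

lemma runs_Seq:
  assumes "runs c1 s os1 k1 s1" "runs c2 s1 os2 k2 s2"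
  shows "runs (Seq c1 c2) s (os1 @ os2) (k1 + k2) s2"
  unfolding runs_def
proof (intro impI conjI allI)
  assume w: "wf s"
  have w1: "wf s1" using assms(1) w by (simp add: runs_def)
  show "wf s2" using assms(2) w1 by (simp add: runs_def)
  fix M assume "agree M s"
  then obtain M1 t1 where 1: "exec c1 M os1 t1 M1" "agree M1 s1" "t1 \<le> k1 * cost" using assms(1) w unfolding runs_def by blast
  then obtain M2 t2 where 2: "exec c2 M1 os2 t2 M2" "agree M2 s2" "t2 \<le> k2 * cost" using assms(2) w1 unfolding runs_def by blast
  show "\<exists>M' t. exec (Seq c1 c2) M (os1 @ os2) t M' \<and> agree M' s2 \<and> t \<le> (k1 + k2) * cost"
    using exec.Seq[OF 1(1) 2(1)] 1(3) 2(2,3) by (intro exI[of _ M2] exI[of _ "t1 + t2"]) (simp add: add_mult_distrib)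
qed

lemma wf_upd: "wf s \<Longrightarrow> \<bar>v\<bar> \<le> N0 ^ reg_degree x \<Longrightarrow> wf (s(x := v))"
  by (auto simp: wf_def)

lemma runs_assign:
  assumes "0 \<le> x" "x < 100" "ok_exp e" "degree_bound e \<le> 100" "wf s \<Longrightarrow> \<bar>ev e s\<bar> \<le> N0 ^ reg_degree x"
  shows "runs (assign x e) s [] (esize e + 1) (s(x := ev e s))"
  unfolding runs_def
proof (intro impI conjI allI)
  assume w: "wf s"
  show "wf (s(x := ev e s))" using w assms(5) by (intro wf_upd)
  fix M assume a: "agree M s"
  then obtain M1 t1 where 1: "exec (compile e 100) M [] t1 M1" "\<forall>i<100. M1 i = M i" "M1 100 = ev e s" "t1 \<le> esize e * cost"
    using exec_compile[OF w, of M e 100] assms by (auto simp: agree_def)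
  let ?M2 = "M1(101 := 0)"
  have "exec (assign x e) M ([] @ [] @ []) (t1 + (len 0 + (len (?M2 100) + len (?M2 101)))) (?M2(x := aval Add (?M2 100) (?M2 101)))"
    unfolding assign_def by (rule exec.Seq[OF 1(1) exec.Seq[OF exec.Const exec.Arith]])
  moreover have "len (ev e s) \<le> len (N0 ^ 100)" using abs_ev_le[OF w assms(3)] assms(4) by (rule len_le)
  hence "t1 + (len 0 + (len (?M2 100) + len (?M2 101))) \<le> (esize e + 1) * cost"
    using 1(3,4) len_pos[of "N0 ^ 100"] by (simp add: cost_def)
  moreover have "agree (?M2(x := aval Add (?M2 100) (?M2 101))) (s(x := ev e s))"
    using a 1(2,3) assms(2) by (auto simp: agree_def)
  ultimately show "\<exists>M' t. exec (assign x e) M [] t M' \<and> agree M' (s(x := ev e s)) \<and> t \<le> (esize e + 1) * cost"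
    by (intro exI conjI) auto
qed

lemma reg_degree_le: "reg_degree i \<le> 40" by (simp add: reg_degree_def)

lemma runs_block: "ok_block xs \<Longrightarrow> runs (block xs) s [] (block_size xs) (run_block xs s)"
proof (induction xs arbitrary: s rule: ok_block.induct)
  case (1 s)
  have "exec (Const 100 0) M [] (len 0) (M(100 := 0))" for M by (rule exec.Const)
  moreover have "agree (M(100 := 0)) s" if "agree M s" for M using that by (simp add: agree_def)
  moreover have "len 0 \<le> cost" using len_pos[of "N0 ^ 100"] by (simp add: cost_def)
  ultimately show ?case unfolding runs_def by (auto intro!: exI)
next
  case (2 x e xs s)
  have "runs (assign x e) s [] (esize e + 1) (s(x := ev e s))"
  proof (rule runs_assign)
    assume "wf s"
    hence "\<bar>ev e s\<bar> \<le> N0 ^ degree_bound e" using 2 by (intro abs_ev_le) auto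
    also have "\<dots> \<le> N0 ^ reg_degree x" using 2 by (intro N0_pow_mono) auto
    finally show "\<bar>ev e s\<bar> \<le> N0 ^ reg_degree x" .
  qed (use 2 reg_degree_le[of x] in auto)
  moreover have "ok_block xs" using 2(2) by simp
  ultimately show ?case unfolding block.simps by (rule runs_eq[OF runs_Seq[OF _ 2(1)]]) (simp_all del: fun_upd_apply)
qed

lemma len_reg_le: "wf s \<Longrightarrow> i < 100 \<Longrightarrow> len (s i) \<le> cost"
  using len_le[of "s i" "reg_degree i"] reg_degree_le[of i] by (auto simp: wf_def cost_def)

lemma runs_IfPos:
  assumes "x < 100" "0 < s x \<Longrightarrow> runs c1 s os k s'" "\<not> 0 < s x \<Longrightarrow> runs c2 s os k s'"
  shows "runs (IfPos x c1 c2) s os (k + 1) s'"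
  unfolding runs_def
proof (intro impI conjI allI)
  assume w: "wf s"
  show "wf s'" using assms w by (cases "0 < s x") (auto simp: runs_def)
  fix M assume a: "agree M s"
  have Mx: "M x = s x" using a assms(1) by (simp add: agree_def)
  have l: "len (M x) \<le> cost" using len_reg_le[OF w assms(1)] Mx by simp
  show "\<exists>M' t. exec (IfPos x c1 c2) M os t M' \<and> agree M' s' \<and> t \<le> (k + 1) * cost"
  proof (cases "0 < s x")
    case True
    then obtain M1 t1 where "exec c1 M os t1 M1" "agree M1 s'" "t1 \<le> k * cost" using assms(2) w a unfolding runs_def by blast
    moreover from this have "exec (IfPos x c1 c2) M os (len (M x) + t1) M1" using True Mx by (intro exec.IfTrue) simp_all
    ultimately show ?thesis using l by (intro exI[of _ M1] exI[of _ "len (M x) + t1"]) simp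
  next
    case False
    then obtain M1 t1 where "exec c2 M os t1 M1" "agree M1 s'" "t1 \<le> k * cost" using assms(3) w a unfolding runs_def by blast
    moreover from this have "exec (IfPos x c1 c2) M os (len (M x) + t1) M1" using False Mx by (intro exec.IfFalse) simp_all
    ultimately show ?thesis using l by (intro exI[of _ M1] exI[of _ "len (M x) + t1"]) simp
  qed
qed

lemma runs_Print: "x < 100 \<Longrightarrow> runs (Print x) s [s x] 1 s"
  unfolding runs_def
proof (intro impI conjI allI)
  fix M assume "x < 100" "wf s" "agree M s"
  moreover from this have "M x = s x" by (simp add: agree_def)
  ultimately show "\<exists>M' t. exec (Print x) M [s x] t M' \<and> agree M' s \<and> t \<le> 1 * cost"
    using exec.Print[of x M] len_reg_le[of s x] by (intro exI[of _ M] exI[of _ "len (M x)"]) auto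
qed

lemma runs_While_end: "x < 100 \<Longrightarrow> \<not> 0 < s x \<Longrightarrow> runs (WhilePos x c) s [] 1 s"
  unfolding runs_def
proof (intro impI conjI allI)
  fix M assume "x < 100" "\<not> 0 < s x" "wf s" "agree M s"
  moreover from this have "M x = s x" by (simp add: agree_def)
  ultimately show "\<exists>M' t. exec (WhilePos x c) M [] t M' \<and> agree M' s \<and> t \<le> 1 * cost"
    using exec.WhileFalse[of M x c] len_reg_le[of s x] by (intro exI[of _ M] exI[of _ "len (M x)"]) auto
qed

lemma runs_While_step:
  assumes "x < 100" "0 < s x" "runs c s os1 k1 s1" "runs (WhilePos x c) s1 os2 k2 s2"
  shows "runs (WhilePos x c) s (os1 @ os2) (1 + k1 + k2) s2"
  unfolding runs_def
proof (intro impI conjI allI)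
  assume w: "wf s"
  have w1: "wf s1" using assms(3) w by (simp add: runs_def)
  show "wf s2" using assms(4) w1 by (simp add: runs_def)
  fix M assume a: "agree M s"
  have Mx: "M x = s x" using a assms(1) by (simp add: agree_def)
  have l: "len (M x) \<le> cost" using len_reg_le[OF w assms(1)] Mx by simp
  obtain M1 t1 where 1: "exec c M os1 t1 M1" "agree M1 s1" "t1 \<le> k1 * cost" using assms(3) w a unfolding runs_def by blast
  then obtain M2 t2 where 2: "exec (WhilePos x c) M1 os2 t2 M2" "agree M2 s2" "t2 \<le> k2 * cost" using assms(4) w1 unfolding runs_def by blast
  have "exec (WhilePos x c) M (os1 @ os2) (len (M x) + t1 + t2) M2"
    using assms(2) Mx by (intro exec.WhileTrue[OF _ 1(1) 2(1)]) simp
  thus "\<exists>M' t. exec (WhilePos x c) M (os1 @ os2) t M' \<and> agree M' s2 \<and> t \<le> (1 + k1 + k2) * cost"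
    using 1(3) 2(2,3) l by (intro exI[of _ M2] exI[of _ "len (M x) + t1 + t2"]) (simp add: add_mult_distrib)
qed

lemma runs_for:
  assumes "x < 100" "\<And>i. i < n \<Longrightarrow> 0 < st i x" "\<And>i. i < n \<Longrightarrow> runs c (st i) (out i) k (st (Suc i))" "\<not> 0 < st n x"
  shows "runs (WhilePos x c) (st 0) (concat (map out [0..<n])) (n * (k + 1) + 1) (st n)"
proof -
  have "runs (WhilePos x c) (st (n - m)) (concat (map out [n-m..<n])) (m * (k + 1) + 1) (st n)" if "m \<le> n" for m
    using that
  proof (induction m)
    case 0
    thus ?case using runs_While_end[where s = "st n", OF assms(1,4)] by simp
  next
    case (Suc m)
    have e: "Suc (n - Suc m) = n - m" "n - Suc m < n" using Suc.prems by auto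
    have "runs (WhilePos x c) (st (n - m)) (concat (map out [n-m..<n])) (m * (k + 1) + 1) (st n)" using Suc by simp
    from runs_While_step[OF assms(1) assms(2)[OF e(2)] assms(3)[OF e(2), unfolded e(1)] this]
    show ?case using e by (rule_tac runs_eq) (auto simp: upt_conv_Cons)
  qed
  from this[of n] show ?thesis by simp
qed

end

section \<open>The program\<close>

abbreviation "eadd a b \<equiv> Op Add a b"
abbreviation "esub a b \<equiv> Op Sub a b"
abbreviation "emul a b \<equiv> Op Mul a b"
abbreviation "ediv a b \<equiv> Op Div a b"
abbreviation "mod2 r \<equiv> esub (Var r) (emul (Lit 2) (ediv (Var r) (Lit 2)))"

text \<open>Parity of the number of common binary digits: the exponent in the Sylvester matrix.\<close>

fun parity :: "nat \<Rightarrow> nat \<Rightarrow> nat" where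
  "parity r j = (if r = 0 then 0 else (parity (r div 2) (j div 2) + (r mod 2) * (j mod 2)) mod 2)"

declare parity.simps [simp del]

lemma parity_0 [simp]: "parity 0 j = 0" by (simp add: parity.simps)
lemma parity_pos: "r > 0 \<Longrightarrow> parity r j = (parity (r div 2) (j div 2) + (r mod 2) * (j mod 2)) mod 2"
  by (subst parity.simps) simp

text \<open>\<open>p + t - 2 * p * t\<close> is the exclusive or of two bits. Plain
  \<open>assign\<close> instead of \<open>block\<close> marks an assignment whose syntactic degree
  exceeds that of the target register, so that the size of the value is argued separately.\<close>

definition parity_body :: com where
  "parity_body = Seq (assign rT (emul (mod2 rU) (mod2 rV)))
    (Seq (assign rP (esub (eadd (Var rP) (Var rT)) (emul (Lit 2) (emul (Var rP) (Var rT)))))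
      (block [(rT, Lit 0), (rU, ediv (Var rU) (Lit 2)), (rV, ediv (Var rV) (Lit 2))]))"

text \<open>\<open>rKind\<close> selects between a spike at position \<open>rIdx\<close> and a row
  of signs. The machine can only test positivity, so equality of \<open>rJ\<close> and
  \<open>rIdx\<close> is decided by the square of their difference.\<close>

definition coord :: com where
  "coord = IfPos rKind
    (Seq (block [(rT, emul (esub (Var rJ) (Var rIdx)) (esub (Var rJ) (Var rIdx)))])
      (Seq (IfPos rT (block [(rX, Var rLo)]) (block [(rX, Var rHi)])) (block [(rT, Lit 0)])))
    (Seq (block [(rP, Var rFlip), (rU, Var rIdx), (rV, Var rJ), (rT, Lit 0)])
      (Seq (WhilePos rU parity_body)
        (Seq (IfPos rP (block [(rX, Var rLo)]) (block [(rX, Var rHi)])) (block [(rP, Lit 0), (rV, Lit 0)]))))"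

definition gcd_body :: com where
  "gcd_body = Seq (assign rT (esub (Var rU) (emul (ediv (Var rU) (Var rV)) (Var rV))))
    (block [(rU, Var rV), (rV, Var rT), (rT, Lit 0)])"

definition ratio :: com where
  "ratio = Seq (block [(rU, Var rA), (rV, Var rB), (rT, Lit 0)]) (Seq (WhilePos rV gcd_body)
    (Seq (block [(rT, ediv (Var rA) (Var rU))]) (Seq (Print rT) (Seq (block [(rT, ediv (Var rB) (Var rU))]) (Seq (Print rT)
      (block [(rU, Lit 0), (rT, Lit 0), (rA, Lit 0), (rB, Lit 0)]))))))"

definition step_J :: com where
  "step_J = Seq (assign rJ (eadd (Var rJ) (Lit 1))) (assign rC (esub (Var rN) (Var rJ)))"

definition sum_body :: com where
  "sum_body = Seq coord (Seq (assign rS (eadd (Var rS) (Var rX))) (Seq (block [(rX, Lit 0)]) step_J))"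

definition print_body :: com where
  "print_body = Seq coord (Seq (block [(rA, Var rX), (rB, Var rS), (rX, Lit 0)]) (Seq ratio step_J))"

text \<open>The coordinate sum is needed before anything is printed, as the denominator of all
  coordinates and as a factor of the weight. Hence two passes: the coordinates are computed again
  instead of being stored, and a fixed set of registers suffices.\<close>

definition emit :: com where
  "emit = Seq (block [(rC, Var rN)]) (Seq (WhilePos rC sum_body)
    (Seq (block [(rA, emul (Var rW) (emul (Var rS) (emul (Var rS) (Var rS)))), (rB, Var rD), (rJ, Lit 0), (rC, Var rN)])
      (Seq ratio (Seq (WhilePos rC print_body) (block [(rS, Lit 0), (rJ, Lit 0)])))))"

definition step_I :: "int \<Rightarrow> com" where
  "step_I r = Seq (assign rIdx (eadd (Var rIdx) (Lit 1))) (assign rI (esub (Var r) (Var rIdx)))"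

definition vertex_loop :: com where
  "vertex_loop = WhilePos rI (Seq emit (step_I rN))"

definition sign_loop :: com where
  "sign_loop = WhilePos rI (Seq emit (Seq (block [(rFlip, Lit 1)]) (Seq emit (Seq (block [(rFlip, Lit 0)]) (step_I rL)))))"

definition coord_value :: "(int \<Rightarrow> int) \<Rightarrow> nat \<Rightarrow> int" where
  "coord_value s j = (if 0 < s rKind then (if int j = s rIdx then s rHi else s rLo)
     else if (nat (s rFlip) + parity (nat (s rIdx)) j) mod 2 = 1 then s rLo else s rHi)"

definition reduced :: "int \<Rightarrow> int \<Rightarrow> int list" where
  "reduced a b = [a div gcd a b, b div gcd a b]"

definition point_out :: "int \<Rightarrow> int \<times> int list \<Rightarrow> int list" where
  "point_out D = (\<lambda>(w, q). reduced (w * sum_list q ^ 3) D @ concat (map (\<lambda>x. reduced x (sum_list q)) q))"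

text \<open>The scratch registers are 0 before and after \<open>emit\<close>. Thus it restores the
  abstract state exactly, and loop invariants are equations between states.\<close>

definition clean :: "(int \<Rightarrow> int) \<Rightarrow> bool" where
  "clean s \<longleftrightarrow> s rS = 0 \<and> s rJ = 0 \<and> s rX = 0 \<and> s rU = 0 \<and> s rV = 0 \<and> s rT = 0 \<and> s rP = 0 \<and> s rA = 0 \<and> s rB = 0 \<and> s rC = 0"

section \<open>Correctness and cost of the subroutines\<close>

context ram
begin

definition nb :: nat where "nb = len (N0 ^ 100)"

lemma wfD: "wf s \<Longrightarrow> i < 100 \<Longrightarrow> \<bar>s i\<bar> \<le> N0 ^ reg_degree i"
  by (simp add: wf_def)

lemma runs_assignI:
  assumes "0 \<le> x" "x < 100" "ok_exp e" "degree_bound e \<le> 100" "ev e s = v" "wf s \<Longrightarrow> \<bar>v\<bar> \<le> N0 ^ reg_degree x"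
    "esize e + 1 \<le> k" "s' = s(x := v)"
  shows "runs (assign x e) s [] k s'"
  using runs_mono[OF runs_assign[of x e s]] assms by blast

lemma runs_blockI: "ok_block xs \<Longrightarrow> block_size xs \<le> k \<Longrightarrow> run_block xs s = s' \<Longrightarrow> runs (block xs) s [] k s'"
  using runs_mono[OF runs_block] by blast

text \<open>Converts size into a number of iterations: the parity loop halves a register and the
  Euclidean loop halves a product, so about \<open>nb\<close> rounds are enough.\<close>

lemma less_pow_nb:
  assumes "x \<le> N0 ^ d" "d \<le> 100"
  shows "x < 2 ^ nb"
proof -
  have "x \<le> N0 ^ 100" using assms N0_pow_mono[of d 100] by simp
  also have "N0 ^ 100 < 2 ^ nat (bitlen (N0 ^ 100))" using bitlen_bounds[of "N0 ^ 100"] N0_ge by simp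
  also have "\<dots> \<le> 2 ^ nb" using N0_ge by (intro power_increasing) (auto simp: nb_def len_def)
  finally show ?thesis .
qed

lemma runs_parity_body:
  assumes "p \<le> 1"
  shows "runs parity_body (s(rP := int p, rU := int u, rV := int v, rT := 0)) [] 99
     (s(rP := int ((p + (u mod 2) * (v mod 2)) mod 2), rU := int (u div 2), rV := int (v div 2), rT := 0))"
proof -
  let ?s = "s(rP := int p, rU := int u, rV := int v, rT := 0)"
  define t where "t = (u mod 2) * (v mod 2)"
  have t01: "t = 0 \<or> t = 1" unfolding t_def by (cases "u mod 2 = 0"; cases "v mod 2 = 0") auto
  have m2: "int x - 2 * (int x div 2) = int (x mod 2)" for x by (simp add: zmod_int minus_mult_div_eq_mod)
  have e1: "ev (emul (mod2 rU) (mod2 rV)) ?s = int t" by (simp add: m2 t_def)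
  have 1: "runs (assign rT (emul (mod2 rU) (mod2 rV))) ?s [] (esize (emul (mod2 rU) (mod2 rV)) + 1) (?s(rT := int t))"
    by (rule runs_assignI[OF _ _ _ _ e1]) (use N0_ge t01 in \<open>auto simp: reg_degree_def\<close>)
  let ?e = "esub (eadd (Var rP) (Var rT)) (emul (Lit 2) (emul (Var rP) (Var rT)))"
  have e2: "ev ?e (?s(rT := int t)) = int ((p + t) mod 2)"
  proof -
    have "p = 0 \<or> p = 1" using assms by auto
    thus ?thesis using t01 by auto
  qed
  have 2: "runs (assign rP ?e) (?s(rT := int t)) [] (esize ?e + 1) (?s(rT := int t, rP := int ((p + t) mod 2)))"
    by (rule runs_assignI[OF _ _ _ _ e2]) (use N0_ge in \<open>auto simp: reg_degree_def\<close>)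
  let ?b = "[(rT, Lit 0), (rU, ediv (Var rU) (Lit 2)), (rV, ediv (Var rV) (Lit 2))]"
  have 3: "runs (block ?b) (?s(rT := int t, rP := int ((p + t) mod 2))) [] (block_size ?b) (run_block ?b (?s(rT := int t, rP := int ((p + t) mod 2))))"
    by (rule runs_block) (simp add: reg_degree_def)
  show ?thesis unfolding parity_body_def
    by (rule runs_eq[OF runs_Seq[OF 1 runs_Seq[OF 2 3]]]) (auto simp: fun_eq_iff t_def zdiv_int)
qed

lemma runs_parity:
  "u < 2 ^ N \<Longrightarrow> p \<le> 1 \<Longrightarrow> \<exists>v'. runs (WhilePos rU parity_body) (s(rP := int p, rU := int u, rV := int v, rT := 0)) [] (N * 100 + 1)
     (s(rP := int ((p + parity u v) mod 2), rU := 0, rV := v', rT := 0))"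
proof (induction N arbitrary: u v p)
  case 0
  hence u: "u = 0" by simp
  have r: "runs (WhilePos rU parity_body) (s(rP := int p, rU := int u, rV := int v, rT := 0)) [] 1 (s(rP := int p, rU := int u, rV := int v, rT := 0))"
    by (rule runs_While_end) (auto simp: u)
  have "p mod 2 = p" using 0 by auto
  thus ?case using u by (intro exI[of _ "int v"], intro runs_eq[OF r]) auto
next
  case (Suc N)
  show ?case
  proof (cases "u = 0")
    case True
    have r: "runs (WhilePos rU parity_body) (s(rP := int p, rU := int u, rV := int v, rT := 0)) [] 1 (s(rP := int p, rU := int u, rV := int v, rT := 0))"
      by (rule runs_While_end) (auto simp: True)
    have "p mod 2 = p" using Suc.prems by auto
    thus ?thesis using True by (intro exI[of _ "int v"], intro runs_eq[OF r]) auto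
  next
    case False
    let ?p = "(p + (u mod 2) * (v mod 2)) mod 2"
    have "\<exists>v'. runs (WhilePos rU parity_body) (s(rP := int ?p, rU := int (u div 2), rV := int (v div 2), rT := 0)) [] (N * 100 + 1)
       (s(rP := int ((?p + parity (u div 2) (v div 2)) mod 2), rU := 0, rV := v', rT := 0))"
      by (rule Suc.IH) (use Suc.prems in auto)
    then obtain v' where v': "runs (WhilePos rU parity_body) (s(rP := int ?p, rU := int (u div 2), rV := int (v div 2), rT := 0)) [] (N * 100 + 1)
       (s(rP := int ((?p + parity (u div 2) (v div 2)) mod 2), rU := 0, rV := v', rT := 0))"
      by blast
    have e: "(?p + parity (u div 2) (v div 2)) mod 2 = (p + parity u v) mod 2"
      using False by (simp add: parity_pos mod_simps add_ac)
    have r: "runs (WhilePos rU parity_body) (s(rP := int p, rU := int u, rV := int v, rT := 0)) ([] @ []) (1 + 99 + (N * 100 + 1))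
       (s(rP := int ((?p + parity (u div 2) (v div 2)) mod 2), rU := 0, rV := v', rT := 0))"
      by (rule runs_While_step[OF _ _ runs_parity_body[OF Suc.prems(2)] v']) (use False in auto)
    show ?thesis by (rule exI[of _ v'], rule runs_eq[OF r]) (simp_all add: e fun_eq_iff)
  qed
qed

lemma runs_coord:
  assumes s: "s rJ = int j" "s rIdx \<ge> 0" "s rFlip \<in> {0, 1}" "s rU = 0" "s rV = 0" "s rT = 0" "s rP = 0"
  shows "runs coord s [] (100 * nb + 200) (s(rX := coord_value s j))"
proof (rule runsI)
  assume wf: "wf s"
  have X: "runs (block [(rX, Var rLo)]) s' [] 3 (s'(rX := s' rLo))" "runs (block [(rX, Var rHi)]) s' [] 3 (s'(rX := s' rHi))" for s'
    by (rule runs_blockI; simp add: reg_degree_def)+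
  show ?thesis unfolding coord_def
  proof (rule runs_eq[OF runs_IfPos[where k = "100 * nb + 199" and os = "[]" and s' = "s(rX := coord_value s j)"]])
    assume k: "0 < s rKind"
    let ?b1 = "[(rT, emul (esub (Var rJ) (Var rIdx)) (esub (Var rJ) (Var rIdx)))]"
    let ?d = "(int j - s rIdx) * (int j - s rIdx)"
    have 1: "runs (block ?b1) s [] (block_size ?b1) (s(rT := ?d))"
      by (rule runs_blockI) (use s in \<open>simp_all add: reg_degree_def\<close>)
    have d: "0 < ?d \<longleftrightarrow> int j \<noteq> s rIdx" by (simp add: zero_less_mult_iff) linarith
    have 2: "runs (IfPos rT (block [(rX, Var rLo)]) (block [(rX, Var rHi)])) (s(rT := ?d)) [] (3 + 1) (s(rT := ?d, rX := coord_value s j))"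
      by (rule runs_IfPos; (rule runs_eq[OF X(1)] runs_eq[OF X(2)])?) (use k d in \<open>auto simp: coord_value_def fun_eq_iff\<close>)
    have 3: "runs (block [(rT, Lit 0)]) (s(rT := ?d, rX := coord_value s j)) [] 3 (s(rT := ?d, rX := coord_value s j, rT := 0))"
      by (rule runs_blockI) (simp_all add: reg_degree_def)
    show "runs (Seq (block ?b1) (Seq (IfPos rT (block [(rX, Var rLo)]) (block [(rX, Var rHi)])) (block [(rT, Lit 0)]))) s [] (100 * nb + 199) (s(rX := coord_value s j))"
      by (rule runs_eq[OF runs_Seq[OF 1 runs_Seq[OF 2 3]]]) (use s in \<open>auto simp: fun_eq_iff\<close>)
  next
    assume k: "\<not> 0 < s rKind"
    define u where "u = nat (s rIdx)"
    define p where "p = nat (s rFlip)"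
    have up: "s rIdx = int u" "s rFlip = int p" "p \<le> 1" using s by (auto simp: u_def p_def)
    have "s rIdx \<le> N0 ^ 1" using wfD[OF wf, of rIdx] by (simp add: reg_degree_def)
    hence "s rIdx < 2 ^ nb" by (rule less_pow_nb) simp
    hence "int u < int (2 ^ nb)" using up(1) by simp
    hence u: "u < 2 ^ nb" by linarith
    let ?b1 = "[(rP, Var rFlip), (rU, Var rIdx), (rV, Var rJ), (rT, Lit 0)]"
    have 1: "runs (block ?b1) s [] (block_size ?b1) (s(rP := int p, rU := int u, rV := int j, rT := 0))"
      by (rule runs_blockI) (use s up in \<open>simp_all add: reg_degree_def\<close>)
    obtain v' where 2: "runs (WhilePos rU parity_body) (s(rP := int p, rU := int u, rV := int j, rT := 0)) [] (nb * 100 + 1)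
      (s(rP := int ((p + parity u j) mod 2), rU := 0, rV := v', rT := 0))"
      using runs_parity[OF u up(3)] by blast
    let ?s2 = "s(rP := int ((p + parity u j) mod 2), rU := 0, rV := v', rT := 0)"
    have 3: "runs (IfPos rP (block [(rX, Var rLo)]) (block [(rX, Var rHi)])) ?s2 [] (3 + 1) (?s2(rX := coord_value s j))"
      by (rule runs_IfPos; (rule runs_eq[OF X(1)] runs_eq[OF X(2)])?) (use k up in \<open>auto simp: coord_value_def fun_eq_iff\<close>)
    let ?b2 = "[(rP, Lit 0), (rV, Lit 0)]"
    have 4: "runs (block ?b2) (?s2(rX := coord_value s j)) [] (block_size ?b2) (run_block ?b2 (?s2(rX := coord_value s j)))"
      by (rule runs_block) (simp add: reg_degree_def)
    show "runs (Seq (block ?b1) (Seq (WhilePos rU parity_body) (Seq (IfPos rP (block [(rX, Var rLo)]) (block [(rX, Var rHi)])) (block ?b2)))) s [] (100 * nb + 199) (s(rX := coord_value s j))"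
      by (rule runs_eq[OF runs_Seq[OF 1 runs_Seq[OF 2 runs_Seq[OF 3 4]]]]) (use s in \<open>auto simp: fun_eq_iff\<close>)
  qed auto
qed

lemma runs_gcd_body:
  assumes "0 < b" "b \<le> a"
  shows "runs gcd_body (s(rU := a, rV := b, rT := 0)) [] 98 (s(rU := b, rV := a mod b, rT := 0))"
proof -
  let ?s = "s(rU := a, rV := b, rT := 0)" and ?e = "esub (Var rU) (emul (ediv (Var rU) (Var rV)) (Var rV))"
  have e: "ev ?e ?s = a mod b" by (simp add: minus_div_mult_eq_mod)
  have 1: "runs (assign rT ?e) ?s [] (esize ?e + 1) (?s(rT := a mod b))"
  proof -
    have "\<bar>a mod b\<bar> \<le> N0 ^ 40" if "wf ?s"
    proof -
      have "\<bar>?s rV\<bar> \<le> N0 ^ reg_degree rV" by (rule wfD[OF that]) simp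
      hence "b \<le> N0 ^ 40" using assms by (simp add: reg_degree_def)
      thus ?thesis using pos_mod_sign[OF assms(1), of a] pos_mod_bound[OF assms(1), of a] by linarith
    qed
    thus ?thesis by (intro runs_assignI[OF _ _ _ _ e]) (auto simp: reg_degree_def)
  qed
  let ?b = "[(rU, Var rV), (rV, Var rT), (rT, Lit 0)]"
  have 2: "runs (block ?b) (?s(rT := a mod b)) [] (block_size ?b) (run_block ?b (?s(rT := a mod b)))"
    by (rule runs_block) (simp add: reg_degree_def)
  show ?thesis unfolding gcd_body_def
    by (rule runs_eq[OF runs_Seq[OF 1 2]]) (auto simp: fun_eq_iff)
qed

text \<open>One step of Euclid's algorithm at least halves the product of the two numbers once they are ordered.\<close>

lemma runs_gcd:
  "0 \<le> b \<Longrightarrow> b \<le> a \<Longrightarrow> a * b < 2 ^ N \<Longrightarrow>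
    runs (WhilePos rV gcd_body) (s(rU := a, rV := b, rT := 0)) [] (N * 100 + 1) (s(rU := gcd a b, rV := 0, rT := 0))"
proof (induction N arbitrary: a b)
  case 0
  have "b = 0"
  proof (rule ccontr)
    assume "b \<noteq> 0"
    hence "1 * 1 \<le> a * b" using 0 by (intro mult_mono) auto
    thus False using 0 by simp
  qed
  have r: "runs (WhilePos rV gcd_body) (s(rU := a, rV := 0, rT := 0)) [] 1 (s(rU := a, rV := 0, rT := 0))"
    by (rule runs_While_end) auto
  show ?case unfolding \<open>b = 0\<close> by (rule runs_eq[OF r]) (use 0 in auto)
next
  case (Suc N)
  show ?case
  proof (cases "b = 0")
    case True
    have r: "runs (WhilePos rV gcd_body) (s(rU := a, rV := b, rT := 0)) [] 1 (s(rU := a, rV := b, rT := 0))"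
      by (rule runs_While_end) (auto simp: True)
    show ?thesis by (rule runs_eq[OF r]) (use Suc.prems True in auto)
  next
    case False
    hence b: "0 < b" using Suc.prems by simp
    have m: "0 \<le> a mod b" "a mod b < b" using b by simp_all
    have "1 * b \<le> (a div b) * b" using b Suc.prems by (intro mult_right_mono) (auto simp: pos_imp_zdiv_pos_iff int_one_le_iff_zero_less)
    hence "2 * (a mod b) \<le> a" using m div_mult_mod_eq[of a b] by linarith
    hence "2 * (a mod b) * b \<le> a * b" using b by (intro mult_right_mono) auto
    hence "b * (a mod b) < 2 ^ N" using Suc.prems(3) by (simp add: mult.commute)
    from Suc.IH[OF m(1) _ this] m(2)
    have r: "runs (WhilePos rV gcd_body) (s(rU := b, rV := a mod b, rT := 0)) [] (N * 100 + 1) (s(rU := gcd b (a mod b), rV := 0, rT := 0))"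
      by (simp only: less_imp_le)
    have g: "gcd b (a mod b) = gcd a b" by (metis gcd.commute gcd_red_int)
    show ?thesis
      by (rule runs_eq[OF runs_While_step[OF _ _ runs_gcd_body[OF b Suc.prems(2)] r]]) (use b in \<open>auto simp: g\<close>)
  qed
qed

lemma runs_ratio:
  assumes s: "s rA = a" "s rB = b" "a \<ge> 0" "b > 0" "s rU = 0" "s rV = 0" "s rT = 0"
  shows "runs ratio s (reduced a b) (100 * nb + 300) (s(rA := 0, rB := 0))"
proof (rule runsI)
  assume wf: "wf s"
  have "\<bar>s rA\<bar> \<le> N0 ^ reg_degree rA" "\<bar>s rB\<bar> \<le> N0 ^ reg_degree rB" by (rule wfD[OF wf]; simp)+
  hence ab: "a \<le> N0 ^ 40" "b \<le> N0 ^ 40" using s by (simp_all add: reg_degree_def)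
  have "a * b \<le> N0 ^ 40 * N0 ^ 40" using ab s by (intro mult_mono) auto
  hence "a * b \<le> N0 ^ 80" by (simp flip: power_add)
  hence prod: "a * b < 2 ^ nb" by (rule less_pow_nb) simp
  let ?s1 = "s(rU := a, rV := b, rT := 0)" and ?s2 = "s(rU := gcd a b, rV := 0, rT := 0)"
  have 2: "runs (WhilePos rV gcd_body) ?s1 [] (nb * 100 + 101) ?s2"
  proof (cases "b \<le> a")
    case True
    show ?thesis by (rule runs_eq[OF runs_gcd[OF _ True prod]]) (use s in auto)
  next
    case False
    let ?e = "esub (Var rU) (emul (ediv (Var rU) (Var rV)) (Var rV))"
    \<comment> \<open>For \<open>a < b\<close> one step of Euclid merely exchanges the two numbers;
      then the halving argument applies.\<close>
    have ge: "runs gcd_body ?s1 [] 98 (s(rU := b, rV := a, rT := 0))"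
    proof -
      have e: "ev ?e ?s1 = a" using False s by simp
      have 1: "runs (assign rT ?e) ?s1 [] (esize ?e + 1) (?s1(rT := a))"
        using ab s by (intro runs_assignI[OF _ _ _ _ e]) (auto simp: reg_degree_def)
      let ?b = "[(rU, Var rV), (rV, Var rT), (rT, Lit 0)]"
      have 2: "runs (block ?b) (?s1(rT := a)) [] (block_size ?b) (run_block ?b (?s1(rT := a)))"
        by (rule runs_block) (simp add: reg_degree_def)
      show ?thesis unfolding gcd_body_def
        by (rule runs_eq[OF runs_Seq[OF 1 2]]) (auto simp: fun_eq_iff)
    qed
    have "runs (WhilePos rV gcd_body) (s(rU := b, rV := a, rT := 0)) [] (nb * 100 + 1) (s(rU := gcd b a, rV := 0, rT := 0))"
      using False s prod by (intro runs_gcd) (auto simp: mult.commute)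
    thus ?thesis by (intro runs_eq[OF runs_While_step[OF _ _ ge]]) (use s in \<open>auto simp: gcd.commute\<close>)
  qed
  let ?b1 = "[(rU, Var rA), (rV, Var rB), (rT, Lit 0)]" and ?b3 = "[(rT, ediv (Var rA) (Var rU))]"
    and ?b4 = "[(rT, ediv (Var rB) (Var rU))]" and ?b5 = "[(rU, Lit 0), (rT, Lit 0), (rA, Lit 0), (rB, Lit 0)]"
  have 1: "runs (block ?b1) s [] (block_size ?b1) ?s1"
    by (rule runs_blockI) (use s in \<open>simp_all add: reg_degree_def\<close>)
  have 3: "runs (block ?b3) ?s2 [] (block_size ?b3) (?s2(rT := a div gcd a b))"
    by (rule runs_blockI) (use s in \<open>simp_all add: reg_degree_def\<close>)
  have 4: "runs (Print rT) (?s2(rT := a div gcd a b)) [a div gcd a b] 1 (?s2(rT := a div gcd a b))"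
    using runs_Print[of rT "?s2(rT := a div gcd a b)"] by simp
  have 5: "runs (block ?b4) (?s2(rT := a div gcd a b)) [] (block_size ?b4) (?s2(rT := b div gcd a b))"
    by (rule runs_blockI) (use s in \<open>simp_all add: reg_degree_def\<close>)
  have 6: "runs (Print rT) (?s2(rT := b div gcd a b)) [b div gcd a b] 1 (?s2(rT := b div gcd a b))"
    using runs_Print[of rT "?s2(rT := b div gcd a b)"] by simp
  have 7: "runs (block ?b5) (?s2(rT := b div gcd a b)) [] (block_size ?b5) (run_block ?b5 (?s2(rT := b div gcd a b)))"
    by (rule runs_block) (simp add: reg_degree_def)
  show ?thesis unfolding ratio_def
    by (rule runs_eq[OF runs_Seq[OF 1 runs_Seq[OF 2 runs_Seq[OF 3 runs_Seq[OF 4 runs_Seq[OF 5 runs_Seq[OF 6 7]]]]]]])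
       (use s in \<open>auto simp: fun_eq_iff reduced_def\<close>)
qed

lemma runs_step_J:
  assumes "s rN = int n" "s rJ = int j" "j < n"
  shows "runs step_J s [] 8 (s(rJ := int (Suc j), rC := int n - int (Suc j)))"
proof -
  have nN: "int n \<le> N0" if "wf s'" "s' rN = int n" for s'
  proof -
    have "\<bar>s' rN\<bar> \<le> N0 ^ reg_degree rN" by (rule wfD[OF that(1)]) simp
    thus ?thesis using that(2) by (simp add: reg_degree_def)
  qed
  have 1: "runs (assign rJ (eadd (Var rJ) (Lit 1))) s [] 4 (s(rJ := int (Suc j)))"
    using nN[of s] assms by (intro runs_assignI) (auto simp: reg_degree_def)
  have 2: "runs (assign rC (esub (Var rN) (Var rJ))) (s(rJ := int (Suc j))) [] 4 (s(rJ := int (Suc j), rC := int n - int (Suc j)))"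
    using nN[of "s(rJ := int (Suc j))"] assms by (intro runs_assignI) (auto simp: reg_degree_def)
  show ?thesis unfolding step_J_def by (rule runs_eq[OF runs_Seq[OF 1 2]]) auto
qed

lemma coord_value_cong:
  "(\<And>r. r \<in> {rKind, rIdx, rFlip, rLo, rHi} \<Longrightarrow> s' r = s r) \<Longrightarrow> coord_value s' j = coord_value s j"
  by (simp add: coord_value_def)

lemma runs_emit:
  assumes c: "clean s" and n: "s rN = int n" "n \<ge> 1" and i: "s rIdx \<ge> 0" "s rFlip \<in> {0, 1}"
    and w: "s rW \<ge> 0" "s rD > 0" and lh: "s rLo \<ge> 0" "s rHi \<ge> 0"
    and pos: "(\<Sum>j<n. coord_value s j) > 0"
  shows "runs emit s (point_out (s rD) (s rW, map (coord_value s) [0..<n])) (n * (400 * nb + 1300)) s"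
proof -
  define x where "x = coord_value s"
  define S where "S = (\<lambda>j. \<Sum>i<j. x i)"
  note c' = c[unfolded clean_def]
  have x0: "x j \<ge> 0" for j using lh by (auto simp: x_def coord_value_def)
  have S0: "S j \<ge> 0" for j unfolding S_def by (intro sum_nonneg x0)
  define st1 where "st1 = (\<lambda>j. s(rS := S j, rJ := int j, rC := int n - int j))"
  define st2 where "st2 = (\<lambda>j. s(rS := S n, rJ := int j, rC := int n - int j))"
  have cv1: "coord_value (st1 j) = x" "coord_value (st2 j) = x" for j
    unfolding x_def st1_def st2_def by (rule ext, rule coord_value_cong, auto)+
  have body1: "runs sum_body (st1 j) [] (100 * nb + 250) (st1 (Suc j))" if j: "j < n" for j
  proof -
    have 1: "runs coord (st1 j) [] (100 * nb + 200) ((st1 j)(rX := x j))"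
      using runs_coord[of "st1 j" j] c' i unfolding cv1 by (simp add: st1_def)
    let ?s = "(st1 j)(rX := x j)"
    have b: "\<bar>S j + x j\<bar> \<le> N0 ^ 5" if "wf ?s"
    proof -
      have r: "\<bar>?s rN\<bar> \<le> N0 ^ reg_degree rN" "\<bar>?s rLo\<bar> \<le> N0 ^ reg_degree rLo" "\<bar>?s rHi\<bar> \<le> N0 ^ reg_degree rHi"
        by (rule wfD[OF that]; simp)+
      have xb: "x i \<le> N0 ^ 4" for i using r lh by (auto simp: st1_def x_def coord_value_def reg_degree_def)
      have "S j + x j = (\<Sum>i<Suc j. x i)" by (simp add: S_def)
      also have "\<dots> \<le> (\<Sum>i<Suc j. N0 ^ 4)" by (intro sum_mono xb)
      also have "\<dots> = int (Suc j) * N0 ^ 4" by simp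
      also have "\<dots> \<le> N0 * N0 ^ 4" using r(1) n(1) j N0_ge by (intro mult_right_mono) (auto simp: st1_def reg_degree_def)
      finally show ?thesis using S0[of j] x0[of j] by (simp flip: power_Suc)
    qed
    have 2: "runs (assign rS (eadd (Var rS) (Var rX))) ?s [] 4 (?s(rS := S (Suc j)))"
      using b by (intro runs_assignI) (auto simp: reg_degree_def st1_def S_def)
    let ?s2 = "?s(rS := S (Suc j))"
    have 3: "runs (block [(rX, Lit 0)]) ?s2 [] 3 (?s2(rX := 0))"
      by (rule runs_blockI) (simp_all add: reg_degree_def)
    have 4: "runs step_J (?s2(rX := 0)) [] 8 ((?s2(rX := 0))(rJ := int (Suc j), rC := int n - int (Suc j)))"
      by (rule runs_step_J) (use j n in \<open>auto simp: st1_def\<close>)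
    show ?thesis unfolding sum_body_def
      by (rule runs_eq[OF runs_Seq[OF 1 runs_Seq[OF 2 runs_Seq[OF 3 4]]]]) (use c' in \<open>auto simp: fun_eq_iff st1_def\<close>)
  qed
  have Sn: "S n > 0" using pos by (simp add: S_def x_def)
  have body2: "runs print_body (st2 j) (reduced (x j) (S n)) (200 * nb + 550) (st2 (Suc j))" if j: "j < n" for j
  proof -
    have 1: "runs coord (st2 j) [] (100 * nb + 200) ((st2 j)(rX := x j))"
      using runs_coord[of "st2 j" j] c' i unfolding cv1 by (simp add: st2_def)
    let ?s = "(st2 j)(rX := x j)" and ?b = "[(rA, Var rX), (rB, Var rS), (rX, Lit 0)]"
    have 2: "runs (block ?b) ?s [] (block_size ?b) ((st2 j)(rX := 0, rA := x j, rB := S n))"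
      by (rule runs_blockI) (auto simp: reg_degree_def st2_def fun_eq_iff)
    let ?s2 = "(st2 j)(rX := 0, rA := x j, rB := S n)"
    have 3: "runs ratio ?s2 (reduced (x j) (S n)) (100 * nb + 300) (?s2(rA := 0, rB := 0))"
      by (rule runs_ratio) (use c' x0 Sn in \<open>auto simp: st2_def\<close>)
    have 4: "runs step_J (?s2(rA := 0, rB := 0)) [] 8 ((?s2(rA := 0, rB := 0))(rJ := int (Suc j), rC := int n - int (Suc j)))"
      by (rule runs_step_J) (use j n in \<open>auto simp: st2_def\<close>)
    show ?thesis unfolding print_body_def
      by (rule runs_eq[OF runs_Seq[OF 1 runs_Seq[OF 2 runs_Seq[OF 3 4]]]]) (use c' in \<open>auto simp: fun_eq_iff st2_def\<close>)
  qed
  have 1: "runs (block [(rC, Var rN)]) s [] 3 (st1 0)"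
    by (rule runs_blockI) (use c' n in \<open>auto simp: reg_degree_def st1_def S_def fun_eq_iff\<close>)
  have 2: "runs (WhilePos rC sum_body) (st1 0) (concat (map (\<lambda>_. []) [0..<n])) (n * ((100 * nb + 250) + 1) + 1) (st1 n)"
  proof (rule runs_for)
    show "runs sum_body (st1 j) [] (100 * nb + 250) (st1 (Suc j))" if "j < n" for j by (rule body1[OF that])
  qed (auto simp: st1_def)
  let ?b = "[(rA, emul (Var rW) (emul (Var rS) (emul (Var rS) (Var rS)))), (rB, Var rD), (rJ, Lit 0), (rC, Var rN)]"
  let ?A = "s rW * (S n * (S n * S n))"
  have 3: "runs (block ?b) (st1 n) [] (block_size ?b) ((st2 0)(rA := ?A, rB := s rD))"
    by (rule runs_blockI) (use n in \<open>auto simp: reg_degree_def st1_def st2_def fun_eq_iff\<close>)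
  have 4: "runs ratio ((st2 0)(rA := ?A, rB := s rD)) (reduced ?A (s rD)) (100 * nb + 300) ((st2 0)(rA := ?A, rB := s rD, rA := 0, rB := 0))"
    by (rule runs_ratio) (use c' w Sn in \<open>auto simp: st2_def\<close>)
  have e4: "(st2 0)(rA := ?A, rB := s rD, rA := 0, rB := 0) = st2 0" using c' by (auto simp: st2_def fun_eq_iff)
  have 5: "runs (WhilePos rC print_body) (st2 0) (concat (map (\<lambda>j. reduced (x j) (S n)) [0..<n])) (n * ((200 * nb + 550) + 1) + 1) (st2 n)"
  proof (rule runs_for)
    show "runs print_body (st2 j) (reduced (x j) (S n)) (200 * nb + 550) (st2 (Suc j))" if "j < n" for j by (rule body2[OF that])
  qed (auto simp: st2_def)
  let ?b2 = "[(rS, Lit 0), (rJ, Lit 0)]"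
  have 6: "runs (block ?b2) (st2 n) [] (block_size ?b2) s"
    by (rule runs_blockI) (use c' in \<open>auto simp: reg_degree_def st2_def fun_eq_iff\<close>)
  have sl: "sum_list (map x [0..<n]) = S n"
    by (simp add: S_def interv_sum_list_conv_sum_set_nat atLeast0LessThan)
  have k: "3 + (n * ((100 * nb + 250) + 1) + 1 + (block_size ?b + (100 * nb + 300 + (n * ((200 * nb + 550) + 1) + 1 + block_size ?b2)))) \<le> n * (400 * nb + 1300)"
  proof -
    have "1 * (100 * nb + 400) \<le> n * (100 * nb + 400)" using n(2) by (intro mult_right_mono) auto
    thus ?thesis by (simp add: algebra_simps)
  qed
  show ?thesis unfolding emit_def
    by (rule runs_eq[OF runs_Seq[OF 1 runs_Seq[OF 2 runs_Seq[OF 3 runs_Seq[OF 4[unfolded e4] runs_Seq[OF 5 6]]]]] _ k refl])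
       (simp add: point_out_def x_def[symmetric] sl power3_eq_cube mult.assoc o_def)
qed

end

definition lg :: "nat \<Rightarrow> nat" where "lg n = (LEAST k. n \<le> 2 ^ k)"

lemma lg_ge: "n \<le> 2 ^ lg n"
  unfolding lg_def by (rule LeastI[of _ n]) (simp add: less_imp_le)

lemma lg_less: "k < lg n \<Longrightarrow> 2 ^ k < n"
  unfolding lg_def using not_less_Least[of k "\<lambda>k. n \<le> 2 ^ k"] by simp

lemma lg_le: "lg n \<le> n"
  unfolding lg_def by (rule Least_le) (simp add: less_imp_le)

lemma two_pow_lg_less: assumes "n \<ge> 1" shows "2 ^ lg n < 2 * n"
proof (cases "lg n")
  case 0 thus ?thesis using assms by simp
next
  case (Suc k)
  thus ?thesis using lg_less[of k n] by simp
qed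

section \<open>The family of formulas\<close>

text \<open>Integer points and weights; the formula itself arises by scaling each point to the simplex, which
  multiplies its weight by \<open>(sum_list q) ^ 3\<close>, and by dividing the weights by \<open>common_denom\<close>.
  The sign points, with levels 1 and \<open>fam_q\<close>, have almost the moments required; the spikes correct the
  coefficients of \<open>[i = j]\<close> and of \<open>[i = j = k]\<close>, and the centre corrects the constant, which it can do with
  a positive weight because \<open>fam_m\<close> is large.  The parameter \<open>b\<close> selects the boundary formula, where the
  vertices replace one of the two copies of the spikes.\<close>

context
  fixes b :: bool and n :: nat
begin

definition fam_m :: int where "fam_m = 8 * int n"
text \<open>The levels 1 and \<open>2 m^2 + 1\<close> are \<open>(m^2 + 1) - m^2\<close> and
  \<open>(m^2 + 1) + m^2\<close>. The ratio of mean to deviation is \<open>1 + 1 / m^2\<close>, so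
  close to 1 that the excess in the constant moment is smaller than the reduction by
  \<open>k / m\<close> of the weight.\<close>

definition fam_q :: int where "fam_q = 2 * fam_m * fam_m + 1"
definition fam_l :: nat where "fam_l = 2 ^ lg n"
text \<open>The number of copies of the spikes. Each copy contributes \<open>1 / m\<close> to the
  coefficient of \<open>[i = j]\<close>, so the sign points are left with
  \<open>1 - k / m\<close>.\<close>

definition fam_k :: int where "fam_k = (if b then 1 else 2)"

text \<open>This is \<open>2 l m^5 (m^2 + 1) n (n + 1) (n + 2)\<close>. Relative to
  \<open>2 l m^5 (m^2 + 1)\<close> the weights are 1 for vertices, \<open>1 / m^3\<close> for spikes
  and \<open>center_coeff / m^5\<close> for the centre. The nesting follows the program's
  expression, so that evaluation produces it literally.\<close>

definition common_denom :: int where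
  "common_denom = 2 * (int fam_l * (fam_m * (fam_m * (fam_m * (fam_m * (fam_m * ((fam_m * fam_m + 1) *
     (int n * ((int n + 1) * (int n + 2))))))))))"

definition inner_weight :: int where "inner_weight = 2 * (int fam_l * (fam_m * (fam_m * (fam_m * fam_m + 1))))"
definition vertex_weight :: int where
  "vertex_weight = 2 * (int fam_l * (fam_m * (fam_m * (fam_m * (fam_m * (fam_m * (fam_m * fam_m + 1)))))))"
text \<open>Horner form of \<open>m^5 - (m - k) (m^2 + 1)^2 - k (n m^2 + 3 m^3)\<close>: the
  constant moment, scaled by \<open>m^5\<close>, that sign points and spikes leave over.\<close>

definition center_coeff :: int where
  "center_coeff = fam_m * (fam_m * (fam_m * (fam_k * fam_m - (2 + 3 * fam_k)) + (2 * fam_k - fam_k * int n)) - 1) + fam_k"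
definition center_weight :: int where "center_weight = 2 * (int fam_l * ((fam_m * fam_m + 1) * center_coeff))"

definition spike :: "int \<Rightarrow> int \<Rightarrow> nat \<Rightarrow> int list" where
  "spike lo hi i = map (\<lambda>j. if j = i then hi else lo) [0..<n]"

definition sign_point :: "nat \<Rightarrow> nat \<Rightarrow> int list" where
  "sign_point f r = map (\<lambda>j. if (f + parity r j) mod 2 = 1 then 1 else fam_q) [0..<n]"

definition first_points :: "(int \<times> int list) list" where
  "first_points = map (\<lambda>i. (if b then vertex_weight else inner_weight, spike (if b then 0 else 1) (if b then 1 else fam_m + 1) i)) [0..<n]"

definition int_points :: "(int \<times> int list) list" where
  "int_points = first_points @ map (\<lambda>i. (inner_weight, spike 1 (fam_m + 1) i)) [0..<n] @
    concat (map (\<lambda>r. [(fam_m - fam_k, sign_point 0 r), (fam_m - fam_k, sign_point 1 r)]) [0..<fam_l]) @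
    [(center_weight, spike 1 1 0)]"

text \<open>The leading term \<open>k m^4\<close> wins. The Horner form is estimated from the inside
  outwards; \<open>m \<ge> 16\<close> makes the innermost factor at least \<open>11 k\<close>, and
  \<open>n \<le> m\<close> absorbs the term with \<open>n\<close>.\<close>

lemma center_coeff_pos:
  assumes "n \<ge> 2" shows "center_coeff > 0"
proof -
  define m where "m = fam_m"
  have m: "m \<ge> 16" "int n \<le> m" using assms by (auto simp: m_def fam_m_def)
  have k: "fam_k = 1 \<or> fam_k = 2" by (auto simp: fam_k_def)
  have "11 * fam_k \<le> fam_k * m - (2 + 3 * fam_k)" using k m by auto
  hence "m * (11 * fam_k) \<le> m * (fam_k * m - (2 + 3 * fam_k))" using m by (intro mult_left_mono) auto
  moreover have "1 \<le> m * (11 * fam_k) + (2 * fam_k - fam_k * int n)" using k m by auto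
  ultimately have "1 \<le> m * (fam_k * m - (2 + 3 * fam_k)) + (2 * fam_k - fam_k * int n)" by linarith
  hence "m * 1 \<le> m * (m * (fam_k * m - (2 + 3 * fam_k)) + (2 * fam_k - fam_k * int n))" using m by (intro mult_left_mono) auto
  hence "0 \<le> m * (m * (fam_k * m - (2 + 3 * fam_k)) + (2 * fam_k - fam_k * int n)) - 1" using m by linarith
  hence "0 \<le> m * (m * (m * (fam_k * m - (2 + 3 * fam_k)) + (2 * fam_k - fam_k * int n)) - 1)" using m by (intro mult_nonneg_nonneg) auto
  thus ?thesis using k unfolding center_coeff_def m_def[symmetric] by auto
qed

end

definition double_body :: com where
  "double_body = Seq (assign rL (emul (Lit 2) (Var rL))) (assign rC (esub (Var rN) (Var rL)))"

abbreviation "m2p1 \<equiv> eadd (emul (Var rM) (Var rM)) (Lit 1)"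

definition denom_exp :: exp where
  "denom_exp = emul (Lit 2) (emul (Var rL) (emul (Var rM) (emul (Var rM) (emul (Var rM) (emul (Var rM) (emul (Var rM)
     (emul m2p1 (emul (Var rN) (emul (eadd (Var rN) (Lit 1)) (eadd (Var rN) (Lit 2)))))))))))"

definition inner_exp :: exp where
  "inner_exp = emul (Lit 2) (emul (Var rL) (emul (Var rM) (emul (Var rM) m2p1)))"

definition vertex_exp :: exp where
  "vertex_exp = emul (Lit 2) (emul (Var rL) (emul (Var rM) (emul (Var rM) (emul (Var rM) (emul (Var rM) (emul (Var rM) m2p1))))))"

definition center_exp :: "bool \<Rightarrow> exp" where
  "center_exp b = emul (Lit 2) (emul (Var rL) (emul m2p1 (eadd (emul (Var rM) (esub (emul (Var rM) (eadd
     (emul (Var rM) (esub (emul (Lit (fam_k b)) (Var rM)) (Lit (2 + 3 * fam_k b))))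
     (esub (Lit (2 * fam_k b)) (emul (Lit (fam_k b)) (Var rN))))) (Lit 1))) (Lit (fam_k b)))))"

text \<open>The input is the dimension \<open>d\<close>; adding 1 gives the number \<open>n\<close>
  of coordinates. The loop doubles \<open>rL\<close> until it reaches \<open>n\<close>.\<close>

definition init :: "bool \<Rightarrow> com" where
  "init b = Seq (assign rN (eadd (Var rN) (Lit 1))) (Seq (assign rM (emul (Lit 8) (Var rN)))
    (Seq (block [(rQ, eadd (emul (emul (Lit 2) (Var rM)) (Var rM)) (Lit 1)), (rL, Lit 1)]) (Seq (assign rC (esub (Var rN) (Var rL)))
    (Seq (WhilePos rC double_body)
      (block [(rC, Lit 0), (rD, denom_exp), (rKind, Lit 1), (rI, Var rN), (rW, if b then vertex_exp else inner_exp),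
        (rLo, Lit (if b then 0 else 1)), (rHi, if b then Lit 1 else eadd (Var rM) (Lit 1))])))))"

definition prog :: "bool \<Rightarrow> com" where
  "prog b = Seq (init b) (Seq vertex_loop
    (Seq (block [(rIdx, Lit 0), (rI, Var rN), (rW, inner_exp), (rLo, Lit 1), (rHi, eadd (Var rM) (Lit 1))]) (Seq vertex_loop
    (Seq (block [(rIdx, Lit 0), (rKind, Lit 0), (rI, Var rL), (rW, esub (Var rM) (Lit (fam_k b))), (rHi, Var rQ)]) (Seq sign_loop
    (Seq (block [(rIdx, Lit 0), (rKind, Lit 1), (rW, center_exp b), (rHi, Lit 1)]) emit))))))"

context ram
begin

lemma runs_step_I:
  assumes "0 \<le> r" "r < 100" "r \<noteq> rIdx" "s r = int n" "s rIdx = int j" "j < n" "reg_degree r = 1"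
  shows "runs (step_I r) s [] 8 (s(rIdx := int (Suc j), rI := int n - int (Suc j)))"
proof -
  have nN: "int n \<le> N0" if "wf s'" "s' r = int n" for s'
    using wfD[OF that(1), of r] that(2) assms by simp
  have 1: "runs (assign rIdx (eadd (Var rIdx) (Lit 1))) s [] 4 (s(rIdx := int (Suc j)))"
    using nN[of s] assms by (intro runs_assignI) (auto simp: reg_degree_def)
  have 2: "runs (assign rI (esub (Var r) (Var rIdx))) (s(rIdx := int (Suc j))) [] 4 (s(rIdx := int (Suc j), rI := int n - int (Suc j)))"
    using nN[of "s(rIdx := int (Suc j))"] assms by (intro runs_assignI) (auto simp: reg_degree_def)
  show ?thesis unfolding step_I_def by (rule runs_eq[OF runs_Seq[OF 1 2]]) auto
qed

lemma clean_upd: "clean s \<Longrightarrow> r \<notin> {rS, rJ, rX, rU, rV, rT, rP, rA, rB, rC} \<Longrightarrow> clean (s(r := v))"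
  by (auto simp: clean_def)

lemma runs_vertex_loop:
  assumes c: "clean s" and n: "s rN = int n" "n \<ge> 1" and i: "s rIdx = 0" "s rI = int n" "s rFlip = 0" "s rKind = 1"
    and w: "s rW \<ge> 0" "s rD > 0" and lh: "s rLo \<ge> 0" "s rHi > 0"
  shows "runs vertex_loop s (concat (map (\<lambda>i. point_out (s rD) (s rW, spike n (s rLo) (s rHi) i)) [0..<n]))
     (n * (n * (400 * nb + 1300) + 9) + 1) (s(rIdx := int n, rI := 0))"
proof -
  define st where "st = (\<lambda>i. s(rIdx := int i, rI := int n - int i))"
  have body: "runs (Seq emit (step_I rN)) (st i) (point_out (s rD) (s rW, spike n (s rLo) (s rHi) i)) (n * (400 * nb + 1300) + 8) (st (Suc i))"
    if "i < n" for i
  proof -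
    have cv: "coord_value (st i) j = (if j = i then s rHi else s rLo)" for j
      using assms by (simp add: coord_value_def st_def)
    have "0 < (\<Sum>j<n. coord_value (st i) j)"
      using that lh by (intro sum_pos2[of _ i]) (auto simp: cv)
    hence "runs emit (st i) (point_out (st i rD) (st i rW, map (coord_value (st i)) [0..<n])) (n * (400 * nb + 1300)) (st i)"
      using assms by (intro runs_emit) (auto simp: st_def intro!: clean_upd)
    moreover have "map (coord_value (st i)) [0..<n] = spike n (s rLo) (s rHi) i" by (simp add: spike_def cv)
    ultimately have 1: "runs emit (st i) (point_out (s rD) (s rW, spike n (s rLo) (s rHi) i)) (n * (400 * nb + 1300)) (st i)"
      by (simp add: st_def)
    have 2: "runs (step_I rN) (st i) [] 8 ((st i)(rIdx := int (Suc i), rI := int n - int (Suc i)))"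
      by (rule runs_step_I) (use that n in \<open>auto simp: st_def reg_degree_def\<close>)
    show ?thesis by (rule runs_eq[OF runs_Seq[OF 1 2]]) (auto simp: st_def fun_eq_iff)
  qed
  have l: "runs vertex_loop (st 0) (concat (map (\<lambda>i. point_out (s rD) (s rW, spike n (s rLo) (s rHi) i)) [0..<n])) (n * ((n * (400 * nb + 1300) + 8) + 1) + 1) (st n)"
    unfolding vertex_loop_def
  proof (rule runs_for)
    show "runs (Seq emit (step_I rN)) (st i) (point_out (s rD) (s rW, spike n (s rLo) (s rHi) i)) (n * (400 * nb + 1300) + 8) (st (Suc i))" if "i < n" for i
      by (rule body[OF that])
  qed (auto simp: st_def)
  have "st 0 = s" using i by (auto simp: st_def fun_eq_iff)
  thus ?thesis using l by (intro runs_eq[OF l[unfolded \<open>st 0 = s\<close>]]) (auto simp: st_def fun_eq_iff)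
qed

lemma runs_sign_loop:
  assumes c: "clean s" and n: "s rN = int n" "n \<ge> 1" and i: "s rIdx = 0" "s rI = int l" "s rL = int l" "s rFlip = 0" "s rKind = 0"
    and w: "s rW \<ge> 0" "s rD > 0" and lh: "s rLo = 1" "s rHi = fam_q n"
  shows "runs sign_loop s (concat (map (\<lambda>r. point_out (s rD) (s rW, sign_point n 0 r) @ point_out (s rD) (s rW, sign_point n 1 r)) [0..<l]))
     (l * (2 * n * (400 * nb + 1300) + 17) + 1) (s(rIdx := int l, rI := 0))"
proof -
  define st where "st = (\<lambda>i. s(rIdx := int i, rI := int l - int i))"
  have q: "fam_q n \<ge> 1" by (simp add: fam_q_def)
  have body: "runs (Seq emit (Seq (block [(rFlip, Lit 1)]) (Seq emit (Seq (block [(rFlip, Lit 0)]) (step_I rL))))) (st i)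
     (point_out (s rD) (s rW, sign_point n 0 i) @ point_out (s rD) (s rW, sign_point n 1 i)) (2 * n * (400 * nb + 1300) + 16) (st (Suc i))"
    if "i < l" for i
  proof -
    have em: "runs emit ((st i)(rFlip := int f)) (point_out (s rD) (s rW, sign_point n f i)) (n * (400 * nb + 1300)) ((st i)(rFlip := int f))"
      if "f = 0 \<or> f = 1" for f :: nat
    proof -
      let ?s = "(st i)(rFlip := int f)"
      have cv: "coord_value ?s j = (if (f + parity i j) mod 2 = 1 then 1 else fam_q n)" for j
        using assms by (simp add: coord_value_def st_def)
      have "0 < (\<Sum>j<n. coord_value ?s j)"
        using n q by (intro sum_pos) (auto simp: cv lessThan_empty_iff)
      hence "runs emit ?s (point_out (?s rD) (?s rW, map (coord_value ?s) [0..<n])) (n * (400 * nb + 1300)) ?s"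
        using assms that q by (intro runs_emit) (auto simp: st_def intro!: clean_upd)
      moreover have "map (coord_value ?s) [0..<n] = sign_point n f i" by (simp add: sign_point_def cv)
      moreover have "?s rD = s rD" "?s rW = s rW" by (simp_all add: st_def)
      ultimately show ?thesis by (simp only:)
    qed
    have e0: "(st i)(rFlip := int 0) = st i" using i by (auto simp: st_def fun_eq_iff)
    note 1 = em[of 0, unfolded e0]
    have 2: "runs (block [(rFlip, Lit 1)]) (st i) [] 3 ((st i)(rFlip := int 1))"
      by (rule runs_blockI) (simp_all add: reg_degree_def)
    note 3 = em[of 1]
    have 4: "runs (block [(rFlip, Lit 0)]) ((st i)(rFlip := int 1)) [] 3 (st i)"
      by (rule runs_blockI) (use i in \<open>auto simp: reg_degree_def st_def fun_eq_iff\<close>)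
    have 5: "runs (step_I rL) (st i) [] 8 ((st i)(rIdx := int (Suc i), rI := int l - int (Suc i)))"
      by (rule runs_step_I) (use that i in \<open>auto simp: st_def reg_degree_def\<close>)
    show ?thesis
      by (rule runs_eq[OF runs_Seq[OF 1 runs_Seq[OF 2 runs_Seq[OF 3 runs_Seq[OF 4 5]]]]]) (auto simp: st_def fun_eq_iff)
  qed
  have lp: "runs sign_loop (st 0) (concat (map (\<lambda>r. point_out (s rD) (s rW, sign_point n 0 r) @ point_out (s rD) (s rW, sign_point n 1 r)) [0..<l]))
     (l * ((2 * n * (400 * nb + 1300) + 16) + 1) + 1) (st l)"
    unfolding sign_loop_def
  proof (rule runs_for)
    show "runs (Seq emit (Seq (block [(rFlip, Lit 1)]) (Seq emit (Seq (block [(rFlip, Lit 0)]) (step_I rL))))) (st i)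
     (point_out (s rD) (s rW, sign_point n 0 i) @ point_out (s rD) (s rW, sign_point n 1 i)) (2 * n * (400 * nb + 1300) + 16) (st (Suc i))" if "i < l" for i
      by (rule body[OF that])
  qed (auto simp: st_def)
  have "st 0 = s" using i by (auto simp: st_def fun_eq_iff)
  thus ?thesis by (intro runs_eq[OF lp[unfolded \<open>st 0 = s\<close>]]) (auto simp: st_def fun_eq_iff)
qed

definition init_state :: "bool \<Rightarrow> nat \<Rightarrow> int \<Rightarrow> int" where
  "init_state b n = (\<lambda>_. 0)(rN := int n, rM := fam_m n, rQ := fam_q n, rL := int (fam_l n), rD := common_denom n, rKind := 1, rI := int n,
    rW := (if b then vertex_weight n else inner_weight n), rLo := (if b then 0 else 1), rHi := (if b then 1 else fam_m n + 1))"

lemma runs_init: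
  assumes N0: "N0 = 100 * int n" and n: "n = Suc d" "n \<ge> 2"
  shows "runs (init b) ((\<lambda>_. 0)(0 := int d)) [] (20 * n + 200) (init_state b n)"
proof -
  let ?s0 = "(\<lambda>_::int. 0::int)(0 := int d)"
  let ?s1 = "(\<lambda>_::int. 0::int)(rN := int n)"
  let ?s2 = "?s1(rM := fam_m n)"
  let ?s3 = "?s2(rQ := fam_q n, rL := 1)"
  define st where "st = (\<lambda>i::nat. ?s2(rQ := fam_q n, rL := 2 ^ i, rC := int n - 2 ^ i))"
  have 1: "runs (assign rN (eadd (Var rN) (Lit 1))) ?s0 [] 4 ?s1"
    by (rule runs_assignI) (use N0 n in \<open>auto simp: reg_degree_def fun_eq_iff\<close>)
  have 2: "runs (assign rM (emul (Lit 8) (Var rN))) ?s1 [] 4 ?s2"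
    by (rule runs_assignI) (use N0 n in \<open>auto simp: reg_degree_def fam_m_def\<close>)
  have 3: "runs (block [(rQ, eadd (emul (emul (Lit 2) (Var rM)) (Var rM)) (Lit 1)), (rL, Lit 1)]) ?s2 [] 20 ?s3"
    by (rule runs_blockI) (auto simp: reg_degree_def fam_q_def fun_eq_iff)
  have 4: "runs (assign rC (esub (Var rN) (Var rL))) ?s3 [] 4 (st 0)"
    by (rule runs_assignI) (use N0 n in \<open>auto simp: reg_degree_def st_def fun_eq_iff\<close>)
  have body: "runs double_body (st i) [] 8 (st (Suc i))" if "i < lg n" for i
  proof -
    have "2 ^ i < n" using lg_less[OF that] .
    hence lt: "(2::int) ^ i < int n" by (metis of_nat_less_iff of_nat_numeral of_nat_power)
    have p: "(2::int) ^ i > 0" by simp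
    have a: "runs (assign rL (emul (Lit 2) (Var rL))) (st i) [] 4 ((st i)(rL := 2 ^ Suc i))"
      by (rule runs_assignI) (use N0 n lt in \<open>auto simp: reg_degree_def st_def\<close>)
    have b: "runs (assign rC (esub (Var rN) (Var rL))) ((st i)(rL := 2 ^ Suc i)) [] 4 (st (Suc i))"
    proof (rule runs_assignI[where v = "int n - 2 * 2 ^ i"])
      have "int n - 2 * 2 ^ i \<le> N0" "- (int n - 2 * 2 ^ i) \<le> N0" using lt p N0 n(2) by linarith+
      thus "\<bar>int n - 2 * 2 ^ i\<bar> \<le> N0 ^ reg_degree rC" by (simp add: reg_degree_def abs_le_iff)
    qed (auto simp: reg_degree_def st_def fun_eq_iff)
    show ?thesis unfolding double_body_def by (rule runs_eq[OF runs_Seq[OF a b]]) auto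
  qed
  have 5: "runs (WhilePos rC double_body) (st 0) (concat (map (\<lambda>_. []) [0..<lg n])) (lg n * (8 + 1) + 1) (st (lg n))"
  proof (rule runs_for)
    show "runs double_body (st i) [] 8 (st (Suc i))" if "i < lg n" for i by (rule body[OF that])
    show "0 < st i rC" if "i < lg n" for i
    proof -
      have "2 ^ i < n" using lg_less[OF that] .
      hence "(2::int) ^ i < int n" by (metis of_nat_less_iff of_nat_numeral of_nat_power)
      thus ?thesis by (simp add: st_def)
    qed
    have "int n \<le> 2 ^ lg n" using lg_ge[of n] by (metis of_nat_le_iff of_nat_numeral of_nat_power)
    thus "\<not> 0 < st (lg n) rC" by (simp add: st_def)
  qed auto
  let ?b = "[(rC, Lit 0), (rD, denom_exp), (rKind, Lit 1), (rI, Var rN), (rW, if b then vertex_exp else inner_exp),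
        (rLo, Lit (if b then 0 else 1)), (rHi, if b then Lit 1 else eadd (Var rM) (Lit 1))]"
  have 6: "runs (block ?b) (st (lg n)) [] 150 (init_state b n)"
    by (rule runs_blockI)
       (auto simp: reg_degree_def st_def fun_eq_iff init_state_def denom_exp_def vertex_exp_def inner_exp_def common_denom_def
          vertex_weight_def inner_weight_def fam_l_def)
  show ?thesis unfolding init_def
    by (rule runs_eq[OF runs_Seq[OF 1 runs_Seq[OF 2 runs_Seq[OF 3 runs_Seq[OF 4 runs_Seq[OF 5 6]]]]]]) (use lg_le[of n] in auto)
qed

theorem runs_prog:
  assumes N0: "N0 = 100 * int n" and n: "n = Suc d" "n \<ge> 2"
  shows "\<exists>s'. runs (prog b) ((\<lambda>_. 0)(0 := int d)) (concat (map (point_out (common_denom n)) (int_points b n))) (8 * n * (n * (400 * nb + 1300))) s'"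
proof -
  define k where "k = n * (400 * nb + 1300)"
  have lpos: "int (fam_l n) > 0" by (simp add: fam_l_def)
  have mpos: "fam_m n > 0" using n by (simp add: fam_m_def)
  have qpos: "fam_q n > 0" using mpos by (simp add: fam_q_def add_pos_pos)
  have m2: "fam_m n * fam_m n + 1 > 0" by (simp add: add_nonneg_pos)
  have Dpos: "common_denom n > 0" unfolding common_denom_def using lpos mpos m2 n by (intro mult_pos_pos) auto
  have w: "vertex_weight n > 0" "inner_weight n > 0" unfolding vertex_weight_def inner_weight_def using lpos mpos m2 by (intro mult_pos_pos; simp)+
  have cw: "center_weight b n > 0" unfolding center_weight_def using lpos m2 center_coeff_pos[OF n(2), of b] by (intro mult_pos_pos) auto
  have kk: "fam_m n - fam_k b \<ge> 0" using n by (simp add: fam_m_def fam_k_def)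
  let ?s1 = "init_state b n"
  have cl: "clean ?s1" by (simp add: init_state_def clean_def)
  have 1: "runs (init b) ((\<lambda>_. 0)(0 := int d)) [] (20 * n + 200) ?s1" by (rule runs_init[OF N0 n])
  let ?D = "common_denom n"
  let ?o2 = "concat (map (\<lambda>i. point_out ?D (if b then vertex_weight n else inner_weight n, spike n (if b then 0 else 1) (if b then 1 else fam_m n + 1) i)) [0..<n])"
  have 2: "runs vertex_loop ?s1 ?o2 (n * (k + 9) + 1) (?s1(rIdx := int n, rI := 0))"
    using runs_vertex_loop[OF cl, of n] n Dpos w mpos unfolding k_def by (simp add: init_state_def split del: if_split) (auto split: if_splits)
  let ?b3 = "[(rIdx, Lit 0), (rI, Var rN), (rW, inner_exp), (rLo, Lit 1), (rHi, eadd (Var rM) (Lit 1))]"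
  let ?s3 = "?s1(rIdx := 0, rI := int n, rW := inner_weight n, rLo := 1, rHi := fam_m n + 1)"
  have 3: "runs (block ?b3) (?s1(rIdx := int n, rI := 0)) [] 50 ?s3"
    by (rule runs_blockI) (auto simp: reg_degree_def fun_eq_iff init_state_def inner_exp_def inner_weight_def)
  let ?o4 = "concat (map (\<lambda>i. point_out ?D (inner_weight n, spike n 1 (fam_m n + 1) i)) [0..<n])"
  have cl3: "clean ?s3" using cl by (simp add: clean_def)
  have 4: "runs vertex_loop ?s3 ?o4 (n * (k + 9) + 1) (?s3(rIdx := int n, rI := 0))"
  proof -
    have "?s3 rD = ?D" "?s3 rW = inner_weight n" "?s3 rLo = 1" "?s3 rHi = fam_m n + 1" by (simp_all add: init_state_def)
    moreover have "runs vertex_loop ?s3 (concat (map (\<lambda>i. point_out (?s3 rD) (?s3 rW, spike n (?s3 rLo) (?s3 rHi) i)) [0..<n])) (n * (k + 9) + 1) (?s3(rIdx := int n, rI := 0))"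
      unfolding k_def by (rule runs_vertex_loop[OF cl3]) (use n Dpos w mpos in \<open>auto simp: init_state_def\<close>)
    ultimately show ?thesis by (simp only:)
  qed
  let ?b5 = "[(rIdx, Lit 0), (rKind, Lit 0), (rI, Var rL), (rW, esub (Var rM) (Lit (fam_k b))), (rHi, Var rQ)]"
  let ?s5 = "?s3(rIdx := 0, rKind := 0, rI := int (fam_l n), rW := fam_m n - fam_k b, rHi := fam_q n)"
  have 5: "runs (block ?b5) (?s3(rIdx := int n, rI := 0)) [] 50 ?s5"
    by (rule runs_blockI) (auto simp: reg_degree_def fun_eq_iff init_state_def fam_k_def)
  let ?o6 = "concat (map (\<lambda>r. point_out ?D (fam_m n - fam_k b, sign_point n 0 r) @ point_out ?D (fam_m n - fam_k b, sign_point n 1 r)) [0..<fam_l n])"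
  have cl5: "clean ?s5" using cl by (simp add: clean_def)
  have 6: "runs sign_loop ?s5 ?o6 (fam_l n * (2 * n * (400 * nb + 1300) + 17) + 1) (?s5(rIdx := int (fam_l n), rI := 0))"
  proof -
    have "?s5 rD = ?D" "?s5 rW = fam_m n - fam_k b" by (simp_all add: init_state_def)
    moreover have "runs sign_loop ?s5 (concat (map (\<lambda>r. point_out (?s5 rD) (?s5 rW, sign_point n 0 r) @ point_out (?s5 rD) (?s5 rW, sign_point n 1 r)) [0..<fam_l n]))
      (fam_l n * (2 * n * (400 * nb + 1300) + 17) + 1) (?s5(rIdx := int (fam_l n), rI := 0))"
      by (rule runs_sign_loop[OF cl5]) (use n Dpos kk in \<open>auto simp: init_state_def\<close>)
    ultimately show ?thesis by (simp only:)
  qed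
  let ?b7 = "[(rIdx, Lit 0), (rKind, Lit 1), (rW, center_exp b), (rHi, Lit 1)]"
  let ?s7 = "?s5(rIdx := 0, rKind := 1, rI := 0, rW := center_weight b n, rHi := 1)"
  have 7: "runs (block ?b7) (?s5(rIdx := int (fam_l n), rI := 0)) [] 80 ?s7"
    by (rule runs_blockI) (auto simp: reg_degree_def fun_eq_iff init_state_def center_exp_def center_weight_def center_coeff_def fam_k_def)
  have cv: "coord_value ?s7 j = 1" for j by (simp add: coord_value_def init_state_def)
  have pos7: "0 < (\<Sum>j<n. coord_value ?s7 j)" unfolding cv using n by simp
  have 8: "runs emit ?s7 (point_out ?D (center_weight b n, spike n 1 1 0)) k ?s7"
  proof -
    have "?s7 rD = ?D" "?s7 rW = center_weight b n" by (simp_all add: init_state_def)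
    moreover have "map (coord_value ?s7) [0..<n] = spike n 1 1 0" unfolding cv by (simp add: spike_def)
    moreover have "runs emit ?s7 (point_out (?s7 rD) (?s7 rW, map (coord_value ?s7) [0..<n])) k ?s7"
      unfolding k_def
    proof (rule runs_emit[OF _ _ _ _ _ _ _ _ _ pos7])
      show "clean ?s7" using cl by (simp add: clean_def)
      show "1 \<le> n" using n(2) by simp
      show "0 \<le> ?s7 rW" using cw by simp
      show "0 < ?s7 rD" using Dpos by (simp add: init_state_def)
    qed (simp_all add: init_state_def)
    ultimately show ?thesis by (simp only:)
  qed
  have out: "[] @ ?o2 @ [] @ ?o4 @ [] @ ?o6 @ [] @ point_out ?D (center_weight b n, spike n 1 1 0) = concat (map (point_out ?D) (int_points b n))"
  proof -
    have "concat (map (\<lambda>r. f (c, x r) @ f (c, y r)) xs) = concat (map f (concat (map (\<lambda>r. [(c, x r), (c, y r)]) xs)))"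
      for f :: "int \<times> int list \<Rightarrow> int list" and c :: int and x y :: "nat \<Rightarrow> int list" and xs by (induction xs) auto
    thus ?thesis unfolding int_points_def first_points_def by (simp add: o_def)
  qed
  \<comment> \<open>The two spike loops cost about \<open>2 n k\<close>; the sign loop emits
    \<open>2 l\<close> points, which by \<open>l \<le> 2 n\<close> costs about \<open>4 n k\<close>.
    The rest absorbs the centre and the overhead.\<close>
  have kle: "20 * n + 200 + (n * (k + 9) + 1 + (50 + (n * (k + 9) + 1 + (50 + (fam_l n * (2 * n * (400 * nb + 1300) + 17) + 1 + (80 + k)))))) \<le> 8 * n * k"
  proof -
    have l: "fam_l n \<le> 2 * n" using two_pow_lg_less[of n] n by (simp add: fam_l_def)
    have "fam_l n * (2 * n * (400 * nb + 1300) + 17) \<le> (2 * n) * (2 * n * (400 * nb + 1300) + 17)" by (rule mult_right_mono[OF l]) simp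
    also have "\<dots> = 4 * (n * k) + 34 * n" by (simp add: k_def algebra_simps)
    finally have a: "fam_l n * (2 * n * (400 * nb + 1300) + 17) \<le> 4 * (n * k) + 34 * n" .
    have "2 * 1300 \<le> k" unfolding k_def using n by (intro mult_mono) auto
    moreover have "2 * k \<le> n * k" using n by (intro mult_right_mono) auto
    moreover have "n * 2600 \<le> n * k" using \<open>2 * 1300 \<le> k\<close> by (intro mult_left_mono) auto
    ultimately show ?thesis using a n by (simp add: algebra_simps)
  qed
  have "runs (prog b) ((\<lambda>_. 0)(0 := int d)) (concat (map (point_out ?D) (int_points b n))) (8 * n * k) ?s7"
    unfolding prog_def
    by (rule runs_eq[OF runs_Seq[OF 1 runs_Seq[OF 2 runs_Seq[OF 3 runs_Seq[OF 4 runs_Seq[OF 5 runs_Seq[OF 6 runs_Seq[OF 7 8]]]]]]] out kle refl])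
  thus ?thesis unfolding k_def by blast
qed

end

section \<open>Sylvester matrices and the moments of the family\<close>

lemma parity_rec: "parity r j = (parity (r div 2) (j div 2) + (r mod 2) * (j mod 2)) mod 2"
  by (cases "r = 0") (auto simp: parity_pos)

definition sylvester :: "nat \<Rightarrow> nat \<Rightarrow> real" where "sylvester r j = (-1) ^ parity r j"

lemma minus_one_power_mod: "(-1 :: real) ^ (a mod 2) = (-1) ^ a"
  by (cases "even a") (auto simp: even_iff_mod_2_eq_zero odd_iff_mod_2_eq_one)

lemma sylvester_rec: "sylvester r j = sylvester (r div 2) (j div 2) * (-1) ^ ((r mod 2) * (j mod 2))"
  unfolding sylvester_def by (subst parity_rec) (simp add: minus_one_power_mod power_add)

text \<open>The matrix is a Kronecker power. Splitting off the lowest binary digit of the row index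
  leaves the factor \<open>1 + (-1) ^ (i mod 2) * (-1) ^ (j mod 2)\<close>, which vanishes when the
  lowest digits of \<open>i\<close> and \<open>j\<close> differ.\<close>

lemma sylvester_orthogonal:
  "i < 2 ^ k \<Longrightarrow> j < 2 ^ k \<Longrightarrow> (\<Sum>r<2 ^ k. sylvester r i * sylvester r j) = 2 ^ k * of_bool (i = j)"
proof (induction k arbitrary: i j)
  case 0
  thus ?case by (simp add: sylvester_def)
next
  case (Suc k)
  let ?f = "\<lambda>r. sylvester r i * sylvester r j" and ?g = "\<lambda>r. sylvester r (i div 2) * sylvester r (j div 2)"
  have split: "(\<Sum>r<2 * N. h r) = (\<Sum>r<N. h (2 * r) + h (2 * r + 1))" for N and h :: "nat \<Rightarrow> real"
    by (induction N) auto
  have "?f (2 * r) + ?f (2 * r + 1) = ?g r * (1 + (-1) ^ (i mod 2) * (-1) ^ (j mod 2))" for r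
  proof -
    have d: "(2 * r) div 2 = r" "(2 * r + 1) div 2 = r" "(2 * r) mod 2 = 0" "(2 * r + 1) mod 2 = 1" by simp_all
    show ?thesis
      unfolding sylvester_rec[of "2 * r" i] sylvester_rec[of "2 * r" j] sylvester_rec[of "2 * r + 1" i] sylvester_rec[of "2 * r + 1" j] d
      by (simp add: algebra_simps)
  qed
  hence "(\<Sum>r<2 ^ Suc k. ?f r) = (\<Sum>r<2 ^ k. ?g r) * (1 + (-1) ^ (i mod 2) * (-1) ^ (j mod 2))"
    by (simp add: split sum_distrib_right)
  also have "(\<Sum>r<2 ^ k. ?g r) = 2 ^ k * of_bool (i div 2 = j div 2)"
    using Suc.prems by (intro Suc.IH) auto
  finally have e: "(\<Sum>r<2 ^ Suc k. ?f r) = 2 ^ k * of_bool (i div 2 = j div 2) * (1 + (-1) ^ (i mod 2) * (-1) ^ (j mod 2))" .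
  show ?case
  proof (cases "i mod 2 = j mod 2")
    case True
    hence "i = j \<longleftrightarrow> i div 2 = j div 2" by (metis div_mult_mod_eq)
    moreover have "(-1 :: real) ^ (i mod 2) * (-1) ^ (j mod 2) = 1" unfolding True by (simp flip: power_mult_distrib)
    ultimately show ?thesis using e by simp
  next
    case False
    hence "i mod 2 = 0 \<and> j mod 2 = 1 \<or> i mod 2 = 1 \<and> j mod 2 = 0" by auto
    thus ?thesis using e False by auto
  qed
qed

definition scale_points :: "real \<Rightarrow> (int \<times> int list) list \<Rightarrow> formula" where
  "scale_points c P = map (\<lambda>(w, q). (c * real_of_int w, map real_of_int q)) P"

text \<open>The factor \<open>n (n + 1) (n + 2)\<close> cancels the division in \<open>normalize_formula\<close>.\<close>

definition family :: "bool \<Rightarrow> nat \<Rightarrow> formula" where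
  "family b n = normalize_formula n
     (scale_points (real n * (real n + 1) * (real n + 2) / real_of_int (common_denom n)) (int_points b n))"

lemma fam_m_pos: "n \<ge> 1 \<Longrightarrow> fam_m n \<ge> 8" by (simp add: fam_m_def)

lemma common_denom_pos: "n \<ge> 1 \<Longrightarrow> common_denom n > 0"
  using fam_m_pos[of n] unfolding common_denom_def by (intro mult_pos_pos) (auto simp: fam_l_def add_pos_pos)

lemma int_points_cases:
  assumes "n \<ge> 2" "(w, q) \<in> set (int_points b n)"
  shows "w > 0 \<and> length q = n \<and> (\<forall>x\<in>set q. 0 \<le> x) \<and> sum_list q > 0 \<and> (\<not> b \<longrightarrow> (\<forall>x\<in>set q. 0 < x))"
proof -
  have l: "int (fam_l n) > 0" by (simp add: fam_l_def)
  have m: "fam_m n \<ge> 16" using assms(1) by (simp add: fam_m_def)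
  hence m0: "fam_m n > 0" by simp
  have m2: "fam_m n * fam_m n + 1 > 0" using m by (simp add: add_pos_pos)
  have q: "fam_q n > 0" using m by (simp add: fam_q_def add_pos_pos)
  have k: "fam_m n - fam_k b > 0" using m by (simp add: fam_k_def)
  have w1: "vertex_weight n > 0" unfolding vertex_weight_def using l m0 m2 by (intro mult_pos_pos) auto
  have w2: "inner_weight n > 0" unfolding inner_weight_def using l m0 m2 by (intro mult_pos_pos) auto
  have w3: "center_weight b n > 0" unfolding center_weight_def using l m2 center_coeff_pos[OF assms(1), of b] by (intro mult_pos_pos) auto
  have S: "sum_list q > 0" if q: "length q = n" "\<forall>x\<in>set q. 0 < x" for q :: "int list"
  proof -
    obtain x xs where qx: "q = x # xs" using q(1) assms(1) by (cases q) auto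
    hence "x > 0" "sum_list xs \<ge> 0" using q(2) by (auto simp: less_imp_le intro!: sum_list_nonneg)
    thus ?thesis unfolding qx by simp
  qed
  have V: "sum_list (spike n 0 1 i) = 1" if "i < n" for i
    unfolding spike_def by (subst interv_sum_list_conv_sum_set_nat) (use that in simp)
  have len: "length (spike n x y i) = n" "length (sign_point n f r) = n" for x y i f r by (simp_all add: spike_def sign_point_def)
  have sp: "z = x \<or> z = y" if "z \<in> set (spike n x y i)" for x y z i using that by (auto simp: spike_def split: if_splits)
  have sg: "z = 1 \<or> z = fam_q n" if "z \<in> set (sign_point n f r)" for z f r using that by (auto simp: sign_point_def split: if_splits)
  consider i where "i < n" "b" "w = vertex_weight n" "q = spike n 0 1 i" | i where "w = inner_weight n" "q = spike n 1 (fam_m n + 1) i"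
    | f r where "w = fam_m n - fam_k b" "q = sign_point n f r" | "w = center_weight b n" "q = spike n 1 1 0"
    using assms(2) unfolding int_points_def first_points_def by (cases b) auto
  thus ?thesis
  proof cases
    case 1
    thus ?thesis using w1 V len sp by fastforce
  next
    case 2
    hence p: "\<forall>x\<in>set q. 0 < x" using sp m0 by fastforce
    thus ?thesis using 2 w2 len S[OF _ p] by (auto simp: less_imp_le)
  next
    case 3
    hence p: "\<forall>x\<in>set q. 0 < x" using sg q by fastforce
    thus ?thesis using 3 k len S[OF _ p] by (auto simp: less_imp_le)
  next
    case 4
    hence p: "\<forall>x\<in>set q. 0 < x" using sp by fastforce
    thus ?thesis using 4 w3 len S[OF _ p] by (auto simp: less_imp_le)
  qed
qed

lemma formula_sum_scale_append: "formula_sum (scale_points c (P @ Q)) f = formula_sum (scale_points c P) f + formula_sum (scale_points c Q) f"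
  by (simp add: scale_points_def)

lemma formula_sum_scale_map:
  "formula_sum (scale_points c (map (\<lambda>i. (w, h i)) [0..<n])) f = c * of_int w * (\<Sum>i<n. f (map real_of_int (h i)))"
  using formula_sum_map_upt[of "c * of_int w" "\<lambda>i. map real_of_int (h i)" 0 n f]
  by (simp add: scale_points_def o_def lessThan_atLeast0)

lemma formula_sum_scale_concat:
  "formula_sum (scale_points c (concat (map h [0..<n]))) f = (\<Sum>i<n. formula_sum (scale_points c (h i)) f)"
  using formula_sum_concat[of "\<lambda>i. scale_points c (h i)" 0 n f]
  by (simp add: scale_points_def map_concat o_def lessThan_atLeast0)

lemma spike_moment:
  assumes "i < n" "j < n" "k < n"
  shows "(\<Sum>a<n. map real_of_int (spike n 1 (m + 1) a) ! i * map real_of_int (spike n 1 (m + 1) a) ! j * map real_of_int (spike n 1 (m + 1) a) ! k)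
    = real n + 3 * of_int m + of_int m ^ 2 * (of_bool (i = j) + of_bool (j = k) + of_bool (i = k)) + of_int m ^ 3 * of_bool (i = j \<and> j = k)"
proof -
  let ?m = "real_of_int m"
  define d where "d = (\<lambda>i a :: nat. of_bool (i = a) :: real)"
  have s1: "(\<Sum>a<n. d x a) = 1" if "x < n" for x using that by (simp add: d_def)
  have s2: "(\<Sum>a<n. d x a * d y a) = of_bool (x = y)" if "x < n" for x y
    using that by (cases "x = y") (auto simp: d_def if_distrib cong: if_cong intro!: sum.neutral)
  have s3: "(\<Sum>a<n. d x a * d y a * d z a) = of_bool (x = y \<and> y = z)" if "x < n" for x y z
    using that by (cases "x = y \<and> y = z") (auto simp: d_def if_distrib cong: if_cong intro!: sum.neutral)
  have nth: "map real_of_int (spike n 1 (m + 1) a) ! x = 1 + ?m * d x a" if "x < n" for x a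
    using that by (simp add: spike_def d_def)
  have "(\<Sum>a<n. map real_of_int (spike n 1 (m + 1) a) ! i * map real_of_int (spike n 1 (m + 1) a) ! j * map real_of_int (spike n 1 (m + 1) a) ! k)
     = (\<Sum>a<n. 1 + ?m * d i a + ?m * d j a + ?m * d k a + ?m ^ 2 * (d i a * d j a) + ?m ^ 2 * (d j a * d k a) + ?m ^ 2 * (d i a * d k a)
          + ?m ^ 3 * (d i a * d j a * d k a))"
    unfolding nth[OF assms(1)] nth[OF assms(2)] nth[OF assms(3)] by (intro sum.cong refl) (simp add: algebra_simps power2_eq_square power3_eq_cube)
  thus ?thesis unfolding sum.distrib sum_distrib_left[symmetric] s1[OF assms(1)] s1[OF assms(2)] s1[OF assms(3)] s2[OF assms(1)] s2[OF assms(2)] s3[OF assms(1)]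
    by (simp add: algebra_simps)
qed

lemma vertex_moment:
  assumes "i < n" "j < n" "k < n"
  shows "(\<Sum>a<n. map real_of_int (spike n 0 1 a) ! i * map real_of_int (spike n 0 1 a) ! j * map real_of_int (spike n 0 1 a) ! k)
    = of_bool (i = j \<and> j = k)"
proof -
  have "(\<Sum>a<n. map real_of_int (spike n 0 1 a) ! i * map real_of_int (spike n 0 1 a) ! j * map real_of_int (spike n 0 1 a) ! k)
     = (\<Sum>a<n. if i = a then of_bool (i = j \<and> j = k) else 0)"
    using assms by (intro sum.cong refl) (auto simp: spike_def)
  thus ?thesis using assms by simp
qed

text \<open>With coordinates \<open>P + Q s\<close> and \<open>P - Q s\<close> the odd powers of the
  signs cancel between the two points of a row. What remains is \<open>P^3\<close> and
  \<open>P Q^2\<close> times products of two signs, which orthogonality of the columns evaluates;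
  here \<open>P = M^2 + 1\<close> and \<open>Q = M^2\<close>.\<close>

lemma sign_moment:
  assumes "i < n" "j < n" "k < n"
  defines "M \<equiv> real_of_int (fam_m n)"
  shows "(\<Sum>r<fam_l n. (map real_of_int (sign_point n 0 r) ! i * map real_of_int (sign_point n 0 r) ! j * map real_of_int (sign_point n 0 r) ! k)
     + (map real_of_int (sign_point n 1 r) ! i * map real_of_int (sign_point n 1 r) ! j * map real_of_int (sign_point n 1 r) ! k))
    = 2 * real (fam_l n) * (M\<^sup>2 + 1) * ((M\<^sup>2 + 1)\<^sup>2 + M ^ 4 * (of_bool (i = j) + of_bool (j = k) + of_bool (i = k)))"
proof -
  let ?l = "fam_l n"
  have n: "x < 2 ^ lg n" if "x < n" for x using lg_ge[of n] that by simp
  have o: "(\<Sum>r<?l. sylvester r x * sylvester r y) = real ?l * of_bool (x = y)" if "x < n" "y < n" for x y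
    unfolding fam_l_def using sylvester_orthogonal[OF n[OF that(1)] n[OF that(2)]] by simp
  have nth: "map real_of_int (sign_point n 0 r) ! x = (M\<^sup>2 + 1) + M\<^sup>2 * sylvester r x"
    "map real_of_int (sign_point n 1 r) ! x = (M\<^sup>2 + 1) - M\<^sup>2 * sylvester r x" if "x < n" for x r
  proof -
    have "parity r x = 0 \<or> parity r x = 1" using parity_rec[of r x] by linarith
    thus "map real_of_int (sign_point n 0 r) ! x = (M\<^sup>2 + 1) + M\<^sup>2 * sylvester r x"
      "map real_of_int (sign_point n 1 r) ! x = (M\<^sup>2 + 1) - M\<^sup>2 * sylvester r x"
      using that by (auto simp: sign_point_def sylvester_def fam_q_def M_def power2_eq_square)
  qed
  have e: "(P + Q * a) * (P + Q * b) * (P + Q * c) + (P - Q * a) * (P - Q * b) * (P - Q * c)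
    = 2 * P ^ 3 + 2 * P * Q ^ 2 * (a * b) + 2 * P * Q ^ 2 * (b * c) + 2 * P * Q ^ 2 * (a * c)" for P Q a b c :: real
    by (simp add: algebra_simps power2_eq_square power3_eq_cube)
  show ?thesis
    unfolding nth(1)[OF assms(1)] nth(1)[OF assms(2)] nth(1)[OF assms(3)] nth(2)[OF assms(1)] nth(2)[OF assms(2)] nth(2)[OF assms(3)] e
      sum.distrib sum_distrib_left[symmetric] o[OF assms(1,2)] o[OF assms(2,3)] o[OF assms(1,3)]
    by (simp add: algebra_simps power2_eq_square power3_eq_cube power4_eq_xxxx)
qed

lemma cubic_moments_family:
  assumes n: "n \<ge> 2"
  shows "cubic_moments n (scale_points (real n * (real n + 1) * (real n + 2) / real_of_int (common_denom n)) (int_points b n))"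
  unfolding cubic_moments_def
proof (intro allI impI)
  fix i j k assume ijk: "i < n" "j < n" "k < n"
  define M where "M = real_of_int (fam_m n)"
  define L where "L = real (fam_l n)"
  define c where "c = real n * (real n + 1) * (real n + 2) / real_of_int (common_denom n)"
  define K where "K = real_of_int (fam_k b)"
  define E where "E = (of_bool (i = j) + of_bool (j = k) + of_bool (i = k) :: real)"
  define T where "T = (of_bool (i = j \<and> j = k) :: real)"
  let ?g = "\<lambda>q :: real list. q ! i * q ! j * q ! k"
  have M0: "M > 0" using fam_m_pos[of n] n by (simp add: M_def)
  have L0: "L > 0" by (simp add: L_def fam_l_def)
  have MM: "M * M + 1 > 0" by (simp add: add_nonneg_pos)
  have D: "real_of_int (common_denom n) = 2 * L * M ^ 5 * (M * M + 1) * (real n * (real n + 1) * (real n + 2))"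
    by (simp add: common_denom_def M_def L_def eval_nat_numeral mult_ac)
  have c: "c = 1 / (2 * L * M ^ 5 * (M * M + 1))"
  proof -
    have "N3 / (X * N3) = 1 / X" if "N3 \<noteq> 0" for N3 X :: real using that by simp
    thus ?thesis unfolding c_def D using n by simp
  qed
  have cv: "c * of_int (vertex_weight n) = 1"
    unfolding c vertex_weight_def using M0 L0 MM by (simp add: M_def[symmetric] L_def[symmetric] eval_nat_numeral)
  have ci: "c * of_int (inner_weight n) = 1 / M ^ 3"
    unfolding c inner_weight_def using M0 L0 MM by (simp add: M_def[symmetric] L_def[symmetric] eval_nat_numeral)
  have cc: "c * of_int (center_weight b n) = of_int (center_coeff b n) / M ^ 5"
    unfolding c center_weight_def using M0 L0 MM by (simp add: M_def[symmetric] L_def[symmetric])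
  have F2: "formula_sum (scale_points c (map (\<lambda>i. (inner_weight n, spike n 1 (fam_m n + 1) i)) [0..<n])) ?g
    = (real n + 3 * M + M ^ 2 * E + M ^ 3 * T) / M ^ 3"
    unfolding formula_sum_scale_map ci spike_moment[OF ijk] by (simp add: M_def E_def T_def)
  have F1: "formula_sum (scale_points c (first_points b n)) ?g = (if b then T else (real n + 3 * M + M ^ 2 * E + M ^ 3 * T) / M ^ 3)"
  proof (cases b)
    case True
    thus ?thesis unfolding first_points_def by (simp add: formula_sum_scale_map cv vertex_moment[OF ijk] T_def)
  next
    case False
    thus ?thesis using F2 unfolding first_points_def by simp
  qed
  have F3: "formula_sum (scale_points c (concat (map (\<lambda>r. [(fam_m n - fam_k b, sign_point n 0 r), (fam_m n - fam_k b, sign_point n 1 r)]) [0..<fam_l n]))) ?g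
    = (M - K) / M ^ 5 * ((M\<^sup>2 + 1)\<^sup>2 + M ^ 4 * E)"
  proof -
    have "formula_sum (scale_points c (concat (map (\<lambda>r. [(fam_m n - fam_k b, sign_point n 0 r), (fam_m n - fam_k b, sign_point n 1 r)]) [0..<fam_l n]))) ?g
      = c * (M - K) * (\<Sum>r<fam_l n. ?g (map real_of_int (sign_point n 0 r)) + ?g (map real_of_int (sign_point n 1 r)))"
      unfolding formula_sum_scale_concat sum_distrib_left by (intro sum.cong refl) (simp add: scale_points_def M_def K_def algebra_simps)
    also have "\<dots> = c * (M - K) * (2 * L * (M\<^sup>2 + 1) * ((M\<^sup>2 + 1)\<^sup>2 + M ^ 4 * E))"
      unfolding sign_moment[OF ijk] by (simp add: M_def L_def E_def)
    also have "\<dots> = (c * (2 * L * (M * M + 1))) * (M - K) * ((M\<^sup>2 + 1)\<^sup>2 + M ^ 4 * E)" by (simp add: power2_eq_square)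
    also have "c * (2 * L * (M * M + 1)) = 1 / M ^ 5" unfolding c using L0 MM by simp
    finally show ?thesis by simp
  qed
  have F4: "formula_sum (scale_points c [(center_weight b n, spike n 1 1 0)]) ?g = of_int (center_coeff b n) / M ^ 5"
    using ijk cc by (simp add: scale_points_def spike_def)
  have CC: "of_int (center_coeff b n) = M ^ 5 - (M - K) * (M\<^sup>2 + 1)\<^sup>2 - K * (real n * M\<^sup>2 + 3 * M ^ 3)"
    unfolding center_coeff_def by (simp add: M_def[symmetric] K_def[symmetric] algebra_simps eval_nat_numeral)
  have K: "K = (if b then 1 else 2)" by (simp add: K_def fam_k_def)
  have total: "formula_sum (scale_points c (int_points b n)) ?g
    = (if b then T else (real n + 3 * M + M ^ 2 * E + M ^ 3 * T) / M ^ 3) + ((real n + 3 * M + M ^ 2 * E + M ^ 3 * T) / M ^ 3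
      + ((M - K) / M ^ 5 * ((M\<^sup>2 + 1)\<^sup>2 + M ^ 4 * E) + of_int (center_coeff b n) / M ^ 5))"
    unfolding int_points_def formula_sum_scale_append F1 F2 F3 F4 ..
  \<comment> \<open>The coefficient of \<open>E\<close> is \<open>K / M\<close> from the spikes and
    \<open>1 - K / M\<close> from the sign points. That of \<open>T\<close> is 2: two copies of the
    spikes, or one copy and the vertices. The constant is right by the choice of
    \<open>center_coeff\<close>.\<close>
  have "\<dots> = 1 + E + 2 * T"
  proof -
    have a: "(real n + 3 * M + M ^ 2 * E + M ^ 3 * T) / M ^ 3 = (real n * M\<^sup>2 + 3 * M ^ 3 + M ^ 4 * E + M ^ 5 * T) / M ^ 5"
      using M0 by (simp add: field_simps eval_nat_numeral)
    define A where "A = real n * M\<^sup>2 + 3 * M ^ 3 + M ^ 4 * E + M ^ 5 * T"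
    define B where "B = (M - K) * ((M\<^sup>2 + 1)\<^sup>2 + M ^ 4 * E)"
    define C where "C = M ^ 5 - (M - K) * (M\<^sup>2 + 1)\<^sup>2 - K * (real n * M\<^sup>2 + 3 * M ^ 3)"
    have "(if b then M ^ 5 * T else A) + (A + (B + C)) = M ^ 5 * (1 + E + 2 * T)"
      unfolding A_def B_def C_def by (cases b) (simp_all add: K algebra_simps eval_nat_numeral)
    moreover have "(if b then T else A / M ^ 5) + (A / M ^ 5 + (B / M ^ 5 + C / M ^ 5)) = ((if b then M ^ 5 * T else A) + (A + (B + C))) / M ^ 5"
      using M0 by (auto simp: field_simps)
    ultimately show ?thesis
      unfolding a CC A_def[symmetric] C_def[symmetric] times_divide_eq_left B_def[symmetric] using M0 by simp
  qed
  hence "formula_sum (scale_points c (int_points b n)) ?g = monomial3_moment i j k"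
    unfolding total monomial3_moment_eq E_def T_def by simp
  thus "formula_sum (scale_points (real n * (real n + 1) * (real n + 2) / real_of_int (common_denom n)) (int_points b n)) ?g = monomial3_moment i j k"
    unfolding c_def .
qed

lemma sum_list_map_of_int: "sum_list (map real_of_int q) = real_of_int (sum_list q)"
  by (induction q) auto

theorem simplex_cubature3_family:
  assumes n: "n \<ge> 2" shows "simplex_cubature3 n (family b n)"
  unfolding family_def
proof (rule simplex_cubature3_normalize)
  show "length q = n \<and> sum_list q \<noteq> 0"
    if "(v, q) \<in> set (scale_points (real n * (real n + 1) * (real n + 2) / real_of_int (common_denom n)) (int_points b n))" for v q
    using that int_points_cases[OF n, of _ _ b] by (fastforce simp: scale_points_def sum_list_map_of_int)
qed (use n cubic_moments_family[OF n] in auto)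

lemma family_eq:
  assumes n: "n \<ge> 1"
  shows "family b n = map (\<lambda>(w, q). (real_of_int (w * sum_list q ^ 3) / real_of_int (common_denom n),
    map (\<lambda>x. real_of_int x / real_of_int (sum_list q)) q)) (int_points b n)"
proof -
  have "N3 / D * w * s / N3 = w * s / D" if "N3 \<noteq> 0" for N3 D w s :: real using that by simp
  note e = this[of "real n * (real n + 1) * (real n + 2)"]
  show ?thesis
    unfolding family_def normalize_formula_def scale_points_def map_map
    using n by (intro map_cong refl) (auto simp: sum_list_map_of_int o_def e simp del: times_divide_eq_left times_divide_eq_right)
qed

lemma family_points:
  assumes n: "n \<ge> 2" and wp: "(w, p) \<in> set (family b n)"
  shows "w > 0 \<and> in_simplex p \<and> (\<not> b \<longrightarrow> (\<forall>x\<in>set p. 0 < x))"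
proof -
  have n1: "n \<ge> 1" using n by simp
  obtain v q where vq: "(v, q) \<in> set (int_points b n)"
    "w = real_of_int (v * sum_list q ^ 3) / real_of_int (common_denom n)" "p = map (\<lambda>x. real_of_int x / real_of_int (sum_list q)) q"
    using wp unfolding family_eq[OF n1] by auto
  note c = int_points_cases[OF n vq(1)]
  have "sum_list p = 1"
    using c sum_list_map_divide[of "real_of_int (sum_list q)" "map real_of_int q"] unfolding vq(3) by (simp add: sum_list_map_of_int o_def)
  moreover have "w > 0" unfolding vq(2) using c common_denom_pos[OF n1] by simp
  ultimately show ?thesis unfolding in_simplex_def using c unfolding vq(3) by auto
qed

lemma positive_family: "n \<ge> 2 \<Longrightarrow> positive_formula (family b n)"
  using family_points[of n _ _ b] by (auto simp: positive_formula_def)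

lemma interior_family: "n \<ge> 2 \<Longrightarrow> interior_formula (family False n)"
  using family_points[of n _ _ False] by (auto simp: interior_formula_def)

lemma boundary_family:
  assumes n: "n \<ge> 2" shows "boundary_formula (family True n)"
proof -
  have "(vertex_weight n, spike n 0 1 0) \<in> set (int_points True n)" using n by (auto simp: int_points_def first_points_def)
  moreover have "0 \<in> set (spike n 0 1 0)" using n by (auto simp: spike_def intro!: image_eqI[of _ _ 1])
  ultimately have "\<exists>(w, p)\<in>set (family True n). \<exists>x\<in>set p. x = 0"
    unfolding family_eq[OF order.trans[OF one_le_numeral n]] by force
  thus ?thesis using family_points[OF n, of _ _ True] by (auto simp: boundary_formula_def)
qed

lemma length_int_points: "length (int_points b n) = 2 * n + 2 * fam_l n + 1"
proof -
  have "length (concat (map (\<lambda>r. [f r, g r]) xs)) = 2 * length xs" for f g :: "nat \<Rightarrow> int \<times> int list" and xs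
    by (induction xs) auto
  thus ?thesis by (simp add: int_points_def first_points_def)
qed

lemma length_family: "n \<ge> 1 \<Longrightarrow> length (family b n) \<le> 7 * n"
  using two_pow_lg_less[of n] by (simp add: family_eq length_int_points fam_l_def)

section \<open>Output, its length and the running time\<close>

lemma prints_point_out:
  assumes P: "\<And>w q. (w, q) \<in> set P \<Longrightarrow> sum_list q > 0" and D: "D > 0"
  shows "prints_formula (concat (map (point_out D) P))
    (map (\<lambda>(w, q). (real_of_int (w * sum_list q ^ 3) / real_of_int D, map (\<lambda>x. real_of_int x / real_of_int (sum_list q)) q)) P)"
proof -
  define red where "red = (\<lambda>(a :: int, b). (a div gcd a b, b div gcd a b))"
  define fr where "fr = concat (map (\<lambda>(w, q). (w * sum_list q ^ 3, D) # map (\<lambda>x. (x, sum_list q)) q) P)"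
  have pos: "b > 0" if "(a, b) \<in> set fr" for a b using that P D by (auto simp: fr_def)
  have r: "0 < b div gcd a b \<and> coprime (a div gcd a b) (b div gcd a b) \<and> real_of_int (a div gcd a b) / real_of_int (b div gcd a b) = real_of_int a / real_of_int b"
    if "b > 0" for a b :: int
  proof -
    have g: "gcd a b > 0" using that by simp
    obtain x y where x: "a = gcd a b * x" and y: "b = gcd a b * y" by (meson dvdE gcd_dvd1 gcd_dvd2)
    have "a div gcd a b = x" "b div gcd a b = y" using x y g by (metis nonzero_mult_div_cancel_left less_irrefl)+
    moreover have "real_of_int a / real_of_int b = real_of_int x / real_of_int y"
    proof -
      have "real_of_int (h * x) / real_of_int (h * y) = real_of_int x / real_of_int y" if "h > 0" for h using that by simp
      from this[OF g] show ?thesis unfolding x[symmetric] y[symmetric] .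
    qed
    moreover have "y > 0" using y g that by (metis zero_less_mult_pos)
    moreover have "coprime (a div gcd a b) (b div gcd a b)" using that by (intro div_gcd_coprime) auto
    ultimately show ?thesis by simp
  qed
  show ?thesis unfolding prints_formula_def
  proof (intro exI[of _ "map red fr"] conjI)
    show "\<forall>(a, b)\<in>set (map red fr). 0 < b \<and> coprime a b" using r pos by (auto simp: red_def)
    show "concat (map (point_out D) P) = concat (map (\<lambda>(a, b). [a, b]) (map red fr))"
      unfolding fr_def by (induction P) (auto simp: point_out_def reduced_def red_def o_def)
    have "map (\<lambda>(a, b). real_of_int a / real_of_int b) (map red fr) = map (\<lambda>(a, b). real_of_int a / real_of_int b) fr"
      unfolding map_map by (rule map_cong[OF refl]) (use r pos in \<open>auto simp: red_def\<close>)
    also have "\<dots> = concat (map (\<lambda>(w, p). w # p)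
      (map (\<lambda>(w, q). (real_of_int (w * sum_list q ^ 3) / real_of_int D, map (\<lambda>x. real_of_int x / real_of_int (sum_list q)) q)) P))"
      unfolding fr_def by (induction P) (auto simp: o_def)
    finally show "map (\<lambda>(a, b). real_of_int a / real_of_int b) (map red fr) = concat (map (\<lambda>(w, p). w # p)
      (map (\<lambda>(w, q). (real_of_int (w * sum_list q ^ 3) / real_of_int D, map (\<lambda>x. real_of_int x / real_of_int (sum_list q)) q)) P))" .
  qed
qed

lemma prints_family: "n \<ge> 2 \<Longrightarrow> prints_formula (concat (map (point_out (common_denom n)) (int_points b n))) (family b n)"
  using prints_point_out[of "int_points b n" "common_denom n"] int_points_cases[of n _ _ b] common_denom_pos[of n] family_eq[of n b] by simp

text \<open>There are at least \<open>n\<close> points with \<open>n\<close> coordinates each, and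
  every printed integer has length at least 1. A lower bound is what the comparison with the running
  time needs.\<close>

lemma output_length:
  assumes n: "n \<ge> 2"
  shows "n\<^sup>2 \<le> sum_list (map len (concat (map (point_out (common_denom n)) (int_points b n))))"
proof -
  have "length xs \<le> sum_list (map len xs)" for xs
  proof (induction xs)
    case (Cons x xs)
    thus ?case using len_pos[of x] by simp
  qed simp
  moreover have "length (concat (map (point_out D) P)) = length P * (2 + 2 * n)" if "\<forall>(w, q)\<in>set P. length q = n" for D P
  proof -
    have "length (concat (map (\<lambda>x. reduced x s) q)) = 2 * length q" for s q by (induction q) (auto simp: reduced_def)
    hence "length (point_out D (w, q)) = 2 + 2 * length q" for w q by (simp add: point_out_def reduced_def)
    thus ?thesis using that by (induction P) (auto simp: algebra_simps)
  qed
  hence "length (concat (map (point_out (common_denom n)) (int_points b n))) = length (int_points b n) * (2 + 2 * n)"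
    using int_points_cases[OF n, of _ _ b] by blast
  moreover have "n * n \<le> length (int_points b n) * (2 + 2 * n)" by (intro mult_mono) (auto simp: length_int_points)
  ultimately show ?thesis by (metis order.trans power2_eq_square)
qed

lemma len_le_log:
  assumes "x \<ge> 1" shows "real (len x) \<le> log 2 (real_of_int x) + 2"
proof -
  have "len x = nat (\<lfloor>log 2 (real_of_int x)\<rfloor> + 1) + 1" using assms by (simp add: len_def bitlen_alt_def)
  moreover have "log 2 (real_of_int x) \<ge> 0" using assms by simp
  ultimately show ?thesis by linarith
qed

theorem quasilinear_family: "quasilinear (\<lambda>d. family b (d + 1))"
proof -
  define os where "os = (\<lambda>d. concat (map (point_out (common_denom (d + 1))) (int_points b (d + 1))))"
  define L where "L = (\<lambda>d. sum_list (map len (os d)))"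
  \<comment> \<open>A bound for \<open>nb\<close>, the length of \<open>(100 * n) ^ 100\<close>. It
    enters the time once through the loops over digits and once through the cost of an instruction;
    hence the exponent 2 of the logarithm.\<close>
  define lb where "lb = (\<lambda>d :: nat. 100 * log 2 (100 * (real d + 1)) + 2)"
  define B where "B = (\<lambda>d. 8 * (real d + 1) * ((real d + 1) * (400 * lb d + 1300)) * (3 * lb d))"
  have ex: "\<exists>t M'. exec (prog b) ((\<lambda>_. 0)(0 := int d)) (os d) t M' \<and> real t \<le> B d" if d: "d \<ge> 1" for d
  proof -
    define n where "n = d + 1"
    have n: "n = Suc d" "n \<ge> 2" using d by (auto simp: n_def)
    interpret ram "100 * int n" by standard (use n in simp)
    let ?s = "(\<lambda>_. 0)(0 := int d)"
    obtain s' where r: "runs (prog b) ?s (os d) (8 * n * (n * (400 * nb + 1300))) s'"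
      using runs_prog[OF refl n, of b] unfolding os_def n_def by auto
    have "wf ?s"
      unfolding wf_def
    proof (intro allI impI)
      fix i :: int
      have "int d \<le> (100 * int n) ^ reg_degree 0" using n by (simp add: reg_degree_def)
      thus "\<bar>?s i\<bar> \<le> (100 * int n) ^ reg_degree i" by (cases "i = 0") auto
    qed
    moreover have "agree ?s ?s" by (simp add: agree_def)
    ultimately obtain M' t where t: "exec (prog b) ?s (os d) t M'" "t \<le> 8 * n * (n * (400 * nb + 1300)) * cost"
      using r unfolding runs_def by blast
    have nb: "real nb \<le> lb d"
    proof -
      have "real nb \<le> log 2 (real_of_int ((100 * int n) ^ 100)) + 2"
        unfolding nb_def by (intro len_le_log) (use n in simp)
      also have "real_of_int ((100 * int n) ^ 100) = (100 * real n) ^ 100" by simp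
      also have "log 2 ((100 * real n) ^ 100) = 100 * log 2 (100 * real n)" using n by (subst log_nat_power) auto
      finally show ?thesis by (simp add: lb_def n algebra_simps)
    qed
    have "real t \<le> real (8 * n * (n * (400 * nb + 1300)) * cost)" using t(2) by linarith
    also have "\<dots> = 8 * real n * (real n * (400 * real nb + 1300)) * (3 * real nb)" by (simp add: cost_def nb_def)
    also have "\<dots> \<le> 8 * real n * (real n * (400 * lb d + 1300)) * (3 * lb d)"
      using nb by (intro mult_mono add_mono mult_nonneg_nonneg) auto
    also have "\<dots> = B d" by (simp add: B_def n add_ac)
    finally show ?thesis using t(1) by blast
  qed
  hence "\<forall>d. \<exists>t. d \<ge> 1 \<longrightarrow> (\<exists>M'. exec (prog b) ((\<lambda>_. 0)(0 := int d)) (os d) t M') \<and> real t \<le> B d" by blast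
  then obtain T where T: "\<And>d. d \<ge> 1 \<Longrightarrow> (\<exists>M'. exec (prog b) ((\<lambda>_. 0)(0 := int d)) (os d) (T d) M') \<and> real (T d) \<le> B d" by metis
  have "(\<lambda>d. real (T d)) \<in> O(B)"
  proof (rule landau_o.big_mono)
    show "\<forall>\<^sub>F d in at_top. norm (real (T d)) \<le> norm (B d)"
      using eventually_ge_at_top[of 1] by eventually_elim (use T in force)
  qed
  also have "B \<in> O(\<lambda>d. ln ((real d + 1)\<^sup>2) powr 2 * (real d + 1)\<^sup>2)"
    unfolding B_def lb_def by real_asymp
  also have "(\<lambda>d. ln ((real d + 1)\<^sup>2) powr 2 * (real d + 1)\<^sup>2) \<in> O(\<lambda>d. ln (real (L d)) powr 2 * real (L d))"
  proof (rule landau_o.big_mono)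
    show "\<forall>\<^sub>F d in at_top. norm (ln ((real d + 1)\<^sup>2) powr 2 * (real d + 1)\<^sup>2) \<le> norm (ln (real (L d)) powr 2 * real (L d))"
      using eventually_ge_at_top[of 1]
    proof eventually_elim
      case (elim d)
      have "(d + 1)\<^sup>2 \<le> L d" unfolding L_def os_def using elim by (intro output_length) simp
      hence L: "(real d + 1)\<^sup>2 \<le> real (L d)" by (metis of_nat_1 of_nat_add of_nat_le_iff of_nat_power)
      have one: "1 \<le> (real d + 1)\<^sup>2" by simp
      have "ln ((real d + 1)\<^sup>2) \<le> ln (real (L d))" using L one by (subst ln_le_cancel_iff) linarith+
      moreover have "0 \<le> ln ((real d + 1)\<^sup>2)" using one by simp
      ultimately have "ln ((real d + 1)\<^sup>2) powr 2 * (real d + 1)\<^sup>2 \<le> ln (real (L d)) powr 2 * real (L d)"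
        using L by (intro mult_mono powr_mono2) auto
      thus ?case by simp
    qed
  qed
  finally have O: "(\<lambda>d. real (T d)) \<in> O(\<lambda>d. ln (real (sum_list (map len (os d)))) powr 2 * real (sum_list (map len (os d))))"
    unfolding L_def .
  show ?thesis unfolding quasilinear_def
    by (rule exI[of _ "prog b"], rule exI[of _ os], rule exI[of _ T], rule exI[of _ 2])
       (use T O prints_family[of _ b] in \<open>auto simp: os_def\<close>)
qed

lemma length_family_O: "(\<lambda>d. real (length (family b (d + 1)))) \<in> O(\<lambda>d. real d)"
proof (rule bigoI[of _ 14])
  show "\<forall>\<^sub>F d in at_top. norm (real (length (family b (d + 1)))) \<le> 14 * norm (real d)"
    using eventually_ge_at_top[of 1]
  proof eventually_elim
    case (elim d)
    have "length (family b (d + 1)) \<le> 7 * (d + 1)" by (rule length_family) simp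
    thus ?case using elim by simp
  qed
qed

section \<open>The order of the matrix and the number of projected points\<close>

definition next_prime_3_mod_4 :: "nat \<Rightarrow> nat" where
  "next_prime_3_mod_4 n = (LEAST p. prime p \<and> n < p \<and> p mod 4 = 3)"

lemma next_prime_3_mod_4_le: "prime p \<Longrightarrow> n < p \<Longrightarrow> p mod 4 = 3 \<Longrightarrow> next_prime_3_mod_4 n \<le> p"
  unfolding next_prime_3_mod_4_def by (rule Least_le) simp

lemma next_prime_3_mod_4:
  "prime (next_prime_3_mod_4 n) \<and> n < next_prime_3_mod_4 n \<and> next_prime_3_mod_4 n mod 4 = 3"
proof -
  obtain N where N: "\<And>m. m \<ge> N \<Longrightarrow> \<exists>p. prime p \<and> m < p \<and> p mod 4 = (3 :: nat)"
  proof -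
    have "\<exists>N. \<forall>n\<ge>N. \<exists>p. prime p \<and> n < p \<and> real p \<le> (1 + 1) * real n \<and> p mod 4 = 3"
      using prime_3_mod_4_in_interval[of 1] by (simp only: eventually_sequentially zero_less_one simp_thms)
    thus ?thesis using that by blast
  qed
  obtain p where "prime p" "max n N < p" "p mod 4 = 3" using N[of "max n N"] by auto
  hence "\<exists>p. prime p \<and> n < p \<and> p mod 4 = 3" by auto
  thus ?thesis unfolding next_prime_3_mod_4_def by (rule LeastI_ex)
qed

lemma first_prime_3mod4_after_next_prime: "first_prime_3mod4_after n (next_prime_3_mod_4 n)"
  using next_prime_3_mod_4[of n] next_prime_3_mod_4_le[of _ n] by (auto simp: first_prime_3mod4_after_def)

lemma next_prime_3_mod_4_bound:
  assumes "c > 0"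
  shows "eventually (\<lambda>n. real (next_prime_3_mod_4 n) + 1 - real n \<le> c * real n) sequentially"
proof -
  \<comment> \<open>One half of \<open>c\<close> pays for the gap between \<open>n\<close> and the
    prime, the other for the step from the prime to the order of the matrix.\<close>
  have "eventually (\<lambda>n. 1 \<le> c / 2 * real n) sequentially"
    using assms by real_asymp
  moreover have "c / 2 > 0" using assms by simp
  note prime_3_mod_4_in_interval[OF this]
  ultimately show ?thesis
  proof eventually_elim
    case (elim n)
    then obtain p where p: "prime p" "n < p" "real p \<le> (1 + c / 2) * real n" "p mod 4 = 3" by blast
    hence "real (next_prime_3_mod_4 n) \<le> real p" using next_prime_3_mod_4_le by simp
    thus ?case using p(3) elim(1) by (simp add: algebra_simps)
  qed
qed

lemma next_prime_3_mod_4_smallo: "(\<lambda>n. real (next_prime_3_mod_4 n + 1) - real n) \<in> o(\<lambda>n. real n)"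
proof (rule landau_o.smallI)
  fix c :: real assume "c > 0"
  from next_prime_3_mod_4_bound[OF this]
  show "\<forall>\<^sub>F n in at_top. norm (real (next_prime_3_mod_4 n + 1) - real n) \<le> c * norm (real n)"
  proof eventually_elim
    case (elim n)
    thus ?case using next_prime_3_mod_4[of n] by simp
  qed
qed

text \<open>Eventually \<open>l n < 2 * n\<close>, so the length is exactly
  \<open>n + 2 * l n - 1\<close>, and its distance from \<open>3 * n\<close> is less than twice
  \<open>l n - n\<close>.\<close>

lemma length_project_smallo:
  fixes l :: "nat \<Rightarrow> nat"
  assumes H: "\<And>n. n \<ge> 1 \<Longrightarrow> normalized_hadamard (l n) (H n)" and l: "\<And>n. n < l n"
    and o: "(\<lambda>n. real (l n) - real n) \<in> o(\<lambda>n. real n)"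
  shows "(\<lambda>n. real (length (project_formula (l n) n (hadamard_formula (l n) (H n)))) - 3 * real n) \<in> o(\<lambda>n. real n)"
proof -
  have "\<forall>\<^sub>F n in at_top. norm (real (l n) - real n) \<le> 1 / 2 * norm (real n)"
    using landau_o.smallD[OF o, of "1 / 2"] by simp
  hence "\<forall>\<^sub>F n in at_top. norm (real (length (project_formula (l n) n (hadamard_formula (l n) (H n)))) - 3 * real n)
      \<le> 2 * norm (real (l n) - real n)"
    using eventually_ge_at_top[of 1]
  proof eventually_elim
    case (elim n)
    have "l n < 2 * n" using elim l[of n] by auto
    hence "length (project_formula (l n) n (hadamard_formula (l n) (H n))) = n + 2 * l n - 1"
      using length_project_eq[OF elim(2) less_imp_le[OF l[of n]] H[OF elim(2)]] by simp
    thus ?case using l[of n] by simp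
  qed
  hence "(\<lambda>n. real (length (project_formula (l n) n (hadamard_formula (l n) (H n)))) - 3 * real n) \<in> O(\<lambda>n. real (l n) - real n)"
    by (rule bigoI)
  thus ?thesis using o by (rule landau_o.big_small_trans)
qed

text \<open>The upper bound is \<open>n + 2 * (n + 3) - 1\<close>. The exact count needs
  \<open>l < 2 * n\<close>, which can fail only for \<open>n \<le> 3\<close>; there the cruder lower
  bound takes over.\<close>

lemma length_project_hadamard_conjecture:
  assumes n: "n \<ge> 1" and l: "n \<le> l" "l \<le> n + 3" and H: "normalized_hadamard l H"
  shows "3 * n - 1 \<le> length (project_formula l n (hadamard_formula l H))"
    and "length (project_formula l n (hadamard_formula l H)) \<le> 3 * n + 5"
  using length_project_ge[OF n l(1) H] length_project_le[OF n l(1) H] length_project_eq[OF n l(1) H] n l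
  by (cases "l < 2 * n"; simp)+

lemma four_ceiling_bounds:
  assumes "n \<ge> 1" "l = 4 * nat \<lceil>real n / 4\<rceil>"
  shows "n \<le> l" "l \<le> n + 3" "4 dvd l"
proof -
  have "\<lceil>real n / 4\<rceil> \<ge> 0" using assms(1) by simp
  hence l: "int l = 4 * \<lceil>real n / 4\<rceil>" using assms(2) by simp
  have "real n / 4 \<le> of_int \<lceil>real n / 4\<rceil>" "of_int \<lceil>real n / 4\<rceil> < real n / 4 + 1" by linarith+
  thus "n \<le> l" "l \<le> n + 3" using l by linarith+
  show "4 dvd l" using assms(2) by simp
qed

theorem mainTheorem5:
  shows
    "(\<exists>F. (\<forall>d\<ge>1. simplex_cubature3 (d + 1) (F d) \<and> positive_formula (F d) \<and> boundary_formula (F d))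
          \<and> quasilinear F
          \<and> (\<lambda>d. real (length (F d))) \<in> O(\<lambda>d. real d))
   \<and> (\<exists>F. (\<forall>d\<ge>1. simplex_cubature3 (d + 1) (F d) \<and> positive_formula (F d) \<and> interior_formula (F d))
          \<and> quasilinear F
          \<and> (\<lambda>d. real (length (F d))) \<in> O(\<lambda>d. real d))
   \<and> (\<forall>n\<ge>1. (\<exists>H. hadamard_matrix n H) \<longrightarrow>
          (\<exists>H. normalized_hadamard n H)
        \<and> (\<forall>H. normalized_hadamard n H \<longrightarrow>
              simplex_cubature3 n (hadamard_formula n H)
            \<and> length (hadamard_formula n H) = 3 * n - 1
            \<and> positive_formula (hadamard_formula n H)
            \<and> (n \<ge> 2 \<longrightarrow> boundary_formula (hadamard_formula n H))))
   \<and> (\<forall>n\<ge>1. \<forall>l\<ge>n. \<forall>H. normalized_hadamard l H \<longrightarrow>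
          simplex_cubature3 n (project_formula l n (hadamard_formula l H))
        \<and> positive_formula (project_formula l n (hadamard_formula l H))
        \<and> (n \<ge> 2 \<longrightarrow> boundary_formula (project_formula l n (hadamard_formula l H))))
   \<and> (\<exists>l :: nat \<Rightarrow> nat.
          (\<forall>n\<ge>1. (\<exists>p. l n = p + 1 \<and> first_prime_3mod4_after n p)
                 \<and> (\<exists>H. normalized_hadamard (l n) H))
        \<and> (\<lambda>n. real (l n) - real n) \<in> o(\<lambda>n. real n)
        \<and> (\<forall>H. (\<forall>n\<ge>1. normalized_hadamard (l n) (H n)) \<longrightarrow>
              (\<forall>n\<ge>1. simplex_cubature3 n (project_formula (l n) n (hadamard_formula (l n) (H n))))
            \<and> (\<lambda>n. real (length (project_formula (l n) n (hadamard_formula (l n) (H n)))) - 3 * real n)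
                \<in> o(\<lambda>n. real n)))
   \<and> (hadamard_conjecture \<longrightarrow>
        (\<forall>n\<ge>1. \<forall>l. l = 4 * nat \<lceil>real n / 4\<rceil> \<longrightarrow>
            (\<exists>H. normalized_hadamard l H)
          \<and> (\<forall>H. normalized_hadamard l H \<longrightarrow>
                simplex_cubature3 n (project_formula l n (hadamard_formula l H))
              \<and> 3 * n - 1 \<le> length (project_formula l n (hadamard_formula l H))
              \<and> length (project_formula l n (hadamard_formula l H)) \<le> 3 * n + 5)))"
  (is "?boundary \<and> ?interior \<and> ?hadamard \<and> ?project \<and> ?prime \<and> ?conjecture")
proof (intro conjI)
  show ?boundary
    by (rule exI[of _ "\<lambda>d. family True (d + 1)"])
       (simp add: simplex_cubature3_family positive_family boundary_family quasilinear_family[simplified] length_family_O[simplified])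
  show ?interior
    by (rule exI[of _ "\<lambda>d. family False (d + 1)"])
       (simp add: simplex_cubature3_family positive_family interior_family quasilinear_family[simplified] length_family_O[simplified])
  show ?hadamard
  proof (intro allI impI conjI)
    fix n :: nat and H assume n: "n \<ge> 1" "\<exists>H. hadamard_matrix n H"
    show "\<exists>H. normalized_hadamard n H" using n normalized_exists by blast
    show "length (hadamard_formula n H) = 3 * n - 1" by (rule length_hadamard_formula[OF n(1)])
    assume H: "normalized_hadamard n H"
    show "simplex_cubature3 n (hadamard_formula n H)" by (rule simplex_cubature3_hadamard[OF H n(1)])
    show "positive_formula (hadamard_formula n H)" by (rule positive_hadamard_formula[OF H n(1)])
    show "boundary_formula (hadamard_formula n H)" if "n \<ge> 2" by (rule boundary_hadamard_formula[OF H that])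
  qed
  show ?project
  proof (intro allI impI conjI)
    fix n l :: nat and H assume A: "n \<ge> 1" "n \<le> l" "normalized_hadamard l H"
    show "simplex_cubature3 n (project_formula l n (hadamard_formula l H))" by (rule simplex_cubature3_project[OF A])
    show "positive_formula (project_formula l n (hadamard_formula l H))" by (rule positive_project[OF A])
    show "boundary_formula (project_formula l n (hadamard_formula l H))" if "n \<ge> 2" by (rule boundary_project[OF A that])
  qed
  show ?prime
  proof (rule exI[of _ "\<lambda>n. next_prime_3_mod_4 n + 1"], intro conjI allI impI)
    fix n :: nat assume "n \<ge> 1"
    show "\<exists>p. next_prime_3_mod_4 n + 1 = p + 1 \<and> first_prime_3mod4_after n p"
      using first_prime_3mod4_after_next_prime by blast
    show "\<exists>H. normalized_hadamard (next_prime_3_mod_4 n + 1) H"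
      using normalized_hadamard_paley[of "next_prime_3_mod_4 n"] next_prime_3_mod_4[of n] by blast
  next
    show "(\<lambda>n. real (next_prime_3_mod_4 n + 1) - real n) \<in> o(\<lambda>n. real n)" by (rule next_prime_3_mod_4_smallo)
  next
    fix H and n :: nat
    assume H: "\<forall>n\<ge>1. normalized_hadamard (next_prime_3_mod_4 n + 1) (H n)" and n: "n \<ge> 1"
    show "simplex_cubature3 n (project_formula (next_prime_3_mod_4 n + 1) n (hadamard_formula (next_prime_3_mod_4 n + 1) (H n)))"
      by (rule simplex_cubature3_project) (use H n next_prime_3_mod_4[of n] in auto)
  next
    fix H
    assume H: "\<forall>n\<ge>1. normalized_hadamard (next_prime_3_mod_4 n + 1) (H n)"
    show "(\<lambda>n. real (length (project_formula (next_prime_3_mod_4 n + 1) n (hadamard_formula (next_prime_3_mod_4 n + 1) (H n)))) - 3 * real n)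
        \<in> o(\<lambda>n. real n)"
      by (rule length_project_smallo[OF _ _ next_prime_3_mod_4_smallo]) (use H next_prime_3_mod_4 in \<open>auto simp: less_SucI\<close>)
  qed
  show ?conjecture
  proof (intro impI allI)
    fix n l :: nat assume hc: hadamard_conjecture and n: "n \<ge> 1" and l: "l = 4 * nat \<lceil>real n / 4\<rceil>"
    note b = four_ceiling_bounds[OF n l]
    have "\<exists>H. normalized_hadamard l H"
    proof -
      have "0 < l" using b(1) n by simp
      then obtain H where "hadamard_matrix l H" using hc b(3) unfolding hadamard_conjecture_def by blast
      thus ?thesis by (rule normalized_exists) (use \<open>0 < l\<close> in simp)
    qed
    thus "(\<exists>H. normalized_hadamard l H) \<and> (\<forall>H. normalized_hadamard l H \<longrightarrow>
                simplex_cubature3 n (project_formula l n (hadamard_formula l H))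
              \<and> 3 * n - 1 \<le> length (project_formula l n (hadamard_formula l H))
              \<and> length (project_formula l n (hadamard_formula l H)) \<le> 3 * n + 5)"
      using simplex_cubature3_project[OF n b(1)] length_project_hadamard_conjecture[OF n b(1,2)] by blast
  qed
qed

end
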